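(* Let $n\ge 3$. (a) Let $(M,g)$ be a pseudo-Riemannian $n$-manifold. Then every (non-null) unparametrised geodesic of $g$ is an unparametrised conformal circle of $(M,[g])$ if, and only if, $g$ is Einstein. (b) Let $(M,\boldsymbol{c},\sigma)$ be a conformally compact $n$-manifold. Then every generalised geodesic of $(M,\boldsymbol{c},\sigma)$ is an unparametrised conformal circle of $(M,\boldsymbol{c})$ if, and only if, $(M,\boldsymbol{c},\sigma)$ is Poincaré-Einstein.
   Context: Conformally compact: $M$ is a smooth connected $n$-manifold with boundary $\partial M$ and interior $\mathring M$, with a metric $\mathring g=r^{-2}g$ on $\mathring M$, where $g$ is a metric (of any signature) on all of $M$, nondegenerate up to $\partial M$, and $r$ is a defining function for $\partial M$: $\mathcal{Z}(r)=\partial M$ and $dr\ne0$ at all points of $\partial M$. Then $\boldsymbol{c}=[g]$ and $\sigma=r\sigma_g$ where $g=\sigma_g^{-2}\mathbf{g}$, so $\mathring g=\sigma^{-2}\mathbf{g}$ on $\mathring M$. It is Poincaré-Einstein if in addition $\mathring g$ is Einstein. Conventions. Manifolds are smooth and connected. Abstract indices are used: $\mathcal{E}^a=TM$, $\mathcal{E}_a=T^*M$. Density bundles: $\mathcal{E}[w]=\big((\Lambda^nTM)^{2}\big)^{w/2n}$ for $w\in\mathbb{R}$, $\mathcal{E}_+[1]$ is the bundle of positive 1-densities, and $\mathcal{V}[w]=\mathcal{V}\otimes\mathcal{E}[w]$. The conformal metric $\mathbf{g}_{ab}\in\Gamma(\mathcal{E}_{(ab)}[2])$ is characterised by: each $g\in\boldsymbol{c}$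 is $\sigma_g^{-2}\mathbf{g}$ for a unique $\sigma_g\in\Gamma(\mathcal{E}_+[1])$. Indices are raised and lowered with $\mathbf{g}$; the Levi-Civita connection $\nabla$ of $g\in\boldsymbol{c}$ acts on densities and preserves $\mathbf{g}$ and $\sigma_g$. $P_{ab}=\frac{1}{n-2}(\mathrm{Ric}_{ab}-J\mathbf{g}_{ab})$ is the Schouten tensor of $g$, $J=\mathbf{g}^{ab}P_{ab}$, $\Delta=\mathbf{g}^{ab}\nabla_a\nabla_b$. Tractors. The standard tractor bundle $\mathcal{T}$ is the rank $n+2$ bundle which, for each $g\in\boldsymbol{c}$, is identified with $\mathcal{E}[1]\oplus\mathcal{E}_a[1]\oplus\mathcal{E}[-1]$; for $\hat g=e^{2\omega}g$, $\Upsilon=d\omega$, the triples are related by $(\hat\sigma,\hat\mu_a,\hat\rho)=(\sigma,\ \mu_a+\Upsilon_a\sigma,\ \rho-\Upsilon^b\mu_b-\tfrac12\Upsilon^b\Upsilon_b\sigma)$. In a scale $g$ write $V^A=\sigma Y^A+\mu^aZ^A{}_a+\rho X^A$ for the triple $(\sigma,\mu_a,\rho)$; $X^A\in\Gamma(\mathcal{E}^A[1])$ is conformally invariant. The tractor connection is $\nabla_a(\sigma,\mu_b,\rho)=(\nabla_a\sigma-\mu_a,\ \nabla_a\mu_b+\mathbf{g}_{ab}\rho+P_{ab}\sigma,\ \nabla_a\rho-P_{ab}\mu^b)$. Scale tractor of $\sigma\in\Gamma(\mathcal{E}[1])$: $I=\big(\sigma,\ \nabla_a\sigma,\ -\tfrac1n(\Delta\sigma+J\sigma)\big)\in\Gamma(\mathcal{T})$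 (conformally invariant). Curves. A curve is a smooth regular map from an interval to $M$. For a nowhere-null curve with velocity $u^a$ put $\sigma_u=\sqrt{\pm\mathbf{g}_{ab}u^au^b}$ ($+$ if spacelike, $-$ if timelike), weighted velocity $\mathbf{u}^a=\sigma_u^{-1}u^a$ (so $\mathbf{u}^a\mathbf{u}_a=\pm1$), and, in a scale $g$, weighted acceleration $\mathbf{a}^b=\mathbf{u}^a\nabla_a\mathbf{u}^b$. With $U^A=\sigma_u\mathbf{u}^a\nabla_a(\sigma_u^{-1}X^A)$ and $A^B=\sigma_u\mathbf{u}^a\nabla_aU^B$, the 3-tractor of $\gamma$ is $$\Sigma^{ABC}=6\sigma_u^{-1}X^{[A}U^BA^{C]}=\pm6\,\mathbf{u}^cX^{[A}Y^BZ^{C]}{}_c+6\,\mathbf{u}^b\mathbf{a}^cX^{[A}Z^B{}_bZ^{C]}{}_c ,$$ which is conformally invariant and parametrisation independent. Geodesics and generalised geodesics. $\gamma$ is an unparametrised geodesic of $g$ if $u^a\nabla_au^b\propto u^b$ for the Levi-Civita connection of $g$. A generalised geodesic of $(M,\boldsymbol{c},\sigma)$ is a (nowhere-null) unparametrised curve with $I\wedge\Sigma=0$ at all of its points, where $I\wedge\Sigma:=I^{[A}\Sigma^{BCD]}$. Conformal circles. A nowhere-null curve $\gamma$ is an (unparametrised) conformal circle of $(M,\boldsymbol{c})$ if for one, equivalently any, $g\in\boldsymbol{c}$: $(\mathbf{u}^c\nabla_c\mathbf{a}^{[a})\mathbf{u}^{b]}=\pm\mathbf{u}^cP_c{}^{[a}\mathbf{u}^{b]}$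 when $\mathbf{u}^a\mathbf{u}_a=\pm1$ (a conformally invariant equation). *)

theory Defs
  imports "HOL-Analysis.Analysis"
begin

section \<open>Smooth manifolds with boundary\<close>

text \<open>All derivatives below are taken \<^emph>\<open>within\<close> the domain \<open>S\<close>. They are used only where
  \<open>S\<close> is relatively open in a closed half space of \<open>\<real>\<^sup>n\<close>, or in an interval with
  nonempty interior; there the derivative within \<open>S\<close> is unique, it is the usual one at interior
  points of \<open>S\<close>, and \<open>smooth_on\<close> is smoothness up to the boundary.\<close>

primrec Ck_on :: "nat \<Rightarrow> 'a::real_normed_vector set \<Rightarrow> ('a \<Rightarrow> 'b::real_normed_vector) \<Rightarrow> bool" where
  "Ck_on 0 S f \<longleftrightarrow> continuous_on S f"
| "Ck_on (Suc k) S f \<longleftrightarrow>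
     f differentiable_on S \<and> (\<forall>v. Ck_on k S (\<lambda>x. frechet_derivative f (at x within S) v))"

definition smooth_on :: "'a::real_normed_vector set \<Rightarrow> ('a \<Rightarrow> 'b::real_normed_vector) \<Rightarrow> bool" where
  "smooth_on S f \<longleftrightarrow> (\<forall>k. Ck_on k S f)"

definition partial :: "(real^'n) set \<Rightarrow> 'n \<Rightarrow> (real^'n \<Rightarrow> real) \<Rightarrow> real^'n \<Rightarrow> real" where
  "partial S i f x = frechet_derivative f (at x within S) (axis i 1)"

text \<open>A chart is a pair of a domain and a coordinate map (relevant on the domain only).\<close>

type_synonym ('a, 'n) chart = "'a set \<times> ('a \<Rightarrow> real^'n)"

definition img :: "('a, 'n::finite) chart \<Rightarrow> (real^'n) set" where
  "img c = snd c ` fst c"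

definition chart_inv :: "('a, 'n::finite) chart \<Rightarrow> real^'n \<Rightarrow> 'a" where
  "chart_inv c = inv_into (fst c) (snd c)"

definition half_space :: "'n::finite \<Rightarrow> (real^'n) set" where
  "half_space k = {x. 0 \<le> x $ k}"

definition is_chart :: "'a topology \<Rightarrow> ('a, 'n::finite) chart \<Rightarrow> bool" where
  "is_chart M c \<longleftrightarrow> openin M (fst c)
     \<and> (\<exists>k. openin (top_of_set (half_space k)) (img c))
     \<and> homeomorphic_map (subtopology M (fst c)) (top_of_set (img c)) (snd c)"

definition overlap :: "('a, 'n::finite) chart \<Rightarrow> ('a, 'n) chart \<Rightarrow> (real^'n) set" where
  "overlap c d = snd c ` (fst c \<inter> fst d)"

definition transition :: "('a, 'n::finite) chart \<Rightarrow> ('a, 'n) chart \<Rightarrow> real^'n \<Rightarrow> real^'n" where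
  "transition c d = snd d \<circ> chart_inv c"

definition jacobian :: "('a, 'n::finite) chart \<Rightarrow> ('a, 'n) chart \<Rightarrow> real^'n \<Rightarrow> real^'n^'n" where
  "jacobian c d x = matrix (frechet_derivative (transition c d) (at x within overlap c d))"

definition atlas :: "'a topology \<Rightarrow> ('a, 'n::finite) chart set \<Rightarrow> bool" where
  "atlas M A \<longleftrightarrow> (\<forall>c\<in>A. is_chart M c) \<and> (\<Union>c\<in>A. fst c) = topspace M
     \<and> (\<forall>c\<in>A. \<forall>d\<in>A. smooth_on (overlap c d) (transition c d))"

definition connected_manifold_with_boundary ::
    "'a topology \<Rightarrow> ('a, 'n::finite) chart set \<Rightarrow> bool" where
  "connected_manifold_with_boundary M A \<longleftrightarrow>
     Hausdorff_space M \<and> second_countable M \<and> connected_space M \<and> atlas M A"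

text \<open>The interior below is that of \<open>\<real>\<^sup>n\<close>: an image that is open in a half space but does not
  meet the bounding hyperplane contributes no boundary points.\<close>

definition manifold_boundary :: "('a, 'n::finite) chart set \<Rightarrow> 'a set" where
  "manifold_boundary A = {p. \<exists>c\<in>A. p \<in> fst c \<and> snd c p \<notin> interior (img c)}"

definition manifold_interior :: "'a topology \<Rightarrow> ('a, 'n::finite) chart set \<Rightarrow> 'a set" where
  "manifold_interior M A = topspace M - manifold_boundary A"

definition connected_manifold :: "'a topology \<Rightarrow> ('a, 'n::finite) chart set \<Rightarrow> bool" where
  "connected_manifold M A \<longleftrightarrow>
     connected_manifold_with_boundary M A \<and> manifold_boundary A = {}"

definition smooth_function :: "('a, 'n::finite) chart set \<Rightarrow> ('a \<Rightarrow> real) \<Rightarrow> bool" where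
  "smooth_function A f \<longleftrightarrow> (\<forall>c\<in>A. smooth_on (img c) (f \<circ> chart_inv c))"

definition defining_function ::
    "'a topology \<Rightarrow> ('a, 'n::finite) chart set \<Rightarrow> ('a \<Rightarrow> real) \<Rightarrow> bool" where
  "defining_function M A r \<longleftrightarrow> smooth_function A r
     \<and> {p \<in> topspace M. r p = 0} = manifold_boundary A
     \<and> (\<forall>c\<in>A. \<forall>p \<in> fst c \<inter> manifold_boundary A.
           \<exists>i. partial (img c) i (r \<circ> chart_inv c) (snd c p) \<noteq> 0)"

section \<open>Metrics and densities\<close>

text \<open>Tensor fields and densities are given by their components in every chart. A section of
  \<open>\<E>[w]\<close> is represented by its coefficient with respect to the frame
  \<open>((\<partial>\<^sub>1 \<and> \<dots> \<and> \<partial>\<^sub>n)\<^sup>2)\<close> to the power \<open>w/2n\<close> of \<open>\<E>[w]\<close>,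
  so that coefficients change by the factor \<open>\<bar>det (jacobian c d x)\<bar>\<close> to the power \<open>w/n\<close>;
  weighted tensors likewise.\<close>

type_synonym ('a, 'n) bilinear_field = "('a, 'n) chart \<Rightarrow> real^'n \<Rightarrow> real^'n^'n"
type_synonym ('a, 'n) density_field = "('a, 'n) chart \<Rightarrow> real^'n \<Rightarrow> real"

definition pseudo_riemannian_metric ::
    "('a, 'n::finite) chart set \<Rightarrow> ('a, 'n) bilinear_field \<Rightarrow> bool" where
  "pseudo_riemannian_metric A g \<longleftrightarrow>
     (\<forall>c\<in>A. smooth_on (img c) (g c)
        \<and> (\<forall>x\<in>img c. transpose (g c x) = g c x \<and> det (g c x) \<noteq> 0))
     \<and> (\<forall>c\<in>A. \<forall>d\<in>A. \<forall>x\<in>overlap c d.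
           g c x = transpose (jacobian c d x) ** g d (transition c d x) ** jacobian c d x)"

definition conformal_class ::
    "('a, 'n::finite) chart set \<Rightarrow> ('a, 'n) bilinear_field \<Rightarrow> ('a, 'n) bilinear_field set" where
  "conformal_class A g = {h. \<exists>\<omega>. smooth_function A \<omega>
     \<and> (\<forall>c\<in>A. \<forall>p\<in>fst c. h c (snd c p) = exp (2 * \<omega> p) *\<^sub>R g c (snd c p))}"

text \<open>In the following definitions \<open>S\<close> is the image of a chart, \<open>G\<close> the component matrix of
  a metric \<open>g\<close> in that chart, and \<open>x\<close> a coordinate vector. First \<open>\<sigma>\<^sub>g\<close>, then the conformal
  metric, normalised by \<open>\<bar>det\<bar> = 1\<close>; it takes the same value for all metrics in a conformal
  class, and \<open>G = \<sigma>\<^sub>g\<close> to the power \<open>-2\<close> times it.\<close>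

definition scale_density :: "(real^'n::finite \<Rightarrow> real^'n^'n) \<Rightarrow> real^'n \<Rightarrow> real" where
  "scale_density G x = \<bar>det (G x)\<bar> powr (- 1 / (2 * real CARD('n)))"

definition conf_metric :: "(real^'n::finite \<Rightarrow> real^'n^'n) \<Rightarrow> real^'n \<Rightarrow> real^'n^'n" where
  "conf_metric G x = (scale_density G x)\<^sup>2 *\<^sub>R G x"

abbreviation conf_metric_inv :: "(real^'n::finite \<Rightarrow> real^'n^'n) \<Rightarrow> real^'n \<Rightarrow> real^'n^'n" where
  "conf_metric_inv G x \<equiv> matrix_inv (conf_metric G x)"

section \<open>Levi-Civita connection and curvature\<close>

definition christoffel ::
    "(real^'n::finite) set \<Rightarrow> (real^'n \<Rightarrow> real^'n^'n) \<Rightarrow> real^'n \<Rightarrow> 'n \<Rightarrow> 'n \<Rightarrow> 'n \<Rightarrow> real" where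
  "christoffel S G x k i j =
     (\<Sum>l\<in>UNIV. matrix_inv (G x) $ k $ l *
        (partial S i (\<lambda>z. G z $ j $ l) x + partial S j (\<lambda>z. G z $ i $ l) x
         - partial S l (\<lambda>z. G z $ i $ j) x)) / 2"

text \<open>The component \<open>R\<^sub>i\<^sub>j\<^sup>k\<^sub>l\<close> of \<open>(\<nabla>\<^sub>i\<nabla>\<^sub>j - \<nabla>\<^sub>j\<nabla>\<^sub>i)v\<^sup>k = R\<^sub>i\<^sub>j\<^sup>k\<^sub>l v\<^sup>l\<close>; the Ricci tensor
  \<open>R\<^sub>k\<^sub>i\<^sup>k\<^sub>j\<close> is then positive on round spheres.\<close>

definition riemann ::
    "(real^'n::finite) set \<Rightarrow> (real^'n \<Rightarrow> real^'n^'n) \<Rightarrow> real^'n \<Rightarrow> 'n \<Rightarrow> 'n \<Rightarrow> 'n \<Rightarrow> 'n \<Rightarrow> real" where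
  "riemann S G x i j k l =
     partial S i (\<lambda>z. christoffel S G z k j l) x - partial S j (\<lambda>z. christoffel S G z k i l) x
     + (\<Sum>m\<in>UNIV. christoffel S G x k i m * christoffel S G x m j l
                   - christoffel S G x k j m * christoffel S G x m i l)"

definition ricci :: "(real^'n::finite) set \<Rightarrow> (real^'n \<Rightarrow> real^'n^'n) \<Rightarrow> real^'n \<Rightarrow> real^'n^'n" where
  "ricci S G x = (\<chi> i j. \<Sum>k\<in>UNIV. riemann S G x k i k j)"

definition conf_trace ::
    "(real^'n::finite \<Rightarrow> real^'n^'n) \<Rightarrow> real^'n \<Rightarrow> real^'n^'n \<Rightarrow> real" where
  "conf_trace G x T = (\<Sum>a\<in>UNIV. \<Sum>b\<in>UNIV. conf_metric_inv G x $ a $ b * T $ a $ b)"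

text \<open>\<open>J\<close>, of weight \<open>-2\<close>, solves \<open>(n-2) J = tr Ric - n J\<close>, which says that it is the trace of the
  Schouten tensor.\<close>

definition schouten_trace ::
    "(real^'n::finite) set \<Rightarrow> (real^'n \<Rightarrow> real^'n^'n) \<Rightarrow> real^'n \<Rightarrow> real" where
  "schouten_trace S G x = conf_trace G x (ricci S G x) / (2 * (real CARD('n) - 1))"

definition schouten :: "(real^'n::finite) set \<Rightarrow> (real^'n \<Rightarrow> real^'n^'n) \<Rightarrow> real^'n \<Rightarrow> real^'n^'n" where
  "schouten S G x = (1 / (real CARD('n) - 2)) *\<^sub>R
     (ricci S G x - schouten_trace S G x *\<^sub>R conf_metric G x)"

definition einstein_on ::
    "('a, 'n::finite) chart set \<Rightarrow> 'a set \<Rightarrow> ('a, 'n) bilinear_field \<Rightarrow> bool" where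
  "einstein_on A U g \<longleftrightarrow> (\<exists>k::real. \<forall>c\<in>A. \<forall>p\<in>fst c \<inter> U.
     ricci (img c) (g c) (snd c p) = k *\<^sub>R g c (snd c p))"

text \<open>The connection form of \<open>\<E>[w]\<close> in the above frame: \<open>\<nabla>\<^sub>a f = \<partial>\<^sub>a f + (w/n) \<Gamma>\<^sup>b\<^sub>a\<^sub>b f\<close>.\<close>

definition density_form ::
    "(real^'n::finite) set \<Rightarrow> (real^'n \<Rightarrow> real^'n^'n) \<Rightarrow> real \<Rightarrow> real^'n \<Rightarrow> real^'n" where
  "density_form S G w x = (\<chi> a. w / real CARD('n) * (\<Sum>b\<in>UNIV. christoffel S G x b a b))"

definition nabla_density ::
    "(real^'n::finite) set \<Rightarrow> (real^'n \<Rightarrow> real^'n^'n) \<Rightarrow> real \<Rightarrow> (real^'n \<Rightarrow> real) \<Rightarrow> real^'n \<Rightarrow> real^'n" where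
  "nabla_density S G w f x = (\<chi> a. partial S a f x + density_form S G w x $ a * f x)"

definition nabla_covector ::
    "(real^'n::finite) set \<Rightarrow> (real^'n \<Rightarrow> real^'n^'n) \<Rightarrow> real \<Rightarrow> (real^'n \<Rightarrow> real^'n) \<Rightarrow> real^'n \<Rightarrow> real^'n^'n" where
  "nabla_covector S G w m x = (\<chi> a b. partial S a (\<lambda>z. m z $ b) x
     - (\<Sum>k\<in>UNIV. christoffel S G x k a b * m x $ k) + density_form S G w x $ a * m x $ b)"

definition laplacian ::
    "(real^'n::finite) set \<Rightarrow> (real^'n \<Rightarrow> real^'n^'n) \<Rightarrow> real \<Rightarrow> (real^'n \<Rightarrow> real) \<Rightarrow> real^'n \<Rightarrow> real" where
  "laplacian S G w f x = conf_trace G x (nabla_covector S G w (nabla_density S G w f) x)"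

section \<open>Curves\<close>

definition curve ::
    "'a topology \<Rightarrow> ('a, 'n::finite) chart set \<Rightarrow> real set \<Rightarrow> (real \<Rightarrow> 'a) \<Rightarrow> bool" where
  "curve M A I \<gamma> \<longleftrightarrow> is_interval I \<and> interior I \<noteq> {}
     \<and> continuous_map (top_of_set I) M \<gamma>
     \<and> (\<forall>c\<in>A. smooth_on {t\<in>I. \<gamma> t \<in> fst c} (snd c \<circ> \<gamma>)
          \<and> (\<forall>t\<in>I. \<gamma> t \<in> fst c \<longrightarrow> vector_derivative (snd c \<circ> \<gamma>) (at t within I) \<noteq> 0))"

text \<open>In the following, \<open>y\<close> is a curve \<open>\<gamma>\<close>, defined on \<open>I\<close>, read in the chart with image \<open>S\<close>.
  The functions \<open>cov_density\<close>, \<open>cov_vector\<close> and \<open>cov_covector\<close> are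
  \<open>u\<^sup>a\<nabla>\<^sub>a\<close> on fields of weight \<open>w\<close> along the curve.\<close>

definition velocity :: "real set \<Rightarrow> (real \<Rightarrow> real^'n::finite) \<Rightarrow> real \<Rightarrow> real^'n" where
  "velocity I y t = vector_derivative y (at t within I)"

definition cov_density ::
    "(real^'n::finite) set \<Rightarrow> (real^'n \<Rightarrow> real^'n^'n) \<Rightarrow> real set \<Rightarrow> (real \<Rightarrow> real^'n) \<Rightarrow> real
      \<Rightarrow> (real \<Rightarrow> real) \<Rightarrow> real \<Rightarrow> real" where
  "cov_density S G I y w f t = vector_derivative f (at t within I)
     + (density_form S G w (y t) \<bullet> velocity I y t) * f t"

definition cov_vector ::
    "(real^'n::finite) set \<Rightarrow> (real^'n \<Rightarrow> real^'n^'n) \<Rightarrow> real set \<Rightarrow> (real \<Rightarrow> real^'n) \<Rightarrow> real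
      \<Rightarrow> (real \<Rightarrow> real^'n) \<Rightarrow> real \<Rightarrow> real^'n" where
  "cov_vector S G I y w V t = vector_derivative V (at t within I)
     + (\<chi> b. \<Sum>a\<in>UNIV. \<Sum>k\<in>UNIV. christoffel S G (y t) b a k * velocity I y t $ a * V t $ k)
     + (density_form S G w (y t) \<bullet> velocity I y t) *\<^sub>R V t"

definition cov_covector ::
    "(real^'n::finite) set \<Rightarrow> (real^'n \<Rightarrow> real^'n^'n) \<Rightarrow> real set \<Rightarrow> (real \<Rightarrow> real^'n) \<Rightarrow> real
      \<Rightarrow> (real \<Rightarrow> real^'n) \<Rightarrow> real \<Rightarrow> real^'n" where
  "cov_covector S G I y w m t = vector_derivative m (at t within I)
     - (\<chi> b. \<Sum>a\<in>UNIV. \<Sum>k\<in>UNIV. christoffel S G (y t) k a b * velocity I y t $ a * m t $ k)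
     + (density_form S G w (y t) \<bullet> velocity I y t) *\<^sub>R m t"

definition conf_square ::
    "(real^'n::finite \<Rightarrow> real^'n^'n) \<Rightarrow> real set \<Rightarrow> (real \<Rightarrow> real^'n) \<Rightarrow> real \<Rightarrow> real" where
  "conf_square G I y t = velocity I y t \<bullet> (conf_metric G (y t) *v velocity I y t)"

definition speed_density ::
    "(real^'n::finite \<Rightarrow> real^'n^'n) \<Rightarrow> real set \<Rightarrow> (real \<Rightarrow> real^'n) \<Rightarrow> real \<Rightarrow> real" where
  "speed_density G I y t = sqrt \<bar>conf_square G I y t\<bar>"

definition weighted_velocity ::
    "(real^'n::finite \<Rightarrow> real^'n^'n) \<Rightarrow> real set \<Rightarrow> (real \<Rightarrow> real^'n) \<Rightarrow> real \<Rightarrow> real^'n" where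
  "weighted_velocity G I y t = (1 / speed_density G I y t) *\<^sub>R velocity I y t"

definition weighted_acceleration ::
    "(real^'n::finite) set \<Rightarrow> (real^'n \<Rightarrow> real^'n^'n) \<Rightarrow> real set \<Rightarrow> (real \<Rightarrow> real^'n) \<Rightarrow> real \<Rightarrow> real^'n" where
  "weighted_acceleration S G I y t = (1 / speed_density G I y t) *\<^sub>R
     cov_vector S G I y (- 1) (weighted_velocity G I y) t"

definition skew_pair :: "real^'n::finite \<Rightarrow> real^'n \<Rightarrow> real^'n^'n" where
  "skew_pair v w = (\<chi> a b. (v $ a * w $ b - v $ b * w $ a) / 2)"

text \<open>The sign in the equation is that of \<open>conf_square\<close>, constant along a nowhere-null curve.\<close>

definition conformal_circle_eq ::
    "(real^'n::finite) set \<Rightarrow> (real^'n \<Rightarrow> real^'n^'n) \<Rightarrow> real set \<Rightarrow> (real \<Rightarrow> real^'n) \<Rightarrow> real \<Rightarrow> bool" where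
  "conformal_circle_eq S G I y t \<longleftrightarrow>
     skew_pair ((1 / speed_density G I y t) *\<^sub>R
         cov_vector S G I y (- 2) (weighted_acceleration S G I y) t) (weighted_velocity G I y t)
     = sgn (conf_square G I y t) *\<^sub>R
       skew_pair (conf_metric_inv G (y t) *v (weighted_velocity G I y t v* schouten S G (y t)))
         (weighted_velocity G I y t)"

definition nowhere_null ::
    "('a, 'n::finite) chart set \<Rightarrow> ('a, 'n) bilinear_field \<Rightarrow> real set \<Rightarrow> (real \<Rightarrow> 'a) \<Rightarrow> bool" where
  "nowhere_null A g I \<gamma> \<longleftrightarrow> (\<forall>c\<in>A. \<forall>t\<in>I. \<gamma> t \<in> fst c \<longrightarrow>
     velocity I (snd c \<circ> \<gamma>) t \<bullet> (g c (snd c (\<gamma> t)) *v velocity I (snd c \<circ> \<gamma>) t) \<noteq> 0)"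

definition geodesic ::
    "'a topology \<Rightarrow> ('a, 'n::finite) chart set \<Rightarrow> ('a, 'n) bilinear_field \<Rightarrow> real set \<Rightarrow> (real \<Rightarrow> 'a) \<Rightarrow> bool" where
  "geodesic M A g I \<gamma> \<longleftrightarrow> curve M A I \<gamma> \<and>
     (\<forall>c\<in>A. \<forall>t\<in>I. \<gamma> t \<in> fst c \<longrightarrow> (\<exists>k.
        cov_vector (img c) (g c) I (snd c \<circ> \<gamma>) 0 (velocity I (snd c \<circ> \<gamma>)) t
        = k *\<^sub>R velocity I (snd c \<circ> \<gamma>) t))"

text \<open>Here and in \<open>generalised_geodesic\<close>, \<open>C\<close> is a conformal class, and the choice of \<open>g\<close> in it
  does not matter.\<close>

definition conformal_circle ::
    "'a topology \<Rightarrow> ('a, 'n::finite) chart set \<Rightarrow> ('a, 'n) bilinear_field set \<Rightarrow> real set \<Rightarrow> (real \<Rightarrow> 'a) \<Rightarrow> bool" where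
  "conformal_circle M A C I \<gamma> \<longleftrightarrow> curve M A I \<gamma> \<and>
     (\<exists>g\<in>C. nowhere_null A g I \<gamma> \<and>
        (\<forall>c\<in>A. \<forall>t\<in>I. \<gamma> t \<in> fst c \<longrightarrow> conformal_circle_eq (img c) (g c) I (snd c \<circ> \<gamma>) t))"

section \<open>Tractors\<close>

text \<open>An element of the standard tractor bundle is given, in a scale \<open>g\<close> and a chart, by its triple
  \<open>(\<sigma>, \<mu>\<^sub>a, \<rho>)\<close> in \<open>\<E>[1] \<oplus> \<E>\<^sub>a[1] \<oplus> \<E>[-1]\<close>. The triples of the same tractor in
  two scales or charts differ by an invertible linear map, so vanishing of a tensor built from tractors
  may be tested on components in any of them.\<close>

type_synonym 'n tractor = "real \<times> (real^'n) \<times> real"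

datatype 'n tractor_index = Top | Mid 'n | Bot

fun tractor_component :: "'n::finite tractor \<Rightarrow> 'n tractor_index \<Rightarrow> real" where
  "tractor_component (s, m, r) Top = s"
| "tractor_component (s, m, r) (Mid a) = m $ a"
| "tractor_component (s, m, r) Bot = r"

text \<open>\<open>u\<^sup>a\<nabla>\<^sub>a\<close> of a tractor field \<open>V\<close> along a curve, for the tractor connection.\<close>

definition cov_tractor ::
    "(real^'n::finite) set \<Rightarrow> (real^'n \<Rightarrow> real^'n^'n) \<Rightarrow> real set \<Rightarrow> (real \<Rightarrow> real^'n)
      \<Rightarrow> (real \<Rightarrow> 'n tractor) \<Rightarrow> real \<Rightarrow> 'n tractor" where
  "cov_tractor S G I y V t =
     (let s = (\<lambda>t. fst (V t)); m = (\<lambda>t. fst (snd (V t))); r = (\<lambda>t. snd (snd (V t)));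
          u = velocity I y t; P = schouten S G (y t)
      in (cov_density S G I y 1 s t - u \<bullet> m t,
          cov_covector S G I y 1 m t + r t *\<^sub>R (u v* conf_metric G (y t)) + s t *\<^sub>R (u v* P),
          cov_density S G I y (- 1) r t - u \<bullet> (P *v (conf_metric_inv G (y t) *v m t))))"

definition tractor_X :: "'n::finite tractor" where
  "tractor_X = (0, 0, 1)"

definition tractor_U ::
    "(real^'n::finite) set \<Rightarrow> (real^'n \<Rightarrow> real^'n^'n) \<Rightarrow> real set \<Rightarrow> (real \<Rightarrow> real^'n) \<Rightarrow> real \<Rightarrow> 'n tractor" where
  "tractor_U S G I y = cov_tractor S G I y (\<lambda>t. (1 / speed_density G I y t) *\<^sub>R tractor_X)"

definition tractor_A ::
    "(real^'n::finite) set \<Rightarrow> (real^'n \<Rightarrow> real^'n^'n) \<Rightarrow> real set \<Rightarrow> (real \<Rightarrow> real^'n) \<Rightarrow> real \<Rightarrow> 'n tractor" where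
  "tractor_A S G I y = cov_tractor S G I y (tractor_U S G I y)"

text \<open>Skew-symmetrisation over \<open>k\<close> indices, with \<open>T i\<close> depending on \<open>i 0, \<dots>, i (k-1)\<close> only.\<close>

definition skew :: "nat \<Rightarrow> ((nat \<Rightarrow> 'i) \<Rightarrow> real) \<Rightarrow> (nat \<Rightarrow> 'i) \<Rightarrow> real" where
  "skew k T i = (\<Sum>\<pi> | \<pi> permutes {..<k}. of_int (sign \<pi>) * T (i \<circ> \<pi>)) / fact k"

definition three_tractor ::
    "(real^'n::finite) set \<Rightarrow> (real^'n \<Rightarrow> real^'n^'n) \<Rightarrow> real set \<Rightarrow> (real \<Rightarrow> real^'n) \<Rightarrow> real
      \<Rightarrow> (nat \<Rightarrow> 'n tractor_index) \<Rightarrow> real" where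
  "three_tractor S G I y t i = 6 / speed_density G I y t *
     skew 3 (\<lambda>j. tractor_component tractor_X (j 0)
                * tractor_component (tractor_U S G I y t) (j 1)
                * tractor_component (tractor_A S G I y t) (j 2)) i"

definition scale_tractor ::
    "(real^'n::finite) set \<Rightarrow> (real^'n \<Rightarrow> real^'n^'n) \<Rightarrow> (real^'n \<Rightarrow> real) \<Rightarrow> real^'n \<Rightarrow> 'n tractor" where
  "scale_tractor S G \<sigma> x = (\<sigma> x, nabla_density S G 1 \<sigma> x,
     - (laplacian S G 1 \<sigma> x + schouten_trace S G x * \<sigma> x) / real CARD('n))"

definition wedge_scale_three ::
    "(real^'n::finite) set \<Rightarrow> (real^'n \<Rightarrow> real^'n^'n) \<Rightarrow> (real^'n \<Rightarrow> real) \<Rightarrow> real set \<Rightarrow> (real \<Rightarrow> real^'n)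
      \<Rightarrow> real \<Rightarrow> (nat \<Rightarrow> 'n tractor_index) \<Rightarrow> real" where
  "wedge_scale_three S G \<sigma> I y t = skew 4 (\<lambda>j.
     tractor_component (scale_tractor S G \<sigma> (y t)) (j 0) * three_tractor S G I y t (\<lambda>k. j (Suc k)))"

definition generalised_geodesic ::
    "'a topology \<Rightarrow> ('a, 'n::finite) chart set \<Rightarrow> ('a, 'n) bilinear_field set \<Rightarrow> ('a, 'n) density_field
      \<Rightarrow> real set \<Rightarrow> (real \<Rightarrow> 'a) \<Rightarrow> bool" where
  "generalised_geodesic M A C \<sigma> I \<gamma> \<longleftrightarrow> curve M A I \<gamma> \<and>
     (\<exists>g\<in>C. nowhere_null A g I \<gamma> \<and>
        (\<forall>c\<in>A. \<forall>t\<in>I. \<gamma> t \<in> fst c \<longrightarrow>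
           (\<forall>i. wedge_scale_three (img c) (g c) (\<sigma> c) I (snd c \<circ> \<gamma>) t i = 0)))"

section \<open>Conformally compact and Poincare-Einstein manifolds\<close>

definition conformally_compact ::
    "'a topology \<Rightarrow> ('a, 'n::finite) chart set \<Rightarrow> ('a, 'n) bilinear_field set \<Rightarrow> ('a, 'n) density_field \<Rightarrow> bool" where
  "conformally_compact M A C \<sigma> \<longleftrightarrow> connected_manifold_with_boundary M A \<and>
     (\<exists>g r. pseudo_riemannian_metric A g \<and> defining_function M A r \<and> C = conformal_class A g
        \<and> (\<forall>c\<in>A. \<forall>p\<in>fst c. \<sigma> c (snd c p) = r p * scale_density (g c) (snd c p)))"

text \<open>The interior metric is \<open>\<sigma>\<close> to the power \<open>-2\<close> times the conformal metric, which may be computed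
  from any \<open>g\<close> in \<open>C\<close>.\<close>

definition poincare_einstein ::
    "'a topology \<Rightarrow> ('a, 'n::finite) chart set \<Rightarrow> ('a, 'n) bilinear_field set \<Rightarrow> ('a, 'n) density_field \<Rightarrow> bool" where
  "poincare_einstein M A C \<sigma> \<longleftrightarrow> conformally_compact M A C \<sigma> \<and>
     (\<exists>g\<in>C. einstein_on A (manifold_interior M A)
        (\<lambda>c x. (1 / (\<sigma> c x)\<^sup>2) *\<^sub>R conf_metric (g c) x))"

end

theory Submission
  imports Defs
begin

text \<open>For \<open>\<phi> > 0\<close>, a geodesic of \<open>g\<close> satisfies the conformal circle equation of \<open>\<phi> g\<close> at a point if and
  only if its velocity there is an eigenvector of the Ricci endomorphism of \<open>g\<close>. There are geodesics
  through every point in every non-null direction, so if all of them are conformal circles, then by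
  density all directions are eigenvectors, \<open>Ric\<close> is a multiple of \<open>g\<close>, and \<open>g\<close> is Einstein by the
  contracted Bianchi identity, as \<open>n \<ge> 3\<close>. For the compactification, \<open>I \<and> \<Sigma> = 0\<close> is the
  unparametrised geodesic equation of the interior metric at interior points, while at the boundary it
  makes the curve normal to the boundary. Boundary times are therefore isolated, and there the conformal
  circle equation follows by continuity.\<close>

text \<open>The definitions ask for the circle equation in some metric of the conformal class, so it
  is evaluated for an arbitrary positive multiple \<phi> g along a geodesic of g. The derivatives of
  \<phi> enter the left side through the rescaled acceleration and the right side through the
  conformal change of Ricci; both contribute the same term, and the Ricci tensor of g is what
  remains. For (b), \<phi> is the square of the defining function: the interior metric, singular at
  the boundary, plays the role of g, while the equation is tested in a metric smooth up to the
  boundary. In I \<and> \<Sigma> the factor X absorbs the bottom slots, where alone curvature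
  occurs; this leaves a relation between the gradient of \<sigma> and the acceleration. Connections
  are handled as matrices: a change of coordinates is a gauge transformation by the Jacobian, and
  it, like a conformal change, is identified through uniqueness of the Levi-Civita connection. Only
  M, not its interior, is assumed connected; convex half balls at boundary points bridge this when
  the Einstein factor is shown to be constant.\<close>

section \<open>Domains within which derivatives are unique\<close>

text \<open>The condition is the hypothesis of \<open>frechet_derivative_unique_within\<close>. It
  passes to relatively open subsets and holds for closed half spaces and nondegenerate intervals, so
  boundary charts and one-sided times are handled like interior ones.\<close>

definition rich :: "'a::euclidean_space set \<Rightarrow> bool" where
  "rich S \<longleftrightarrow> (\<forall>x\<in>S. \<forall>i\<in>Basis. \<forall>e>0. \<exists>d. 0 < \<bar>d\<bar> \<and> \<bar>d\<bar> < e \<and> x + d *\<^sub>R i \<in> S)"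

lemma rich_unique:
  assumes "rich S" "x \<in> S" "(f has_derivative f') (at x within S)" "(f has_derivative f'') (at x within S)"
  shows "f' = f''"
  by (rule frechet_derivative_unique_within[OF assms(3,4)]) (use assms(1,2) in \<open>auto simp: rich_def\<close>)

lemma rich_frechet:
  assumes "rich S" "x \<in> S" "(f has_derivative f') (at x within S)"
  shows "frechet_derivative f (at x within S) = f'"
  using rich_unique[OF assms(1,2) _ assms(3)] assms(3) frechet_derivative_works
  unfolding differentiable_def by blast

text \<open>The filters themselves agree, so every notion built from derivatives within a set may be
  restricted to a relatively open part. This is what later localises chart images and time
  intervals.\<close>

lemma at_within_openin:
  assumes "openin (top_of_set S) T" "x \<in> T"
  shows "at x within T = at x within S"
proof -
  obtain U where "open U" "T = S \<inter> U" using assms(1) by (auto simp: openin_open)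
  then show ?thesis using assms(2) by (intro at_within_nhd[of x U]) auto
qed

lemma rich_openin:
  fixes S :: "'a::euclidean_space set"
  assumes "rich S" "openin (top_of_set S) T"
  shows "rich T"
  unfolding rich_def
proof (intro ballI allI impI)
  fix x i :: 'a and e :: real assume x: "x \<in> T" and i: "i \<in> Basis" and e: "e > 0"
  obtain U where U: "open U" "T = S \<inter> U" using assms(2) by (auto simp: openin_open)
  then obtain d where d: "d > 0" "ball x d \<subseteq> U" using x by (auto simp: open_contains_ball)
  obtain r where r: "0 < \<bar>r\<bar>" "\<bar>r\<bar> < min e d" "x + r *\<^sub>R i \<in> S"
  proof -
    have "x \<in> S" "min e d > 0" using x U e d by auto
    then show ?thesis using assms(1) i that unfolding rich_def by blast
  qed
  have "x + r *\<^sub>R i \<in> ball x d" using r i by (simp add: dist_norm)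
  then show "\<exists>d. 0 < \<bar>d\<bar> \<and> \<bar>d\<bar> < e \<and> x + d *\<^sub>R i \<in> T" using r d U by auto
qed

lemma rich_UNIV: "rich (UNIV :: 'a::euclidean_space set)"
  unfolding rich_def
proof (intro ballI allI impI)
  fix x i :: 'a and e :: real assume "e > 0"
  then show "\<exists>d. 0 < \<bar>d\<bar> \<and> \<bar>d\<bar> < e \<and> x + d *\<^sub>R i \<in> UNIV"
    by (intro exI[of _ "e/2"]) auto
qed

lemma rich_open: "open S \<Longrightarrow> rich S"
  by (rule rich_openin[OF rich_UNIV]) (simp add: openin_open_eq)

lemma rich_half_space: "rich (half_space k :: (real^'n::finite) set)"
  unfolding rich_def
proof (intro ballI allI impI)
  fix x i :: "real^'n" and e :: real assume x: "x \<in> half_space k" and i: "i \<in> Basis" and e: "e > 0"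
  \<comment> \<open>A forward step along a basis vector never decreases the coordinate
    \<open>k\<close>, so the same sign works at boundary points.\<close>
  then have "x + (e/2) *\<^sub>R i \<in> half_space k"
    by (auto simp: half_space_def Basis_vec_def axis_def)
  with e show "\<exists>d. 0 < \<bar>d\<bar> \<and> \<bar>d\<bar> < e \<and> x + d *\<^sub>R i \<in> half_space k"
    by (intro exI[of _ "e/2"]) auto
qed

lemma rich_interval:
  fixes I :: "real set"
  assumes "is_interval I" "interior I \<noteq> {}"
  shows "rich I"
  unfolding rich_def
proof (intro ballI allI impI)
  fix x i :: real and e :: real assume x: "x \<in> I" and i: "i \<in> Basis" and e: "e > 0"
  obtain y where y: "y \<in> interior I" using assms by auto
  then obtain d where d: "d > 0" "ball y d \<subseteq> I" by (meson mem_interior)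
  \<comment> \<open>A second point of the interval; \<open>x\<close> is moved along the segment
    towards it, which stays inside by convexity.\<close>
  define z where "z = (if x = y then y + d/2 else y)"
  have z: "z \<in> I" "z \<noteq> x" using d by (auto simp: z_def subset_iff dist_real_def)
  \<comment> \<open>The bound \<open>1/2\<close> keeps the convex combination admissible, the other
    one limits the displacement to \<open>e/2\<close>.\<close>
  define s where "s = min (1/2) (e / (2 * \<bar>z - x\<bar>))"
  have s: "s > 0" "s \<le> 1" "s * \<bar>z - x\<bar> < e"
  proof -
    show "s > 0" "s \<le> 1" using e z by (auto simp: s_def)
    have "s * \<bar>z - x\<bar> \<le> e / (2 * \<bar>z - x\<bar>) * \<bar>z - x\<bar>"
      by (rule mult_right_mono) (auto simp: s_def)
    also have "\<dots> = e / 2" using z by simp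
    finally show "s * \<bar>z - x\<bar> < e" using e by simp
  qed
  have "(1 - s) *\<^sub>R x + s *\<^sub>R z \<in> I"
    using is_interval_convex[OF assms(1)] x z s unfolding convex_alt by simp
  then have "x + (s * (z - x)) *\<^sub>R i \<in> I" using i by (simp add: algebra_simps)
  then show "\<exists>d. 0 < \<bar>d\<bar> \<and> \<bar>d\<bar> < e \<and> x + d *\<^sub>R i \<in> I"
    using s z by (intro exI[of _ "s * (z - x)"]) (auto simp: abs_mult)
qed

lemma rich_img: "is_chart M c \<Longrightarrow> rich (img c)"
  unfolding is_chart_def using rich_openin[OF rich_half_space] by blast

lemma rich_not_bot:
  fixes S :: "real set"
  assumes "rich S" "t \<in> S"
  shows "at t within S \<noteq> bot"
  unfolding trivial_limit_within not_not islimpt_approachable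
proof (intro allI impI)
  fix e :: real assume "e > 0"
  then obtain d where "0 < \<bar>d\<bar>" "\<bar>d\<bar> < e" "t + d *\<^sub>R 1 \<in> S"
    using assms(1,2) unfolding rich_def by force
  then show "\<exists>x'\<in>S. x' \<noteq> t \<and> dist x' t < e"
    by (intro bexI[of _ "t + d"]) (auto simp: dist_real_def)
qed

lemma rich_vector_derivative:
  fixes S :: "real set"
  assumes "rich S" "t \<in> S" "(f has_vector_derivative f') (at t within S)"
  shows "vector_derivative f (at t within S) = f'"
  using vector_derivative_within[OF rich_not_bot[OF assms(1,2)] assms(3)] .

text \<open>\<open>frechet_derivative\<close> is a choice among all derivatives, and the two
  functions have the same ones. The terms therefore agree even where no derivative exists.\<close>

lemma frechet_derivative_cong_on:
  assumes "x \<in> S" "\<And>z. z \<in> S \<Longrightarrow> f z = g z"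
  shows "frechet_derivative f (at x within S) = frechet_derivative g (at x within S)"
proof -
  have "(f has_derivative f') (at x within S) \<longleftrightarrow> (g has_derivative f') (at x within S)" for f'
    using assms has_derivative_transform[of x S f g] has_derivative_transform[of x S g f] by metis
  then show ?thesis by (simp add: frechet_derivative_def)
qed

section \<open>Calculus of functions smooth within a set\<close>

lemma Ck_on_cong:
  assumes "\<And>x. x \<in> S \<Longrightarrow> f x = g x"
  shows "Ck_on k S f \<longleftrightarrow> Ck_on k S g"
proof -
  have "Ck_on k S f \<Longrightarrow> Ck_on k S g" if "\<And>x. x \<in> S \<Longrightarrow> f x = g x" for f g :: "'a \<Rightarrow> 'b"
    using that
  proof (induction k arbitrary: f g)
    case 0 then show ?case using continuous_on_cong by fastforce
  next
    case (Suc k)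
    have "f differentiable_on S \<Longrightarrow> g differentiable_on S"
      using Suc.prems(2) unfolding differentiable_on_def differentiable_def
      by (metis has_derivative_transform)
    moreover have "Ck_on k S (\<lambda>x. frechet_derivative g (at x within S) v)" for v
    proof (rule Suc.IH)
      show "Ck_on k S (\<lambda>x. frechet_derivative f (at x within S) v)" using Suc.prems(1) by simp
      show "frechet_derivative f (at x within S) v = frechet_derivative g (at x within S) v" if "x \<in> S" for x
        using frechet_derivative_cong_on[of x S f g] that Suc.prems(2) by simp
    qed
    ultimately show ?case using Suc.prems(1) by auto
  qed
  from this[of f g] this[of g f] show ?thesis using assms by metis
qed

lemma Ck_on_SucD: "Ck_on (Suc k) S f \<Longrightarrow> Ck_on k S f"
proof (induction k arbitrary: f)
  case 0 then show ?case by (auto intro: differentiable_imp_continuous_on)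
next
  case (Suc k)
  have "Ck_on (Suc k) S (\<lambda>x. frechet_derivative f (at x within S) v)" for v
    using Suc.prems by (subst (asm) Ck_on.simps(2)) blast
  then have "Ck_on k S (\<lambda>x. frechet_derivative f (at x within S) v)" for v
    by (rule Suc.IH)
  then show ?case using Suc.prems by auto
qed

text \<open>The recursion in \<open>Ck_on\<close> speaks of the chosen derivative; on a rich set any
  explicit derivative equals it and may be used instead.\<close>

lemma Ck_on_SucI:
  assumes "rich S" "\<And>x. x \<in> S \<Longrightarrow> (f has_derivative f' x) (at x within S)"
    "\<And>v. Ck_on k S (\<lambda>x. f' x v)"
  shows "Ck_on (Suc k) S f"
proof -
  have "Ck_on k S (\<lambda>x. frechet_derivative f (at x within S) v)" for v
    using assms(3)[of v] Ck_on_cong[of S "\<lambda>x. frechet_derivative f (at x within S) v" "\<lambda>x. f' x v" k]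
      rich_frechet[OF assms(1) _ assms(2)] by simp
  then show ?thesis using assms(2) by (auto simp: differentiable_on_def differentiable_def)
qed

lemma Ck_on_SucE:
  assumes "Ck_on (Suc k) S f"
  obtains f' where "\<And>x. x \<in> S \<Longrightarrow> (f has_derivative f' x) (at x within S)"
    "\<And>v. Ck_on k S (\<lambda>x. f' x v)"
  using assms that[of "\<lambda>x. frechet_derivative f (at x within S)"]
  by (auto simp: differentiable_on_def frechet_derivative_works)

lemma Ck_on_openin:
  assumes "openin (top_of_set S) T" "Ck_on k S f"
  shows "Ck_on k T f"
  using assms(2)
proof (induction k arbitrary: f)
  case 0 then show ?case using continuous_on_subset[of S f T] openin_imp_subset[OF assms(1)] by simp
next
  case (Suc k)
  have "T \<subseteq> S" using assms(1) openin_imp_subset by auto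
  then have "f differentiable_on T" using Suc.prems differentiable_on_subset by auto
  moreover have "Ck_on k T (\<lambda>x. frechet_derivative f (at x within T) v)" for v
    using Suc.IH[of "\<lambda>x. frechet_derivative f (at x within S) v"] Suc.prems
      Ck_on_cong[of T "\<lambda>x. frechet_derivative f (at x within S) v" "\<lambda>x. frechet_derivative f (at x within T) v" k]
      at_within_openin[OF assms(1)] by simp
  ultimately show ?case by simp
qed


lemma Ck_on_const: "rich S \<Longrightarrow> Ck_on k S (\<lambda>x. c)"
proof (induction k arbitrary: c)
  case (Suc k)
  then show ?case by (intro Ck_on_SucI[where f' = "\<lambda>x v. 0"]) (auto simp: Suc)
qed simp

lemma Ck_on_bounded_linear:
  assumes "bounded_linear h" "rich S" "Ck_on k S f"
  shows "Ck_on k S (\<lambda>x. h (f x))"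
  using assms(3)
proof (induction k arbitrary: f)
  case 0 then show ?case using bounded_linear.continuous_on[OF assms(1)] by auto
next
  case (Suc k)
  from Suc.prems obtain f' where f': "\<And>x. x \<in> S \<Longrightarrow> (f has_derivative f' x) (at x within S)"
    "\<And>v. Ck_on k S (\<lambda>x. f' x v)" by (rule Ck_on_SucE) blast
  show ?case
    by (rule Ck_on_SucI[where f' = "\<lambda>x v. h (f' x v)"])
       (use f' Suc.IH assms in \<open>auto intro: bounded_linear.has_derivative\<close>)
qed

lemma Ck_on_add:
  assumes "rich S" "Ck_on k S f" "Ck_on k S g"
  shows "Ck_on k S (\<lambda>x. f x + g x)"
  using assms(2,3)
proof (induction k arbitrary: f g)
  case 0 then show ?case by (auto intro: continuous_on_add)
next
  case (Suc k)
  obtain f' where f': "\<And>x. x \<in> S \<Longrightarrow> (f has_derivative f' x) (at x within S)"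
    "\<And>v. Ck_on k S (\<lambda>x. f' x v)" by (rule Ck_on_SucE[OF Suc.prems(1)]) blast
  obtain g' where g': "\<And>x. x \<in> S \<Longrightarrow> (g has_derivative g' x) (at x within S)"
    "\<And>v. Ck_on k S (\<lambda>x. g' x v)" by (rule Ck_on_SucE[OF Suc.prems(2)]) blast
  show ?case
    by (rule Ck_on_SucI[where f' = "\<lambda>x v. f' x v + g' x v"])
       (use f' g' Suc.IH assms in \<open>auto intro: has_derivative_add\<close>)
qed

lemma Ck_on_bilinear:
  assumes "bounded_bilinear h" "rich S" "Ck_on k S f" "Ck_on k S g"
  shows "Ck_on k S (\<lambda>x. h (f x) (g x))"
  using assms(3,4)
proof (induction k arbitrary: f g)
  case 0 then show ?case using bounded_bilinear.continuous_on[OF assms(1)] by auto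
next
  case (Suc k)
  obtain f' where f': "\<And>x. x \<in> S \<Longrightarrow> (f has_derivative f' x) (at x within S)"
    "\<And>v. Ck_on k S (\<lambda>x. f' x v)" by (rule Ck_on_SucE[OF Suc.prems(1)]) blast
  obtain g' where g': "\<And>x. x \<in> S \<Longrightarrow> (g has_derivative g' x) (at x within S)"
    "\<And>v. Ck_on k S (\<lambda>x. g' x v)" by (rule Ck_on_SucE[OF Suc.prems(2)]) blast
  \<comment> \<open>The product rule differentiates one factor and keeps the other, so both factors
    are also needed at the lower order.\<close>
  note low = Suc.prems[THEN Ck_on_SucD]
  show ?case
    by (rule Ck_on_SucI[where f' = "\<lambda>x v. h (f x) (g' x v) + h (f' x v) (g x)"])
       (use f' g' Suc.IH low assms in \<open>auto intro!: Ck_on_add bounded_bilinear.FDERIV\<close>)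
qed

lemma Ck_on_sum:
  assumes "rich S" "\<And>i. i \<in> A \<Longrightarrow> Ck_on k S (f i)"
  shows "Ck_on k S (\<lambda>x. \<Sum>i\<in>A. f i x)"
  using assms(2)
  by (induction A rule: infinite_finite_induct) (auto intro: Ck_on_const Ck_on_add assms(1))

lemma Ck_on_compose:
  fixes f :: "'a::euclidean_space \<Rightarrow> 'b::euclidean_space" and g :: "'b \<Rightarrow> 'c::real_normed_vector"
  assumes "rich S" "rich T" "f ` S \<subseteq> T" "Ck_on k S f" "Ck_on k T g"
  shows "Ck_on k S (\<lambda>x. g (f x))"
  using assms(4,5)
proof (induction k arbitrary: g)
  case 0 then show ?case using continuous_on_compose2[of T g S f] assms(3) by auto
next
  case (Suc k)
  obtain f' where f': "\<And>x. x \<in> S \<Longrightarrow> (f has_derivative f' x) (at x within S)"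
    "\<And>v. Ck_on k S (\<lambda>x. f' x v)" by (rule Ck_on_SucE[OF Suc.prems(1)]) blast
  obtain g' where g': "\<And>x. x \<in> T \<Longrightarrow> (g has_derivative g' x) (at x within T)"
    "\<And>v. Ck_on k T (\<lambda>x. g' x v)" by (rule Ck_on_SucE[OF Suc.prems(2)]) blast
  \<comment> \<open>The direction \<open>f' x v\<close> varies with \<open>x\<close>, whereas
    \<open>Ck_on\<close> controls derivatives of \<open>g\<close> in fixed directions only.
    Expansion in the basis yields products of functions covered by the induction hypothesis.\<close>
  have eq: "g' (f x) (f' x v) = (\<Sum>b\<in>Basis. (f' x v \<bullet> b) *\<^sub>R g' (f x) b)" if "x \<in> S" for x v
  proof -
    have lin: "linear (g' (f x))"
      using g'(1)[of "f x"] that assms(3) has_derivative_linear by blast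
    have "g' (f x) (f' x v) = g' (f x) (\<Sum>b\<in>Basis. (f' x v \<bullet> b) *\<^sub>R b)"
      by (simp add: euclidean_representation)
    then show ?thesis by (simp add: linear_sum[OF lin] linear_scale[OF lin])
  qed
  show ?case
  proof (rule Ck_on_SucI[OF assms(1), where f' = "\<lambda>x v. g' (f x) (f' x v)"])
    show "((\<lambda>x. g (f x)) has_derivative (\<lambda>v. g' (f x) (f' x v))) (at x within S)" if "x \<in> S" for x
      using has_derivative_in_compose[OF f'(1)[OF that], of g "g' (f x)"]
        has_derivative_subset[OF g'(1)[of "f x"] assms(3)] that assms(3) by auto
    show "Ck_on k S (\<lambda>x. g' (f x) (f' x v))" for v
    proof -
      have "Ck_on k S (\<lambda>x. \<Sum>b\<in>Basis. (f' x v \<bullet> b) *\<^sub>R g' (f x) b)"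
        by (intro Ck_on_sum Ck_on_bilinear[OF bounded_bilinear_scaleR] assms(1) Suc.IH g'
            Ck_on_bounded_linear[OF bounded_linear_inner_left] f' Ck_on_SucD[OF Suc.prems(1)])
      then show ?thesis by (subst Ck_on_cong[OF eq])
    qed
  qed
qed

lemma smooth_on_cong: "(\<And>x. x \<in> S \<Longrightarrow> f x = g x) \<Longrightarrow> smooth_on S f \<longleftrightarrow> smooth_on S g"
  unfolding smooth_on_def using Ck_on_cong by blast

lemma smooth_on_openin: "openin (top_of_set S) T \<Longrightarrow> smooth_on S f \<Longrightarrow> smooth_on T f"
  unfolding smooth_on_def using Ck_on_openin by blast

lemma smooth_on_const: "rich S \<Longrightarrow> smooth_on S (\<lambda>x. c)"
  by (simp add: smooth_on_def Ck_on_const)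

lemma smooth_on_bounded_linear:
  "bounded_linear h \<Longrightarrow> rich S \<Longrightarrow> smooth_on S f \<Longrightarrow> smooth_on S (\<lambda>x. h (f x))"
  by (simp add: smooth_on_def Ck_on_bounded_linear)

lemma smooth_on_add: "rich S \<Longrightarrow> smooth_on S f \<Longrightarrow> smooth_on S g \<Longrightarrow> smooth_on S (\<lambda>x. f x + g x)"
  by (simp add: smooth_on_def Ck_on_add)

lemma smooth_on_uminus: "rich S \<Longrightarrow> smooth_on S f \<Longrightarrow> smooth_on S (\<lambda>x. - f x)"
  by (rule smooth_on_bounded_linear[OF bounded_linear_minus[OF bounded_linear_ident]])

lemma smooth_on_diff: "rich S \<Longrightarrow> smooth_on S f \<Longrightarrow> smooth_on S g \<Longrightarrow> smooth_on S (\<lambda>x. f x - g x)"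
  using smooth_on_add[of S f "\<lambda>x. - g x"] smooth_on_uminus by auto

lemma smooth_on_bilinear:
  "bounded_bilinear h \<Longrightarrow> rich S \<Longrightarrow> smooth_on S f \<Longrightarrow> smooth_on S g \<Longrightarrow> smooth_on S (\<lambda>x. h (f x) (g x))"
  by (simp add: smooth_on_def Ck_on_bilinear)

lemmas smooth_on_mult = smooth_on_bilinear[OF bounded_bilinear_mult]
lemmas smooth_on_scaleR = smooth_on_bilinear[OF bounded_bilinear_scaleR]
lemmas smooth_on_inner = smooth_on_bilinear[OF bounded_bilinear_inner]

lemma smooth_on_sum: "rich S \<Longrightarrow> (\<And>i. i \<in> A \<Longrightarrow> smooth_on S (f i)) \<Longrightarrow> smooth_on S (\<lambda>x. \<Sum>i\<in>A. f i x)"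
  by (simp add: smooth_on_def Ck_on_sum)

lemma smooth_on_prod:
  fixes f :: "'i \<Rightarrow> 'a::euclidean_space \<Rightarrow> real"
  assumes "rich S" "\<And>i. i \<in> A \<Longrightarrow> smooth_on S (f i)"
  shows "smooth_on S (\<lambda>x. \<Prod>i\<in>A. f i x)"
  using assms(2)
  by (induction A rule: infinite_finite_induct) (auto intro: smooth_on_const smooth_on_mult assms(1))

lemma smooth_on_power:
  fixes f :: "'a::euclidean_space \<Rightarrow> real"
  shows "rich S \<Longrightarrow> smooth_on S f \<Longrightarrow> smooth_on S (\<lambda>x. f x ^ k)"
  by (induction k) (auto intro: smooth_on_const smooth_on_mult)

lemma smooth_on_compose:
  fixes f :: "'a::euclidean_space \<Rightarrow> 'b::euclidean_space" and g :: "'b \<Rightarrow> 'c::real_normed_vector"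
  shows "rich S \<Longrightarrow> rich T \<Longrightarrow> f ` S \<subseteq> T \<Longrightarrow> smooth_on S f \<Longrightarrow> smooth_on T g \<Longrightarrow> smooth_on S (\<lambda>x. g (f x))"
  using Ck_on_compose unfolding smooth_on_def by blast

lemma smooth_on_has_derivative:
  assumes "smooth_on S f" "x \<in> S"
  shows "(f has_derivative frechet_derivative f (at x within S)) (at x within S)"
proof -
  have "Ck_on (Suc 0) S f" using assms(1) unfolding smooth_on_def by blast
  then show ?thesis using assms(2) by (auto simp: differentiable_on_def frechet_derivative_works)
qed

lemma smooth_on_continuous_on: "smooth_on S f \<Longrightarrow> continuous_on S f"
  unfolding smooth_on_def using Ck_on.simps(1) by blast

lemma smooth_on_frechet: "smooth_on S f \<Longrightarrow> smooth_on S (\<lambda>x. frechet_derivative f (at x within S) v)"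
  unfolding smooth_on_def using Ck_on.simps(2) by blast

lemma smooth_on_partial: "smooth_on S f \<Longrightarrow> smooth_on S (partial S i f)"
  unfolding partial_def using smooth_on_frechet by auto

text \<open>Bootstrapping: if the derivative is as regular as the function itself, each order of
  differentiability yields the next. It serves functions that satisfy a differential equation, such
  as reciprocals, exponentials, powers and solutions of ODEs.\<close>

lemma smooth_onI:
  assumes "rich S" "\<And>x. x \<in> S \<Longrightarrow> (f has_derivative f' x) (at x within S)"
    "\<And>k v. Ck_on k S f \<Longrightarrow> Ck_on k S (\<lambda>x. f' x v)"
  shows "smooth_on S f"
  unfolding smooth_on_def
proof
  fix k show "Ck_on k S f"
  proof (induction k)
    case 0
    have "f differentiable_on S" using assms(2) unfolding differentiable_on_def differentiable_def by blast
    then show ?case by (simp add: differentiable_imp_continuous_on)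
  next
    case (Suc k) then show ?case using assms by (intro Ck_on_SucI[where f' = f']) auto
  qed
qed

lemma smooth_on_ident: "rich S \<Longrightarrow> smooth_on S (\<lambda>x. x)"
  by (rule smooth_onI[where f' = "\<lambda>x v. v"]) (auto intro: Ck_on_const)

lemma smooth_on_inverse:
  fixes f :: "'a::euclidean_space \<Rightarrow> real"
  assumes "rich S" "smooth_on S f" "\<And>x. x \<in> S \<Longrightarrow> f x \<noteq> 0"
  shows "smooth_on S (\<lambda>x. inverse (f x))"
proof (rule smooth_onI[OF assms(1)])
  let ?f' = "\<lambda>x v. - (inverse (f x) * frechet_derivative f (at x within S) v * inverse (f x))"
  show "((\<lambda>x. inverse (f x)) has_derivative ?f' x) (at x within S)" if "x \<in> S" for x
    using Deriv.has_derivative_inverse[OF assms(3)[OF that] smooth_on_has_derivative[OF assms(2) that]] .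
  show "Ck_on k S (\<lambda>x. ?f' x v)" if "Ck_on k S (\<lambda>x. inverse (f x))" for k v
    using that smooth_on_frechet[OF assms(2), of v] assms(1) unfolding smooth_on_def
    by (intro Ck_on_bounded_linear[OF bounded_linear_minus[OF bounded_linear_ident]]
        Ck_on_bilinear[OF bounded_bilinear_mult]) auto
qed

lemma smooth_on_divide:
  fixes f g :: "'a::euclidean_space \<Rightarrow> real"
  assumes "rich S" "smooth_on S f" "smooth_on S g" "\<And>x. x \<in> S \<Longrightarrow> g x \<noteq> 0"
  shows "smooth_on S (\<lambda>x. f x / g x)"
  unfolding divide_inverse using assms by (intro smooth_on_mult smooth_on_inverse)

lemma smooth_on_powr:
  fixes f :: "'a::euclidean_space \<Rightarrow> real"
  assumes "rich S" "smooth_on S f" "\<And>x. x \<in> S \<Longrightarrow> f x > 0"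
  shows "smooth_on S (\<lambda>x. f x powr a)"
proof (rule smooth_onI[OF assms(1)])
  let ?f' = "\<lambda>x v. (f x powr a) * (frechet_derivative f (at x within S) v * a / f x)"
  show "((\<lambda>x. f x powr a) has_derivative ?f' x) (at x within S)" if "x \<in> S" for x
    using has_derivative_powr[OF smooth_on_has_derivative[OF assms(2) that] has_derivative_const[of a] assms(3)[OF that] that]
    by simp
  show "Ck_on k S (\<lambda>x. ?f' x v)" if "Ck_on k S (\<lambda>x. f x powr a)" for k v
  proof -
    have "smooth_on S (\<lambda>x. frechet_derivative f (at x within S) v * a / f x)"
      using assms by (intro smooth_on_divide smooth_on_mult smooth_on_frechet smooth_on_const) force+
    then show ?thesis using that assms(1)
      unfolding smooth_on_def by (intro Ck_on_bilinear[OF bounded_bilinear_mult]) auto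
  qed
qed

lemma smooth_on_exp:
  fixes f :: "'a::euclidean_space \<Rightarrow> real"
  assumes "rich S" "smooth_on S f"
  shows "smooth_on S (\<lambda>x. exp (f x))"
proof (rule smooth_onI[OF assms(1)])
  let ?f' = "\<lambda>x v. exp (f x) * frechet_derivative f (at x within S) v"
  show "((\<lambda>x. exp (f x)) has_derivative ?f' x) (at x within S)" if "x \<in> S" for x
    using has_derivative_exp[OF smooth_on_has_derivative[OF assms(2) that]] by (simp add: mult.commute)
  show "Ck_on k S (\<lambda>x. ?f' x v)" if "Ck_on k S (\<lambda>x. exp (f x))" for k v
    using that smooth_on_frechet[OF assms(2)] assms(1)
      unfolding smooth_on_def by (intro Ck_on_bilinear[OF bounded_bilinear_mult]) auto
qed

text \<open>Away from zeros a continuous function has locally constant sign. Absolute values are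
  thereby smooth, as needed for determinants and squared lengths in arbitrary signature.\<close>

lemma has_derivative_sgn:
  fixes f :: "'a::euclidean_space \<Rightarrow> real"
  assumes "smooth_on S f" "x \<in> S" "f x \<noteq> 0"
  shows "((\<lambda>x. sgn (f x)) has_derivative (\<lambda>v. 0)) (at x within S)"
proof -
  have "continuous (at x within S) f"
    using smooth_on_continuous_on[OF assms(1)] assms(2) by (simp add: continuous_on_eq_continuous_within)
  then have "\<forall>\<^sub>F z in at x within S. f z * f x > 0"
    using assms(3)
    by (intro order_tendstoD[of "\<lambda>z. f z * f x" "f x * f x"] tendsto_intros)
       (auto simp: continuous_within zero_less_mult_iff)
  then have "\<forall>\<^sub>F z in at x within S. sgn (f x) = sgn (f z)"
    by eventually_elim (auto simp: sgn_if zero_less_mult_iff split: if_splits)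
  then show ?thesis
    by (rule has_derivative_transform_eventually[OF has_derivative_const]) (use assms(2) in auto)
qed

lemma smooth_on_sgn:
  fixes f :: "'a::euclidean_space \<Rightarrow> real"
  assumes "rich S" "smooth_on S f" "\<And>x. x \<in> S \<Longrightarrow> f x \<noteq> 0"
  shows "smooth_on S (\<lambda>x. sgn (f x))"
  by (rule smooth_onI[OF assms(1) has_derivative_sgn[OF assms(2) _ assms(3)]]) (auto intro: Ck_on_const assms)

lemma smooth_on_abs:
  fixes f :: "'a::euclidean_space \<Rightarrow> real"
  assumes "rich S" "smooth_on S f" "\<And>x. x \<in> S \<Longrightarrow> f x \<noteq> 0"
  shows "smooth_on S (\<lambda>x. \<bar>f x\<bar>)"
  unfolding abs_sgn using assms by (intro smooth_on_mult smooth_on_sgn)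

lemma smooth_on_sqrt:
  fixes f :: "'a::euclidean_space \<Rightarrow> real"
  assumes "rich S" "smooth_on S f" "\<And>x. x \<in> S \<Longrightarrow> f x > 0"
  shows "smooth_on S (\<lambda>x. sqrt (f x))"
  using smooth_on_powr[OF assms, of "1/2"] smooth_on_cong[of S "\<lambda>x. sqrt (f x)" "\<lambda>x. f x powr (1/2)"]
    assms(3) by (auto simp: powr_half_sqrt less_imp_le)

section \<open>Smoothness of vector and matrix valued maps\<close>

lemma smooth_on_nth: "rich S \<Longrightarrow> smooth_on S f \<Longrightarrow> smooth_on S (\<lambda>x. f x $ i)"
  by (rule smooth_on_bounded_linear[OF bounded_linear_vec_nth])

lemma smooth_on_vec:
  fixes f :: "'a::euclidean_space \<Rightarrow> 'b::euclidean_space ^ 'n::finite"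
  assumes "rich S" "\<And>i. smooth_on S (\<lambda>x. f x $ i)"
  shows "smooth_on S f"
proof -
  have bl: "bounded_linear (\<lambda>y. axis i y :: 'b ^ 'n)" for i
    unfolding linear_conv_bounded_linear[symmetric]
    by (rule linearI) (auto simp: axis_def vec_eq_iff)
  have "f x = (\<Sum>i\<in>UNIV. axis i (f x $ i))" for x
    by (auto simp: vec_eq_iff axis_def if_distrib sum.delta cong: if_cong)
  then show ?thesis
    using smooth_on_sum[OF assms(1), of UNIV "\<lambda>i x. axis i (f x $ i)"]
      smooth_on_bounded_linear[OF bl assms(1) assms(2)] by simp
qed

lemma smooth_on_det:
  fixes f :: "'a::euclidean_space \<Rightarrow> real ^ 'n ^ 'n::finite"
  assumes "rich S" "\<And>i j. smooth_on S (\<lambda>x. f x $ i $ j)"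
  shows "smooth_on S (\<lambda>x. det (f x))"
  unfolding det_def using assms
  by (intro smooth_on_sum smooth_on_mult smooth_on_const smooth_on_prod)

lemma smooth_on_entry: "rich S \<Longrightarrow> smooth_on S f \<Longrightarrow> smooth_on S (\<lambda>x. f x $ i $ j)"
  by (intro smooth_on_nth)

lemma matrix_inv_invertible:
  fixes A :: "real ^ 'n ^ 'n"
  assumes "det A \<noteq> 0"
  shows "A ** matrix_inv A = mat 1" "matrix_inv A ** A = mat 1"
proof -
  obtain B where "A ** B = mat 1 \<and> B ** A = mat 1"
    using assms invertible_det_nz invertible_def by blast
  then have "A ** matrix_inv A = mat 1 \<and> matrix_inv A ** A = mat 1"
    unfolding matrix_inv_def by (rule someI)
  then show "A ** matrix_inv A = mat 1" "matrix_inv A ** A = mat 1" by auto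
qed

text \<open>Cramer's rule exhibits the entries of the inverse as quotients of determinants, from
  which smoothness of \<open>matrix_inv\<close> is read off.\<close>

lemma matrix_inv_cramer:
  fixes A :: "real ^ 'n ^ 'n"
  assumes "det A \<noteq> 0"
  shows "matrix_inv A $ k $ l = det (\<chi> i j. if j = k then axis l 1 $ i else A $ i $ j) / det A"
proof -
  have "A *v (matrix_inv A *v axis l 1) = axis l 1"
    by (simp add: matrix_vector_mul_assoc matrix_inv_invertible[OF assms])
  then have "matrix_inv A *v axis l 1 = (\<chi> k. det (\<chi> i j. if j = k then axis l 1 $ i else A $ i $ j) / det A)"
    using cramer[OF assms] by blast
  moreover have "(matrix_inv A *v axis l 1) $ k = matrix_inv A $ k $ l"
    by (simp add: matrix_vector_mult_basis column_def)
  ultimately show ?thesis by simp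
qed

lemma smooth_on_matrix_inv:
  fixes f :: "'a::euclidean_space \<Rightarrow> real ^ 'n ^ 'n::finite"
  assumes "rich S" "smooth_on S f" "\<And>x. x \<in> S \<Longrightarrow> det (f x) \<noteq> 0"
  shows "smooth_on S (\<lambda>x. matrix_inv (f x))"
proof (intro smooth_on_vec assms(1))
  fix k l
  have "smooth_on S (\<lambda>x. det (\<chi> i j. if j = k then axis l 1 $ i else f x $ i $ j) / det (f x))"
  proof (intro smooth_on_divide smooth_on_det assms(1,3))
    show "smooth_on S (\<lambda>x. (\<chi> i j. if j = k then axis l 1 $ i else f x $ i $ j) $ i $ j)" for i j
      using smooth_on_const smooth_on_entry assms by (cases "j = k") auto
  qed (use smooth_on_entry assms in auto)
  then show "smooth_on S (\<lambda>x. matrix_inv (f x) $ k $ l)"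
    by (subst smooth_on_cong[OF matrix_inv_cramer[OF assms(3)]])
qed

lemma smooth_on_velocity:
  assumes "rich J" "smooth_on J y"
  shows "smooth_on J (\<lambda>t. vector_derivative y (at t within J))"
proof (subst smooth_on_cong)
  show "smooth_on J (\<lambda>t. frechet_derivative y (at t within J) 1)"
    by (rule smooth_on_frechet[OF assms(2)])
  fix t assume t: "t \<in> J"
  have D: "(y has_derivative frechet_derivative y (at t within J)) (at t within J)"
    by (rule smooth_on_has_derivative[OF assms(2) t])
  then have "frechet_derivative y (at t within J) = (\<lambda>x. x *\<^sub>R frechet_derivative y (at t within J) 1)"
    using has_derivative_linear[OF D] by (metis linear_cmul mult.right_neutral real_scaleR_def)
  with D have "(y has_vector_derivative frechet_derivative y (at t within J) 1) (at t within J)"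
    unfolding has_vector_derivative_def by simp
  then show "vector_derivative y (at t within J) = frechet_derivative y (at t within J) 1"
    by (rule rich_vector_derivative[OF assms(1) t])
qed

lemma smooth_on_has_vector_derivative:
  assumes "smooth_on J y" "t \<in> J"
  shows "(y has_vector_derivative vector_derivative y (at t within J)) (at t within J)"
proof -
  have "y differentiable (at t within J)"
    using smooth_on_has_derivative[OF assms] differentiable_def by blast
  then show ?thesis by (simp add: vector_derivative_works)
qed

section \<open>Symmetry of second partial derivatives\<close>

lemma partial_eq_at:
  assumes "open S" "x \<in> S"
  shows "partial S i f x = frechet_derivative f (at x) (axis i 1)"
  using at_within_open[OF assms(2,1)] by (simp add: partial_def)

text \<open>The mean value theorem is applied to \<open>\<phi> s h - \<phi> s 0\<close> as a
  function of \<open>s\<close>, and then to \<open>p s\<close> as a function of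
  \<open>t\<close>.\<close>

lemma mixed_difference:
  fixes \<phi> :: "real \<Rightarrow> real \<Rightarrow> real"
  assumes "h > 0"
    and p: "\<And>s t. s \<in> {0..h} \<Longrightarrow> t \<in> {0..h} \<Longrightarrow> ((\<lambda>s. \<phi> s t) has_real_derivative p s t) (at s)"
    and r: "\<And>s t. s \<in> {0..h} \<Longrightarrow> t \<in> {0..h} \<Longrightarrow> ((\<lambda>t. p s t) has_real_derivative r s t) (at t)"
  obtains s t where "s \<in> {0..h}" "t \<in> {0..h}" "\<phi> h h - \<phi> 0 h - (\<phi> h 0 - \<phi> 0 0) = h * h * r s t"
proof -
  have "\<exists>z>0. z < h \<and> (\<phi> h h - \<phi> h 0) - (\<phi> 0 h - \<phi> 0 0) = (h - 0) * (p z h - p z 0)"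
    by (rule MVT2[OF \<open>h > 0\<close>, where f = "\<lambda>s. \<phi> s h - \<phi> s 0"]) (auto intro!: derivative_eq_intros p)
  then obtain s where s: "0 < s" "s < h" "(\<phi> h h - \<phi> h 0) - (\<phi> 0 h - \<phi> 0 0) = h * (p s h - p s 0)" by auto
  have "\<exists>z>0. z < h \<and> p s h - p s 0 = (h - 0) * r s z"
    by (rule MVT2[OF \<open>h > 0\<close>]) (use s in \<open>auto intro!: r\<close>)
  then obtain t where "0 < t" "t < h" "p s h - p s 0 = h * r s t" by auto
  with s show ?thesis by (intro that[of s t]) auto
qed

lemma directional_field_derivative:
  fixes f :: "'a::euclidean_space \<Rightarrow> real"
  assumes "(f has_derivative f') (at (a + s *\<^sub>R v))"
  shows "((\<lambda>s. f (a + s *\<^sub>R v)) has_real_derivative f' v) (at s)"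
proof -
  have "((\<lambda>s. a + s *\<^sub>R v) has_derivative (\<lambda>h. h *\<^sub>R v)) (at s)"
    by (auto intro!: derivative_eq_intros)
  from has_derivative_compose[OF this assms]
  have "((\<lambda>s. f (a + s *\<^sub>R v)) has_derivative (\<lambda>h. f' (h *\<^sub>R v))) (at s)" .
  then show ?thesis
    unfolding has_field_derivative_def
    using has_derivative_linear[OF assms] by (simp add: linear_scale mult.commute[of _ "f' v"] mult_commute_abs)
qed

lemma partial_commute:
  fixes f :: "real^'n::finite \<Rightarrow> real"
  assumes "open S" "smooth_on S f" "x \<in> S"
  shows "partial S i (partial S j f) x = partial S j (partial S i f) x"
proof -
  have P: "((\<lambda>s. f (a + s *\<^sub>R axis m 1)) has_real_derivative partial S m f (a + s *\<^sub>R axis m 1)) (at s)"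
    if "smooth_on S f" "a + s *\<^sub>R axis m 1 \<in> S" for f :: "real^'n \<Rightarrow> real" and a s m
    unfolding partial_eq_at[OF assms(1) that(2)]
    by (rule directional_field_derivative)
      (use smooth_on_has_derivative[OF that] at_within_open[OF that(2) assms(1)] in simp)
  obtain d where d: "d > 0" "ball x d \<subseteq> S" using assms by (auto simp: open_contains_ball)
  have inb: "x + s *\<^sub>R axis k 1 + t *\<^sub>R axis l 1 \<in> ball x (2 * h + e)"
    if "s \<in> {0..h}" "t \<in> {0..h}" "e > 0" for s t h e :: real and k l :: 'n
  proof -
    have "norm (s *\<^sub>R axis k 1 + t *\<^sub>R axis l (1::real) :: real^'n) \<le> s + t"
      using norm_triangle_ineq[of "s *\<^sub>R axis k 1 :: real^'n" "t *\<^sub>R axis l 1"] that by (simp add: norm_axis_1)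
    moreover have "dist x (x + s *\<^sub>R axis k 1 + t *\<^sub>R axis l 1) = norm (s *\<^sub>R axis k 1 + t *\<^sub>R axis l (1::real) :: real^'n)"
      by (metis add.assoc add_diff_cancel_left' dist_commute dist_norm)
    ultimately show ?thesis using that by auto
  qed
  \<comment> \<open>A point of the square of side \<open>h\<close> at \<open>x\<close> is at
    distance at most \<open>2 * h\<close> from \<open>x\<close>; the third \<open>h\<close> makes
    room for an open ball.\<close>
  have key: "\<exists>z\<in>ball x (3 * h). f (x + h *\<^sub>R axis k 1 + h *\<^sub>R axis l 1) - f (x + h *\<^sub>R axis l 1)
      - (f (x + h *\<^sub>R axis k 1) - f x) = h * h * partial S l (partial S k f) z"
    if h: "h > 0" "3 * h < d" for h and k l
  proof -
    have inS: "x + s *\<^sub>R axis k 1 + t *\<^sub>R axis l 1 \<in> S" if "s \<in> {0..h}" "t \<in> {0..h}" for s t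
      using inb[OF that \<open>h > 0\<close>, of k l] d(2) h by auto
    define \<phi> where "\<phi> = (\<lambda>s t. f (x + s *\<^sub>R axis k 1 + t *\<^sub>R axis l 1))"
    have 1: "((\<lambda>s. \<phi> s t) has_real_derivative partial S k f (x + s *\<^sub>R axis k 1 + t *\<^sub>R axis l 1)) (at s)"
      if "s \<in> {0..h}" "t \<in> {0..h}" for s t
      using P[OF assms(2), of "x + t *\<^sub>R axis l 1" s k] inS[OF that] unfolding \<phi>_def by (simp add: add_ac)
    have 2: "((\<lambda>t. partial S k f (x + s *\<^sub>R axis k 1 + t *\<^sub>R axis l 1)) has_real_derivative
        partial S l (partial S k f) (x + s *\<^sub>R axis k 1 + t *\<^sub>R axis l 1)) (at t)"
      if "s \<in> {0..h}" "t \<in> {0..h}" for s t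
      using P[OF smooth_on_partial[OF assms(2)], of "x + s *\<^sub>R axis k 1" t l k] inS[OF that] by simp
    obtain s t where st: "s \<in> {0..h}" "t \<in> {0..h}"
      "\<phi> h h - \<phi> 0 h - (\<phi> h 0 - \<phi> 0 0) = h * h * partial S l (partial S k f) (x + s *\<^sub>R axis k 1 + t *\<^sub>R axis l 1)"
      by (rule mixed_difference[where \<phi> = \<phi>, OF h(1) 1 2])
    show ?thesis
      using inb[OF st(1,2) h(1), of k l] st(3)
      by (intro bexI[of _ "x + s *\<^sub>R axis k 1 + t *\<^sub>R axis l 1"]) (auto simp: \<phi>_def)
  qed
  have cont: "continuous (at x) (partial S l (partial S k f))" for k l
    using smooth_on_continuous_on[OF smooth_on_partial[OF smooth_on_partial[OF assms(2)]]] assms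
    by (simp add: continuous_on_eq_continuous_at)
  have ed: "\<exists>d>0. \<forall>z. dist z x < d \<longrightarrow> dist (partial S l (partial S k f) z) (partial S l (partial S k f) x) < e"
    if "e > 0" for e k l
    using cont[of l k] that unfolding continuous_within_eps_delta by auto
  show ?thesis
  proof (rule ccontr)
    assume neq: "\<not> ?thesis"
    define e where "e = \<bar>partial S i (partial S j f) x - partial S j (partial S i f) x\<bar> / 2"
    have e: "e > 0" using neq by (simp add: e_def)
    obtain d1 where d1: "d1 > 0" "\<And>z. dist z x < d1 \<Longrightarrow> dist (partial S i (partial S j f) z) (partial S i (partial S j f) x) < e"
      using ed[OF e, of i j] by blast
    obtain d2 where d2: "d2 > 0" "\<And>z. dist z x < d2 \<Longrightarrow> dist (partial S j (partial S i f) z) (partial S j (partial S i f) x) < e"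
      using ed[OF e, of j i] by blast
    \<comment> \<open>Dividing by 4 leaves room for the radius \<open>3 * h\<close> below all three
      bounds.\<close>
    define h where "h = min d (min d1 d2) / 4"
    have h: "h > 0" "3 * h < d" "3 * h < d1" "3 * h < d2" using d d1 d2 by (auto simp: h_def)
    obtain z1 where z1: "z1 \<in> ball x (3*h)" "f (x + h *\<^sub>R axis j 1 + h *\<^sub>R axis i 1) - f (x + h *\<^sub>R axis i 1)
      - (f (x + h *\<^sub>R axis j 1) - f x) = h * h * partial S i (partial S j f) z1"
      using key[OF h(1,2), of j i] by blast
    obtain z2 where z2: "z2 \<in> ball x (3*h)" "f (x + h *\<^sub>R axis i 1 + h *\<^sub>R axis j 1) - f (x + h *\<^sub>R axis j 1)
      - (f (x + h *\<^sub>R axis i 1) - f x) = h * h * partial S j (partial S i f) z2"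
      using key[OF h(1,2), of i j] by blast
    \<comment> \<open>Both second differences have the same four corners, so the two mixed
      derivatives agree at the intermediate points \<open>z1\<close> and \<open>z2\<close>.
      Continuity at \<open>x\<close> then contradicts the gap \<open>2 * e\<close>.\<close>
    have sw: "x + h *\<^sub>R axis j 1 + h *\<^sub>R axis i 1 = x + h *\<^sub>R axis i 1 + h *\<^sub>R axis j 1"
      by (simp add: ac_simps)
    have "h * h * partial S i (partial S j f) z1 = h * h * partial S j (partial S i f) z2"
      using z1(2) z2(2) unfolding sw by linarith
    then have eq: "partial S i (partial S j f) z1 = partial S j (partial S i f) z2" using h by simp
    have "dist (partial S i (partial S j f) z1) (partial S i (partial S j f) x) < e"
      using z1(1) h by (intro d1) (auto simp: dist_commute)
    moreover have "dist (partial S j (partial S i f) z2) (partial S j (partial S i f) x) < e"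
      using z2(1) h by (intro d2) (auto simp: dist_commute)
    ultimately have "\<bar>partial S i (partial S j f) x - partial S j (partial S i f) x\<bar> < 2 * e"
      using eq unfolding dist_real_def by linarith
    then show False by (simp add: e_def)
  qed
qed

section \<open>Ordinary differential equations\<close>

text \<open>Compactness bounds the derivative in each fixed direction. The sum of these bounds over
  the basis controls the operator norm, and the mean value inequality on the convex ball gives the
  Lipschitz constant.\<close>

lemma smooth_lipschitz_on_cball:
  fixes f :: "'a::euclidean_space \<Rightarrow> 'b::euclidean_space"
  assumes "open E" "smooth_on E f" "cball x0 r \<subseteq> E"
  obtains L where "L \<ge> 0" "\<And>x y. x \<in> cball x0 r \<Longrightarrow> y \<in> cball x0 r \<Longrightarrow> norm (f x - f y) \<le> L * norm (x - y)"
proof -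
  let ?D = "\<lambda>x. frechet_derivative f (at x within E)"
  have der: "(f has_derivative ?D x) (at x within cball x0 r)" if "x \<in> cball x0 r" for x
    using has_derivative_subset[OF smooth_on_has_derivative[OF assms(2)] assms(3)] that assms(3) by blast
  have "\<exists>K. \<forall>x\<in>cball x0 r. norm (?D x b) \<le> K" for b
  proof -
    have "continuous_on (cball x0 r) (\<lambda>x. ?D x b)"
      using continuous_on_subset[OF smooth_on_continuous_on[OF smooth_on_frechet[OF assms(2)]] assms(3)] .
    then have "bounded ((\<lambda>x. ?D x b) ` cball x0 r)"
      by (intro compact_imp_bounded compact_continuous_image) auto
    then show ?thesis by (auto simp: bounded_iff)
  qed
  then obtain K where K: "\<And>b x. x \<in> cball x0 r \<Longrightarrow> norm (?D x b) \<le> K b" by metis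
  define L where "L = (\<Sum>b\<in>Basis. \<bar>K b\<bar>)"
  have "onorm (?D x) \<le> L" if "x \<in> cball x0 r" for x
  proof (rule onorm_le)
    fix v
    have lin: "linear (?D x)" using has_derivative_linear[OF der[OF that]] .
    have "norm (?D x v) = norm (\<Sum>b\<in>Basis. (v \<bullet> b) *\<^sub>R ?D x b)"
      by (subst euclidean_representation[of v, symmetric]) (simp add: linear_sum[OF lin] linear_scale[OF lin])
    also have "\<dots> \<le> (\<Sum>b\<in>Basis. norm v * \<bar>K b\<bar>)"
      using K[OF that] by (intro sum_norm_le) (auto intro!: mult_mono Basis_le_norm intro: order_trans[OF _ abs_ge_self])
    also have "\<dots> = L * norm v" by (simp add: L_def sum_distrib_left mult.commute sum_distrib_right)
    finally show "norm (?D x v) \<le> L * norm v" .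
  qed
  then have "norm (f x - f y) \<le> L * norm (x - y)" if "x \<in> cball x0 r" "y \<in> cball x0 r" for x y
    using differentiable_bound[OF convex_cball der _ that] by blast
  moreover have "L \<ge> 0" by (auto simp: L_def intro: sum_nonneg)
  ultimately show ?thesis using that by blast
qed

lemma picard_global:
  fixes F :: "'a::euclidean_space \<Rightarrow> 'a"
  assumes L: "L \<ge> 0" "\<And>x y. norm (F x - F y) \<le> L * norm (x - y)"
    and B: "\<And>x. norm (F x) \<le> B" and T: "T > 0" "L * T \<le> 1/2"
  obtains u where "\<And>t. t \<in> {0..T} \<Longrightarrow> (u has_vector_derivative F (u t)) (at t within {0..T})"
    "\<And>t. t \<in> {0..T} \<Longrightarrow> norm (u t - x0) \<le> B * T" "u 0 = x0"
proof -
  have contF: "continuous_on UNIV F"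
    by (rule lipschitz_on_continuous_on[of L]) (auto simp: lipschitz_on_def dist_norm L)
  \<comment> \<open>Clamping time to \<open>{0..T}\<close> lets the Picard operator act on bounded
    continuous functions on the whole line. These form a complete type, so Banach's fixed point
    theorem applies without restricting to a subset.\<close>
  define c where "c = (\<lambda>t::real. max 0 (min T t))"
  have c: "c t \<in> {0..T}" "t \<in> {0..T} \<Longrightarrow> c t = t" for t using T by (auto simp: c_def)
  have contFu: "continuous_on X (\<lambda>s. F (u s))" if "continuous_on UNIV u" for u :: "real \<Rightarrow> 'a" and X
    using continuous_on_compose2[OF contF continuous_on_subset[OF that]] by blast
  have int: "(\<lambda>s. F (u s)) integrable_on {0..t}" if "continuous_on UNIV u" for u :: "real \<Rightarrow> 'a" and t
    by (rule integrable_continuous_real[OF contFu[OF that]])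
  define P where "P = (\<lambda>u t. x0 + integral {0..c t} (\<lambda>s. F (u s)))"
  have B0: "B \<ge> 0" using B[of 0] norm_ge_zero[of "F 0"] by linarith
  have bound: "norm (integral {0..t} (\<lambda>s. F (u s))) \<le> B * T"
    if "continuous_on UNIV u" "t \<in> {0..T}" for u t
  proof -
    have "norm (integral {0..t} (\<lambda>s. F (u s))) \<le> B * (t - 0)"
      by (rule integral_bound) (use that contFu B in auto)
    also have "\<dots> \<le> B * T" using that B0 by (auto intro: mult_left_mono)
    finally show ?thesis .
  qed
  have PC: "P u \<in> bcontfun" if "continuous_on UNIV u" for u
    unfolding bcontfun_def
  proof (intro CollectI conjI)
    have "continuous_on {0..T} (\<lambda>t. integral {0..t} (\<lambda>s. F (u s)))"
      by (rule indefinite_integral_continuous_1[OF int[OF that]])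
    then have "continuous_on UNIV (\<lambda>t. integral {0..c t} (\<lambda>s. F (u s)))"
      by (rule continuous_on_compose2) (use c in \<open>auto simp: c_def intro!: continuous_intros\<close>)
    then show "continuous_on UNIV (P u)" unfolding P_def by (intro continuous_intros)
    show "bounded (range (P u))"
      unfolding bounded_iff P_def
      using norm_triangle_le[of x0 _ "norm x0 + B * T"] bound[OF that c(1)]
      by (intro exI[of _ "norm x0 + B * T"]) auto
  qed
  \<comment> \<open>\<open>PC\<close> makes the abstraction \<open>Bcontfun\<close> faithful here,
    so \<open>Q\<close> is the operator \<open>P\<close> on the type of bounded continuous
    functions.\<close>
  define Q where "Q = (\<lambda>u :: real \<Rightarrow>\<^sub>C 'a. Bcontfun (P (apply_bcontfun u)))"
  have Q: "apply_bcontfun (Q u) = P (apply_bcontfun u)" for u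
    unfolding Q_def by (rule Bcontfun_inverse[OF PC]) simp
  have "\<exists>!u. Q u = u"
  proof (rule banach_fix_type[of "1/2"])
    show "\<forall>u v. dist (Q u) (Q v) \<le> 1/2 * dist u v"
    proof (intro allI dist_bound)
      fix u v :: "real \<Rightarrow>\<^sub>C 'a" and t
      have cu: "continuous_on UNIV (apply_bcontfun w)" for w :: "real \<Rightarrow>\<^sub>C 'a" by simp
      have "dist (Q u t) (Q v t) = norm (integral {0..c t} (\<lambda>s. F (u s) - F (v s)))"
        unfolding Q P_def dist_norm using int[OF cu] by (simp add: Henstock_Kurzweil_Integration.integral_diff)
      also have "\<dots> \<le> L * dist u v * (c t - 0)"
      proof (rule integral_bound)
        show "0 \<le> c t" using c(1)[of t] by auto
        show "continuous_on {0..c t} (\<lambda>s. F (u s) - F (v s))" using contFu[OF cu] by (intro continuous_intros)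
        show "norm (F (u s) - F (v s)) \<le> L * dist u v" for s
          using L(2)[of "u s" "v s"] mult_left_mono[OF dist_bounded[of u s v] L(1)] by (simp add: dist_norm)
      qed
      also have "\<dots> \<le> L * dist u v * T" using c(1)[of t] L(1) by (intro mult_left_mono) auto
      also have "\<dots> \<le> 1/2 * dist u v" using mult_right_mono[OF T(2), of "dist u v"] by (simp add: algebra_simps)
      finally show "dist (Q u t) (Q v t) \<le> 1/2 * dist u v" .
    qed
  qed auto
  then obtain u where u: "Q u = u" by blast
  have cu: "continuous_on UNIV (apply_bcontfun u)" by simp
  have eq: "u t = x0 + integral {0..t} (\<lambda>s. F (u s))" if "t \<in> {0..T}" for t
    using fun_cong[OF Q[of u], of t] c(2)[OF that] unfolding u P_def by simp
  show ?thesis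
  proof (rule that[of "apply_bcontfun u"])
    show "norm (u t - x0) \<le> B * T" if "t \<in> {0..T}" for t
      using bound[OF cu that] eq[OF that] by simp
    show "u 0 = x0" using eq[of 0] T by simp
    show "(u has_vector_derivative F (u t)) (at t within {0..T})" if t: "t \<in> {0..T}" for t
    proof -
      have "((\<lambda>t. x0 + integral {0..t} (\<lambda>s. F (u s))) has_vector_derivative 0 + F (u t)) (at t within {0..T})"
        by (intro has_vector_derivative_add has_vector_derivative_const integral_has_vector_derivative t contFu[OF cu])
      then show ?thesis
        using has_vector_derivative_transform[OF t, of "apply_bcontfun u"] eq by simp
    qed
  qed
qed

lemma ode_exists:
  fixes f :: "'a::euclidean_space \<Rightarrow> 'a"
  assumes "open E" "smooth_on E f" "x0 \<in> E"
  obtains T x where "T > 0" "x 0 = x0" "x ` {0..T} \<subseteq> E"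
    "\<And>t. t \<in> {0..T} \<Longrightarrow> (x has_vector_derivative f (x t)) (at t within {0..T})"
proof -
  obtain r where r: "r > 0" "cball x0 r \<subseteq> E" using assms by (auto simp: open_contains_cball)
  obtain L where L: "L \<ge> 0" "\<And>x y. x \<in> cball x0 r \<Longrightarrow> y \<in> cball x0 r \<Longrightarrow> norm (f x - f y) \<le> L * norm (x - y)"
    using smooth_lipschitz_on_cball[OF assms(1,2) r(2)] by blast
  \<comment> \<open>Composition with the nearest-point projection, which is 1-Lipschitz, extends the
    local vector field to a bounded and globally Lipschitz one without changing it on the
    ball.\<close>
  define p where "p = closest_point (cball x0 r)"
  have p: "p x \<in> cball x0 r" "norm (p x - p y) \<le> norm (x - y)" "x \<in> cball x0 r \<Longrightarrow> p x = x" for x y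
    using closest_point_in_set[of "cball x0 r" x] closest_point_lipschitz[of "cball x0 r" x y]
      closest_point_self[of x "cball x0 r"] r unfolding p_def by (auto simp: dist_norm)
  define F where "F = (\<lambda>x. f (p x))"
  have FL: "norm (F x - F y) \<le> L * norm (x - y)" for x y
    using L(2)[OF p(1) p(1), of x y] mult_left_mono[OF p(2) L(1), of x y] unfolding F_def by linarith
  define B where "B = norm (f x0) + L * r"
  have "norm (F x) \<le> B" for x
  proof -
    have "norm (f (p x) - f x0) \<le> L * norm (p x - x0)" using r by (intro L(2) p) auto
    also have "\<dots> \<le> L * r" using p(1)[of x] L(1) by (intro mult_left_mono) (auto simp: dist_norm norm_minus_commute)
    finally show ?thesis unfolding F_def B_def using norm_triangle_sub[of "f (p x)" "f x0"] by linarith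
  qed
  note FB = this
  have B0: "B \<ge> 0" using L r by (simp add: B_def)
  \<comment> \<open>The first bound makes the Picard operator a contraction, the second keeps the
    solution in the ball, where the projection is the identity. The added 1 excludes division by
    zero.\<close>
  define T where "T = min (1 / (2 * (L + 1))) (r / (B + 1))"
  have T: "T > 0" using L B0 r by (simp add: T_def)
  have "L * T \<le> L * (1 / (2 * (L + 1)))" using L by (intro mult_left_mono) (auto simp: T_def)
  also have "\<dots> \<le> 1 / 2" using L by (simp add: field_simps)
  finally have LT: "L * T \<le> 1 / 2" .
  have "B * T \<le> B * (r / (B + 1))" using B0 by (intro mult_left_mono) (auto simp: T_def)
  also have "\<dots> \<le> r" using B0 r by (simp add: field_simps)
  finally have BT: "B * T \<le> r" .
  obtain u where u: "\<And>t. t \<in> {0..T} \<Longrightarrow> (u has_vector_derivative F (u t)) (at t within {0..T})"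
    "\<And>t. t \<in> {0..T} \<Longrightarrow> norm (u t - x0) \<le> B * T" "u 0 = x0"
    using picard_global[OF L(1) FL FB T LT] by blast
  have in_ball: "u t \<in> cball x0 r" if "t \<in> {0..T}" for t
    using u(2)[OF that] BT by (simp add: dist_norm norm_minus_commute)
  show ?thesis
    by (rule that[OF T, of u, OF u(3)]) (use u(1) in_ball r(2) p(3) in \<open>auto simp: F_def\<close>)
qed

text \<open>The derivative of a solution is \<open>f\<close> composed with the solution, hence as
  regular as the solution itself, and \<open>smooth_onI\<close> applies.\<close>

lemma ode_smooth:
  fixes f :: "'a::euclidean_space \<Rightarrow> 'a" and x :: "real \<Rightarrow> 'a"
  assumes "rich J" "rich E" "smooth_on E f" "x ` J \<subseteq> E"
    and der: "\<And>t. t \<in> J \<Longrightarrow> (x has_vector_derivative f (x t)) (at t within J)"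
  shows "smooth_on J x"
proof (rule smooth_onI[OF assms(1), where f' = "\<lambda>t v. v *\<^sub>R f (x t)"])
  show "(x has_derivative (\<lambda>v. v *\<^sub>R f (x t))) (at t within J)" if "t \<in> J" for t
    using der[OF that] by (simp add: has_vector_derivative_def)
  show "Ck_on k J (\<lambda>t. v *\<^sub>R f (x t))" if "Ck_on k J x" for k v
    using assms(3) unfolding smooth_on_def
    by (intro Ck_on_bounded_linear[OF bounded_linear_scaleR_right] assms Ck_on_compose[OF assms(1,2,4) that]) auto
qed

section \<open>Jacobi's formula\<close>

text \<open>\<open>w\<close> is the combination of the rows of \<open>A\<close> with coefficients
  \<open>w v* matrix_inv A\<close>, and only the multiple of row \<open>k\<close> contributes to the
  determinant.\<close>

lemma det_replace_row:
  fixes A :: "real^'n^'n::finite"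
  assumes "det A \<noteq> 0"
  shows "det (\<chi> i. if i = k then w else A $ i) = (w v* matrix_inv A) $ k * det A"
proof -
  let ?c = "w v* matrix_inv A"
  have "?c v* A = w" by (simp add: vector_matrix_mul_assoc matrix_inv_invertible[OF assms])
  moreover have "?c v* A = (\<Sum>i\<in>UNIV. ?c $ i *s row i A)"
    by (simp add: vector_matrix_mult_def row_def vec_eq_iff mult.commute)
  ultimately have w: "w = (\<Sum>i\<in>UNIV. ?c $ i *s row i A)" by simp
  have "(\<chi> i. if i = k then w else A $ i) = (\<chi> i. if i = k then (\<Sum>i\<in>UNIV. ?c $ i *s row i A) else row i A)"
    using w by (simp add: vec_eq_iff row_def)
  then show ?thesis using cramer_lemma_transpose[of k ?c A] by simp
qed

text \<open>Differentiating the Leibniz formula and exchanging the sums gives, for each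
  \<open>k\<close>, the determinant with row \<open>k\<close> replaced by its derivative.\<close>

lemma has_derivative_det:
  fixes A :: "'a::real_normed_vector \<Rightarrow> real^'n^'n::finite"
  assumes A: "(A has_derivative A') (at x within S)" and nz: "det (A x) \<noteq> 0"
  shows "((\<lambda>x. det (A x)) has_derivative (\<lambda>v. det (A x) * trace (A' v ** matrix_inv (A x)))) (at x within S)"
proof -
  have ent: "((\<lambda>x. A x $ i $ j) has_derivative (\<lambda>v. A' v $ i $ j)) (at x within S)" for i j
    using bounded_linear.has_derivative[OF bounded_linear_vec_nth bounded_linear.has_derivative[OF bounded_linear_vec_nth A]] .
  have "((\<lambda>x. det (A x)) has_derivative
      (\<lambda>v. \<Sum>p\<in>{p. p permutes (UNIV::'n set)}. of_int (sign p) * (\<Sum>k\<in>UNIV. A' v $ k $ p k * (\<Prod>i\<in>UNIV - {k}. A x $ i $ p i)))) (at x within S)"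
    unfolding det_def
    by (intro has_derivative_sum has_derivative_mult_right has_derivative_prod ent)
  moreover have "(\<Sum>p\<in>{p. p permutes (UNIV::'n set)}. of_int (sign p) * (\<Sum>k\<in>UNIV. A' v $ k $ p k * (\<Prod>i\<in>UNIV - {k}. A x $ i $ p i)))
      = det (A x) * trace (A' v ** matrix_inv (A x))" for v
  proof -
    have "(\<Sum>p\<in>{p. p permutes (UNIV::'n set)}. of_int (sign p) * (\<Sum>k\<in>UNIV. A' v $ k $ p k * (\<Prod>i\<in>UNIV - {k}. A x $ i $ p i)))
      = (\<Sum>k\<in>UNIV. \<Sum>p\<in>{p. p permutes (UNIV::'n set)}. of_int (sign p) * (A' v $ k $ p k * (\<Prod>i\<in>UNIV - {k}. A x $ i $ p i)))"
      by (simp add: sum_distrib_left sum.swap[of _ UNIV])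
    also have "\<dots> = (\<Sum>k\<in>UNIV. det (\<chi> i. if i = k then A' v $ k else A x $ i))"
    proof (intro sum.cong refl)
      fix k :: 'n
      have "(\<Prod>i\<in>UNIV. (\<chi> i. if i = k then A' v $ k else A x $ i) $ i $ p i)
          = A' v $ k $ p k * (\<Prod>i\<in>UNIV - {k}. A x $ i $ p i)" for p
        by (subst prod.remove[of UNIV k]) auto
      then show "(\<Sum>p\<in>{p. p permutes (UNIV::'n set)}. of_int (sign p) * (A' v $ k $ p k * (\<Prod>i\<in>UNIV - {k}. A x $ i $ p i)))
          = det (\<chi> i. if i = k then A' v $ k else A x $ i)"
        unfolding det_def by simp
    qed
    also have "\<dots> = (\<Sum>k\<in>UNIV. (A' v $ k v* matrix_inv (A x)) $ k * det (A x))"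
      by (simp add: det_replace_row[OF nz])
    also have "\<dots> = det (A x) * trace (A' v ** matrix_inv (A x))"
      by (simp add: trace_def matrix_matrix_mult_def vector_matrix_mult_def sum_distrib_left sum_distrib_right mult_ac)
    finally show ?thesis .
  qed
  ultimately show ?thesis by simp
qed

section \<open>Rules for partial derivatives\<close>

lemma partial_cong: "x \<in> S \<Longrightarrow> (\<And>z. z \<in> S \<Longrightarrow> f z = g z) \<Longrightarrow> partial S i f x = partial S i g x"
  unfolding partial_def by (simp add: frechet_derivative_cong_on[of x S f g])

lemma partial_eqI:
  assumes "rich S" "x \<in> S" "(f has_derivative f') (at x within S)"
  shows "partial S i f x = f' (axis i 1)"
  unfolding partial_def by (simp add: rich_frechet[OF assms])

lemma partial_const: "rich S \<Longrightarrow> x \<in> S \<Longrightarrow> partial S i (\<lambda>z. c) x = 0"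
  by (rule partial_eqI) auto

lemma partial_add:
  assumes "rich S" "x \<in> S" "smooth_on S f" "smooth_on S g"
  shows "partial S i (\<lambda>z. f z + g z) x = partial S i f x + partial S i g x"
  using partial_eqI[OF assms(1,2) has_derivative_add[OF smooth_on_has_derivative[OF assms(3,2)] smooth_on_has_derivative[OF assms(4,2)]]]
  by (simp add: partial_def)

lemma partial_uminus:
  assumes "rich S" "x \<in> S" "smooth_on S f"
  shows "partial S i (\<lambda>z. - f z) x = - partial S i f x"
  using partial_eqI[OF assms(1,2) has_derivative_minus[OF smooth_on_has_derivative[OF assms(3,2)]]]
  by (simp add: partial_def)

lemma partial_diff:
  assumes "rich S" "x \<in> S" "smooth_on S f" "smooth_on S g"
  shows "partial S i (\<lambda>z. f z - g z) x = partial S i f x - partial S i g x"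
  using partial_eqI[OF assms(1,2) has_derivative_diff[OF smooth_on_has_derivative[OF assms(3,2)] smooth_on_has_derivative[OF assms(4,2)]]]
  by (simp add: partial_def)

lemma partial_mult:
  assumes "rich S" "x \<in> S" "smooth_on S f" "smooth_on S g"
  shows "partial S i (\<lambda>z. f z * g z) x = partial S i f x * g x + f x * partial S i g x"
  using partial_eqI[OF assms(1,2) has_derivative_mult[OF smooth_on_has_derivative[OF assms(3,2)] smooth_on_has_derivative[OF assms(4,2)]]]
  by (simp add: partial_def add.commute)

lemma partial_sum:
  assumes "rich S" "x \<in> S" "\<And>a. a \<in> A \<Longrightarrow> smooth_on S (f a)"
  shows "partial S i (\<lambda>z. \<Sum>a\<in>A. f a z) x = (\<Sum>a\<in>A. partial S i (f a) x)"
  using partial_eqI[OF assms(1,2) has_derivative_sum[OF smooth_on_has_derivative[OF assms(3,2)]]]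
  by (simp add: partial_def)

lemma partial_openin:
  assumes "openin (top_of_set S) T" "x \<in> T"
  shows "partial T i f x = partial S i f x"
  unfolding partial_def at_within_openin[OF assms] ..

section \<open>Matrix valued connections and the Levi-Civita connection\<close>

definition dmat :: "(real^'n::finite) set \<Rightarrow> 'n \<Rightarrow> (real^'n \<Rightarrow> real^'m^'k) \<Rightarrow> real^'n \<Rightarrow> real^'m^'k" where
  "dmat S i F x = (\<chi> a b. partial S i (\<lambda>z. F z $ a $ b) x)"

text \<open>Fixing the direction \<open>i\<close> turns the Christoffel symbols into a matrix acting
  on vector components, so that their index identities become identities of matrix algebra.\<close>

definition conn :: "(real^'n::finite) set \<Rightarrow> (real^'n \<Rightarrow> real^'n^'n) \<Rightarrow> 'n \<Rightarrow> real^'n \<Rightarrow> real^'n^'n" where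
  "conn S G i x = (\<chi> k j. christoffel S G x k i j)"

text \<open>The family \<open>A\<close> is arbitrary because the formula is also applied to a
  connection pulled back along a coordinate change, whose matrices act on components in the target
  coordinates.\<close>

definition curv :: "(real^'n::finite) set \<Rightarrow> ('n \<Rightarrow> real^'n \<Rightarrow> real^'n^'n) \<Rightarrow> 'n \<Rightarrow> 'n \<Rightarrow> real^'n \<Rightarrow> real^'n^'n" where
  "curv S A i j x = dmat S i (A j) x - dmat S j (A i) x + (A i x ** A j x - A j x ** A i x)"

lemma dmat_cong: "x \<in> S \<Longrightarrow> (\<And>z. z \<in> S \<Longrightarrow> F z = H z) \<Longrightarrow> dmat S i F x = dmat S i H x"
  unfolding dmat_def vec_eq_iff by (auto intro!: partial_cong)

lemma matrix_mul_nth: "(A ** B) $ i $ j = (\<Sum>k\<in>UNIV. A $ i $ k * B $ k $ j)"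
  by (simp add: matrix_matrix_mult_def)

lemma matrix_add_distrib_right: "(A + B) ** C = A ** C + B ** (C :: real^'c^'b)"
  by (simp add: vec_eq_iff matrix_mul_nth sum.distrib distrib_right)

lemma matrix_sub_distribs:
  fixes A B :: "real^'b^'a"
  shows "(A - B) ** C = A ** C - B ** C" "D ** (A - B) = D ** A - D ** B"
  by (simp_all add: vec_eq_iff matrix_mul_nth sum_subtractf left_diff_distrib right_diff_distrib)

lemma matrix_minus_distribs:
  fixes A :: "real^'b^'a"
  shows "(- A) ** C = - (A ** C)" "D ** (- A) = - (D ** A)"
  by (simp_all add: vec_eq_iff matrix_mul_nth sum_negf)

lemma matrix_scaleR_distribs:
  fixes A :: "real^'b^'a"
  shows "(c *\<^sub>R A) ** C = c *\<^sub>R (A ** C)" "D ** (c *\<^sub>R A) = c *\<^sub>R (D ** A)"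
  by (simp_all add: vec_eq_iff matrix_mul_nth sum_distrib_left mult_ac)

lemma matrix_sum_distribs:
  fixes A :: "'i \<Rightarrow> real^'b^'a"
  shows "(\<Sum>i\<in>I. A i) ** C = (\<Sum>i\<in>I. A i ** C)" "D ** (\<Sum>i\<in>I. A i) = (\<Sum>i\<in>I. D ** A i)"
  by (induction I rule: infinite_finite_induct)
     (simp_all add: matrix_add_distrib_right matrix_add_ldistrib)

lemmas matrix_ring = matrix_add_distrib_right matrix_add_ldistrib matrix_sub_distribs matrix_minus_distribs matrix_mul_assoc

lemma smooth_on_matmul:
  fixes F :: "'a::euclidean_space \<Rightarrow> real^'b^'c" and H :: "'a \<Rightarrow> real^'d^'b"
  assumes "rich S" "smooth_on S F" "smooth_on S H"
  shows "smooth_on S (\<lambda>x. F x ** H x)"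
  by (intro smooth_on_vec assms(1))
     (simp add: matrix_mul_nth, intro smooth_on_sum smooth_on_mult smooth_on_entry assms)

lemma smooth_on_transpose:
  fixes F :: "'a::euclidean_space \<Rightarrow> real^'b^'c"
  assumes "rich S" "smooth_on S F"
  shows "smooth_on S (\<lambda>x. transpose (F x))"
  by (intro smooth_on_vec assms(1)) (simp add: transpose_def smooth_on_entry assms)

lemma smooth_on_matvec:
  fixes F :: "'a::euclidean_space \<Rightarrow> real^'b^'c" and v :: "'a \<Rightarrow> real^'b"
  assumes "rich S" "smooth_on S F" "smooth_on S v"
  shows "smooth_on S (\<lambda>x. F x *v v x)"
  by (intro smooth_on_vec assms(1))
     (simp add: matrix_vector_mult_def, intro smooth_on_sum smooth_on_mult smooth_on_nth assms)

lemma smooth_on_vecmat: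
  fixes F :: "'a::euclidean_space \<Rightarrow> real^'b^'c" and v :: "'a \<Rightarrow> real^'c"
  assumes "rich S" "smooth_on S F" "smooth_on S v"
  shows "smooth_on S (\<lambda>x. v x v* F x)"
  by (intro smooth_on_vec assms(1))
     (simp add: vector_matrix_mult_def, intro smooth_on_sum smooth_on_mult smooth_on_nth assms)

lemma smooth_on_dmat: "rich S \<Longrightarrow> smooth_on S F \<Longrightarrow> smooth_on S (dmat S i F)"
  by (intro smooth_on_vec) (simp_all add: dmat_def smooth_on_partial smooth_on_entry)

lemma dmat_add:
  assumes "rich S" "x \<in> S" "smooth_on S F" "smooth_on S H"
  shows "dmat S i (\<lambda>z. F z + H z) x = dmat S i F x + dmat S i H x"
  using assms by (simp add: dmat_def vec_eq_iff partial_add smooth_on_entry)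

lemma dmat_diff:
  assumes "rich S" "x \<in> S" "smooth_on S F" "smooth_on S H"
  shows "dmat S i (\<lambda>z. F z - H z) x = dmat S i F x - dmat S i H x"
  using assms by (simp add: dmat_def vec_eq_iff partial_diff smooth_on_entry)

lemma dmat_matmul:
  assumes "rich S" "x \<in> S" "smooth_on S F" "smooth_on S H"
  shows "dmat S i (\<lambda>z. F z ** H z) x = dmat S i F x ** H x + F x ** dmat S i H x"
  using assms
  by (simp add: dmat_def vec_eq_iff matrix_mul_nth partial_sum partial_mult smooth_on_mult smooth_on_entry sum.distrib)

lemma dmat_transpose: "dmat S i (\<lambda>z. transpose (F z)) x = transpose (dmat S i F x)"
  by (simp add: dmat_def transpose_def)

lemma dmat_scaleR:
  assumes "rich S" "x \<in> S" "smooth_on S \<phi>" "smooth_on S F"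
  shows "dmat S i (\<lambda>z. \<phi> z *\<^sub>R F z) x = partial S i \<phi> x *\<^sub>R F x + \<phi> x *\<^sub>R dmat S i F x"
  using assms by (simp add: dmat_def vec_eq_iff partial_mult smooth_on_entry)

lemma dmat_sum:
  assumes "rich S" "x \<in> S" "\<And>a. a \<in> A \<Longrightarrow> smooth_on S (F a)"
  shows "dmat S i (\<lambda>z. \<Sum>a\<in>A. F a z) x = (\<Sum>a\<in>A. dmat S i (F a) x)"
  using assms by (simp add: dmat_def vec_eq_iff partial_sum smooth_on_entry)

lemma dmat_const: "rich S \<Longrightarrow> x \<in> S \<Longrightarrow> dmat S i (\<lambda>z. C) x = 0"
  by (simp add: dmat_def vec_eq_iff partial_const)

lemma dmat_commute:
  assumes "open S" "x \<in> S" "smooth_on S F"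
  shows "dmat S i (dmat S j F) x = dmat S j (dmat S i F) x"
  using partial_commute[OF assms(1) smooth_on_entry[OF rich_open[OF assms(1)] assms(3)] assms(2)]
  by (simp add: dmat_def vec_eq_iff)

text \<open>The Levi-Civita connection is unique: this identifies it after a change of coordinates or of
  conformal scale without differentiating the inverse metric.\<close>

lemma christoffel_lower:
  assumes "det (G x) \<noteq> 0"
  shows "(\<Sum>k\<in>UNIV. G x $ m $ k * christoffel S G x k i j) =
     (partial S i (\<lambda>z. G z $ j $ m) x + partial S j (\<lambda>z. G z $ i $ m) x - partial S m (\<lambda>z. G z $ i $ j) x) / 2"
proof -
  let ?X = "\<lambda>l. partial S i (\<lambda>z. G z $ j $ l) x + partial S j (\<lambda>z. G z $ i $ l) x - partial S l (\<lambda>z. G z $ i $ j) x"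
  have "(\<Sum>k\<in>UNIV. G x $ m $ k * christoffel S G x k i j)
      = (\<Sum>k\<in>UNIV. \<Sum>l\<in>UNIV. G x $ m $ k * matrix_inv (G x) $ k $ l * ?X l / 2)"
    by (simp add: christoffel_def sum_distrib_left sum_divide_distrib mult_ac)
  also have "\<dots> = (\<Sum>l\<in>UNIV. (G x ** matrix_inv (G x)) $ m $ l * ?X l / 2)"
    by (subst sum.swap) (simp add: matrix_mul_nth sum_distrib_right sum_divide_distrib)
  also have "\<dots> = ?X m / 2"
    by (simp add: matrix_inv_invertible[OF assms] mat_def if_distrib if_distribR sum.delta cong: if_cong)
  finally show ?thesis .
qed

lemma christoffel_sym:
  assumes "x \<in> S" "\<And>z. z \<in> S \<Longrightarrow> transpose (G z) = G z"
  shows "christoffel S G x k i j = christoffel S G x k j i"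
proof -
  have "G z $ i $ j = G z $ j $ i" if "z \<in> S" for z i j
    using assms(2)[OF that] by (metis transpose_def vec_lambda_beta)
  then have "partial S l (\<lambda>z. G z $ i $ j) x = partial S l (\<lambda>z. G z $ j $ i) x" for l i j
    by (intro partial_cong assms(1)) auto
  then show ?thesis
    unfolding christoffel_def by (simp add: add.commute)
qed

text \<open>With the index lowered, the two products are Koszul expressions, and in their sum
  everything but the derivative in direction \<open>i\<close> cancels.\<close>

lemma metric_compatible:
  assumes "x \<in> S" "\<And>z. z \<in> S \<Longrightarrow> transpose (G z) = G z" "det (G x) \<noteq> 0"
  shows "dmat S i G x = transpose (conn S G i x) ** G x + G x ** conn S G i x"
proof -
  have sym: "G z $ a $ b = G z $ b $ a" if "z \<in> S" for z a b
    using assms(2)[OF that] by (metis transpose_def vec_lambda_beta)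
  have psym: "partial S l (\<lambda>z. G z $ a $ b) x = partial S l (\<lambda>z. G z $ b $ a) x" for l a b
    by (intro partial_cong assms(1) sym)
  have "dmat S i G x $ a $ b = (transpose (conn S G i x) ** G x + G x ** conn S G i x) $ a $ b" for a b
  proof -
    have "(transpose (conn S G i x) ** G x + G x ** conn S G i x) $ a $ b
      = (\<Sum>k\<in>UNIV. G x $ b $ k * christoffel S G x k i a) + (\<Sum>k\<in>UNIV. G x $ a $ k * christoffel S G x k i b)"
      by (simp add: matrix_mul_nth transpose_def conn_def sym[OF assms(1), of _ b] mult.commute)
    also have "\<dots> = partial S i (\<lambda>z. G z $ a $ b) x"
      unfolding christoffel_lower[of G x, OF assms(3)] using psym[of i a b] psym[of a b i] psym[of b a i] psym[of a i b] psym[of b i a]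
      by (simp add: field_simps)
    finally show ?thesis by (simp add: dmat_def)
  qed
  then show ?thesis by (simp add: vec_eq_iff)
qed

lemma levi_civita_unique:
  assumes "x \<in> S" "\<And>z. z \<in> S \<Longrightarrow> transpose (G z) = G z" "det (G x) \<noteq> 0"
    and sym: "\<And>i j k. C i $ k $ j = C j $ k $ i"
    and compat: "\<And>i. dmat S i G x = transpose (C i) ** G x + G x ** C i"
  shows "conn S G i x = C i"
proof -
  have Gsym: "G x $ a $ b = G x $ b $ a" for a b
    using assms(2)[OF assms(1)] by (metis transpose_def vec_lambda_beta)
  \<comment> \<open>\<open>C\<close> with its upper index lowered. Compatibility writes each
    derivative of the metric as a sum of two values of \<open>K\<close>, and the Koszul combination
    of three of them leaves \<open>2 * K l i j\<close> by symmetry.\<close>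
  define K where "K = (\<lambda>m i j. \<Sum>k\<in>UNIV. G x $ m $ k * C i $ k $ j)"
  have Ksym: "K m i j = K m j i" for m i j unfolding K_def using sym[of i] by simp
  have D: "partial S i (\<lambda>z. G z $ a $ b) x = K b i a + K a i b" for i a b
  proof -
    have "partial S i (\<lambda>z. G z $ a $ b) x = dmat S i G x $ a $ b" by (simp add: dmat_def)
    also have "\<dots> = K b i a + K a i b"
      unfolding compat K_def by (simp add: matrix_mul_nth transpose_def Gsym[of _ b] mult.commute)
    finally show ?thesis .
  qed
  have "christoffel S G x k i j = C i $ k $ j" for k j
  proof -
    have "christoffel S G x k i j = (\<Sum>l\<in>UNIV. matrix_inv (G x) $ k $ l * K l i j)"
      unfolding christoffel_def D sum_divide_distrib
    proof (intro sum.cong refl)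
      fix l
      show "matrix_inv (G x) $ k $ l * (K l i j + K j i l + (K l j i + K i j l) - (K j l i + K i l j)) / 2 = matrix_inv (G x) $ k $ l * K l i j"
        using Ksym[of l i j] Ksym[of j i l] Ksym[of i j l] by simp
    qed
    also have "\<dots> = (matrix_inv (G x) ** (G x ** C i)) $ k $ j"
      by (simp add: matrix_mul_nth K_def)
    also have "\<dots> = C i $ k $ j" by (simp add: matrix_mul_assoc matrix_inv_invertible[OF assms(3)])
    finally show ?thesis .
  qed
  then show ?thesis by (simp add: conn_def vec_eq_iff)
qed

lemma smooth_on_christoffel:
  assumes "rich S" "smooth_on S G" "\<And>x. x \<in> S \<Longrightarrow> det (G x) \<noteq> 0"
  shows "smooth_on S (\<lambda>x. christoffel S G x k i j)"
  unfolding christoffel_def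
  by (intro smooth_on_divide smooth_on_sum smooth_on_mult smooth_on_add smooth_on_diff smooth_on_const
      smooth_on_entry smooth_on_matrix_inv smooth_on_partial assms) auto

lemma smooth_on_conn:
  assumes "rich S" "smooth_on S G" "\<And>x. x \<in> S \<Longrightarrow> det (G x) \<noteq> 0"
  shows "smooth_on S (conn S G i)"
  by (intro smooth_on_vec assms(1)) (simp add: conn_def smooth_on_christoffel assms)

lemma smooth_on_curv:
  assumes "rich S" "\<And>i. smooth_on S (A i)"
  shows "smooth_on S (curv S A i j)"
  unfolding curv_def by (intro smooth_on_add smooth_on_diff smooth_on_dmat smooth_on_matmul assms)

lemma riemann_curv: "riemann S G x i j k l = curv S (conn S G) i j x $ k $ l"
  by (simp add: riemann_def curv_def dmat_def conn_def matrix_mul_nth sum_subtractf)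

lemma ricci_curv: "ricci S G x $ i $ j = (\<Sum>k\<in>UNIV. curv S (conn S G) k i x $ k $ j)"
  by (simp add: ricci_def riemann_curv)

lemma curv_skew: "curv S A j i x = - curv S A i j x"
  by (simp add: curv_def)

lemma smooth_on_ricci:
  assumes "rich S" "smooth_on S G" "\<And>x. x \<in> S \<Longrightarrow> det (G x) \<noteq> 0"
  shows "smooth_on S (ricci S G)"
  by (intro smooth_on_vec assms(1)) (simp add: ricci_curv, intro smooth_on_sum smooth_on_entry smooth_on_curv smooth_on_conn assms)

text \<open>Curvature is a local invariant of the metric.\<close>

lemma christoffel_local:
  assumes "openin (top_of_set S) T" "x \<in> T" "\<And>z. z \<in> T \<Longrightarrow> G z = H z"
  shows "christoffel S G x k i j = christoffel T H x k i j"
proof -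
  have "partial S i (\<lambda>z. G z $ a $ b) x = partial T i (\<lambda>z. H z $ a $ b) x" for i a b
    unfolding partial_openin[OF assms(1,2), symmetric] by (intro partial_cong assms(2)) (simp add: assms(3))
  then show ?thesis by (simp add: christoffel_def assms)
qed

lemma conn_local:
  assumes "openin (top_of_set S) T" "x \<in> T" "\<And>z. z \<in> T \<Longrightarrow> G z = H z"
  shows "conn S G i x = conn T H i x"
  by (simp add: conn_def vec_eq_iff christoffel_local[OF assms])

lemma ricci_local:
  assumes "openin (top_of_set S) T" "x \<in> T" "\<And>z. z \<in> T \<Longrightarrow> G z = H z"
  shows "ricci S G x = ricci T H x"
proof -
  have "dmat S i (conn S G j) x = dmat T i (conn T H j) x" for i j
  proof -
    have "dmat S i (conn S G j) x = dmat T i (conn S G j) x"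
      by (simp add: dmat_def partial_openin[OF assms(1,2)])
    also have "\<dots> = dmat T i (conn T H j) x"
      by (intro dmat_cong assms(2) conn_local assms)
    finally show ?thesis .
  qed
  then show ?thesis by (simp add: vec_eq_iff ricci_curv curv_def conn_local[OF assms])
qed

section \<open>The Bianchi identities\<close>

text \<open>The exterior covariant derivative of the curvature of a matrix connection vanishes: once
  the second derivatives of \<open>A\<close> commute, all terms cancel. The commutators are the
  connection terms of the two matrix indices; \<open>i\<close>, \<open>j\<close> and
  \<open>m\<close> are form indices.\<close>

lemma second_bianchi:
  assumes "open S" "x \<in> S" "\<And>i. smooth_on S (A i)"
  shows "(dmat S m (curv S A i j) x + (A m x ** curv S A i j x - curv S A i j x ** A m x))
    + (dmat S i (curv S A j m) x + (A i x ** curv S A j m x - curv S A j m x ** A i x))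
    + (dmat S j (curv S A m i) x + (A j x ** curv S A m i x - curv S A m i x ** A j x)) = 0"
proof -
  note R = rich_open[OF assms(1)]
  have d: "dmat S m (curv S A i j) x = dmat S m (dmat S i (A j)) x - dmat S m (dmat S j (A i)) x
     + (dmat S m (A i) x ** A j x + A i x ** dmat S m (A j) x - (dmat S m (A j) x ** A i x + A j x ** dmat S m (A i) x))" for m i j
    unfolding curv_def using R assms
    by (simp add: dmat_add dmat_diff dmat_matmul smooth_on_add smooth_on_diff smooth_on_dmat smooth_on_matmul)
  show ?thesis
    unfolding d unfolding curv_def dmat_commute[OF assms(1,2,3), of m i j] dmat_commute[OF assms(1,2,3), of m j i]
      dmat_commute[OF assms(1,2,3), of i j m]
    by (simp add: matrix_ring algebra_simps)
qed

lemma transpose_add: "transpose (A + B) = transpose A + transpose (B :: real^'b^'a)"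
  by (simp add: transpose_def vec_eq_iff)

lemma transpose_diff: "transpose (A - B) = transpose A - transpose (B :: real^'b^'a)"
  by (simp add: transpose_def vec_eq_iff)

lemma transpose_scaleR: "transpose (c *\<^sub>R A) = c *\<^sub>R transpose (A :: real^'b^'a)"
  by (simp add: transpose_def vec_eq_iff)

lemma matrix_inv_sym:
  fixes G :: "real^'n^'n::finite"
  assumes "transpose G = G" "det G \<noteq> 0"
  shows "transpose (matrix_inv G) = matrix_inv G"
proof -
  have "transpose (matrix_inv G) ** G = mat 1"
    using arg_cong[OF matrix_inv_invertible(1)[OF assms(2)], of transpose] assms(1)
    by (simp add: matrix_transpose_mul)
  then have "(transpose (matrix_inv G) ** G) ** matrix_inv G = matrix_inv G" by simp
  then show ?thesis
    by (simp add: matrix_mul_assoc[symmetric] matrix_inv_invertible(1)[OF assms(2)])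
qed

text \<open>Openness of the domain makes second partial derivatives commute, on which the curvature
  identities rest.\<close>

locale metric_on =
  fixes S :: "(real^'n::finite) set" and G :: "real^'n \<Rightarrow> real^'n^'n"
  assumes open_S: "open S" and smooth_G: "smooth_on S G"
    and sym_G: "\<And>x. x \<in> S \<Longrightarrow> transpose (G x) = G x" and det_G: "\<And>x. x \<in> S \<Longrightarrow> det (G x) \<noteq> 0"
begin

abbreviation "H x \<equiv> matrix_inv (G x)"
abbreviation "\<Gamma> \<equiv> conn S G"

lemma rich_S: "rich S" by (rule rich_open[OF open_S])

lemma G_nth_sym: "x \<in> S \<Longrightarrow> G x $ a $ b = G x $ b $ a"
  using arg_cong[OF sym_G, of x "\<lambda>M. M $ b $ a"] by (simp add: transpose_def)

lemma \<Gamma>_sym: "x \<in> S \<Longrightarrow> \<Gamma> i x $ k $ j = \<Gamma> j x $ k $ i"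
  unfolding conn_def using christoffel_sym[of x S G k i j, OF _ sym_G] by simp

lemma smooth_\<Gamma>: "smooth_on S (\<Gamma> i)"
  by (rule smooth_on_conn[OF rich_S smooth_G det_G])

lemma smooth_H: "smooth_on S H"
  by (rule smooth_on_matrix_inv[OF rich_S smooth_G det_G])

lemma dmat_G: "x \<in> S \<Longrightarrow> dmat S i G x = transpose (\<Gamma> i x) ** G x + G x ** \<Gamma> i x"
  using metric_compatible[of x S G] sym_G det_G by simp

lemma GH: "x \<in> S \<Longrightarrow> G x ** H x = mat 1" "x \<in> S \<Longrightarrow> H x ** G x = mat 1"
  using matrix_inv_invertible[OF det_G] by auto

text \<open>Obtained by differentiating \<open>G x ** H x = mat 1\<close>, so no formula for the
  derivative of an inverse matrix enters.\<close>

lemma dmat_H: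
  assumes x: "x \<in> S"
  shows "dmat S i H x = - (H x ** transpose (\<Gamma> i x) + \<Gamma> i x ** H x)"
proof -
  have "dmat S i (\<lambda>z. G z ** H z) x = 0"
    using dmat_cong[OF x GH(1)] dmat_const[OF rich_S x] by simp
  then have "G x ** dmat S i H x = - (dmat S i G x ** H x)"
    by (simp add: dmat_matmul[OF rich_S x smooth_G smooth_H] eq_neg_iff_add_eq_0 add.commute)
  then have "H x ** (G x ** dmat S i H x) = - (H x ** (dmat S i G x ** H x))"
    by (simp add: matrix_minus_distribs)
  then have "dmat S i H x = - (H x ** (dmat S i G x ** H x))"
    by (simp add: matrix_mul_assoc GH[OF x])
  also have "H x ** (dmat S i G x ** H x) = H x ** transpose (\<Gamma> i x) ** (G x ** H x) + (H x ** G x) ** \<Gamma> i x ** H x"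
    unfolding dmat_G[OF x] by (simp add: matrix_ring)
  finally show ?thesis by (simp add: GH[OF x])
qed

text \<open>Second derivatives of \<open>G\<close> commute. Expressing both orders through metric
  compatibility, all terms cancel except those that assemble to the curvature.\<close>

lemma curv_metric_skew:
  assumes x: "x \<in> S"
  shows "transpose (curv S \<Gamma> i j x) ** G x + G x ** curv S \<Gamma> i j x = 0"
proof -
  have dd: "dmat S j (dmat S i G) x = transpose (dmat S j (\<Gamma> i) x) ** G x + transpose (\<Gamma> i x) ** dmat S j G x
      + (dmat S j G x ** \<Gamma> i x + G x ** dmat S j (\<Gamma> i) x)" for i j
  proof -
    have "dmat S j (dmat S i G) x = dmat S j (\<lambda>z. transpose (\<Gamma> i z) ** G z + G z ** \<Gamma> i z) x"
      by (rule dmat_cong[OF x dmat_G])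
    also have "\<dots> = transpose (dmat S j (\<Gamma> i) x) ** G x + transpose (\<Gamma> i x) ** dmat S j G x
      + (dmat S j G x ** \<Gamma> i x + G x ** dmat S j (\<Gamma> i) x)"
      using rich_S x smooth_G smooth_\<Gamma>
      by (simp add: dmat_add dmat_matmul dmat_transpose smooth_on_matmul smooth_on_transpose)
    finally show ?thesis .
  qed
  have "dmat S j (dmat S i G) x = dmat S i (dmat S j G) x"
    by (rule dmat_commute[OF open_S x smooth_G])
  then show ?thesis
    unfolding dd dmat_G[OF x] curv_def
    by (simp add: transpose_add transpose_diff matrix_transpose_mul matrix_ring algebra_simps)
qed

lemma curv_H_skew:
  assumes x: "x \<in> S"
  shows "transpose (curv S \<Gamma> i j x ** H x) = - (curv S \<Gamma> i j x ** H x)"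
proof -
  let ?F = "curv S \<Gamma> i j x"
  have tH: "transpose (H x) = H x" by (rule matrix_inv_sym[OF sym_G[OF x] det_G[OF x]])
  have "H x ** (transpose ?F ** G x + G x ** ?F) ** H x = 0"
    by (simp add: curv_metric_skew[OF x])
  moreover have "H x ** (transpose ?F ** G x + G x ** ?F) ** H x
      = H x ** transpose ?F ** (G x ** H x) + (H x ** G x) ** ?F ** H x"
    by (simp add: matrix_ring)
  ultimately have "H x ** transpose ?F + ?F ** H x = 0" by (simp add: GH[OF x])
  then show ?thesis by (simp add: matrix_transpose_mul tH add_eq_0_iff2)
qed

text \<open>The twice contracted second Bianchi identity. Of the three cyclic terms one contracts to
  \<open>n\<close> times the derivative of \<open>f\<close> and the other two to minus this
  derivative, which leaves the factor \<open>n - 2\<close>.\<close>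

lemma einstein_function_locally_constant:
  assumes f: "smooth_on S f" and ric: "\<And>x. x \<in> S \<Longrightarrow> ricci S G x = f x *\<^sub>R G x"
    and n: "CARD('n) \<ge> 3" and x: "x \<in> S"
  shows "partial S m f x = 0"
proof -
  \<comment> \<open>Curvature with its last index raised: it is skew in both pairs, and for an
    Einstein metric each mixed trace is \<open>f\<close> times a Kronecker symbol. The traces can
    thus be differentiated without differentiating the metric.\<close>
  define E where "E = (\<lambda>i j z. curv S \<Gamma> i j z ** H z)"
  have smE: "smooth_on S (E i j)" for i j
    unfolding E_def by (intro smooth_on_matmul smooth_on_curv smooth_\<Gamma> smooth_H rich_S)
  have skew1: "E i j z $ k $ l = - E j i z $ k $ l" for i j z k l
    unfolding E_def using curv_skew[of S \<Gamma> i j z] by (simp add: matrix_minus_distribs)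
  have skew2: "E i j z $ k $ l = - E i j z $ l $ k" if "z \<in> S" for i j z k l
    using arg_cong[OF curv_H_skew[OF that, of i j], of "\<lambda>M. M $ l $ k"] unfolding E_def by (simp add: transpose_def)
  have tr1: "(\<Sum>i\<in>UNIV. E i j z $ i $ l) = (if j = l then f z else 0)" if "z \<in> S" for j l z
  proof -
    have "(\<Sum>i\<in>UNIV. E i j z $ i $ l) = (\<Sum>k\<in>UNIV. ricci S G z $ j $ k * H z $ k $ l)"
      unfolding E_def by (simp add: matrix_mul_nth ricci_curv sum_distrib_right) (rule sum.swap)
    also have "\<dots> = f z * (G z ** H z) $ j $ l"
      unfolding ric[OF that] by (simp add: matrix_mul_nth sum_distrib_left mult_ac)
    finally show ?thesis by (simp add: GH[OF that] mat_def)
  qed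
  have tr2: "(\<Sum>j\<in>UNIV. E i j z $ p $ j) = (if i = p then f z else 0)" if "z \<in> S" for i p z
    using tr1[OF that, of i p] skew1[of i _ z p] skew2[OF that, of _ i p] by simp
  have tr3: "(\<Sum>j\<in>UNIV. E j m z $ i $ j) = - (if m = i then f z else 0)" if "z \<in> S" for i m z
    using tr1[OF that, of m i] skew2[OF that, of _ m i] by (simp add: sum_negf)
  have tr4: "(\<Sum>i\<in>UNIV. E m i z $ i $ j) = - (if m = j then f z else 0)" if "z \<in> S" for m j z
    using tr1[OF that, of m j] skew1[of m _ z] by (simp add: sum_negf)
  \<comment> \<open>The inverse metric is parallel, so the covariant derivative of \<open>E\<close>
    is that of the curvature followed by \<open>H\<close>.\<close>
  have DE: "dmat S m (E i j) x + \<Gamma> m x ** E i j x + E i j x ** transpose (\<Gamma> m x)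
     = (dmat S m (curv S \<Gamma> i j) x + (\<Gamma> m x ** curv S \<Gamma> i j x - curv S \<Gamma> i j x ** \<Gamma> m x)) ** H x" for m i j
  proof -
    have "dmat S m (E i j) x = dmat S m (curv S \<Gamma> i j) x ** H x + curv S \<Gamma> i j x ** dmat S m H x"
      unfolding E_def by (rule dmat_matmul[OF rich_S x smooth_on_curv[OF rich_S smooth_\<Gamma>] smooth_H])
    then show ?thesis unfolding dmat_H[OF x] E_def by (simp add: matrix_ring algebra_simps)
  qed
  have bianchi: "(dmat S m (E i j) x + \<Gamma> m x ** E i j x + E i j x ** transpose (\<Gamma> m x))
    + (dmat S i (E j m) x + \<Gamma> i x ** E j m x + E j m x ** transpose (\<Gamma> i x))
    + (dmat S j (E m i) x + \<Gamma> j x ** E m i x + E m i x ** transpose (\<Gamma> j x)) = 0" for i j m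
    unfolding DE using second_bianchi[where A = \<Gamma>, OF open_S x smooth_\<Gamma>, of m i j]
    by (simp only: matrix_add_distrib_right[symmetric]) simp
  define t where "t = (\<Sum>i\<in>UNIV. \<Gamma> m x $ i $ i)"
  have sum0: "(\<Sum>i\<in>UNIV. \<Sum>j\<in>UNIV. ((dmat S m (E i j) x + \<Gamma> m x ** E i j x + E i j x ** transpose (\<Gamma> m x))
    + (dmat S i (E j m) x + \<Gamma> i x ** E j m x + E j m x ** transpose (\<Gamma> i x))
    + (dmat S j (E m i) x + \<Gamma> j x ** E m i x + E m i x ** transpose (\<Gamma> j x))) $ i $ j) = 0"
    unfolding bianchi by simp
  have smEn: "smooth_on S (\<lambda>z. E i j z $ k $ l)" for i j k l by (rule smooth_on_entry[OF rich_S smE])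
  have pfm: "partial S i (\<lambda>z. - (if b then f z else 0)) x = - (if b then partial S i f x else 0)" for b i
    using partial_uminus[OF rich_S x f] partial_const[OF rich_S x] by (cases b) auto
  have a1: "(\<Sum>i\<in>UNIV. \<Sum>j\<in>UNIV. dmat S m (E i j) x $ i $ j) = CARD('n) * partial S m f x"
  proof -
    have "(\<Sum>j\<in>UNIV. dmat S m (E i j) x $ i $ j) = partial S m f x" for i
    proof -
      have "(\<Sum>j\<in>UNIV. dmat S m (E i j) x $ i $ j) = partial S m (\<lambda>z. \<Sum>j\<in>UNIV. E i j z $ i $ j) x"
        by (simp add: dmat_def partial_sum[OF rich_S x smEn])
      also have "\<dots> = partial S m f x" by (rule partial_cong[OF x]) (simp add: tr2)
      finally show ?thesis .
    qed
    then show ?thesis by simp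
  qed
  have a2: "(\<Sum>i\<in>UNIV. \<Sum>j\<in>UNIV. (\<Gamma> m x ** E i j x) $ i $ j) = f x * t"
  proof -
    have "(\<Sum>j\<in>UNIV. (\<Gamma> m x ** E i j x) $ i $ j) = \<Gamma> m x $ i $ i * f x" for i
    proof -
      have "(\<Sum>j\<in>UNIV. (\<Gamma> m x ** E i j x) $ i $ j) = (\<Sum>p\<in>UNIV. \<Gamma> m x $ i $ p * (\<Sum>j\<in>UNIV. E i j x $ p $ j))"
        by (simp add: matrix_mul_nth sum_distrib_left) (rule sum.swap)
      then show ?thesis by (simp add: tr2[OF x] if_distrib sum.delta cong: if_cong)
    qed
    then show ?thesis by (simp add: t_def sum_distrib_left mult.commute)
  qed
  have a3: "(\<Sum>i\<in>UNIV. \<Sum>j\<in>UNIV. (E i j x ** transpose (\<Gamma> m x)) $ i $ j) = f x * t"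
  proof -
    have "(\<Sum>i\<in>UNIV. (E i j x ** transpose (\<Gamma> m x)) $ i $ j) = f x * \<Gamma> m x $ j $ j" for j
    proof -
      have "(\<Sum>i\<in>UNIV. (E i j x ** transpose (\<Gamma> m x)) $ i $ j) = (\<Sum>p\<in>UNIV. (\<Sum>i\<in>UNIV. E i j x $ i $ p) * \<Gamma> m x $ j $ p)"
        by (simp add: matrix_mul_nth sum_distrib_right transpose_def) (rule sum.swap)
      then show ?thesis by (simp add: tr1[OF x] if_distrib if_distribR sum.delta cong: if_cong)
    qed
    then show ?thesis by (subst sum.swap) (simp add: t_def sum_distrib_left)
  qed
  have b1: "(\<Sum>i\<in>UNIV. \<Sum>j\<in>UNIV. dmat S i (E j m) x $ i $ j) = - partial S m f x"
  proof -
    have "(\<Sum>j\<in>UNIV. dmat S i (E j m) x $ i $ j) = - (if m = i then partial S i f x else 0)" for i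
    proof -
      have "(\<Sum>j\<in>UNIV. dmat S i (E j m) x $ i $ j) = partial S i (\<lambda>z. \<Sum>j\<in>UNIV. E j m z $ i $ j) x"
        by (simp add: dmat_def partial_sum[OF rich_S x smEn])
      also have "\<dots> = partial S i (\<lambda>z. - (if m = i then f z else 0)) x" by (rule partial_cong[OF x]) (simp add: tr3)
      also have "\<dots> = - (if m = i then partial S i f x else 0)"
        by (rule pfm)
      finally show ?thesis .
    qed
    then show ?thesis by (simp add: sum_negf sum.delta)
  qed
  have c1: "(\<Sum>i\<in>UNIV. \<Sum>j\<in>UNIV. dmat S j (E m i) x $ i $ j) = - partial S m f x"
  proof -
    have "(\<Sum>i\<in>UNIV. dmat S j (E m i) x $ i $ j) = - (if m = j then partial S j f x else 0)" for j
    proof -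
      have "(\<Sum>i\<in>UNIV. dmat S j (E m i) x $ i $ j) = partial S j (\<lambda>z. \<Sum>i\<in>UNIV. E m i z $ i $ j) x"
        by (simp add: dmat_def partial_sum[OF rich_S x smEn])
      also have "\<dots> = partial S j (\<lambda>z. - (if m = j then f z else 0)) x" by (rule partial_cong[OF x]) (simp add: tr4)
      also have "\<dots> = - (if m = j then partial S j f x else 0)"
        by (rule pfm)
      finally show ?thesis .
    qed
    then show ?thesis by (subst sum.swap) (simp add: sum_negf sum.delta)
  qed
  have b2: "(\<Sum>i\<in>UNIV. \<Sum>j\<in>UNIV. (\<Gamma> i x ** E j m x) $ i $ j) = - (f x * t)"
  proof -
    have "(\<Sum>j\<in>UNIV. (\<Gamma> i x ** E j m x) $ i $ j) = - (\<Gamma> m x $ i $ i * f x)" for i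
    proof -
      have "(\<Sum>j\<in>UNIV. (\<Gamma> i x ** E j m x) $ i $ j) = (\<Sum>p\<in>UNIV. \<Gamma> i x $ i $ p * (\<Sum>j\<in>UNIV. E j m x $ p $ j))"
        by (simp add: matrix_mul_nth sum_distrib_left) (rule sum.swap)
      then show ?thesis by (simp add: tr3[OF x] if_distrib sum.delta sum_negf \<Gamma>_sym[OF x, of i i m] cong: if_cong)
    qed
    then show ?thesis by (simp add: t_def sum_distrib_left mult.commute sum_negf)
  qed
  have c3: "(\<Sum>i\<in>UNIV. \<Sum>j\<in>UNIV. (E m i x ** transpose (\<Gamma> j x)) $ i $ j) = - (f x * t)"
  proof -
    have "(\<Sum>i\<in>UNIV. (E m i x ** transpose (\<Gamma> j x)) $ i $ j) = - (f x * \<Gamma> m x $ j $ j)" for j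
    proof -
      have "(\<Sum>i\<in>UNIV. (E m i x ** transpose (\<Gamma> j x)) $ i $ j) = (\<Sum>p\<in>UNIV. (\<Sum>i\<in>UNIV. E m i x $ i $ p) * \<Gamma> j x $ j $ p)"
        by (simp add: matrix_mul_nth sum_distrib_right transpose_def) (rule sum.swap)
      then show ?thesis by (simp add: tr4[OF x] if_distrib if_distribR sum.delta sum_negf \<Gamma>_sym[OF x, of j j m] cong: if_cong)
    qed
    then show ?thesis by (subst sum.swap) (simp add: t_def sum_distrib_left sum_negf)
  qed
  \<comment> \<open>In \<open>b3\<close> and \<open>c2\<close> a skew pair of indices of
    \<open>E\<close> meets the symmetric lower pair of the Christoffel symbols.\<close>
  have anti: "(\<Sum>a\<in>UNIV. \<Sum>b\<in>UNIV. P a b * Q a b) = 0"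
    if "\<And>a b. P a b = - P b a" "\<And>a b. Q a b = Q b a" for P Q :: "'n \<Rightarrow> 'n \<Rightarrow> real"
  proof -
    have "(\<Sum>a\<in>UNIV. \<Sum>b\<in>UNIV. P a b * Q a b) = (\<Sum>b\<in>UNIV. \<Sum>a\<in>UNIV. P a b * Q a b)" by (rule sum.swap)
    also have "\<dots> = (\<Sum>b\<in>UNIV. \<Sum>a\<in>UNIV. - (P b a * Q b a))"
    proof (intro sum.cong refl)
      fix a b show "P a b * Q a b = - (P b a * Q b a)" using that(1)[of a b] that(2)[of a b] by simp
    qed
    finally show ?thesis by (simp add: sum_negf)
  qed
  have b3: "(\<Sum>i\<in>UNIV. \<Sum>j\<in>UNIV. (E j m x ** transpose (\<Gamma> i x)) $ i $ j) = 0"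
  proof -
    have "(\<Sum>i\<in>UNIV. (E j m x ** transpose (\<Gamma> i x)) $ i $ j) = 0" for j
      using anti[of "\<lambda>i p. E j m x $ i $ p" "\<lambda>i p. \<Gamma> i x $ j $ p", OF skew2[OF x] \<Gamma>_sym[OF x]]
      by (simp add: matrix_mul_nth transpose_def)
    then show ?thesis by (subst sum.swap) simp
  qed
  have c2: "(\<Sum>i\<in>UNIV. \<Sum>j\<in>UNIV. (\<Gamma> j x ** E m i x) $ i $ j) = 0"
  proof -
    have "(\<Sum>j\<in>UNIV. (\<Gamma> j x ** E m i x) $ i $ j) = 0" for i
      using anti[of "\<lambda>j p. E m i x $ p $ j" "\<lambda>j p. \<Gamma> j x $ i $ p", OF skew2[OF x] \<Gamma>_sym[OF x]]
      by (simp add: matrix_mul_nth mult.commute)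
    then show ?thesis by simp
  qed
  \<comment> \<open>The terms \<open>a2\<close> and \<open>a3\<close> cancel against
    \<open>b2\<close> and \<open>c3\<close>; the derivatives have coefficients \<open>n\<close>, -1
    and -1.\<close>
  have "(real CARD('n) - 2) * partial S m f x = 0"
    using sum0 by (simp add: sum.distrib a1 a2 a3 b1 b2 b3 c1 c2 c3 algebra_simps)
  then show ?thesis using n by simp
qed

end

section \<open>Conformal change of the metric\<close>

text \<open>With \<phi> = exp (2 \<omega>) this is the differential of \<omega>, the one-form
  \<Upsilon> of the conformal change from g to \<phi> g.\<close>

definition conf_form :: "(real^'n::finite) set \<Rightarrow> (real^'n \<Rightarrow> real) \<Rightarrow> real^'n \<Rightarrow> real^'n" where
  "conf_form S \<phi> x = (\<chi> i. partial S i \<phi> x / (2 * \<phi> x))"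

definition nabla_form ::
  "(real^'n::finite) set \<Rightarrow> (real^'n \<Rightarrow> real^'n^'n) \<Rightarrow> (real^'n \<Rightarrow> real^'n) \<Rightarrow> real^'n \<Rightarrow> real^'n^'n" where
  "nabla_form S G U x = (\<chi> i j. partial S i (\<lambda>z. U z $ j) x - (\<Sum>k\<in>UNIV. christoffel S G x k i j * U x $ k))"

lemma sum_delta_mult:
  "(\<Sum>k\<in>UNIV. (if k = i then a else 0) * (f k :: real)) = a * f (i::'n::finite)"
  "(\<Sum>k\<in>UNIV. (if i = k then a else 0) * f k) = a * f i"
  "(\<Sum>k\<in>UNIV. f k * (if k = i then a else 0)) = f i * a"
  "(\<Sum>k\<in>UNIV. f k * (if i = k then a else 0)) = f i * a"
  "(\<Sum>k\<in>UNIV. (if k = i then g k else 0) * f k) = g i * f i"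
  "(\<Sum>k\<in>UNIV. (if i = k then g k else 0) * f k) = g i * f i"
  "(\<Sum>k\<in>UNIV. f k * (if k = i then g k else 0)) = f i * g i"
  "(\<Sum>k\<in>UNIV. f k * (if i = k then g k else 0)) = f i * g i"
  by (simp_all add: if_distrib if_distribR sum.delta cong: if_cong)

lemma det_scaleR:
  fixes A :: "real^'n^'n::finite"
  shows "det (c *\<^sub>R A) = c ^ CARD('n) * det A"
  by (simp add: det_def prod.distrib sum_distrib_left mult_ac)

locale conformal_change = metric_on S G for S :: "(real^'n::finite) set" and G +
  fixes \<phi> :: "real^'n \<Rightarrow> real"
  assumes smooth_\<phi>: "smooth_on S \<phi>" and \<phi>_pos: "\<And>x. x \<in> S \<Longrightarrow> \<phi> x > 0"
begin

abbreviation "U \<equiv> conf_form S \<phi>"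
abbreviation "G' \<equiv> (\<lambda>z. \<phi> z *\<^sub>R G z)"
abbreviation "V x \<equiv> H x *v U x"

text \<open>The difference of the Levi-Civita connections of \<phi> g and g, in direction
  \<open>i\<close>; \<open>V\<close> is the one-form \<open>U\<close> with raised index.\<close>

definition B :: "'n \<Rightarrow> real^'n \<Rightarrow> real^'n^'n" where
  "B i x = (\<chi> k j. (if k = i then U x $ j else 0) + (if k = j then U x $ i else 0) - G x $ i $ j * V x $ k)"

lemma metric': "metric_on S G'"
proof
  show "open S" by (rule open_S)
  show "smooth_on S G'" by (rule smooth_on_scaleR[OF rich_S smooth_\<phi> smooth_G])
  show "transpose (G' x) = G' x" if "x \<in> S" for x by (simp add: transpose_scaleR sym_G[OF that])
  show "det (G' x) \<noteq> 0" if "x \<in> S" for x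
    using det_G[OF that] \<phi>_pos[OF that] by (simp add: det_scaleR)
qed

lemma smooth_U: "smooth_on S U"
  by (intro smooth_on_vec rich_S)
     (simp add: conf_form_def, intro smooth_on_divide smooth_on_mult smooth_on_const smooth_on_partial rich_S smooth_\<phi>, use \<phi>_pos in fastforce)

lemma smooth_V: "smooth_on S (\<lambda>x. V x)"
  by (intro smooth_on_matvec smooth_H smooth_U rich_S)

lemma partial_\<phi>: "x \<in> S \<Longrightarrow> partial S i \<phi> x = 2 * \<phi> x * U x $ i"
  using \<phi>_pos[of x] by (simp add: conf_form_def)

lemma GV:
  assumes "x \<in> S"
  shows "(\<Sum>k\<in>UNIV. G x $ a $ k * V x $ k) = U x $ a"
proof -
  have "G x *v V x = U x" by (simp add: matrix_vector_mul_assoc GH[OF assms])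
  then show ?thesis by (metis (no_types) matrix_vector_mult_def vec_lambda_beta)
qed

text \<open>By uniqueness it is enough that the sum is symmetric in its lower indices and that
  \<open>B\<close> accounts for the derivative of \<phi>: lowered with the metric, its symmetric
  part is \<open>U x $ i\<close> times the metric.\<close>

lemma conn_conformal:
  assumes x: "x \<in> S"
  shows "conn S G' i x = \<Gamma> i x + B i x"
proof (rule levi_civita_unique[where C = "\<lambda>i. \<Gamma> i x + B i x"])
  interpret m': metric_on S G' by (rule metric')
  show "x \<in> S" "\<And>z. z \<in> S \<Longrightarrow> transpose (G' z) = G' z" "det (G' x) \<noteq> 0"
    using x m'.sym_G m'.det_G by auto
  show "(\<Gamma> i x + B i x) $ k $ j = (\<Gamma> j x + B j x) $ k $ i" for i j k
    using \<Gamma>_sym[OF x, of i k j] by (simp add: B_def G_nth_sym[OF x, of j i])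
  show "dmat S i G' x = transpose (\<Gamma> i x + B i x) ** G' x + G' x ** (\<Gamma> i x + B i x)" for i
  proof -
    have GB: "(G x ** B i x) $ a $ b = G x $ a $ i * U x $ b + G x $ a $ b * U x $ i - G x $ i $ b * U x $ a" for a b
    proof -
      have "(G x ** B i x) $ a $ b = (\<Sum>k\<in>UNIV. G x $ a $ k * (if k = i then U x $ b else 0))
          + (\<Sum>k\<in>UNIV. G x $ a $ k * (if k = b then U x $ i else 0)) - G x $ i $ b * (\<Sum>k\<in>UNIV. G x $ a $ k * V x $ k)"
        by (simp add: matrix_mul_nth B_def sum.distrib sum_subtractf distrib_left right_diff_distrib sum_distrib_left mult_ac)
      then show ?thesis by (simp only: sum_delta_mult GV[OF x])
    qed
    have "transpose (B i x) ** G x = transpose (G x ** B i x)"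
      by (simp add: matrix_transpose_mul sym_G[OF x])
    then have "transpose (B i x) ** G x + G x ** B i x = (2 * U x $ i) *\<^sub>R G x"
      by (simp add: vec_eq_iff transpose_def GB G_nth_sym[OF x, of _ i] algebra_simps)
         (metis G_nth_sym[OF x] mult.commute)
    then have "\<phi> x *\<^sub>R (transpose (B i x) ** G x + G x ** B i x) = partial S i \<phi> x *\<^sub>R G x"
      by (simp add: partial_\<phi>[OF x])
    then show ?thesis
      by (simp add: dmat_scaleR[OF rich_S x smooth_\<phi> smooth_G] dmat_G[OF x] transpose_add matrix_ring
          matrix_scaleR_distribs scaleR_add_right algebra_simps)
  qed
qed

lemma smooth_B: "smooth_on S (B i)"
proof (intro smooth_on_vec rich_S)
  fix k j
  have if0: "smooth_on S (\<lambda>z. if b then U z $ l else 0)" for b l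
    using smooth_on_nth[OF rich_S smooth_U] smooth_on_const[OF rich_S] by (cases b) auto
  show "smooth_on S (\<lambda>x. B i x $ k $ j)"
    unfolding B_def vec_lambda_beta
    by (intro smooth_on_diff smooth_on_add if0 smooth_on_mult smooth_on_nth smooth_V smooth_G rich_S)
qed

text \<open>The curvature of \<open>\<Gamma> + B\<close> is expanded and contracted. The coefficient
  of the metric is left existential: a multiple of the metric contributes a multiple of the velocity
  to the circle equation and is removed by \<open>skew_pair\<close>.\<close>

lemma ricci_conformal:
  assumes x: "x \<in> S"
  obtains \<mu> where "ricci S G' x = ricci S G x
     - (real CARD('n) - 2) *\<^sub>R (nabla_form S G U x - (\<chi> i j. U x $ i * U x $ j)) + \<mu> *\<^sub>R G x"
proof -
  interpret m': metric_on S G' by (rule metric')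
  let ?n = "real CARD('n)"
  define d where "d = (\<lambda>i j. partial S i (\<lambda>z. U z $ j) x)"
  \<comment> \<open>\<open>U\<close> is half the differential of log \<phi>, hence closed; this is
    read off the symmetric second derivatives of \<phi>.\<close>
  have dsym: "d i j = d j i" for i j
  proof -
    have sm: "smooth_on S (\<lambda>z. 2 * \<phi> z)" by (intro smooth_on_mult smooth_on_const smooth_\<phi> rich_S)
    have sU: "smooth_on S (\<lambda>z. U z $ j)" for j by (intro smooth_on_nth rich_S smooth_U)
    have "partial S i (partial S j \<phi>) x = 4 * \<phi> x * U x $ i * U x $ j + 2 * \<phi> x * d i j" for i j
    proof -
      have "partial S i (partial S j \<phi>) x = partial S i (\<lambda>z. 2 * \<phi> z * U z $ j) x"
        by (rule partial_cong[OF x partial_\<phi>])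
      also have "\<dots> = partial S i (\<lambda>z. 2 * \<phi> z) x * U x $ j + 2 * \<phi> x * d i j"
        unfolding d_def by (rule partial_mult[OF rich_S x sm sU])
      also have "partial S i (\<lambda>z. 2 * \<phi> z) x = 4 * \<phi> x * U x $ i"
        using partial_mult[OF rich_S x smooth_on_const[OF rich_S] smooth_\<phi>, of i 2]
        by (simp add: partial_const[OF rich_S x] partial_\<phi>[OF x])
      finally show ?thesis .
    qed
    from this[of i j] this[of j i] partial_commute[OF open_S smooth_\<phi> x, of i j]
    show ?thesis using \<phi>_pos[OF x] by simp
  qed
  define g where "g = (\<lambda>k i j. \<Gamma> i x $ k $ j)"
  define u where "u = (\<lambda>i. U x $ i)"
  define v where "v = (\<lambda>i. V x $ i)"
  define m where "m = (\<lambda>i j. G x $ i $ j)"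
  define b where "b = (\<lambda>k i j. B i x $ k $ j)"
  have gsym: "g k i j = g k j i" for k i j unfolding g_def by (rule \<Gamma>_sym[OF x])
  have msym: "m i j = m j i" for i j unfolding m_def by (rule G_nth_sym[OF x])
  have mv: "(\<Sum>k\<in>UNIV. m a k * v k) = u a" for a unfolding m_def v_def u_def by (rule GV[OF x])
  have b: "b k i j = (if k = i then u j else 0) + (if k = j then u i else 0) - m i j * v k" for k i j
    by (simp add: b_def B_def u_def v_def m_def)
  have dm: "partial S k (\<lambda>z. G z $ j $ l) x = (\<Sum>p\<in>UNIV. g p k j * m p l) + (\<Sum>p\<in>UNIV. m j p * g p k l)" for k j l
    using arg_cong[OF dmat_G[OF x, of k], of "\<lambda>M. M $ j $ l"]
    by (simp add: dmat_def matrix_mul_nth transpose_def g_def m_def)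
  define N where "N = (\<lambda>j l. d j l - (\<Sum>k\<in>UNIV. g k j l * u k))"
  have db: "partial S p (\<lambda>z. B i z $ k $ j) x = (if k = i then d p j else 0) + (if k = j then d p i else 0)
      - (partial S p (\<lambda>z. G z $ i $ j) x * v k + m i j * partial S p (\<lambda>z. V z $ k) x)" for p i j k
  proof -
    have sU: "smooth_on S (\<lambda>z. if c then U z $ l else 0)" for c l
      using smooth_on_nth[OF rich_S smooth_U] smooth_on_const[OF rich_S] by (cases c) auto
    have pU: "partial S p (\<lambda>z. if c then U z $ l else 0) x = (if c then d p l else 0)" for c l
      using partial_const[OF rich_S x] by (cases c) (auto simp: d_def)
    have sG: "smooth_on S (\<lambda>z. G z $ i $ j)" "smooth_on S (\<lambda>z. V z $ k)"
      by (intro smooth_on_nth rich_S smooth_G smooth_V)+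
    show ?thesis
      unfolding B_def vec_lambda_beta m_def v_def
      by (simp add: partial_diff[OF rich_S x] partial_add[OF rich_S x] partial_mult[OF rich_S x] sU sG pU
          smooth_on_add[OF rich_S] smooth_on_mult[OF rich_S])
  qed
  define \<mu>1 where "\<mu>1 = (\<Sum>k\<in>UNIV. partial S k (\<lambda>z. V z $ k) x)"
  have bt: "(\<Sum>k\<in>UNIV. b k k j) = ?n * u j" for j
    using mv[of j] by (simp add: b sum.distrib sum_subtractf msym[of _ j])
  have t1: "(\<Sum>k\<in>UNIV. partial S k (\<lambda>z. B j z $ k $ l) x) = d j l + d l j
      - (\<Sum>k\<in>UNIV. ((\<Sum>p\<in>UNIV. g p k j * m p l) + (\<Sum>p\<in>UNIV. m j p * g p k l)) * v k) - m j l * \<mu>1" for j l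
    by (simp add: db dm sum.distrib sum_subtractf \<mu>1_def sum_distrib_left)
  have t2: "(\<Sum>k\<in>UNIV. partial S j (\<lambda>z. B k z $ k $ l) x) = ?n * d j l" for j l
  proof -
    have sB: "smooth_on S (\<lambda>z. B k z $ k $ l)" for k by (rule smooth_on_entry[OF rich_S smooth_B])
    have sU: "smooth_on S (\<lambda>z. U z $ l)" by (intro smooth_on_nth rich_S smooth_U)
    have "(\<Sum>k\<in>UNIV. partial S j (\<lambda>z. B k z $ k $ l) x) = partial S j (\<lambda>z. \<Sum>k\<in>UNIV. B k z $ k $ l) x"
      by (rule partial_sum[OF rich_S x sB, symmetric])
    also have "\<dots> = partial S j (\<lambda>z. ?n * U z $ l) x"
    proof (rule partial_cong[OF x])
      fix z assume z: "z \<in> S"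
      show "(\<Sum>k\<in>UNIV. B k z $ k $ l) = ?n * U z $ l"
        using GV[OF z, of l] by (simp add: B_def sum.distrib sum_subtractf G_nth_sym[OF z, of _ l])
    qed
    also have "\<dots> = ?n * d j l"
      using partial_mult[OF rich_S x smooth_on_const[OF rich_S] sU, of j ?n] partial_const[OF rich_S x]
      by (simp add: d_def)
    finally show ?thesis .
  qed
  \<comment> \<open>The following sums \<open>q1\<close> to \<open>q6\<close> are the products in
    the contracted curvature of \<open>\<Gamma> + B\<close> that involve \<open>B\<close>: three
    from each of the two orders of multiplication.\<close>
  define tg where "tg = (\<lambda>j. \<Sum>k\<in>UNIV. g k k j)"
  have q1: "(\<Sum>k\<in>UNIV. \<Sum>p\<in>UNIV. g k k p * b p j l) = tg j * u l + tg l * u j - m j l * (\<Sum>p\<in>UNIV. tg p * v p)" for j l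
  proof -
    have "(\<Sum>k\<in>UNIV. \<Sum>p\<in>UNIV. g k k p * b p j l) = (\<Sum>p\<in>UNIV. tg p * b p j l)"
      unfolding tg_def by (subst sum.swap) (simp add: sum_distrib_right)
    also have "\<dots> = (\<Sum>p\<in>UNIV. tg p * (if p = j then u l else 0)) + (\<Sum>p\<in>UNIV. tg p * (if p = l then u j else 0))
        - m j l * (\<Sum>p\<in>UNIV. tg p * v p)"
      by (simp add: b distrib_left right_diff_distrib sum.distrib sum_subtractf sum_distrib_left mult_ac)
    finally show ?thesis by (simp only: sum_delta_mult)
  qed
  have q2: "(\<Sum>k\<in>UNIV. \<Sum>p\<in>UNIV. b k k p * g p j l) = ?n * (\<Sum>p\<in>UNIV. g p j l * u p)" for j l
  proof -
    have "(\<Sum>k\<in>UNIV. \<Sum>p\<in>UNIV. b k k p * g p j l) = (\<Sum>p\<in>UNIV. (\<Sum>k\<in>UNIV. b k k p) * g p j l)"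
      by (subst sum.swap) (simp add: sum_distrib_right)
    then show ?thesis by (simp add: bt sum_distrib_left mult_ac)
  qed
  define vv where "vv = (\<Sum>p\<in>UNIV. u p * v p)"
  have q3: "(\<Sum>k\<in>UNIV. \<Sum>p\<in>UNIV. b k k p * b p j l) = ?n * (2 * u j * u l - m j l * vv)" for j l
  proof -
    have "(\<Sum>k\<in>UNIV. \<Sum>p\<in>UNIV. b k k p * b p j l) = (\<Sum>p\<in>UNIV. (\<Sum>k\<in>UNIV. b k k p) * b p j l)"
      by (subst sum.swap) (simp add: sum_distrib_right)
    also have "\<dots> = ?n * (\<Sum>p\<in>UNIV. u p * b p j l)" by (simp add: bt sum_distrib_left mult_ac)
    also have "(\<Sum>p\<in>UNIV. u p * b p j l) = (\<Sum>p\<in>UNIV. u p * (if p = j then u l else 0)) + (\<Sum>p\<in>UNIV. u p * (if p = l then u j else 0))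
        - m j l * vv"
      by (simp add: b vv_def distrib_left right_diff_distrib sum.distrib sum_subtractf sum_distrib_left mult_ac)
    finally show ?thesis by (simp only: sum_delta_mult) (simp add: algebra_simps)
  qed
  have q4: "(\<Sum>k\<in>UNIV. \<Sum>p\<in>UNIV. g k j p * b p k l) = tg j * u l + (\<Sum>p\<in>UNIV. g p j l * u p)
       - (\<Sum>k\<in>UNIV. \<Sum>p\<in>UNIV. g k j p * m k l * v p)" for j l
  proof -
    have "(\<Sum>k\<in>UNIV. \<Sum>p\<in>UNIV. g k j p * b p k l) = (\<Sum>k\<in>UNIV. \<Sum>p\<in>UNIV. g k j p * (if p = k then u l else 0))
       + (\<Sum>k\<in>UNIV. \<Sum>p\<in>UNIV. g k j p * (if p = l then u k else 0)) - (\<Sum>k\<in>UNIV. \<Sum>p\<in>UNIV. g k j p * m k l * v p)"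
      by (simp add: b distrib_left right_diff_distrib sum.distrib sum_subtractf mult_ac)
    then show ?thesis by (simp only: sum_delta_mult) (simp add: tg_def sum_distrib_right gsym[of _ j])
  qed
  have q5: "(\<Sum>k\<in>UNIV. \<Sum>p\<in>UNIV. b k j p * g p k l) = (\<Sum>p\<in>UNIV. g p j l * u p) + tg l * u j
       - (\<Sum>k\<in>UNIV. \<Sum>p\<in>UNIV. m j p * g p k l * v k)" for j l
  proof -
    have "(\<Sum>k\<in>UNIV. \<Sum>p\<in>UNIV. b k j p * g p k l) = (\<Sum>k\<in>UNIV. \<Sum>p\<in>UNIV. (if k = j then u p else 0) * g p k l)
       + (\<Sum>k\<in>UNIV. \<Sum>p\<in>UNIV. (if k = p then u j else 0) * g p k l) - (\<Sum>k\<in>UNIV. \<Sum>p\<in>UNIV. m j p * g p k l * v k)"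
      by (simp add: b algebra_simps sum.distrib sum_subtractf)
    moreover have "(\<Sum>k\<in>UNIV. \<Sum>p\<in>UNIV. (if k = j then u p else 0) * g p k l) = (\<Sum>p\<in>UNIV. g p j l * u p)"
      by (subst sum.swap) (simp only: sum_delta_mult, simp add: mult.commute)
    ultimately show ?thesis by (simp only: sum_delta_mult) (simp add: tg_def sum_distrib_left mult.commute)
  qed
  have q6: "(\<Sum>k\<in>UNIV. \<Sum>p\<in>UNIV. b k j p * b p k l) = (?n + 2) * u j * u l - 2 * m j l * vv" for j l
  proof -
    have bb: "(\<Sum>p\<in>UNIV. b k j p * b p k l) = (if k = j then (\<Sum>p\<in>UNIV. u p * b p k l) else 0) + u j * b k k l
       - v k * (\<Sum>p\<in>UNIV. m j p * b p k l)" for k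
    proof -
      have "(\<Sum>p\<in>UNIV. b k j p * b p k l) = (\<Sum>p\<in>UNIV. (if k = j then u p else 0) * b p k l)
        + (\<Sum>p\<in>UNIV. (if k = p then u j else 0) * b p k l) - v k * (\<Sum>p\<in>UNIV. m j p * b p k l)"
        by (simp add: b[of k j] algebra_simps sum.distrib sum_subtractf sum_distrib_left)
      then show ?thesis by (simp only: sum_delta_mult) simp
    qed
    have ub: "(\<Sum>p\<in>UNIV. u p * b p k l) = 2 * u k * u l - m k l * vv" for k
    proof -
      have "(\<Sum>p\<in>UNIV. u p * b p k l) = (\<Sum>p\<in>UNIV. u p * (if p = k then u l else 0)) + (\<Sum>p\<in>UNIV. u p * (if p = l then u k else 0))
        - m k l * vv"
        by (simp add: b vv_def distrib_left right_diff_distrib sum.distrib sum_subtractf sum_distrib_left mult_ac)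
      then show ?thesis by (simp only: sum_delta_mult) (simp add: algebra_simps)
    qed
    have mb: "(\<Sum>p\<in>UNIV. m j p * b p k l) = m j k * u l + m j l * u k - m k l * u j" for k
    proof -
      have "(\<Sum>p\<in>UNIV. m j p * b p k l) = (\<Sum>p\<in>UNIV. m j p * (if p = k then u l else 0)) + (\<Sum>p\<in>UNIV. m j p * (if p = l then u k else 0))
        - m k l * (\<Sum>p\<in>UNIV. m j p * v p)"
        by (simp add: b distrib_left right_diff_distrib sum.distrib sum_subtractf sum_distrib_left mult_ac)
      then show ?thesis by (simp only: sum_delta_mult mv)
    qed
    have s1: "(\<Sum>k\<in>UNIV. v k * (m j k * u l + m j l * u k - m k l * u j)) = u j * u l + m j l * vv - u l * u j"
    proof -
      have "(\<Sum>k\<in>UNIV. v k * (m j k * u l + m j l * u k - m k l * u j))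
        = (\<Sum>k\<in>UNIV. m j k * v k) * u l + m j l * vv - (\<Sum>k\<in>UNIV. m l k * v k) * u j"
        by (simp add: vv_def distrib_left right_diff_distrib sum.distrib sum_subtractf sum_distrib_left sum_distrib_right msym[of l] mult_ac)
      then show ?thesis by (simp add: mv)
    qed
    show ?thesis
      unfolding bb ub mb sum.distrib sum_subtractf s1
      by (simp add: sum_distrib_left[symmetric] bt algebra_simps)
  qed
  \<comment> \<open>The derivatives of the metric in \<open>t1\<close> cancel against what
    \<open>q4\<close> and \<open>q5\<close> leave over.\<close>
  have z1: "(\<Sum>k\<in>UNIV. ((\<Sum>p\<in>UNIV. g p k j * m p l) + (\<Sum>p\<in>UNIV. m j p * g p k l)) * v k)
     = (\<Sum>k\<in>UNIV. \<Sum>p\<in>UNIV. g k j p * m k l * v p) + (\<Sum>k\<in>UNIV. \<Sum>p\<in>UNIV. m j p * g p k l * v k)" for j l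
  proof -
    have "(\<Sum>k\<in>UNIV. \<Sum>p\<in>UNIV. g k j p * m k l * v p) = (\<Sum>p\<in>UNIV. \<Sum>k\<in>UNIV. g k p j * m k l * v p)"
      by (subst sum.swap) (simp add: gsym[of _ j])
    then show ?thesis by (simp add: distrib_right sum.distrib sum_distrib_right)
  qed
  \<comment> \<open>Everything proportional to the metric, including the coordinate divergence
    \<open>\<mu>1\<close> of \<open>V\<close>, which need not be evaluated.\<close>
  define \<mu> where "\<mu> = - \<mu>1 - (\<Sum>p\<in>UNIV. tg p * v p) - (?n - 2) * vv"
  have Gam': "\<And>z i. z \<in> S \<Longrightarrow> conn S G' i z = \<Gamma> i z + B i z" by (rule conn_conformal)
  have dG': "dmat S i (conn S G' j) x = dmat S i (\<Gamma> j) x + dmat S i (B j) x" for i j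
    using dmat_cong[OF x Gam'] dmat_add[OF rich_S x smooth_\<Gamma> smooth_B] by simp
  have "ricci S G' x $ j $ l = ricci S G x $ j $ l - (?n - 2) * (N j l - u j * u l) + \<mu> * m j l" for j l
  proof -
    have "ricci S G' x $ j $ l = ricci S G x $ j $ l
      + ((\<Sum>k\<in>UNIV. partial S k (\<lambda>z. B j z $ k $ l) x) - (\<Sum>k\<in>UNIV. partial S j (\<lambda>z. B k z $ k $ l) x))
      + ((\<Sum>k\<in>UNIV. \<Sum>p\<in>UNIV. g k k p * b p j l) + (\<Sum>k\<in>UNIV. \<Sum>p\<in>UNIV. b k k p * g p j l) + (\<Sum>k\<in>UNIV. \<Sum>p\<in>UNIV. b k k p * b p j l)
        - (\<Sum>k\<in>UNIV. \<Sum>p\<in>UNIV. g k j p * b p k l) - (\<Sum>k\<in>UNIV. \<Sum>p\<in>UNIV. b k j p * g p k l) - (\<Sum>k\<in>UNIV. \<Sum>p\<in>UNIV. b k j p * b p k l))"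
      unfolding ricci_curv curv_def dG' Gam'[OF x]
      by (simp add: matrix_mul_nth dmat_def g_def b_def sum.distrib sum_subtractf distrib_left distrib_right)
    then show ?thesis
      unfolding t1 t2 q1 q2 q3 q4 q5 q6 z1
      unfolding N_def \<mu>_def dsym[of l j] by (simp add: algebra_simps)
  qed
  then have "ricci S G' x = ricci S G x
     - (?n - 2) *\<^sub>R (nabla_form S G U x - (\<chi> i j. U x $ i * U x $ j)) + \<mu> *\<^sub>R G x"
    by (simp add: vec_eq_iff nabla_form_def N_def d_def g_def u_def m_def conn_def)
  then show ?thesis by (rule that)
qed

end

section \<open>Change of coordinates\<close>

lemma vec_axis_sum: "(v :: real^'n::finite) = (\<Sum>a\<in>UNIV. v $ a *\<^sub>R axis a 1)"
  by (simp add: vec_eq_iff axis_def if_distrib sum.delta cong: if_cong)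

lemma partial_nth:
  fixes \<psi> :: "real^'n::finite \<Rightarrow> real^'m::finite"
  assumes "rich S" "x \<in> S" "smooth_on S \<psi>"
  shows "partial S i (\<lambda>z. \<psi> z $ a) x = frechet_derivative \<psi> (at x within S) (axis i 1) $ a"
  by (rule partial_eqI[OF assms(1,2)])
     (rule bounded_linear.has_derivative[OF bounded_linear_vec_nth smooth_on_has_derivative[OF assms(3,2)]])

lemma partial_compose:
  fixes \<psi> :: "real^'n::finite \<Rightarrow> real^'m::finite"
  assumes "rich S" "rich T" "\<psi> ` S \<subseteq> T" "smooth_on S \<psi>" "smooth_on T f" "x \<in> S"
  shows "partial S i (\<lambda>z. f (\<psi> z)) x = (\<Sum>a\<in>UNIV. partial S i (\<lambda>z. \<psi> z $ a) x * partial T a f (\<psi> x))"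
proof -
  let ?d = "frechet_derivative \<psi> (at x within S)" and ?f = "frechet_derivative f (at (\<psi> x) within T)"
  have f: "(f has_derivative ?f) (at (\<psi> x) within T)"
    using smooth_on_has_derivative[OF assms(5)] assms(3,6) by blast
  have "((\<lambda>z. f (\<psi> z)) has_derivative (\<lambda>v. ?f (?d v))) (at x within S)"
    by (rule has_derivative_in_compose[OF smooth_on_has_derivative[OF assms(4,6)] has_derivative_subset[OF f assms(3)]])
  then have "partial S i (\<lambda>z. f (\<psi> z)) x = ?f (?d (axis i 1))"
    by (rule partial_eqI[OF assms(1,6)])
  also have "\<dots> = (\<Sum>a\<in>UNIV. ?d (axis i 1) $ a * ?f (axis a 1))"
    using has_derivative_linear[OF f] by (subst vec_axis_sum) (simp add: linear_sum linear_scale)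
  finally show ?thesis unfolding partial_nth[OF assms(1,6,4)] by (simp add: partial_def)
qed

locale coordinate_change =
  m: metric_on S G + m': metric_on S' G' for S :: "(real^'n::finite) set" and G and S' :: "(real^'n) set" and G' +
  fixes \<psi> :: "real^'n \<Rightarrow> real^'n" and J :: "real^'n \<Rightarrow> real^'n^'n"
  assumes smooth_\<psi>: "smooth_on S \<psi>" and \<psi>_image: "\<psi> ` S \<subseteq> S'"
    and J_def: "\<And>x. x \<in> S \<Longrightarrow> J x = (\<chi> a i. partial S i (\<lambda>z. \<psi> z $ a) x)"
    and pullback: "\<And>x. x \<in> S \<Longrightarrow> G x = transpose (J x) ** G' (\<psi> x) ** J x"
begin

lemma \<psi>_in: "x \<in> S \<Longrightarrow> \<psi> x \<in> S'" using \<psi>_image by auto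

lemma smooth_\<psi>_nth: "smooth_on S (\<lambda>z. \<psi> z $ a)"
  by (intro smooth_on_nth m.rich_S smooth_\<psi>)

lemma smooth_J: "smooth_on S J"
proof -
  have "smooth_on S (\<lambda>x. \<chi> a i. partial S i (\<lambda>z. \<psi> z $ a) x)"
    by (intro smooth_on_vec m.rich_S) (simp add: smooth_on_partial smooth_\<psi>_nth)
  then show ?thesis by (subst smooth_on_cong[OF J_def])
qed

text \<open>Invertibility comes from the nondegeneracy of the pulled back metric rather than from an
  inverse coordinate map.\<close>

lemma det_J: "x \<in> S \<Longrightarrow> det (J x) \<noteq> 0"
  using m.det_G[of x] pullback[of x] by (auto simp: det_mul)

lemma dJ_sym:
  assumes x: "x \<in> S"
  shows "dmat S i J x $ k $ j = dmat S j J x $ k $ i"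
proof -
  have "dmat S i J x $ k $ j = partial S i (partial S j (\<lambda>z. \<psi> z $ k)) x" for i j
    unfolding dmat_def vec_lambda_beta by (rule partial_cong[OF x]) (simp add: J_def)
  then show ?thesis using partial_commute[OF m.open_S smooth_\<psi>_nth x] by simp
qed

lemma partial_\<psi>:
  assumes "smooth_on S' f" "x \<in> S"
  shows "partial S i (\<lambda>z. f (\<psi> z)) x = (\<Sum>a\<in>UNIV. J x $ a $ i * partial S' a f (\<psi> x))"
  using partial_compose[OF m.rich_S m'.rich_S \<psi>_image smooth_\<psi> assms] by (simp add: J_def[OF assms(2)])

lemma dmat_\<psi>:
  assumes "smooth_on S' F" "x \<in> S"
  shows "dmat S i (\<lambda>z. F (\<psi> z)) x = (\<Sum>a\<in>UNIV. J x $ a $ i *\<^sub>R dmat S' a F (\<psi> x))"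
  using partial_\<psi>[OF smooth_on_entry[OF m'.rich_S assms(1)] assms(2)]
  by (simp add: dmat_def vec_eq_iff)

lemma smooth_comp_\<psi>: "smooth_on S' f \<Longrightarrow> smooth_on S (\<lambda>z. f (\<psi> z))" for f :: "_ \<Rightarrow> 'c::real_normed_vector"
  by (rule smooth_on_compose[OF m.rich_S m'.rich_S \<psi>_image smooth_\<psi>])

text \<open>The pullback along \<psi> of the target connection: the form index is transformed by the
  Jacobian, while the matrix still acts on components in the target coordinates.\<close>

definition A :: "'n \<Rightarrow> real^'n \<Rightarrow> real^'n^'n" where
  "A i x = (\<Sum>a\<in>UNIV. J x $ a $ i *\<^sub>R m'.\<Gamma> a (\<psi> x))"

lemma smooth_A: "smooth_on S (A i)"
  unfolding A_def
  by (intro smooth_on_sum smooth_on_scaleR smooth_on_entry smooth_J m.rich_S smooth_comp_\<psi> m'.smooth_\<Gamma>)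

text \<open>The transformation law of Christoffel symbols, read as a gauge transformation by
  \<open>J\<close>. Differentiating the pulled back metric shows that
  \<open>matrix_inv (J x) ** (A i x ** J x + dmat S i J x)\<close> is metric, symmetry of second
  derivatives of \<psi> shows that it is torsion free, and uniqueness concludes.\<close>

lemma J_conn:
  assumes x: "x \<in> S"
  shows "J x ** m.\<Gamma> i x = A i x ** J x + dmat S i J x"
proof -
  let ?X = "\<lambda>i. A i x ** J x + dmat S i J x"
  let ?C = "\<lambda>i. matrix_inv (J x) ** ?X i"
  have JC: "J x ** ?C i = ?X i" for i
    by (simp add: matrix_mul_assoc matrix_inv_invertible[OF det_J[OF x]])
  have "m.\<Gamma> i x = ?C i" for i
  proof (rule levi_civita_unique)
    show "x \<in> S" "\<And>z. z \<in> S \<Longrightarrow> transpose (G z) = G z" "det (G x) \<noteq> 0"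
      using x m.sym_G m.det_G by auto
    have "(A i x ** J x) $ k $ j = (\<Sum>q\<in>UNIV. \<Sum>a\<in>UNIV. J x $ a $ i * m'.\<Gamma> a (\<psi> x) $ k $ q * J x $ q $ j)" for i j k
      by (simp add: A_def matrix_mul_nth sum_distrib_right)
    moreover have "(\<Sum>q\<in>UNIV. \<Sum>a\<in>UNIV. J x $ a $ i * m'.\<Gamma> a (\<psi> x) $ k $ q * J x $ q $ j)
        = (\<Sum>q\<in>UNIV. \<Sum>a\<in>UNIV. J x $ a $ j * m'.\<Gamma> a (\<psi> x) $ k $ q * J x $ q $ i)" for i j k
      by (subst sum.swap) (simp add: m'.\<Gamma>_sym[OF \<psi>_in[OF x], of _ k] mult_ac)
    ultimately have "?X i $ k $ j = ?X j $ k $ i" for i j k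
      using dJ_sym[OF x, of i k j] by simp
    then show "?C i $ k $ j = ?C j $ k $ i" for i j k
      by (simp add: matrix_mul_nth)
    show "dmat S i G x = transpose (?C i) ** G x + G x ** ?C i" for i
    proof -
      have "dmat S i G x = dmat S i (\<lambda>z. transpose (J z) ** G' (\<psi> z) ** J z) x"
        by (rule dmat_cong[OF x pullback])
      also have "\<dots> = transpose (dmat S i J x) ** G' (\<psi> x) ** J x
          + transpose (J x) ** dmat S i (\<lambda>z. G' (\<psi> z)) x ** J x + transpose (J x) ** G' (\<psi> x) ** dmat S i J x"
        by (simp add: dmat_matmul[OF m.rich_S x] smooth_on_matmul[OF m.rich_S] smooth_on_transpose[OF m.rich_S]
            smooth_J smooth_comp_\<psi> m'.smooth_G dmat_transpose matrix_ring)
      also have "dmat S i (\<lambda>z. G' (\<psi> z)) x = transpose (A i x) ** G' (\<psi> x) + G' (\<psi> x) ** A i x"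
      proof -
        have tA: "transpose (A i x) = (\<Sum>a\<in>UNIV. J x $ a $ i *\<^sub>R transpose (m'.\<Gamma> a (\<psi> x)))"
          by (simp add: A_def transpose_def vec_eq_iff)
        show ?thesis
          unfolding dmat_\<psi>[OF m'.smooth_G x] m'.dmat_G[OF \<psi>_in[OF x]] tA
          by (simp add: A_def matrix_sum_distribs matrix_scaleR_distribs scaleR_add_right sum.distrib)
      qed
      finally have 1: "dmat S i G x = transpose (?X i) ** G' (\<psi> x) ** J x + transpose (J x) ** G' (\<psi> x) ** ?X i"
        by (simp add: transpose_add matrix_transpose_mul matrix_ring)
      have 2: "G x ** ?C i = transpose (J x) ** G' (\<psi> x) ** ?X i"
        unfolding pullback[OF x] by (simp add: matrix_mul_assoc[symmetric] JC)
      have "transpose (?C i) ** G x = transpose (G x ** ?C i)"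
        by (simp add: matrix_transpose_mul m.sym_G[OF x])
      also have "\<dots> = transpose (?X i) ** G' (\<psi> x) ** J x"
        unfolding 2 by (simp add: matrix_transpose_mul m'.sym_G[OF \<psi>_in[OF x]] matrix_mul_assoc)
      finally show ?thesis using 1 2 by simp
    qed
  qed
  then show ?thesis using JC by simp
qed

text \<open>Gauge covariance of curvature: \<open>J_conn\<close> is differentiated once more, and
  the second derivatives of \<open>J\<close> drop out by symmetry.\<close>

lemma J_curv:
  assumes x: "x \<in> S"
  shows "J x ** curv S m.\<Gamma> i j x = curv S A i j x ** J x"
proof -
  have d: "dmat S i J x ** m.\<Gamma> j x + J x ** dmat S i (m.\<Gamma> j) x
      = dmat S i (A j) x ** J x + A j x ** dmat S i J x + dmat S i (dmat S j J) x" for i j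
  proof -
    have "dmat S i (\<lambda>z. J z ** m.\<Gamma> j z) x = dmat S i (\<lambda>z. A j z ** J z + dmat S j J z) x"
      by (rule dmat_cong[OF x J_conn])
    then show ?thesis
      by (simp add: dmat_add[OF m.rich_S x] dmat_matmul[OF m.rich_S x] smooth_J smooth_A m.smooth_\<Gamma>
          smooth_on_matmul[OF m.rich_S] smooth_on_dmat[OF m.rich_S])
  qed
  have d': "J x ** dmat S i (m.\<Gamma> j) x
      = dmat S i (A j) x ** J x + A j x ** dmat S i J x + dmat S i (dmat S j J) x - dmat S i J x ** m.\<Gamma> j x" for i j
    using d[of i j] by (simp add: eq_diff_eq add.commute)
  have "J x ** (dmat S i (m.\<Gamma> j) x - dmat S j (m.\<Gamma> i) x)
      = (dmat S i (A j) x - dmat S j (A i) x) ** J x + (A j x ** dmat S i J x - A i x ** dmat S j J x)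
        - (dmat S i J x ** m.\<Gamma> j x - dmat S j J x ** m.\<Gamma> i x)"
    unfolding matrix_sub_distribs d' dmat_commute[OF m.open_S x smooth_J, of i j]
    by (simp add: algebra_simps)
  moreover have "J x ** (m.\<Gamma> i x ** m.\<Gamma> j x) = A i x ** A j x ** J x + A i x ** dmat S j J x + dmat S i J x ** m.\<Gamma> j x" for i j
  proof -
    have "J x ** (m.\<Gamma> i x ** m.\<Gamma> j x) = (A i x ** J x + dmat S i J x) ** m.\<Gamma> j x"
      using J_conn[OF x, of i] by (simp add: matrix_mul_assoc)
    also have "\<dots> = A i x ** (J x ** m.\<Gamma> j x) + dmat S i J x ** m.\<Gamma> j x" by (simp add: matrix_ring)
    finally show ?thesis unfolding J_conn[OF x, of j] by (simp add: matrix_ring)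
  qed
  ultimately show ?thesis
    unfolding curv_def by (simp add: matrix_add_ldistrib matrix_sub_distribs matrix_add_distrib_right algebra_simps)
qed

text \<open>Curvature pulls back as a two-form. The derivatives of \<open>J\<close> that arise are
  symmetric in \<open>i\<close> and \<open>j\<close> and disappear under
  skew-symmetrisation.\<close>

lemma curv_A:
  assumes x: "x \<in> S"
  shows "curv S A i j x = (\<Sum>a\<in>UNIV. \<Sum>b\<in>UNIV. (J x $ a $ i * J x $ b $ j) *\<^sub>R curv S' m'.\<Gamma> a b (\<psi> x))"
proof -
  let ?g = "\<lambda>a. m'.\<Gamma> a (\<psi> x)" and ?d = "\<lambda>a b. dmat S' a (m'.\<Gamma> b) (\<psi> x)"
  have dJ_nth: "partial S i (\<lambda>z. J z $ b $ j) x = dmat S i J x $ b $ j" for i b j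
    by (simp add: dmat_def)
  have d: "dmat S i (A j) x = (\<Sum>a\<in>UNIV. dmat S i J x $ a $ j *\<^sub>R ?g a)
      + (\<Sum>a\<in>UNIV. \<Sum>b\<in>UNIV. (J x $ a $ i * J x $ b $ j) *\<^sub>R ?d a b)" for i j
  proof -
    have "dmat S i (A j) x = (\<Sum>b\<in>UNIV. dmat S i (\<lambda>z. J z $ b $ j *\<^sub>R m'.\<Gamma> b (\<psi> z)) x)"
      unfolding A_def by (rule dmat_sum[OF m.rich_S x])
        (intro smooth_on_scaleR smooth_on_entry smooth_J m.rich_S smooth_comp_\<psi> m'.smooth_\<Gamma>)
    also have "\<dots> = (\<Sum>b\<in>UNIV. dmat S i J x $ b $ j *\<^sub>R ?g b + J x $ b $ j *\<^sub>R (\<Sum>a\<in>UNIV. J x $ a $ i *\<^sub>R ?d a b))"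
    proof (intro sum.cong refl)
      fix b
      have "dmat S i (\<lambda>z. J z $ b $ j *\<^sub>R m'.\<Gamma> b (\<psi> z)) x
        = partial S i (\<lambda>z. J z $ b $ j) x *\<^sub>R ?g b + J x $ b $ j *\<^sub>R dmat S i (\<lambda>z. m'.\<Gamma> b (\<psi> z)) x"
        by (rule dmat_scaleR[OF m.rich_S x]) (intro smooth_on_entry smooth_J m.rich_S smooth_comp_\<psi> m'.smooth_\<Gamma>)+
      then show "dmat S i (\<lambda>z. J z $ b $ j *\<^sub>R m'.\<Gamma> b (\<psi> z)) x
        = dmat S i J x $ b $ j *\<^sub>R ?g b + J x $ b $ j *\<^sub>R (\<Sum>a\<in>UNIV. J x $ a $ i *\<^sub>R ?d a b)"
        unfolding dmat_\<psi>[OF m'.smooth_\<Gamma> x] dJ_nth .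
    qed
    also have "\<dots> = (\<Sum>a\<in>UNIV. dmat S i J x $ a $ j *\<^sub>R ?g a)
      + (\<Sum>b\<in>UNIV. \<Sum>a\<in>UNIV. (J x $ a $ i * J x $ b $ j) *\<^sub>R ?d a b)"
      by (simp add: sum.distrib scaleR_right.sum mult.commute)
    also have "(\<Sum>b\<in>UNIV. \<Sum>a\<in>UNIV. (J x $ a $ i * J x $ b $ j) *\<^sub>R ?d a b)
      = (\<Sum>a\<in>UNIV. \<Sum>b\<in>UNIV. (J x $ a $ i * J x $ b $ j) *\<^sub>R ?d a b)" by (rule sum.swap)
    finally show ?thesis .
  qed
  have AA: "A i x ** A j x = (\<Sum>a\<in>UNIV. \<Sum>b\<in>UNIV. (J x $ a $ i * J x $ b $ j) *\<^sub>R (?g a ** ?g b))" for i j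
    by (simp add: A_def matrix_sum_distribs matrix_scaleR_distribs scaleR_right.sum) (subst sum.swap, simp add: mult.commute)
  have sw: "(\<Sum>a\<in>UNIV. \<Sum>b\<in>UNIV. (J x $ a $ j * J x $ b $ i) *\<^sub>R Q a b)
     = (\<Sum>a\<in>UNIV. \<Sum>b\<in>UNIV. (J x $ a $ i * J x $ b $ j) *\<^sub>R Q b a)" for Q :: "'n \<Rightarrow> 'n \<Rightarrow> real^'n^'n"
    by (subst sum.swap) (simp add: mult.commute)
  show ?thesis
    unfolding curv_def d AA sw[of ?d] sw[of "\<lambda>a b. ?g a ** ?g b"]
    by (simp add: dJ_sym[OF x, of j _ i] sum.distrib sum_subtractf scaleR_add_right scaleR_diff_right algebra_simps)
qed

text \<open>The trace pairs the vector index, conjugated by \<open>J\<close>, with a form index,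
  transformed by \<open>J\<close>; in the sum over \<open>k\<close> the Jacobian meets its
  inverse.\<close>

lemma ricci_pullback:
  assumes x: "x \<in> S"
  shows "ricci S G x = transpose (J x) ** ricci S' G' (\<psi> x) ** J x"
proof -
  let ?F = "\<lambda>a b. curv S' m'.\<Gamma> a b (\<psi> x)" and ?I = "matrix_inv (J x)"
  have F: "curv S m.\<Gamma> k j x = ?I ** (curv S A k j x ** J x)" for k j
    unfolding J_curv[OF x, symmetric] by (simp add: matrix_mul_assoc matrix_inv_invertible[OF det_J[OF x]])
  have JI: "(\<Sum>k\<in>UNIV. J x $ a $ k * ?I $ k $ p) = (if a = p then 1 else 0)" for a p
    using arg_cong[OF matrix_inv_invertible(1)[OF det_J[OF x]], of "\<lambda>M. M $ a $ p"]
    by (simp add: matrix_mul_nth mat_def)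
  have "ricci S G x $ j $ l = (transpose (J x) ** ricci S' G' (\<psi> x) ** J x) $ j $ l" for j l
  proof -
    have "ricci S G x $ j $ l = (\<Sum>k\<in>UNIV. \<Sum>p\<in>UNIV. \<Sum>q\<in>UNIV. ?I $ k $ p * (curv S A k j x $ p $ q * J x $ q $ l))"
      unfolding ricci_curv F by (simp add: matrix_mul_nth sum_distrib_left)
    also have "\<dots> = (\<Sum>k\<in>UNIV. \<Sum>p\<in>UNIV. \<Sum>q\<in>UNIV. \<Sum>a\<in>UNIV. \<Sum>b\<in>UNIV.
        (J x $ a $ k * ?I $ k $ p) * (J x $ b $ j * ?F a b $ p $ q * J x $ q $ l))"
      unfolding curv_A[OF x] by (simp add: sum_distrib_left sum_distrib_right mult_ac)
    also have "\<dots> = (\<Sum>p\<in>UNIV. \<Sum>q\<in>UNIV. \<Sum>a\<in>UNIV. \<Sum>b\<in>UNIV. \<Sum>k\<in>UNIV.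
        (J x $ a $ k * ?I $ k $ p) * (J x $ b $ j * ?F a b $ p $ q * J x $ q $ l))"
      by (rule trans[OF sum.swap], rule sum.cong[OF refl], rule trans[OF sum.swap], rule sum.cong[OF refl], rule trans[OF sum.swap], rule sum.cong[OF refl], rule sum.swap)
    also have "\<dots> = (\<Sum>p\<in>UNIV. \<Sum>q\<in>UNIV. \<Sum>a\<in>UNIV. \<Sum>b\<in>UNIV. (if a = p then 1 else 0) * (J x $ b $ j * ?F a b $ p $ q * J x $ q $ l))"
      by (simp only: sum_distrib_right[symmetric] JI)
    also have "\<dots> = (\<Sum>p\<in>UNIV. \<Sum>q\<in>UNIV. \<Sum>b\<in>UNIV. J x $ b $ j * ?F p b $ p $ q * J x $ q $ l)"
      by (simp only: sum_distrib_left[symmetric] sum_delta_mult mult_1)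
    also have "\<dots> = (\<Sum>q\<in>UNIV. \<Sum>b\<in>UNIV. \<Sum>p\<in>UNIV. J x $ b $ j * ?F p b $ p $ q * J x $ q $ l)"
      by (rule trans[OF sum.swap], rule sum.cong[OF refl], rule sum.swap)
    also have "\<dots> = (transpose (J x) ** ricci S' G' (\<psi> x) ** J x) $ j $ l"
      by (simp add: matrix_mul_nth transpose_def ricci_curv sum_distrib_left sum_distrib_right)
    finally show ?thesis .
  qed
  then show ?thesis by (simp add: vec_eq_iff)
qed

end

section \<open>The conformal circle equation along a geodesic\<close>

lemma skew_pair_scaleR: "skew_pair (c *\<^sub>R v) (d *\<^sub>R w) = (c * d) *\<^sub>R skew_pair v w"
  by (simp add: skew_pair_def vec_eq_iff algebra_simps add_divide_distrib diff_divide_distrib)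

lemma skew_pair_add: "skew_pair (v + v') w = skew_pair v w + skew_pair v' w"
  by (simp add: skew_pair_def vec_eq_iff algebra_simps add_divide_distrib diff_divide_distrib)

lemma skew_pair_scaleR_left: "skew_pair (c *\<^sub>R v) w = c *\<^sub>R skew_pair v w"
  by (simp add: skew_pair_def vec_eq_iff algebra_simps add_divide_distrib diff_divide_distrib)

lemma skew_pair_scaleR_right: "skew_pair v (c *\<^sub>R w) = c *\<^sub>R skew_pair v w"
  by (simp add: skew_pair_def vec_eq_iff algebra_simps)

lemma skew_pair_diff: "skew_pair (v - v') w = skew_pair v w - skew_pair v' w"
  by (simp add: skew_pair_def vec_eq_iff algebra_simps add_divide_distrib diff_divide_distrib)

lemma skew_pair_self: "skew_pair (c *\<^sub>R w) w = 0"
  by (simp add: skew_pair_def vec_eq_iff)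

lemma skew_pair_refl: "skew_pair w w = 0"
  by (simp add: skew_pair_def vec_eq_iff)

lemma skew_pair_eq_0_iff:
  assumes "w \<noteq> 0"
  shows "skew_pair v w = 0 \<longleftrightarrow> (\<exists>k. v = k *\<^sub>R w)"
proof
  assume "skew_pair v w = 0"
  then have sk: "v $ a * w $ b = v $ b * w $ a" for a b
    by (simp add: skew_pair_def vec_eq_iff)
  obtain b where b: "w $ b \<noteq> 0" using assms by (auto simp: vec_eq_iff)
  have "v = (v $ b / w $ b) *\<^sub>R w"
    unfolding vec_eq_iff using sk b by (simp add: field_simps)
  then show "\<exists>k. v = k *\<^sub>R w" by blast
qed (auto simp: skew_pair_self)

section \<open>Covariant derivatives along a curve and removal of weights\<close>

lemma frechet_linear:
  assumes "smooth_on S F" "x \<in> S"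
  shows "frechet_derivative F (at x within S) u = (\<Sum>a\<in>UNIV. u $ a *\<^sub>R frechet_derivative F (at x within S) (axis a 1))"
  using has_derivative_linear[OF smooth_on_has_derivative[OF assms]]
  by (subst vec_axis_sum[of u]) (simp add: linear_sum linear_scale)

lemma frechet_axis_matrix:
  fixes F :: "real^'n::finite \<Rightarrow> real^'m::finite^'k::finite"
  assumes "rich S" "x \<in> S" "smooth_on S F"
  shows "frechet_derivative F (at x within S) (axis a 1) = dmat S a F x"
proof -
  have "((\<lambda>z. F z $ i $ j) has_derivative (\<lambda>v. frechet_derivative F (at x within S) v $ i $ j)) (at x within S)" for i j
    by (intro bounded_linear.has_derivative[OF bounded_linear_vec_nth] smooth_on_has_derivative assms)
  from partial_eqI[OF assms(1,2) this]
  show ?thesis by (simp add: dmat_def vec_eq_iff)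
qed

lemma curve_chain:
  assumes "smooth_on S F" "y ` J \<subseteq> S" "t \<in> J" "(y has_vector_derivative u) (at t within J)"
  shows "((\<lambda>t. F (y t)) has_vector_derivative frechet_derivative F (at (y t) within S) u) (at t within J)"
proof -
  have "y t \<in> S" using assms by auto
  then have F: "(F has_derivative frechet_derivative F (at (y t) within S)) (at (y t) within y ` J)"
    using smooth_on_has_derivative[OF assms(1)] has_derivative_subset assms(2) by blast
  have "((\<lambda>t. F (y t)) has_derivative (\<lambda>h. frechet_derivative F (at (y t) within S) (h *\<^sub>R u))) (at t within J)"
    using has_derivative_in_compose[OF assms(4)[unfolded has_vector_derivative_def] F] .
  then show ?thesis
    using has_derivative_linear[OF smooth_on_has_derivative[OF assms(1) \<open>y t \<in> S\<close>]]
    by (simp add: has_vector_derivative_def linear_scale)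
qed

definition connv :: "(real^'n::finite) set \<Rightarrow> (real^'n \<Rightarrow> real^'n^'n) \<Rightarrow> real^'n \<Rightarrow> real^'n \<Rightarrow> real^'n^'n" where
  "connv S G u x = (\<Sum>a\<in>UNIV. u $ a *\<^sub>R conn S G a x)"

lemma density_form_inner:
  "density_form S G w x \<bullet> u = w / real CARD('n) * trace (connv S G u (x :: real^'n::finite))"
proof -
  have "trace (connv S G u x) = (\<Sum>a\<in>UNIV. u $ a * (\<Sum>b\<in>UNIV. christoffel S G x b a b))"
    unfolding trace_def connv_def by (simp add: conn_def sum_distrib_left) (rule sum.swap)
  then show ?thesis
    by (simp add: inner_vec_def density_form_def sum_distrib_left mult_ac)
qed

lemma cov_vector_connv:
  "cov_vector S G J y w V t = vector_derivative V (at t within J) + connv S G (velocity J y t) (y t) *v V t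
     + (w / real CARD('n) * trace (connv S G (velocity J y t) (y t))) *\<^sub>R V (t::real)" for V :: "real \<Rightarrow> real^'n::finite"
proof -
  have "(\<chi> b. \<Sum>a\<in>UNIV. \<Sum>k\<in>UNIV. christoffel S G (y t) b a k * velocity J y t $ a * V t $ k) = connv S G (velocity J y t) (y t) *v V t"
    unfolding connv_def matrix_vector_mult_def vec_eq_iff
    by (simp add: conn_def sum_distrib_left sum_distrib_right mult_ac) (intro allI sum.swap)
  then show ?thesis unfolding cov_vector_def density_form_inner by simp
qed

lemma cov_vector_0:
  "cov_vector S G J y 0 V t = vector_derivative V (at t within J) + connv S G (velocity J y t) (y t) *v V t"
  by (simp add: cov_vector_connv)

lemma vector_derivative_cong_on:
  fixes f :: "real \<Rightarrow> 'a::real_normed_vector"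
  assumes "t \<in> J" "\<And>s. s \<in> J \<Longrightarrow> f s = g s"
  shows "vector_derivative f (at t within J) = vector_derivative g (at t within J)"
proof -
  have "(f has_vector_derivative f') (at t within J) \<longleftrightarrow> (g has_vector_derivative f') (at t within J)" for f'
    using assms has_vector_derivative_transform[of t J f g f'] has_vector_derivative_transform[of t J g f f'] by metis
  then show ?thesis by (simp add: vector_derivative_def)
qed

lemma cov_vector_cong:
  assumes "t \<in> J" "\<And>s. s \<in> J \<Longrightarrow> V s = W s"
  shows "cov_vector S G J y w V t = cov_vector S G J y w W t"
  using vector_derivative_cong_on[OF assms] assms(2)[OF assms(1)] by (simp add: cov_vector_def)

text \<open>The assumption on \<open>f\<close> says that it is a density of weight \<open>w\<close>
  parallel along the curve. It therefore factors out of the weighted derivative and leaves the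
  derivative of weight 0.\<close>

lemma unweight:
  fixes V :: "real \<Rightarrow> real^'n::finite"
  assumes J: "rich J" "t \<in> J"
    and f: "(f has_real_derivative - (w / real CARD('n) * trace (connv S G (velocity J y t) (y t))) * f t) (at t within J)"
    and V: "(V has_vector_derivative V') (at t within J)"
  shows "cov_vector S G J y w (\<lambda>t. f t *\<^sub>R V t) t = f t *\<^sub>R cov_vector S G J y 0 V t"
proof -
  have "((\<lambda>t. f t *\<^sub>R V t) has_vector_derivative (f t *\<^sub>R V' + (- (w / real CARD('n) * trace (connv S G (velocity J y t) (y t))) * f t) *\<^sub>R V t)) (at t within J)"
    by (rule has_vector_derivative_scaleR[OF f V])
  from rich_vector_derivative[OF J this] rich_vector_derivative[OF J V]
  show ?thesis
    by (simp add: cov_vector_connv matrix_vector_mult_scaleR algebra_simps)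
qed

lemma scaleR_matrix_vector_mult: "(c *\<^sub>R A) *v x = c *\<^sub>R (A *v (x :: real^'n))"
  by (simp add: matrix_vector_mult_def vec_eq_iff sum_distrib_left mult_ac)

lemma sum_matrix_vector_mult: "(\<Sum>i\<in>I. A i) *v x = (\<Sum>i\<in>I. A i *v (x :: real^'n))"
  by (induction I rule: infinite_finite_induct) (auto simp: matrix_vector_mult_add_rdistrib)

lemma vec_sym_matrix: "transpose A = A \<Longrightarrow> v v* A = A *v (v :: real^'n::finite)"
  by (metis transpose_matrix_vector)

lemma scaleR_vector_matrix_mult: "(c *\<^sub>R x) v* A = c *\<^sub>R (x v* (A :: real^'m^'n))"
  by (simp add: vector_matrix_mult_def vec_eq_iff sum_distrib_left mult_ac)

lemma matrix_inv_scaleR: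
  fixes A :: "real^'n^'n::finite"
  assumes "det A \<noteq> 0" "c \<noteq> 0"
  shows "matrix_inv (c *\<^sub>R A) = (1 / c) *\<^sub>R matrix_inv A"
proof -
  have d: "det (c *\<^sub>R A) \<noteq> 0" using assms by (simp add: det_scaleR)
  have "(c *\<^sub>R A) ** ((1 / c) *\<^sub>R matrix_inv A) = mat 1"
    using assms by (simp add: matrix_scaleR_distribs matrix_inv_invertible)
  then have "matrix_inv (c *\<^sub>R A) ** ((c *\<^sub>R A) ** ((1 / c) *\<^sub>R matrix_inv A)) = matrix_inv (c *\<^sub>R A)" by simp
  then show ?thesis by (simp add: matrix_mul_assoc matrix_inv_invertible[OF d])
qed

context metric_on
begin

lemma scale_density_pos: "x \<in> S \<Longrightarrow> scale_density G x > 0"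
  using det_G by (simp add: scale_density_def)

lemma smooth_scale_density: "smooth_on S (scale_density G)"
  unfolding scale_density_def
  by (intro smooth_on_powr smooth_on_abs smooth_on_det smooth_on_entry smooth_G rich_S det_G) (use det_G in auto)

text \<open>\<open>scale_density G\<close> is parallel as a density of weight 1. By Jacobi's formula
  its logarithmic derivative is a trace of the derivative of \<open>G\<close>, which metric
  compatibility turns into twice the trace of the connection matrix.\<close>

lemma partial_scale_density:
  assumes x: "x \<in> S"
  shows "partial S a (scale_density G) x = - (1 / real CARD('n) * trace (\<Gamma> a x)) * scale_density G x"
proof -
  let ?p = "- 1 / (2 * real CARD('n))"
  \<comment> \<open>The square of the determinant with half the exponent avoids differentiating an
    absolute value.\<close>
  let ?d = "\<lambda>z. (det (G z))\<^sup>2"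
  have d0: "det (G x) \<noteq> 0" by (rule det_G[OF x])
  have D: "((\<lambda>z. det (G z)) has_derivative (\<lambda>v. det (G x) * trace (frechet_derivative G (at x within S) v ** H x))) (at x within S)"
    by (rule has_derivative_det[OF smooth_on_has_derivative[OF smooth_G x] d0])
  have D2: "(?d has_derivative (\<lambda>v. 2 * (det (G x))\<^sup>2 * trace (frechet_derivative G (at x within S) v ** H x))) (at x within S)"
    using has_derivative_mult[OF D D] by (simp add: power2_eq_square algebra_simps)
  have D3: "((\<lambda>z. ?d z powr (?p/2)) has_derivative
     (\<lambda>v. ?d x powr (?p/2) * ((2 * (det (G x))\<^sup>2 * trace (frechet_derivative G (at x within S) v ** H x)) * (?p/2) / ?d x))) (at x within S)"
    using has_derivative_powr[OF D2 has_derivative_const[of "?p/2"] _ x] d0 by simp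
  have pw: "?d z powr (?p/2) = scale_density G z" for z
  proof -
    have z: "?d z = \<bar>det (G z)\<bar> powr 2" by simp
    show ?thesis unfolding z powr_powr by (simp add: scale_density_def)
  qed
  have "partial S a (scale_density G) x = scale_density G x * ((2 * (det (G x))\<^sup>2 * trace (dmat S a G x ** H x)) * (?p/2) / ?d x)"
    using partial_eqI[OF rich_S x D3, of a] unfolding pw frechet_axis_matrix[OF rich_S x smooth_G] .
  also have "\<dots> = scale_density G x * (?p * trace (dmat S a G x ** H x))" using d0 by simp
  also have "trace (dmat S a G x ** H x) = 2 * trace (\<Gamma> a x)"
  proof -
    have "trace (dmat S a G x ** H x) = trace (transpose (\<Gamma> a x) ** (G x ** H x)) + trace (G x ** (\<Gamma> a x ** H x))"
      unfolding dmat_G[OF x] by (simp add: matrix_ring trace_add)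
    also have "trace (G x ** (\<Gamma> a x ** H x)) = trace (\<Gamma> a x ** (H x ** G x))"
      by (subst trace_mul_sym) (simp add: matrix_mul_assoc)
    finally show ?thesis by (simp add: GH[OF x] trace_def transpose_def)
  qed
  finally show ?thesis by simp
qed

lemma conf_metric_inv_eq: "x \<in> S \<Longrightarrow> conf_metric_inv G x = (1 / (scale_density G x)\<^sup>2) *\<^sub>R H x"
  using scale_density_pos[of x] det_G[of x] by (simp add: conf_metric_def matrix_inv_scaleR)

text \<open>The Schouten tensor differs from the Ricci tensor divided by \<open>n - 2\<close> by a
  multiple of the metric; raised and applied to \<open>e\<close>, that multiple is parallel to
  \<open>e\<close>.\<close>

lemma skew_schouten:
  assumes x: "x \<in> S" and n: "CARD('n) \<ge> 3"
  shows "skew_pair (H x *v (e v* schouten S G x)) e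
     = (1 / (real CARD('n) - 2)) *\<^sub>R skew_pair (H x *v (e v* ricci S G x)) e"
proof -
  let ?k = "1 / (real CARD('n) - 2)" and ?l = "schouten_trace S G x * (scale_density G x)\<^sup>2"
  have "e v* schouten S G x = ?k *\<^sub>R (e v* ricci S G x - ?l *\<^sub>R (e v* G x))"
    unfolding schouten_def conf_metric_def
    by (simp add: vec_eq_iff vector_matrix_mult_def sum_distrib_left sum_subtractf right_diff_distrib left_diff_distrib mult_ac)
  also have "e v* G x = G x *v e" by (rule vec_sym_matrix[OF sym_G[OF x]])
  finally have "H x *v (e v* schouten S G x) = ?k *\<^sub>R (H x *v (e v* ricci S G x) - ?l *\<^sub>R e)"
    by (simp add: matrix_vector_mult_scaleR matrix_vector_mult_diff_distrib matrix_vector_mul_assoc GH[OF x])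
  then show ?thesis by (simp add: skew_pair_scaleR_left skew_pair_diff skew_pair_refl)
qed

end

locale curve_in_metric = metric_on S G for S :: "(real^'n::finite) set" and G +
  fixes J :: "real set" and y :: "real \<Rightarrow> real^'n"
  assumes rich_J: "rich J" and smooth_y: "smooth_on J y" and y_in: "y ` J \<subseteq> S"
    and nonnull: "\<And>t. t \<in> J \<Longrightarrow> velocity J y t \<bullet> (G (y t) *v velocity J y t) \<noteq> 0"
begin

abbreviation "u \<equiv> velocity J y"
abbreviation "N t \<equiv> u t \<bullet> (G (y t) *v u t)"
text \<open>\<open>q\<close> and \<open>e\<close> are the unweighted counterparts of
  \<open>speed_density\<close> and \<open>weighted_velocity\<close>; all weights are carried by
  powers of the parallel density \<open>s\<close>.\<close>

definition q :: "real \<Rightarrow> real" where "q t = sqrt \<bar>N t\<bar>"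
definition e :: "real \<Rightarrow> real^'n" where "e t = (1 / q t) *\<^sub>R u t"
abbreviation "s t \<equiv> scale_density G (y t)"
abbreviation "D V t \<equiv> cov_vector S G J y 0 V t"
abbreviation "C t \<equiv> connv S G (u t) (y t)"

lemma y_S: "t \<in> J \<Longrightarrow> y t \<in> S" using y_in by auto

lemma smooth_u: "smooth_on J u"
  unfolding velocity_def by (rule smooth_on_velocity[OF rich_J smooth_y])

lemma dy: "t \<in> J \<Longrightarrow> (y has_vector_derivative u t) (at t within J)"
  unfolding velocity_def by (rule smooth_on_has_vector_derivative[OF smooth_y])

lemma smooth_comp_y: "smooth_on S f \<Longrightarrow> smooth_on J (\<lambda>t. f (y t))" for f :: "real^'n \<Rightarrow> 'c::real_normed_vector"
  by (rule smooth_on_compose[OF rich_J rich_S y_in smooth_y])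

lemma smooth_N: "smooth_on J N"
  by (intro smooth_on_inner smooth_on_matvec smooth_comp_y smooth_u smooth_G rich_J)

lemma q_pos: "t \<in> J \<Longrightarrow> q t > 0"
  using nonnull[of t] by (simp add: q_def)

lemma smooth_q: "smooth_on J q"
  unfolding q_def by (intro smooth_on_sqrt smooth_on_abs smooth_N rich_J) (use nonnull in auto)

lemma smooth_inverse_q: "smooth_on J (\<lambda>t. 1 / q t)"
  by (intro smooth_on_divide smooth_q smooth_on_const rich_J) (metis less_irrefl q_pos)

lemma smooth_e: "smooth_on J e"
  unfolding e_def by (intro smooth_on_scaleR smooth_inverse_q smooth_u rich_J)

lemma u_eq: "t \<in> J \<Longrightarrow> u t = q t *\<^sub>R e t"
  using q_pos[of t] by (simp add: e_def)

lemma ge: "e t \<bullet> (G (y t) *v e t) = sgn (N t)"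
proof -
  have "e t \<bullet> (G (y t) *v e t) = N t / (q t * q t)"
    by (simp add: e_def matrix_vector_mult_scaleR)
  then show ?thesis by (simp add: real_sgn_eq q_def)
qed

lemma dG_along: "t \<in> J \<Longrightarrow> ((\<lambda>t. G (y t)) has_vector_derivative transpose (C t) ** G (y t) + G (y t) ** C t) (at t within J)"
proof -
  assume t: "t \<in> J"
  have tC: "transpose (C t) = (\<Sum>a\<in>UNIV. u t $ a *\<^sub>R transpose (\<Gamma> a (y t)))"
    by (simp add: connv_def transpose_def vec_eq_iff)
  have "frechet_derivative G (at (y t) within S) (u t) = transpose (C t) ** G (y t) + G (y t) ** C t"
    unfolding frechet_linear[OF smooth_G y_S[OF t], of "u t"] frechet_axis_matrix[OF rich_S y_S[OF t] smooth_G]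
      dmat_G[OF y_S[OF t]]
    unfolding tC unfolding connv_def
    by (simp add: matrix_sum_distribs matrix_scaleR_distribs scaleR_add_right sum.distrib)
  then show ?thesis using curve_chain[OF smooth_G y_in t dy[OF t]] by simp
qed

lemma ds: "t \<in> J \<Longrightarrow> (s has_real_derivative - (1 / real CARD('n) * trace (C t)) * s t) (at t within J)"
proof -
  assume t: "t \<in> J"
  have "frechet_derivative (scale_density G) (at (y t) within S) (u t) = (\<Sum>a\<in>UNIV. u t $ a * partial S a (scale_density G) (y t))"
    unfolding frechet_linear[OF smooth_scale_density y_S[OF t], of "u t"] by (simp add: partial_def)
  also have "\<dots> = - (1 / real CARD('n) * trace (C t)) * s t"
    unfolding partial_scale_density[OF y_S[OF t]] connv_def trace_def
    by (simp add: sum_distrib_left sum_distrib_right sum_negf mult_ac) (rule sum.swap)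
  finally show ?thesis
    using curve_chain[OF smooth_scale_density y_in t dy[OF t]] by (simp add: has_real_derivative_iff_has_vector_derivative)
qed

lemma s_pos: "t \<in> J \<Longrightarrow> s t > 0" by (rule scale_density_pos[OF y_S])

lemma ds_inverse:
  "t \<in> J \<Longrightarrow> ((\<lambda>t. 1 / s t) has_real_derivative - ((- 1) / real CARD('n) * trace (C t)) * (1 / s t)) (at t within J)"
  "t \<in> J \<Longrightarrow> ((\<lambda>t. 1 / (s t)\<^sup>2) has_real_derivative - ((- 2) / real CARD('n) * trace (C t)) * (1 / (s t)\<^sup>2)) (at t within J)"
  using s_pos[of t]
  by (auto intro!: derivative_eq_intros ds simp: power2_eq_square field_simps)

lemma conf_square_eq: "t \<in> J \<Longrightarrow> conf_square G J y t = (s t)\<^sup>2 * N t"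
  by (simp add: conf_square_def conf_metric_def scaleR_matrix_vector_mult)

lemma speed_density_eq: "t \<in> J \<Longrightarrow> speed_density G J y t = s t * q t"
  using s_pos[of t] by (simp add: speed_density_def conf_square_eq abs_mult real_sqrt_mult q_def)

lemma weighted_velocity_eq: "t \<in> J \<Longrightarrow> weighted_velocity G J y t = (1 / s t) *\<^sub>R e t"
  by (simp add: weighted_velocity_def speed_density_eq e_def)

lemma smooth_D: "smooth_on J V \<Longrightarrow> smooth_on J (\<lambda>t. D V t)"
proof -
  assume V: "smooth_on J V"
  have "smooth_on J C"
    unfolding connv_def
    by (intro smooth_on_sum smooth_on_scaleR smooth_on_nth smooth_u smooth_comp_y smooth_\<Gamma> rich_J)
  then show ?thesis
    unfolding cov_vector_0
    by (intro smooth_on_add smooth_on_matvec V rich_J smooth_on_velocity)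
qed

lemma weighted_acceleration_eq:
  "t \<in> J \<Longrightarrow> weighted_acceleration S G J y t = (1 / (s t)\<^sup>2) *\<^sub>R ((1 / q t) *\<^sub>R D e t)"
proof -
  assume t: "t \<in> J"
  have "cov_vector S G J y (- 1) (weighted_velocity G J y) t = cov_vector S G J y (- 1) (\<lambda>t. (1 / s t) *\<^sub>R e t) t"
    by (rule cov_vector_cong[OF t weighted_velocity_eq])
  also have "\<dots> = (1 / s t) *\<^sub>R D e t"
    by (rule unweight[OF rich_J t ds_inverse(1)[OF t] smooth_on_has_vector_derivative[OF smooth_e t]])
  finally show ?thesis
    by (simp add: weighted_acceleration_def speed_density_eq[OF t] power2_eq_square)
qed

text \<open>Velocity carries \<open>s\<close> to the power -1, acceleration -2, and the remaining
  factors complete both sides to the power -4. Since \<open>s\<close> is parallel and positive, this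
  common factor can be cancelled.\<close>

lemma conformal_circle_eq_unweighted:
  assumes t: "t \<in> J"
  shows "conformal_circle_eq S G J y t \<longleftrightarrow>
     skew_pair ((1 / q t) *\<^sub>R D (\<lambda>t. (1 / q t) *\<^sub>R D e t) t) (e t)
     = sgn (N t) *\<^sub>R skew_pair (H (y t) *v (e t v* schouten S G (y t))) (e t)"
proof -
  have sm: "smooth_on J (\<lambda>t. (1 / q t) *\<^sub>R D e t)"
    by (intro smooth_on_scaleR smooth_inverse_q smooth_D smooth_e rich_J)
  have "cov_vector S G J y (- 2) (weighted_acceleration S G J y) t
      = cov_vector S G J y (- 2) (\<lambda>t. (1 / (s t)\<^sup>2) *\<^sub>R ((1 / q t) *\<^sub>R D e t)) t"
    by (rule cov_vector_cong[OF t weighted_acceleration_eq])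
  also have "\<dots> = (1 / (s t)\<^sup>2) *\<^sub>R D (\<lambda>t. (1 / q t) *\<^sub>R D e t) t"
    by (rule unweight[OF rich_J t ds_inverse(2)[OF t] smooth_on_has_vector_derivative[OF sm t]])
  finally have L: "skew_pair ((1 / speed_density G J y t) *\<^sub>R cov_vector S G J y (- 2) (weighted_acceleration S G J y) t) (weighted_velocity G J y t)
     = (1 / (s t)^4) *\<^sub>R skew_pair ((1 / q t) *\<^sub>R D (\<lambda>t. (1 / q t) *\<^sub>R D e t) t) (e t)"
    unfolding weighted_velocity_eq[OF t] speed_density_eq[OF t]
    by (simp add: skew_pair_scaleR_right skew_pair_scaleR_left power2_eq_square power4_eq_xxxx mult_ac)
  have R: "skew_pair (conf_metric_inv G (y t) *v (weighted_velocity G J y t v* schouten S G (y t))) (weighted_velocity G J y t)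
    = (1 / (s t)^4) *\<^sub>R skew_pair (H (y t) *v (e t v* schouten S G (y t))) (e t)"
    unfolding weighted_velocity_eq[OF t] conf_metric_inv_eq[OF y_S[OF t]]
    by (simp add: scaleR_vector_matrix_mult scaleR_matrix_vector_mult matrix_vector_mult_scaleR skew_pair_scaleR
        power2_eq_square power4_eq_xxxx mult_ac)
  have sg: "sgn (conf_square G J y t) = sgn (N t)"
    using s_pos[OF t] by (simp add: conf_square_eq[OF t] sgn_mult)
  have "(1 / (s t)^4) \<noteq> 0" using s_pos[OF t] by simp
  then show ?thesis
    unfolding conformal_circle_eq_def L R sg
    unfolding real_vector.scale_left_commute[of "sgn (N t)"] real_vector.scale_cancel_left by blast
qed

end

lemma matvec_has_vector_derivative:
  fixes A :: "real \<Rightarrow> real^'n::finite^'n"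
  assumes "(A has_vector_derivative A') (at t within J)" "(V has_vector_derivative V') (at t within J)"
  shows "((\<lambda>t. A t *v V t) has_vector_derivative A t *v V' + A' *v V t) (at t within J)"
proof -
  have "bounded_bilinear ((*v) :: real^'n^'n \<Rightarrow> real^'n \<Rightarrow> real^'n)"
    unfolding bilinear_conv_bounded_bilinear[symmetric] bilinear_def
    by (auto intro!: linearI simp: matrix_vector_mult_add_rdistrib matrix_vector_right_distrib
        scaleR_matrix_vector_mult matrix_vector_mult_scaleR)
  from bounded_bilinear.has_vector_derivative[OF this assms] show ?thesis .
qed

context curve_in_metric
begin

lemma D_eqI:
  assumes "t \<in> J" "(V has_vector_derivative V') (at t within J)"
  shows "D V t = V' + C t *v V t"
  unfolding cov_vector_0 by (simp add: rich_vector_derivative[OF rich_J assms])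

lemma D_works:
  assumes "t \<in> J" "smooth_on J V"
  shows "(V has_vector_derivative D V t - C t *v V t) (at t within J)"
  using smooth_on_has_vector_derivative[OF assms(2,1)] by (simp add: cov_vector_0)

lemma D_scaleR:
  assumes "t \<in> J" "smooth_on J V" "(f has_real_derivative f') (at t within J)"
  shows "D (\<lambda>t. f t *\<^sub>R V t) t = f' *\<^sub>R V t + f t *\<^sub>R D V t"
  using D_eqI[OF assms(1) has_vector_derivative_scaleR[OF assms(3) D_works[OF assms(1,2)]]]
  by (simp add: matrix_vector_mult_scaleR scaleR_diff_right)

lemma D_diff:
  assumes "t \<in> J" "smooth_on J V" "smooth_on J W"
  shows "D (\<lambda>t. V t - W t) t = D V t - D W t"
  using D_eqI[OF assms(1) has_vector_derivative_diff[OF D_works[OF assms(1,2)] D_works[OF assms(1,3)]]]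
  by (simp add: matrix_vector_mult_diff_distrib)

lemma gue: "t \<in> J \<Longrightarrow> u t \<bullet> (G (y t) *v e t) = q t * sgn (N t)"
proof -
  assume t: "t \<in> J"
  have "u t \<bullet> w = q t * (e t \<bullet> w)" for w
    using q_pos[OF t] by (simp add: e_def)
  then have "u t \<bullet> (G (y t) *v e t) = q t * (e t \<bullet> (G (y t) *v e t))" .
  then show ?thesis by (simp only: ge)
qed

text \<open>The derivative of the metric along the curve supplies the connection terms that turn the
  derivative of \<open>V\<close> into \<open>D V\<close>.\<close>

lemma D_metric:
  assumes t: "t \<in> J" and V: "smooth_on J V"
  shows "((\<lambda>t. V t \<bullet> (G (y t) *v V t)) has_real_derivative 2 * (D V t \<bullet> (G (y t) *v V t))) (at t within J)"
proof -
  let ?G = "G (y t)" and ?dG = "transpose (C t) ** G (y t) + G (y t) ** C t"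
  let ?V' = "D V t - C t *v V t"
  have 1: "((\<lambda>t. G (y t) *v V t) has_vector_derivative ?G *v ?V' + ?dG *v V t) (at t within J)"
    by (rule matvec_has_vector_derivative[OF dG_along[OF t] D_works[OF t V]])
  have 2: "((\<lambda>t. V t \<bullet> (G (y t) *v V t)) has_vector_derivative
      V t \<bullet> (?G *v ?V' + ?dG *v V t) + ?V' \<bullet> (?G *v V t)) (at t within J)"
    by (rule bounded_bilinear.has_vector_derivative[OF bounded_bilinear_inner D_works[OF t V] 1])
  have sym: "a \<bullet> (?G *v b) = b \<bullet> (?G *v a)" for a b
    using dot_lmul_matrix[of a ?G b] vec_sym_matrix[OF sym_G[OF y_S[OF t]], of a] by (simp add: inner_commute)
  have "V t \<bullet> (?dG *v V t) = 2 * ((C t *v V t) \<bullet> (?G *v V t))"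
  proof -
    have "V t \<bullet> (transpose (C t) *v w) = (C t *v V t) \<bullet> w" for w
      by (metis dot_lmul_matrix inner_commute transpose_matrix_vector transpose_transpose vector_transpose_matrix)
    then have "V t \<bullet> (transpose (C t) *v (?G *v V t)) = (C t *v V t) \<bullet> (?G *v V t)" .
    moreover have "V t \<bullet> (?G *v (C t *v V t)) = (C t *v V t) \<bullet> (?G *v V t)" by (rule sym)
    ultimately show ?thesis
      by (simp add: matrix_vector_mult_add_rdistrib inner_add_right matrix_vector_mul_assoc[symmetric])
  qed
  moreover have "V t \<bullet> (?G *v ?V') = ?V' \<bullet> (?G *v V t)" by (rule sym)
  ultimately have "V t \<bullet> (?G *v ?V' + ?dG *v V t) + ?V' \<bullet> (?G *v V t) = 2 * (D V t \<bullet> (G (y t) *v V t))"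
    by (simp add: inner_add_right inner_diff_left)
  then show ?thesis using 2 by (simp add: has_real_derivative_iff_has_vector_derivative)
qed

end

locale geodesic_in_metric = curve_in_metric S G J y for S :: "(real^'n::finite) set" and G J y +
  assumes geo: "\<And>t. t \<in> J \<Longrightarrow> \<exists>k. cov_vector S G J y 0 (velocity J y) t = k *\<^sub>R velocity J y t"
begin

text \<open>The geodesic condition makes \<open>D e t\<close> a multiple of the velocity. As
  \<open>e\<close> has locally constant squared length, \<open>D e t\<close> is also orthogonal to
  \<open>e t\<close>, and a non-null direction leaves only zero.\<close>

lemma D_e: assumes t: "t \<in> J" shows "D e t = 0"
proof -
  have dq: "((\<lambda>t. 1 / q t) has_real_derivative vector_derivative (\<lambda>t. 1 / q t) (at t within J)) (at t within J)"
    using smooth_on_has_vector_derivative[OF smooth_inverse_q t]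
    by (simp add: has_real_derivative_iff_has_vector_derivative)
  obtain k where k: "D u t = k *\<^sub>R u t" using geo[OF t] by blast
  have "D e t = (vector_derivative (\<lambda>t. 1 / q t) (at t within J) + 1 / q t * k) *\<^sub>R u t"
    unfolding e_def D_scaleR[OF t smooth_u dq] k by (simp add: scaleR_add_left)
  then obtain c where c: "D e t = c *\<^sub>R u t" by blast
  have "((\<lambda>t. e t \<bullet> (G (y t) *v e t)) has_real_derivative 2 * (D e t \<bullet> (G (y t) *v e t))) (at t within J)"
    by (rule D_metric[OF t smooth_e])
  moreover have "((\<lambda>t. e t \<bullet> (G (y t) *v e t)) has_real_derivative 0) (at t within J)"
    unfolding ge has_field_derivative_def
    using has_derivative_sgn[OF smooth_N t nonnull[OF t]] by (auto elim!: has_derivative_eq_rhs)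
  ultimately have "(*) (2 * (D e t \<bullet> (G (y t) *v e t))) = (*) 0"
    unfolding has_field_derivative_def by (rule rich_unique[OF rich_J t])
  from fun_cong[OF this, of 1] have "D e t \<bullet> (G (y t) *v e t) = 0" by simp
  moreover have "D e t \<bullet> (G (y t) *v e t) = c * q t * sgn (N t)"
    unfolding c by (simp only: inner_scaleR_left gue[OF t] mult.assoc)
  ultimately have "c = 0" using nonnull[OF t] q_pos[OF t] by (simp add: sgn_zero_iff)
  then show ?thesis using c by simp
qed

end

section \<open>Geodesics and circles under conformal rescaling\<close>

locale curve_rescaled = curve_in_metric S G J y + conformal_change S G \<phi>
  for S :: "(real^'n::finite) set" and G J y \<phi>
begin

lemma curve': "curve_in_metric S G' J y"
proof -
  interpret m': metric_on S G' by (rule metric')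
  show ?thesis
  proof
    show "velocity J y t \<bullet> (G' (y t) *v velocity J y t) \<noteq> 0" if "t \<in> J" for t
      using nonnull[OF that] \<phi>_pos[OF y_S[OF that]] by (simp add: scaleR_matrix_vector_mult)
  qed (use rich_J smooth_y y_in in auto)
qed

sublocale c': curve_in_metric S G' J y by (rule curve')

abbreviation "\<psi> t \<equiv> 1 / sqrt (\<phi> (y t))"
abbreviation "Uy t \<equiv> U (y t)"
abbreviation "Vy t \<equiv> V (y t)"

lemma \<psi>_pos: "t \<in> J \<Longrightarrow> \<psi> t > 0" using \<phi>_pos[OF y_S] by simp

lemma \<psi>_sq: "t \<in> J \<Longrightarrow> (\<psi> t)\<^sup>2 = 1 / \<phi> (y t)" using \<phi>_pos[OF y_S, of t] by (simp add: power_divide)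

lemma N': "c'.N t = \<phi> (y t) * N t"
  by (simp add: scaleR_matrix_vector_mult)

lemma q': "t \<in> J \<Longrightarrow> 1 / c'.q t = \<psi> t / q t"
  unfolding q_def c'.q_def N' using \<phi>_pos[OF y_S, of t] by (simp add: abs_mult real_sqrt_mult)

lemma e': "t \<in> J \<Longrightarrow> c'.e t = \<psi> t *\<^sub>R e t"
  unfolding c'.e_def e_def q' by simp

lemma d\<psi>: assumes t: "t \<in> J" shows "(\<psi> has_real_derivative - (Uy t \<bullet> u t) * \<psi> t) (at t within J)"
proof -
  have pos: "\<phi> (y t) > 0" by (rule \<phi>_pos[OF y_S[OF t]])
  have "frechet_derivative \<phi> (at (y t) within S) (u t) = 2 * \<phi> (y t) * (Uy t \<bullet> u t)"
    unfolding frechet_linear[OF smooth_\<phi> y_S[OF t], of "u t"] using partial_\<phi>[OF y_S[OF t]]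
    by (simp add: partial_def inner_vec_def sum_distrib_left mult_ac)
  then have "((\<lambda>t. \<phi> (y t)) has_real_derivative 2 * \<phi> (y t) * (Uy t \<bullet> u t)) (at t within J)"
    using curve_chain[OF smooth_\<phi> y_in t dy[OF t]] by (simp add: has_real_derivative_iff_has_vector_derivative)
  then show ?thesis using pos
    by (auto intro!: derivative_eq_intros simp: field_simps)
qed


text \<open>The three additional terms are those of the difference tensor \<open>B\<close>,
  contracted with the velocity and \<open>W t\<close>.\<close>

lemma cov_rescaled:
  assumes t: "t \<in> J"
  shows "cov_vector S G' J y 0 W t = D W t + (Uy t \<bullet> W t) *\<^sub>R u t + (Uy t \<bullet> u t) *\<^sub>R W t - (u t \<bullet> (G (y t) *v W t)) *\<^sub>R Vy t"
proof -
  have "connv S G' (u t) (y t) *v W t = C t *v W t + (\<Sum>a\<in>UNIV. u t $ a *\<^sub>R (B a (y t) *v W t))"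
    unfolding connv_def conn_conformal[OF y_S[OF t]]
    by (simp add: sum_matrix_vector_mult scaleR_matrix_vector_mult matrix_vector_mult_add_rdistrib scaleR_add_right sum.distrib)
  moreover have "(\<Sum>a\<in>UNIV. u t $ a *\<^sub>R (B a (y t) *v W t))
      = (Uy t \<bullet> W t) *\<^sub>R u t + (Uy t \<bullet> u t) *\<^sub>R W t - (u t \<bullet> (G (y t) *v W t)) *\<^sub>R Vy t"
  proof -
    have B: "(B a (y t) *v W t) $ k = (if k = a then Uy t \<bullet> W t else 0) + Uy t $ a * W t $ k - (G (y t) *v W t) $ a * Vy t $ k" for a k
    proof -
      have "(B a (y t) *v W t) $ k = (\<Sum>j\<in>UNIV. (if k = a then Uy t $ j else 0) * W t $ j)
        + (\<Sum>j\<in>UNIV. (if k = j then Uy t $ a else 0) * W t $ j) - (\<Sum>j\<in>UNIV. G (y t) $ a $ j * W t $ j) * Vy t $ k"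
        proof -
        have "(B a (y t) *v W t) $ k = (\<Sum>j\<in>UNIV. B a (y t) $ k $ j * W t $ j)"
          by (simp add: matrix_vector_mult_def)
        then show ?thesis
          by (simp add: B_def sum_distrib_left algebra_simps sum.distrib sum_subtractf)
      qed
      then show ?thesis
        by (simp only: sum_delta_mult) (simp add: inner_vec_def matrix_vector_mult_def[of "G (y t)"])
    qed
    show ?thesis
      unfolding vec_eq_iff
    proof
      fix k
      have "(\<Sum>a\<in>UNIV. u t $ a *\<^sub>R (B a (y t) *v W t)) $ k
         = (\<Sum>a\<in>UNIV. u t $ a * (if k = a then Uy t \<bullet> W t else 0)) + (\<Sum>a\<in>UNIV. u t $ a * Uy t $ a) * W t $ k
           - (\<Sum>a\<in>UNIV. u t $ a * (G (y t) *v W t) $ a) * Vy t $ k"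
        by (simp add: B distrib_left right_diff_distrib sum.distrib sum_subtractf sum_distrib_left mult_ac)
      then show "(\<Sum>a\<in>UNIV. u t $ a *\<^sub>R (B a (y t) *v W t)) $ k
         = ((Uy t \<bullet> W t) *\<^sub>R u t + (Uy t \<bullet> u t) *\<^sub>R W t - (u t \<bullet> (G (y t) *v W t)) *\<^sub>R Vy t) $ k"
        by (simp only: sum_delta_mult) (simp add: inner_vec_def mult_ac)
    qed
  qed
  ultimately show ?thesis unfolding cov_vector_0 by (simp add: algebra_simps)
qed

lemma GVy: "t \<in> J \<Longrightarrow> G (y t) *v Vy t = Uy t"
  using GH[OF y_S, of t] by (simp add: matrix_vector_mul_assoc)

text \<open>Raising an index commutes with covariant differentiation. To avoid differentiating the
  inverse metric, the relation \<open>G V = U\<close> is differentiated and solved for the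
  derivative of \<open>V\<close>.\<close>

lemma D_Vy:
  assumes t: "t \<in> J"
  shows "D Vy t = H (y t) *v (u t v* nabla_form S G U (y t))"
proof -
  have x: "y t \<in> S" by (rule y_S[OF t])
  define dV where "dV = (\<lambda>a. \<chi> k. partial S a (\<lambda>z. V z $ k) (y t))"
  have "frechet_derivative (\<lambda>z. V z) (at (y t) within S) (u t) = (\<Sum>a\<in>UNIV. u t $ a *\<^sub>R dV a)"
    unfolding frechet_linear[OF smooth_V x, of "u t"] dV_def
    by (simp add: partial_nth[OF rich_S x smooth_V])
  then have "(Vy has_vector_derivative (\<Sum>a\<in>UNIV. u t $ a *\<^sub>R dV a)) (at t within J)"
    using curve_chain[OF smooth_V y_in t dy[OF t]] by simp
  then have DV: "D Vy t = (\<Sum>a\<in>UNIV. u t $ a *\<^sub>R (dV a + \<Gamma> a (y t) *v Vy t))"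
    using D_eqI[OF t] by (simp add: connv_def sum_matrix_vector_mult scaleR_matrix_vector_mult scaleR_add_right sum.distrib)
  have "G (y t) *v (dV a + \<Gamma> a (y t) *v Vy t) = nabla_form S G U (y t) $ a" for a
  proof -
    have "(G (y t) *v dV a) $ j + (dmat S a G (y t) *v Vy t) $ j = partial S a (\<lambda>z. U z $ j) (y t)" for j
    proof -
      have "partial S a (\<lambda>z. U z $ j) (y t) = partial S a (\<lambda>z. \<Sum>k\<in>UNIV. G z $ j $ k * V z $ k) (y t)"
        by (rule partial_cong[OF x]) (simp add: GV)
      also have "\<dots> = (\<Sum>k\<in>UNIV. partial S a (\<lambda>z. G z $ j $ k) (y t) * Vy t $ k + G (y t) $ j $ k * dV a $ k)"
        by (simp add: partial_sum[OF rich_S x] partial_mult[OF rich_S x] smooth_on_mult[OF rich_S] smooth_on_entry[OF rich_S smooth_G]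
            smooth_on_nth[OF rich_S smooth_V] dV_def)
      finally show ?thesis
        unfolding matrix_vector_mult_def vec_lambda_beta by (simp add: dmat_def sum.distrib)
    qed
    moreover have "dmat S a G (y t) *v Vy t = transpose (\<Gamma> a (y t)) *v Uy t + G (y t) *v (\<Gamma> a (y t) *v Vy t)"
      unfolding dmat_G[OF x] by (simp add: matrix_vector_mult_add_rdistrib matrix_vector_mul_assoc[symmetric] GVy[OF t])
    moreover have "(transpose (\<Gamma> a (y t)) *v Uy t) $ j = (\<Sum>k\<in>UNIV. christoffel S G (y t) k a j * Uy t $ k)" for j
      by (simp add: matrix_vector_mult_def transpose_def conn_def)
    ultimately show ?thesis
      by (simp add: vec_eq_iff nabla_form_def matrix_vector_right_distrib algebra_simps)
  qed
  then have "G (y t) *v D Vy t = u t v* nabla_form S G U (y t)"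
    unfolding DV by (simp add: linear_sum[OF matrix_vector_mul_linear] matrix_vector_mult_scaleR)
      (simp add: vec_eq_iff vector_matrix_mult_def mult.commute)
  then have "H (y t) *v (G (y t) *v D Vy t) = H (y t) *v (u t v* nabla_form S G U (y t))" by simp
  then show ?thesis by (simp only: matrix_vector_mul_assoc GH[OF x] matrix_vector_mul_lid)
qed

text \<open>For the velocity itself the difference tensor gives a multiple of the velocity, which is
  absorbed in \<open>k\<close>, and the term \<open>- N t\<close> times \<open>Vy t\<close>.\<close>

lemma geodesic_rescaled_iff:
  assumes t: "t \<in> J"
  shows "(\<exists>k. c'.D u t = k *\<^sub>R u t) \<longleftrightarrow> (\<exists>k. D u t - N t *\<^sub>R Vy t = k *\<^sub>R u t)"
proof -
  have eq: "c'.D u t = (D u t - N t *\<^sub>R Vy t) + (2 * (Uy t \<bullet> u t)) *\<^sub>R u t"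
    unfolding cov_rescaled[OF t] by (simp add: vec_eq_iff algebra_simps)
  have shift: "(\<exists>k. x + c *\<^sub>R w = k *\<^sub>R w) \<longleftrightarrow> (\<exists>k. x = k *\<^sub>R w)" for x w :: "real^'n" and c
  proof
    assume "\<exists>k. x + c *\<^sub>R w = k *\<^sub>R w"
    then obtain k where "x + c *\<^sub>R w = k *\<^sub>R w" ..
    then have "x = (k - c) *\<^sub>R w" by (simp add: scaleR_diff_left eq_diff_eq)
    then show "\<exists>k. x = k *\<^sub>R w" ..
  next
    assume "\<exists>k. x = k *\<^sub>R w"
    then obtain k where "x = k *\<^sub>R w" ..
    then have "x + c *\<^sub>R w = (k + c) *\<^sub>R w" by (simp add: scaleR_add_left)
    then show "\<exists>k. x + c *\<^sub>R w = k *\<^sub>R w" ..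
  qed
  show ?thesis unfolding eq by (rule shift)
qed

end

locale geodesic_rescaled = curve_rescaled S G J y \<phi> + geodesic_in_metric S G J y
  for S :: "(real^'n::finite) set" and G J y \<phi>
begin

text \<open>Along a geodesic of \<open>G\<close> the acceleration with respect to \<open>G'\<close>
  consists of gradient terms of \<phi> only. Its derivative, skewed with \<open>e\<close>, is the
  same expression in \<open>U\<close> and its covariant derivative that
  \<open>ricci_conformal\<close> contributes to the Schouten side, so just the Ricci tensor of
  \<open>G\<close> is left.\<close>

theorem conformal_circle_iff:
  assumes t: "t \<in> J" and n: "CARD('n) \<ge> 3"
  shows "conformal_circle_eq S G' J y t \<longleftrightarrow> skew_pair (H (y t) *v (e t v* ricci S G (y t))) (e t) = 0"
proof -
  let ?n2 = "real CARD('n) - 2"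
  define \<epsilon> where "\<epsilon> = (\<lambda>t. sgn (N t))"
  \<comment> \<open>Up to the sign \<open>\<epsilon> t\<close> the part of the gradient
    \<open>Vy t\<close> orthogonal to \<open>e t\<close>. The acceleration in the scale
    \<open>G'\<close> is \<open>W\<close>, this vector times the square of
    \<open>\<psi> t\<close>.\<close>
  define X where "X = (\<lambda>t. (Uy t \<bullet> e t) *\<^sub>R e t - \<epsilon> t *\<^sub>R Vy t)"
  define W where "W = (\<lambda>t. (\<psi> t)\<^sup>2 *\<^sub>R X t)"
  have smUe: "smooth_on J (\<lambda>t. Uy t \<bullet> e t)" by (intro smooth_on_inner smooth_comp_y smooth_U smooth_e rich_J)
  have sm\<epsilon>: "smooth_on J \<epsilon>" unfolding \<epsilon>_def by (intro smooth_on_sgn smooth_N rich_J nonnull)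
  have smV: "smooth_on J Vy" by (rule smooth_comp_y[OF smooth_V])
  have smX: "smooth_on J X" unfolding X_def by (intro smooth_on_diff smooth_on_scaleR smUe sm\<epsilon> smV smooth_e rich_J)
  have gUe: "u t \<bullet> (G (y t) *v e t) = q t * \<epsilon> t" if "t \<in> J" for t
    unfolding \<epsilon>_def by (rule gue[OF that])
  have first: "(1 / c'.q t) *\<^sub>R c'.D c'.e t = W t" if t: "t \<in> J" for t
  proof -
    have "c'.D c'.e t = c'.D (\<lambda>t. \<psi> t *\<^sub>R e t) t" by (rule cov_vector_cong[OF t e'])
    also have "\<dots> = (- (Uy t \<bullet> u t) * \<psi> t) *\<^sub>R e t + (Uy t \<bullet> (\<psi> t *\<^sub>R e t)) *\<^sub>R u t + (Uy t \<bullet> u t) *\<^sub>R (\<psi> t *\<^sub>R e t)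
       - (u t \<bullet> (G (y t) *v (\<psi> t *\<^sub>R e t))) *\<^sub>R Vy t"
      unfolding cov_rescaled[OF t] D_scaleR[OF t smooth_e d\<psi>[OF t]] D_e[OF t] by simp
    also have "\<dots> = \<psi> t *\<^sub>R ((Uy t \<bullet> e t) *\<^sub>R u t - (q t * \<epsilon> t) *\<^sub>R Vy t)"
      by (simp add: matrix_vector_mult_scaleR gUe[OF t] scaleR_diff_right mult_ac)
    also have "\<dots> = (\<psi> t * q t) *\<^sub>R X t"
      unfolding X_def u_eq[OF t] by (simp add: scaleR_diff_right mult_ac)
    finally show ?thesis
      unfolding q'[OF t] W_def using q_pos[OF t] by (simp add: power2_eq_square)
  qed
  have Dfirst: "c'.D (\<lambda>t. (1 / c'.q t) *\<^sub>R c'.D c'.e t) t = c'.D W t"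
    by (rule cov_vector_cong[OF t first])
  obtain c0 where c0: "((\<lambda>t. Uy t \<bullet> e t) has_real_derivative c0) (at t within J)"
    using smooth_on_has_vector_derivative[OF smUe t] by (auto simp: has_real_derivative_iff_has_vector_derivative)
  have d\<epsilon>: "(\<epsilon> has_real_derivative 0) (at t within J)"
    unfolding \<epsilon>_def has_field_derivative_def
    using has_derivative_sgn[OF smooth_N t nonnull[OF t]] by (auto elim!: has_derivative_eq_rhs)
  have DX: "D X t = c0 *\<^sub>R e t - \<epsilon> t *\<^sub>R D Vy t"
  proof -
    have "D X t = D (\<lambda>t. (Uy t \<bullet> e t) *\<^sub>R e t) t - D (\<lambda>t. \<epsilon> t *\<^sub>R Vy t) t"
      unfolding X_def by (rule D_diff[OF t]) (intro smooth_on_scaleR smUe sm\<epsilon> smV smooth_e rich_J)+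
    then show ?thesis
      unfolding D_scaleR[OF t smooth_e c0] D_scaleR[OF t smV d\<epsilon>] D_e[OF t] by simp
  qed
  have d\<psi>2: "((\<lambda>t. (\<psi> t)\<^sup>2) has_real_derivative - 2 * (Uy t \<bullet> u t) * (\<psi> t)\<^sup>2) (at t within J)"
    using DERIV_power[OF d\<psi>[OF t], of 2] by (simp add: power2_eq_square mult_ac)
  have DW: "D W t = (- 2 * (Uy t \<bullet> u t) * (\<psi> t)\<^sup>2) *\<^sub>R X t + (\<psi> t)\<^sup>2 *\<^sub>R (c0 *\<^sub>R e t - \<epsilon> t *\<^sub>R D Vy t)"
    unfolding W_def D_scaleR[OF t smX d\<psi>2] DX ..
  \<comment> \<open>The acceleration is orthogonal to the velocity, which removes the gradient term
    when \<open>cov_rescaled\<close> is applied to \<open>W\<close>.\<close>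
  have GX: "u t \<bullet> (G (y t) *v W t) = 0"
  proof -
    have "u t \<bullet> (G (y t) *v Vy t) = q t * (Uy t \<bullet> e t)"
      unfolding GVy[OF t] u_eq[OF t] by (simp add: inner_commute)
    then show ?thesis
      unfolding W_def X_def
      by (simp add: matrix_vector_mult_diff_distrib matrix_vector_mult_scaleR inner_diff_right gUe[OF t])
  qed
  have UW: "(Uy t \<bullet> W t) *\<^sub>R u t = (q t * (Uy t \<bullet> W t)) *\<^sub>R e t"
    unfolding u_eq[OF t] by simp
  have "c'.D W t = ((\<psi> t)\<^sup>2 * c0 + q t * (Uy t \<bullet> W t) - (Uy t \<bullet> u t) * (\<psi> t)\<^sup>2 * (Uy t \<bullet> e t)) *\<^sub>R e t
      + ((\<psi> t)\<^sup>2 * \<epsilon> t) *\<^sub>R ((Uy t \<bullet> u t) *\<^sub>R Vy t - D Vy t)"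
    unfolding cov_rescaled[OF t] DW GX UW unfolding W_def X_def
    by (simp add: vec_eq_iff algebra_simps)
  then have skW: "skew_pair (c'.D W t) (e t) = ((\<psi> t)\<^sup>2 * \<epsilon> t) *\<^sub>R ((Uy t \<bullet> u t) *\<^sub>R skew_pair (Vy t) (e t) - skew_pair (D Vy t) (e t))"
    by (simp only: skew_pair_add skew_pair_self skew_pair_scaleR_left skew_pair_diff add_0_left)
  define K where "K = skew_pair (H (y t) *v (e t v* nabla_form S G U (y t))) (e t)"
  have Uu: "Uy t \<bullet> u t = q t * (Uy t \<bullet> e t)"
    unfolding u_eq[OF t] by simp
  have "D Vy t = q t *\<^sub>R (H (y t) *v (e t v* nabla_form S G U (y t)))"
    unfolding D_Vy[OF t] u_eq[OF t] by (simp only: scaleR_vector_matrix_mult matrix_vector_mult_scaleR)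
  then have skDV: "skew_pair (D Vy t) (e t) = q t *\<^sub>R K"
    by (simp only: skew_pair_scaleR_left K_def)
  have L: "skew_pair ((1 / c'.q t) *\<^sub>R c'.D (\<lambda>t. (1 / c'.q t) *\<^sub>R c'.D c'.e t) t) (c'.e t)
     = ((\<psi> t)^4 * \<epsilon> t) *\<^sub>R ((Uy t \<bullet> e t) *\<^sub>R skew_pair (Vy t) (e t) - K)"
  proof -
    have "skew_pair ((1 / c'.q t) *\<^sub>R c'.D (\<lambda>t. (1 / c'.q t) *\<^sub>R c'.D c'.e t) t) (c'.e t)
      = (\<psi> t / q t * \<psi> t) *\<^sub>R skew_pair (c'.D W t) (e t)"
      unfolding Dfirst q'[OF t] e'[OF t] skew_pair_scaleR ..
    also have "\<dots> = (\<psi> t / q t * \<psi> t * ((\<psi> t)\<^sup>2 * \<epsilon> t) * q t) *\<^sub>R ((Uy t \<bullet> e t) *\<^sub>R skew_pair (Vy t) (e t) - K)"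
      unfolding skW skDV Uu by (simp add: scaleR_diff_right mult_ac)
    also have "\<psi> t / q t * \<psi> t * ((\<psi> t)\<^sup>2 * \<epsilon> t) * q t = (\<psi> t)^4 * \<epsilon> t"
    proof -
      have p4: "p / r * p * (p\<^sup>2 * s) * r = p ^ 4 * s" if "r \<noteq> 0" for p r s :: real
        using that by (simp add: power2_eq_square power4_eq_xxxx)
      show ?thesis by (rule p4) (use q_pos[OF t] in simp)
    qed
    finally show ?thesis .
  qed
  obtain \<mu> where \<mu>: "ricci S G' (y t) = ricci S G (y t)
     - ?n2 *\<^sub>R (nabla_form S G U (y t) - (\<chi> i j. Uy t $ i * Uy t $ j)) + \<mu> *\<^sub>R G (y t)"
    using ricci_conformal[OF y_S[OF t]] by blast
  have eU: "e t v* (\<chi> i j. Uy t $ i * Uy t $ j) = (Uy t \<bullet> e t) *\<^sub>R Uy t"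
    by (simp add: vec_eq_iff vector_matrix_mult_def inner_vec_def sum_distrib_left sum_distrib_right mult_ac)
  have vadd: "w v* (A + B) = w v* A + w v* B" "w v* (A - B) = w v* A - w v* B" "w v* (c *\<^sub>R A) = c *\<^sub>R (w v* A)"
    for w :: "real^'n" and A B :: "real^'n^'n" and c
    by (simp_all add: vec_eq_iff vector_matrix_mult_def algebra_simps sum.distrib sum_subtractf sum_distrib_left)
  have "H (y t) *v (e t v* ricci S G' (y t)) = H (y t) *v (e t v* ricci S G (y t))
     - ?n2 *\<^sub>R (H (y t) *v (e t v* nabla_form S G U (y t)) - (Uy t \<bullet> e t) *\<^sub>R Vy t) + \<mu> *\<^sub>R e t"
    unfolding \<mu> vadd eU
    using vec_sym_matrix[OF sym_G[OF y_S[OF t]], of "e t"] GH[OF y_S[OF t]]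
    by (simp add: matrix_vector_right_distrib matrix_vector_mult_diff_distrib matrix_vector_mult_scaleR matrix_vector_mul_assoc)
  then have skR: "skew_pair (H (y t) *v (e t v* ricci S G' (y t))) (e t) = skew_pair (H (y t) *v (e t v* ricci S G (y t))) (e t)
     - ?n2 *\<^sub>R (K - (Uy t \<bullet> e t) *\<^sub>R skew_pair (Vy t) (e t))"
    unfolding K_def by (simp only: skew_pair_add skew_pair_diff skew_pair_scaleR_left skew_pair_refl scaleR_zero_right add_0_right)
  have H': "c'.H (y t) = (\<psi> t)\<^sup>2 *\<^sub>R H (y t)"
    using det_G[OF y_S[OF t]] \<phi>_pos[OF y_S[OF t]] by (simp add: matrix_inv_scaleR \<psi>_sq[OF t])
  have "skew_pair (c'.H (y t) *v (c'.e t v* schouten S G' (y t))) (c'.e t)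
     = (1 / ?n2) *\<^sub>R skew_pair (c'.H (y t) *v (c'.e t v* ricci S G' (y t))) (c'.e t)"
    by (rule c'.skew_schouten[OF y_S[OF t] n])
  also have "\<dots> = (1 / ?n2 * (\<psi> t)^4) *\<^sub>R skew_pair (H (y t) *v (e t v* ricci S G' (y t))) (e t)"
    unfolding H' e'[OF t] scaleR_vector_matrix_mult matrix_vector_mult_scaleR scaleR_matrix_vector_mult scaleR_scaleR skew_pair_scaleR
    by (simp add: power2_eq_square power4_eq_xxxx)
  finally have R: "skew_pair (c'.H (y t) *v (c'.e t v* schouten S G' (y t))) (c'.e t)
     = (1 / ?n2 * (\<psi> t)^4) *\<^sub>R (skew_pair (H (y t) *v (e t v* ricci S G (y t))) (e t)
     - ?n2 *\<^sub>R (K - (Uy t \<bullet> e t) *\<^sub>R skew_pair (Vy t) (e t)))"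
    unfolding skR .
  have sg: "sgn (c'.N t) = \<epsilon> t"
    unfolding N' \<epsilon>_def using \<phi>_pos[OF y_S[OF t]] by (simp add: sgn_mult)
  have n2: "?n2 > 0" using n by simp
  have nz: "(\<psi> t)^4 * \<epsilon> t \<noteq> 0" using \<psi>_pos[OF t] nonnull[OF t] by (simp add: \<epsilon>_def sgn_zero_iff)
  \<comment> \<open>The term \<open>a *\<^sub>R P - Q\<close> stands on both sides with the same
    factor and cancels; \<open>T\<close>, the Ricci term, keeps a nonzero coefficient.\<close>
  have alg: "(c * s) *\<^sub>R (a *\<^sub>R P - Q) = s *\<^sub>R ((1 / m * c) *\<^sub>R (T - m *\<^sub>R (Q - a *\<^sub>R P))) \<longleftrightarrow> T = 0"
    if "c * s \<noteq> 0" "m > 0" for c s a m :: real and P Q T :: "real^'n^'n"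
  proof -
    have "s *\<^sub>R ((1 / m * c) *\<^sub>R (T - m *\<^sub>R (Q - a *\<^sub>R P))) = (c * s / m) *\<^sub>R T + (c * s) *\<^sub>R (a *\<^sub>R P - Q)"
      using that by (simp add: algebra_simps)
    then show ?thesis using that by simp
  qed
  show ?thesis
    unfolding c'.conformal_circle_eq_unweighted[OF t] L R sg by (rule alg[OF nz n2])
qed

end

section \<open>Generalised geodesics\<close>

text \<open>Every permutation of \<open>{..<Suc k}\<close> is uniquely a transposition of
  \<open>k\<close> with some \<open>b\<close>, composed with a permutation of \<open>{..<k}\<close>;
  for \<open>b = k\<close> the transposition is the identity. Iteration gives the explicit
  expansions below.\<close>

lemma perm_sum_Suc:
  fixes T :: "(nat \<Rightarrow> 'i) \<Rightarrow> real"
  shows "(\<Sum>\<pi> | \<pi> permutes {..<Suc k}. of_int (sign \<pi>) * T (i \<circ> \<pi>))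
   = (\<Sum>b\<le>k. (if b = k then 1 else - 1) *
       (\<Sum>\<pi> | \<pi> permutes {..<k}. of_int (sign \<pi>) * T ((i \<circ> Transposition.transpose k b) \<circ> \<pi>)))"
proof -
  have ins: "{..<Suc k} = insert k {..<k}" by auto
  have "sign (Transposition.transpose k b \<circ> \<pi>) = (if b = k then 1 else - 1) * sign \<pi>" if "\<pi> permutes {..<k}" for b \<pi>
    using that permutes_imp_permutation[of "{..<k}" \<pi>]
    by (simp add: sign_compose permutation_swap_id sign_swap_id)
  then have "(\<Sum>\<pi> | \<pi> permutes {..<k}. real_of_int (sign (Transposition.transpose k b \<circ> \<pi>)) * T (i \<circ> (Transposition.transpose k b \<circ> \<pi>)))
     = (if b = k then 1 else - 1) * (\<Sum>\<pi> | \<pi> permutes {..<k}. of_int (sign \<pi>) * T ((i \<circ> Transposition.transpose k b) \<circ> \<pi>))" for b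
    unfolding sum_distrib_left by (intro sum.cong) (auto simp: o_assoc)
  then show ?thesis
    unfolding ins by (subst sum_over_permutations_insert) (auto simp: lessThan_Suc_atMost[symmetric] lessThan_Suc)
qed

lemma skew_3:
  fixes F :: "'i \<Rightarrow> 'i \<Rightarrow> 'i \<Rightarrow> real"
  shows "skew 3 (\<lambda>j. F (j 0) (j 1) (j 2)) i =
    (F (i 0) (i 1) (i 2) - F (i 1) (i 0) (i 2) - F (i 0) (i 2) (i 1) - F (i 2) (i 1) (i 0)
     + F (i 1) (i 2) (i 0) + F (i 2) (i 0) (i 1)) / 6"
proof -
  have 3: "(3::nat) = Suc (Suc (Suc 0))" by simp
  show ?thesis
    unfolding skew_def 3 perm_sum_Suc[where T = "\<lambda>j. F (j 0) (j 1) (j 2)"]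
    by (simp add: Transposition.transpose_def numeral_2_eq_2)
qed

lemma skew_4:
  fixes F :: "'i \<Rightarrow> 'i \<Rightarrow> 'i \<Rightarrow> 'i \<Rightarrow> real"
  shows "skew 4 (\<lambda>j. F (j 0) (j 1) (j 2) (j 3)) i =
    (let S = (\<lambda>a b c d. F (i a) (i b) (i c) (i d) - F (i b) (i a) (i c) (i d) - F (i a) (i c) (i b) (i d) - F (i c) (i b) (i a) (i d)
     + F (i b) (i c) (i a) (i d) + F (i c) (i a) (i b) (i d))
     in (S 0 1 2 3 - S 3 1 2 0 - S 0 3 2 1 - S 0 1 3 2) / 24)"
proof -
  have 4: "(4::nat) = Suc (Suc (Suc (Suc 0)))" by simp
  show ?thesis
    unfolding skew_def 4 perm_sum_Suc[where T = "\<lambda>j. F (j 0) (j 1) (j 2) (j 3)"] Let_def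
    by (simp add: Transposition.transpose_def numeral_2_eq_2 numeral_3_eq_3)
qed

text \<open>Up to the factor \<open>c / 24\<close> a 4 by 4 determinant, in Laplace expansion by the
  2 by 2 minors of \<open>f0\<close>, \<open>f1\<close> and of \<open>f2\<close>, \<open>f3\<close>.
  The inner skew-symmetrisation is absorbed by the outer one.\<close>

lemma skew_wedge_4:
  fixes f0 f1 f2 f3 :: "'i \<Rightarrow> real"
  shows "skew 4 (\<lambda>j. f0 (j 0) * (c * skew 3 (\<lambda>l. f1 (l 0) * f2 (l 1) * f3 (l 2)) (\<lambda>k. j (Suc k)))) i =
    c * (let m = (\<lambda>f g a b. f (i a) * g (i b) - f (i b) * g (i a)) in
     m f0 f1 0 1 * m f2 f3 2 3 - m f0 f1 0 2 * m f2 f3 1 3 + m f0 f1 0 3 * m f2 f3 1 2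
     + m f0 f1 1 2 * m f2 f3 0 3 - m f0 f1 1 3 * m f2 f3 0 2 + m f0 f1 2 3 * m f2 f3 0 1) / 24"
proof -
  have s: "skew 3 (\<lambda>l. f1 (l 0) * f2 (l 1) * f3 (l 2)) (\<lambda>k. j (Suc k)) =
    (f1 (j 1) * f2 (j 2) * f3 (j 3) - f1 (j 2) * f2 (j 1) * f3 (j 3) - f1 (j 1) * f2 (j 3) * f3 (j 2) - f1 (j 3) * f2 (j 2) * f3 (j 1)
     + f1 (j 2) * f2 (j 3) * f3 (j 1) + f1 (j 3) * f2 (j 1) * f3 (j 2)) / 6" for j :: "nat \<Rightarrow> 'i"
    using skew_3[of "\<lambda>a b c. f1 a * f2 b * f3 c" "\<lambda>k. j (Suc k)"] by (simp add: numeral_2_eq_2 numeral_3_eq_3)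
  show ?thesis
    unfolding s
    unfolding skew_4[of "\<lambda>a b c' d. f0 a * (c * ((f1 b * f2 c' * f3 d - f1 c' * f2 b * f3 d - f1 b * f2 d * f3 c' - f1 d * f2 c' * f3 b
     + f1 c' * f2 d * f3 b + f1 d * f2 b * f3 c') / 6))"] Let_def
    by (simp add: field_simps)
qed


text \<open>The lowered weighted velocity, which is the middle slot of
  \<open>tractor_U\<close>.\<close>

definition unit_form ::
    "(real^'n::finite \<Rightarrow> real^'n^'n) \<Rightarrow> real set \<Rightarrow> (real \<Rightarrow> real^'n) \<Rightarrow> real \<Rightarrow> real^'n" where
  "unit_form G J y t = (1 / speed_density G J y t) *\<^sub>R (velocity J y t v* conf_metric G (y t))"

lemma cov_zero:
  assumes "rich J" "t \<in> J"
  shows "cov_density S G J y w (\<lambda>t. 0) t = 0" "cov_covector S G J y w (\<lambda>t. 0) t = 0"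
proof -
  have z: "vector_derivative (\<lambda>t. 0 :: 'c::real_normed_vector) (at t within J) = 0"
    by (rule rich_vector_derivative[OF assms has_vector_derivative_const])
  show "cov_density S G J y w (\<lambda>t. 0) t = 0" "cov_covector S G J y w (\<lambda>t. 0) t = 0"
    unfolding cov_density_def cov_covector_def z by (simp_all add: vec_eq_iff)
qed

lemma tractor_U_eq:
  assumes "rich J" "t \<in> J"
  shows "fst (tractor_U S G J y t) = 0" "fst (snd (tractor_U S G J y t)) = unit_form G J y t"
  by (simp_all add: tractor_U_def cov_tractor_def tractor_X_def cov_zero[OF assms] unit_form_def)

lemma tractor_A_eq:
  assumes "rich J" "t \<in> J"
  shows "fst (tractor_A S G J y t) = - (velocity J y t \<bullet> unit_form G J y t)"
    "fst (snd (tractor_A S G J y t)) = cov_covector S G J y 1 (unit_form G J y) t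
       + snd (snd (tractor_U S G J y t)) *\<^sub>R (velocity J y t v* conf_metric G (y t))"
proof -
  have "cov_density S G J y 1 (\<lambda>t. fst (tractor_U S G J y t)) t = cov_density S G J y 1 (\<lambda>t. 0) t"
    using vector_derivative_cong_on[of t J "\<lambda>t. fst (tractor_U S G J y t)" "\<lambda>t. 0", OF assms(2) tractor_U_eq(1)[OF assms(1)]] tractor_U_eq(1)[OF assms, of S G y]
    by (simp add: cov_density_def)
  then have s: "cov_density S G J y 1 (\<lambda>t. fst (tractor_U S G J y t)) t = 0" using cov_zero[OF assms] by simp
  have m: "cov_covector S G J y 1 (\<lambda>t. fst (snd (tractor_U S G J y t))) t = cov_covector S G J y 1 (unit_form G J y) t"
    using vector_derivative_cong_on[of t J "\<lambda>t. fst (snd (tractor_U S G J y t))" "unit_form G J y", OF assms(2) tractor_U_eq(2)[OF assms(1)]] tractor_U_eq(2)[OF assms, of S G y]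
    by (simp add: cov_covector_def)
  show "fst (tractor_A S G J y t) = - (velocity J y t \<bullet> unit_form G J y t)"
    "fst (snd (tractor_A S G J y t)) = cov_covector S G J y 1 (unit_form G J y) t
       + snd (snd (tractor_U S G J y t)) *\<^sub>R (velocity J y t v* conf_metric G (y t))"
    unfolding tractor_A_def cov_tractor_def Let_def
    by (simp_all add: s m tractor_U_eq[OF assms])
qed

text \<open>As the velocity is non-null, the tractors X, U and A are independent, so the wedge
  vanishes exactly if the scale tractor lies in their span. X accounts for the bottom slot, the top
  slot fixes the coefficient of A, and the middle slot must then be matched by a multiple of
  \<open>unit_form\<close>. The bottom slots, where curvature occurs, are thus never
  computed.\<close>

lemma wedge_scale_three_zero_iff:
  fixes y :: "real \<Rightarrow> real^'n::finite"
  assumes J: "rich J" "t \<in> J" and nz: "velocity J y t \<bullet> unit_form G J y t \<noteq> 0"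
  shows "(\<forall>i. wedge_scale_three S G \<sigma> J y t i = 0) \<longleftrightarrow>
    (\<exists>\<beta>. (velocity J y t \<bullet> unit_form G J y t) *\<^sub>R nabla_density S G 1 \<sigma> (y t)
       + \<sigma> (y t) *\<^sub>R cov_covector S G J y 1 (unit_form G J y) t = \<beta> *\<^sub>R unit_form G J y t)"
proof -
  define m where "m = unit_form G J y t"
  define Dm where "Dm = cov_covector S G J y 1 (unit_form G J y) t"
  define \<alpha> where "\<alpha> = velocity J y t \<bullet> m"
  define n where "n = nabla_density S G 1 \<sigma> (y t)"
  define sd where "sd = speed_density G J y t"
  define Z where "Z = \<alpha> *\<^sub>R n + \<sigma> (y t) *\<^sub>R Dm"
  have \<alpha>: "\<alpha> \<noteq> 0" using nz by (simp add: \<alpha>_def m_def)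
  then have m0: "m \<noteq> 0" by (auto simp: \<alpha>_def)
  then have sd: "sd \<noteq> 0" by (auto simp: m_def unit_form_def sd_def)
  have um: "velocity J y t v* conf_metric G (y t) = sd *\<^sub>R m"
    using sd by (simp add: m_def unit_form_def sd_def)
  obtain r where U: "tractor_U S G J y t = (0, m, r)"
    using tractor_U_eq[OF J, of S G y] by (metis m_def prod.collapse)
  obtain r' where A: "tractor_A S G J y t = (- \<alpha>, Dm + (r * sd) *\<^sub>R m, r')"
    using tractor_A_eq[OF J, of S G y] unfolding U um
    by (metis \<alpha>_def Dm_def m_def prod.collapse fst_conv scaleR_scaleR snd_conv)
  obtain \<rho> where I: "scale_tractor S G \<sigma> (y t) = (\<sigma> (y t), n, \<rho>)"
    by (simp add: scale_tractor_def n_def)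
  have X: "tractor_X = (0, 0 :: real^'n, 1)" by (simp add: tractor_X_def)
  let ?f0 = "tractor_component (\<sigma> (y t), n, \<rho>)" and ?f1 = "tractor_component (0, 0 :: real^'n, 1)"
    and ?f2 = "tractor_component (0, m, r)" and ?f3 = "tractor_component (- \<alpha>, Dm + (r * sd) *\<^sub>R m, r')"
  define L where "L = (\<lambda>i :: nat \<Rightarrow> 'n tractor_index. let d = (\<lambda>f g a b. f (i a) * g (i b) - f (i b) * g (i a)) in
     d ?f0 ?f1 0 1 * d ?f2 ?f3 2 3 - d ?f0 ?f1 0 2 * d ?f2 ?f3 1 3 + d ?f0 ?f1 0 3 * d ?f2 ?f3 1 2
     + d ?f0 ?f1 1 2 * d ?f2 ?f3 0 3 - d ?f0 ?f1 1 3 * d ?f2 ?f3 0 2 + d ?f0 ?f1 2 3 * d ?f2 ?f3 0 1)"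
  have "wedge_scale_three S G \<sigma> J y t i = 6 / sd * L i / 24" for i
    unfolding L_def
    unfolding wedge_scale_three_def three_tractor_def U A I X sd_def[symmetric] by (rule skew_wedge_4)
  then have W: "wedge_scale_three S G \<sigma> J y t i = 0 \<longleftrightarrow> L i = 0" for i using sd by simp
  have "(\<forall>i. wedge_scale_three S G \<sigma> J y t i = 0) \<longleftrightarrow> skew_pair Z m = 0"
  proof
    assume zero: "\<forall>i. wedge_scale_three S G \<sigma> J y t i = 0"
    have "m $ a * Z $ b = m $ b * Z $ a" for a b
    proof -
      \<comment> \<open>With the indices \<open>Top\<close> and \<open>Bot\<close> fixed, the
        remaining two give the minors of the middle slots of \<open>Z\<close> and
        \<open>m\<close>.\<close>
      define i where "i = (\<lambda>k::nat. [Top, Bot, Mid a, Mid b] ! k)"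
      have "\<sigma> (y t) * (m $ a * Dm $ b - m $ b * Dm $ a) - n $ a * (\<alpha> * m $ b) + n $ b * (\<alpha> * m $ a) = 0"
        using zero[rule_format, of i] unfolding W L_def
        by (simp add: i_def algebra_simps)
      then show ?thesis by (simp add: Z_def algebra_simps)
    qed
    then show "skew_pair Z m = 0" by (simp add: skew_pair_def vec_eq_iff mult.commute)
  next
    assume "skew_pair Z m = 0"
    then obtain k where k: "Z = k *\<^sub>R m" using skew_pair_eq_0_iff[OF m0] by blast
    \<comment> \<open>Coefficients of U and X in the scale tractor once
      \<open>- \<sigma> (y t) / \<alpha>\<close> times A has matched the top slot.\<close>
    define c where "c = (k + \<sigma> (y t) * r * sd) / \<alpha>"
    define d where "d = \<rho> + \<sigma> (y t) / \<alpha> * r' - c * r"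
    have n: "n = (k / \<alpha>) *\<^sub>R m - (\<sigma> (y t) / \<alpha>) *\<^sub>R Dm"
    proof -
      have "\<alpha> *\<^sub>R n = k *\<^sub>R m - \<sigma> (y t) *\<^sub>R Dm" using k unfolding Z_def by (simp add: eq_diff_eq)
      then have "(1 / \<alpha>) *\<^sub>R (\<alpha> *\<^sub>R n) = (1 / \<alpha>) *\<^sub>R (k *\<^sub>R m - \<sigma> (y t) *\<^sub>R Dm)" by simp
      then show ?thesis using \<alpha> by (simp add: scaleR_diff_right)
    qed
    have "n $ a = - (\<sigma> (y t) / \<alpha>) * (Dm $ a + r * sd * m $ a) + c * m $ a" for a
      by (simp add: n c_def add_divide_distrib distrib_left distrib_right)
    then have "?f0 j = - (\<sigma> (y t) / \<alpha>) * ?f3 j + c * ?f2 j + d * ?f1 j" for j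
      using \<alpha> by (cases j) (simp_all add: d_def)
    then have dep: "?f0 = (\<lambda>j. - (\<sigma> (y t) / \<alpha>) * ?f3 j + c * ?f2 j + d * ?f1 j)" by (rule ext)
    show "\<forall>i. wedge_scale_three S G \<sigma> J y t i = 0"
      unfolding W L_def Let_def dep by (simp add: algebra_simps)
  qed
  also have "skew_pair Z m = 0 \<longleftrightarrow> (\<exists>\<beta>. Z = \<beta> *\<^sub>R m)" by (rule skew_pair_eq_0_iff[OF m0])
  finally show ?thesis unfolding Z_def \<alpha>_def n_def Dm_def m_def .
qed

lemma unweight_covector:
  fixes V :: "real \<Rightarrow> real^'n::finite"
  assumes J: "rich J" "t \<in> J"
    and f: "(f has_real_derivative - (w / real CARD('n) * trace (connv S G (velocity J y t) (y t))) * f t) (at t within J)"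
    and V: "(V has_vector_derivative V') (at t within J)"
  shows "cov_covector S G J y w (\<lambda>t. f t *\<^sub>R V t) t = f t *\<^sub>R (V' - transpose (connv S G (velocity J y t) (y t)) *v V t)"
proof -
  have "(\<chi> b. \<Sum>a\<in>UNIV. \<Sum>k\<in>UNIV. christoffel S G (y t) k a b * velocity J y t $ a * (f t *\<^sub>R V t) $ k)
      = f t *\<^sub>R (transpose (connv S G (velocity J y t) (y t)) *v V t)"
    unfolding connv_def matrix_vector_mult_def vec_eq_iff
    by (simp add: conn_def transpose_def sum_distrib_left sum_distrib_right mult_ac) (intro allI sum.swap)
  moreover have "((\<lambda>t. f t *\<^sub>R V t) has_vector_derivative (f t *\<^sub>R V' + (- (w / real CARD('n) * trace (connv S G (velocity J y t) (y t))) * f t) *\<^sub>R V t)) (at t within J)"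
    by (rule has_vector_derivative_scaleR[OF f V])
  ultimately show ?thesis
    using rich_vector_derivative[OF J, of "\<lambda>t. f t *\<^sub>R V t"]
    by (simp add: cov_covector_def density_form_inner algebra_simps)
qed

context curve_in_metric
begin

lemma unit_form_eq: "t \<in> J \<Longrightarrow> unit_form G J y t = s t *\<^sub>R (G (y t) *v e t)"
proof -
  assume t: "t \<in> J"
  have "u t v* G (y t) = G (y t) *v u t" by (rule vec_sym_matrix[OF sym_G[OF y_S[OF t]]])
  moreover have "u t v* conf_metric G (y t) = (s t)\<^sup>2 *\<^sub>R (u t v* G (y t))"
    by (simp add: conf_metric_def vector_matrix_mult_def vec_eq_iff sum_distrib_left mult_ac)
  ultimately have "u t v* conf_metric G (y t) = (s t)\<^sup>2 *\<^sub>R (G (y t) *v u t)" by simp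
  then show ?thesis
    using s_pos[OF t] by (simp add: unit_form_def speed_density_eq[OF t] e_def matrix_vector_mult_scaleR power2_eq_square)
qed

lemma cov_unit_form:
  assumes t: "t \<in> J"
  shows "cov_covector S G J y 1 (unit_form G J y) t = s t *\<^sub>R (G (y t) *v D e t)"
proof -
  have "cov_covector S G J y 1 (unit_form G J y) t = cov_covector S G J y 1 (\<lambda>t. s t *\<^sub>R (G (y t) *v e t)) t"
    using vector_derivative_cong_on[OF t unit_form_eq] unit_form_eq[OF t] by (simp add: cov_covector_def)
  also have "\<dots> = s t *\<^sub>R ((G (y t) *v (D e t - C t *v e t) + (transpose (C t) ** G (y t) + G (y t) ** C t) *v e t)
     - transpose (C t) *v (G (y t) *v e t))"
    by (rule unweight_covector[OF rich_J t ds[OF t] matvec_has_vector_derivative[OF dG_along[OF t] D_works[OF t smooth_e]]])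
  also have "\<dots> = s t *\<^sub>R (G (y t) *v D e t)"
    by (simp add: matrix_vector_mult_diff_distrib matrix_vector_mult_add_rdistrib matrix_vector_mul_assoc[symmetric])
  finally show ?thesis .
qed

lemma D_e_eq:
  assumes t: "t \<in> J"
  obtains c where "D e t = (1 / q t) *\<^sub>R D u t + c *\<^sub>R u t"
proof -
  have dq: "((\<lambda>t. 1 / q t) has_real_derivative vector_derivative (\<lambda>t. 1 / q t) (at t within J)) (at t within J)"
    using smooth_on_has_vector_derivative[OF smooth_inverse_q t]
    by (simp add: has_real_derivative_iff_has_vector_derivative)
  have "D e t = (1 / q t) *\<^sub>R D u t + vector_derivative (\<lambda>t. 1 / q t) (at t within J) *\<^sub>R u t"
    unfolding e_def D_scaleR[OF t smooth_u dq] by simp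
  then show ?thesis by (rule that)
qed

end

text \<open>The situation on the interior part of a chart: \<rho> is the defining function read in
  coordinates and \<open>\<phi>\<close> times \<open>G\<close> is the interior metric.\<close>

locale curve_in_defining_scale = curve_in_metric S G J y for S :: "(real^'n::finite) set" and G J y +
  fixes \<rho> :: "real^'n \<Rightarrow> real"
  assumes smooth_\<rho>: "smooth_on S \<rho>" and \<rho>_nonzero: "\<And>x. x \<in> S \<Longrightarrow> \<rho> x \<noteq> 0"
begin

abbreviation "\<phi> \<equiv> (\<lambda>x. 1 / (\<rho> x)\<^sup>2)"

sublocale curve_rescaled S G J y \<phi>
proof
  show "smooth_on S \<phi>"
    by (intro smooth_on_divide smooth_on_const smooth_on_power smooth_\<rho> rich_S) (use \<rho>_nonzero in simp)
  show "\<phi> x > 0" if "x \<in> S" for x using \<rho>_nonzero[OF that] by simp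
qed

lemma U_eq:
  assumes x: "x \<in> S"
  shows "U x = (- 1 / \<rho> x) *\<^sub>R (\<chi> a. partial S a \<rho> x)"
proof -
  have "((\<lambda>x. 1 / (\<rho> x)\<^sup>2) has_derivative (\<lambda>v. - 2 * frechet_derivative \<rho> (at x within S) v / (\<rho> x) ^ 3)) (at x within S)"
    using \<rho>_nonzero[OF x]
    by (auto intro!: derivative_eq_intros smooth_on_has_derivative[OF smooth_\<rho> x] simp: fun_eq_iff field_simps power2_eq_square power3_eq_cube)
  from partial_eqI[OF rich_S x this]
  have "partial S a \<phi> x = - 2 * partial S a \<rho> x / (\<rho> x) ^ 3" for a by (simp add: partial_def)
  then show ?thesis
    using \<rho>_nonzero[OF x] by (simp add: conf_form_def vec_eq_iff field_simps power2_eq_square power3_eq_cube)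
qed

text \<open>The scale density is parallel, so the gradient of \<sigma> is the differential of \<rho>
  times that density. As \<open>Vy t\<close> is minus the raised differential of log \<rho>, the
  algebraic criterion for the wedge becomes, after raising the index, the geodesic condition of
  \<open>geodesic_rescaled_iff\<close>.\<close>

theorem wedge_zero_iff_geodesic:
  assumes t: "t \<in> J" and \<sigma>: "\<And>x. x \<in> S \<Longrightarrow> \<sigma> x = \<rho> x * scale_density G x"
  shows "(\<forall>i. wedge_scale_three S G \<sigma> J y t i = 0) \<longleftrightarrow> (\<exists>k. cov_vector S G' J y 0 u t = k *\<^sub>R u t)"
proof -
  have x: "y t \<in> S" by (rule y_S[OF t])
  define \<epsilon> where "\<epsilon> = sgn (N t)"
  define r where "r = \<rho> (y t)"
  define d\<rho> where "d\<rho> = (\<chi> a. partial S a \<rho> (y t))"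
  have \<epsilon>: "\<epsilon> \<noteq> 0" "\<epsilon> * \<epsilon> = 1" using nonnull[OF t] by (auto simp: \<epsilon>_def sgn_if)
  have r: "r \<noteq> 0" using \<rho>_nonzero[OF x] by (simp add: r_def)
  have qq: "q t * q t * \<epsilon> = N t" by (simp add: q_def \<epsilon>_def sgn_if abs_if)
  have \<alpha>: "u t \<bullet> unit_form G J y t = s t * q t * \<epsilon>"
    unfolding unit_form_eq[OF t] \<epsilon>_def by (simp add: gue[OF t])
  have \<alpha>0: "u t \<bullet> unit_form G J y t \<noteq> 0"
    unfolding \<alpha> using s_pos[OF t] q_pos[OF t] \<epsilon> by simp
  have nabla: "nabla_density S G 1 \<sigma> (y t) = s t *\<^sub>R d\<rho>"
  proof -
    have "partial S a \<sigma> (y t) = partial S a (\<lambda>x. \<rho> x * scale_density G x) (y t)" for a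
      by (rule partial_cong[OF x \<sigma>])
    then have "partial S a \<sigma> (y t) = partial S a \<rho> (y t) * s t - \<rho> (y t) * (1 / real CARD('n) * trace (\<Gamma> a (y t)) * s t)" for a
      using partial_mult[OF rich_S x smooth_\<rho> smooth_scale_density, of a] partial_scale_density[OF x, of a] by simp
    moreover have "density_form S G 1 (y t) $ a = 1 / real CARD('n) * trace (\<Gamma> a (y t))" for a
      by (simp add: density_form_def trace_def conn_def)
    ultimately show ?thesis
      using \<sigma>[OF x] by (simp add: nabla_density_def vec_eq_iff d\<rho>_def algebra_simps)
  qed
  obtain c where c: "D e t = (1 / q t) *\<^sub>R D u t + c *\<^sub>R u t" by (rule D_e_eq[OF t])
  have Hd: "Vy t = (- 1 / r) *\<^sub>R (H (y t) *v d\<rho>)"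
    unfolding U_eq[OF x] r_def d\<rho>_def by (simp only: matrix_vector_mult_scaleR)
  have "(\<forall>i. wedge_scale_three S G \<sigma> J y t i = 0) \<longleftrightarrow>
     (\<exists>\<beta>. (s t * q t * \<epsilon>) *\<^sub>R (s t *\<^sub>R d\<rho>) + (r * s t) *\<^sub>R (s t *\<^sub>R (G (y t) *v D e t)) = \<beta> *\<^sub>R (s t *\<^sub>R (G (y t) *v e t)))"
    unfolding wedge_scale_three_zero_iff[OF rich_J t \<alpha>0] \<alpha> nabla cov_unit_form[OF t] \<sigma>[OF x] r_def[symmetric]
    unfolding unit_form_eq[OF t] ..
  also have "\<dots> \<longleftrightarrow> (\<exists>k. D u t - N t *\<^sub>R Vy t = k *\<^sub>R u t)"
  proof
    assume "\<exists>\<beta>. (s t * q t * \<epsilon>) *\<^sub>R (s t *\<^sub>R d\<rho>) + (r * s t) *\<^sub>R (s t *\<^sub>R (G (y t) *v D e t)) = \<beta> *\<^sub>R (s t *\<^sub>R (G (y t) *v e t))"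
    then obtain \<beta> where \<beta>: "(s t * q t * \<epsilon>) *\<^sub>R (s t *\<^sub>R d\<rho>) + (r * s t) *\<^sub>R (s t *\<^sub>R (G (y t) *v D e t)) = \<beta> *\<^sub>R (s t *\<^sub>R (G (y t) *v e t))" ..
    \<comment> \<open>Raising the index and clearing the powers of \<open>s t\<close> turns the
      relation of covectors into one of vectors.\<close>
    have "H (y t) *v ((s t * q t * \<epsilon>) *\<^sub>R (s t *\<^sub>R d\<rho>) + (r * s t) *\<^sub>R (s t *\<^sub>R (G (y t) *v D e t))) = H (y t) *v (\<beta> *\<^sub>R (s t *\<^sub>R (G (y t) *v e t)))"
      unfolding \<beta> ..
    then have "(s t * s t) *\<^sub>R ((q t * \<epsilon>) *\<^sub>R (H (y t) *v d\<rho>) + r *\<^sub>R D e t) = (\<beta> * s t) *\<^sub>R e t"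
      by (simp add: matrix_vector_right_distrib matrix_vector_mult_scaleR matrix_vector_mul_assoc GH[OF x] scaleR_add_right mult_ac)
    then have "(1 / (s t * s t)) *\<^sub>R ((s t * s t) *\<^sub>R ((q t * \<epsilon>) *\<^sub>R (H (y t) *v d\<rho>) + r *\<^sub>R D e t)) = (1 / (s t * s t)) *\<^sub>R ((\<beta> * s t) *\<^sub>R e t)" by simp
    then have "(q t * \<epsilon>) *\<^sub>R (H (y t) *v d\<rho>) + r *\<^sub>R D e t = (\<beta> / s t) *\<^sub>R e t"
      using s_pos[OF t] by (simp del: scaleR_add_right)
    then have "(q t / r) *\<^sub>R ((q t * \<epsilon>) *\<^sub>R (H (y t) *v d\<rho>) + r *\<^sub>R D e t) = (q t / r) *\<^sub>R ((\<beta> / s t) *\<^sub>R e t)" by simp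
    then have "(N t / r) *\<^sub>R (H (y t) *v d\<rho>) + q t *\<^sub>R D e t = (q t / r * (\<beta> / s t)) *\<^sub>R e t"
      using r by (simp add: scaleR_add_right qq[symmetric] mult_ac)
    then have "(N t / r) *\<^sub>R (H (y t) *v d\<rho>) + D u t = (\<beta> / s t / r - q t * c) *\<^sub>R u t"
      unfolding c using q_pos[OF t] by (simp add: e_def scaleR_add_right scaleR_diff_left algebra_simps)
    then show "\<exists>k. D u t - N t *\<^sub>R Vy t = k *\<^sub>R u t"
      unfolding Hd by (intro exI[of _ "\<beta> / s t / r - q t * c"]) (simp add: add.commute)
  next
    assume "\<exists>k. D u t - N t *\<^sub>R Vy t = k *\<^sub>R u t"
    then obtain k where k: "D u t = k *\<^sub>R u t + N t *\<^sub>R Vy t" by (auto simp: diff_eq_eq)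
    have GHd: "G (y t) *v (H (y t) *v d\<rho>) = d\<rho>" by (simp add: matrix_vector_mul_assoc GH[OF x])
    have ue: "u t = q t *\<^sub>R e t" by (rule u_eq[OF t])
    have De: "D e t = (k + c * q t) *\<^sub>R e t - (q t * \<epsilon> / r) *\<^sub>R (H (y t) *v d\<rho>)"
    proof -
      have "(1 / q t) *\<^sub>R (N t *\<^sub>R Vy t) = - (q t * \<epsilon> / r) *\<^sub>R (H (y t) *v d\<rho>)"
        unfolding Hd qq[symmetric] using q_pos[OF t] by simp
      moreover have "(1 / q t) *\<^sub>R (k *\<^sub>R u t) + c *\<^sub>R u t = (k + c * q t) *\<^sub>R e t"
        unfolding ue using q_pos[OF t] by (simp add: scaleR_add_left)
      ultimately show ?thesis unfolding c k by (simp add: scaleR_add_right)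
    qed
    have "G (y t) *v D e t = (k + c * q t) *\<^sub>R (G (y t) *v e t) - (q t * \<epsilon> / r) *\<^sub>R d\<rho>"
      unfolding De by (simp add: matrix_vector_mult_diff_distrib matrix_vector_mult_scaleR GHd)
    then have "(s t * q t * \<epsilon>) *\<^sub>R (s t *\<^sub>R d\<rho>) + (r * s t) *\<^sub>R (s t *\<^sub>R (G (y t) *v D e t))
       = (r * s t * (k + c * q t)) *\<^sub>R (s t *\<^sub>R (G (y t) *v e t))"
      using r by (simp add: scaleR_diff_right mult_ac)
    then show "\<exists>\<beta>. (s t * q t * \<epsilon>) *\<^sub>R (s t *\<^sub>R d\<rho>) + (r * s t) *\<^sub>R (s t *\<^sub>R (G (y t) *v D e t)) = \<beta> *\<^sub>R (s t *\<^sub>R (G (y t) *v e t))" ..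
  qed
  also have "\<dots> \<longleftrightarrow> (\<exists>k. cov_vector S G' J y 0 u t = k *\<^sub>R u t)"
    by (rule geodesic_rescaled_iff[OF t, symmetric])
  finally show ?thesis .
qed

end

section \<open>Restriction to smaller domains\<close>

lemma velocity_openin:
  "openin (top_of_set I) J \<Longrightarrow> t \<in> J \<Longrightarrow> velocity I y t = velocity J y t"
  by (simp add: velocity_def at_within_openin)

lemma density_form_local:
  assumes "openin (top_of_set S) T" "x \<in> T" "\<And>z. z \<in> T \<Longrightarrow> G z = K z"
  shows "density_form S G w x = density_form T K w x"
  by (simp add: density_form_def christoffel_local[OF assms])

lemma cov_vector_local:
  assumes "openin (top_of_set I) J" "t \<in> J" "openin (top_of_set S) T" "y t \<in> T" "\<And>z. z \<in> T \<Longrightarrow> G z = K z"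
  shows "cov_vector S G I y w V t = cov_vector T K J y w V t"
  by (simp add: cov_vector_def at_within_openin[OF assms(1,2)] velocity_openin[OF assms(1,2)]
      christoffel_local[OF assms(3,4,5)] density_form_local[OF assms(3,4,5)])

lemma cov_covector_local:
  assumes "openin (top_of_set I) J" "t \<in> J" "openin (top_of_set S) T" "y t \<in> T" "\<And>z. z \<in> T \<Longrightarrow> G z = K z"
  shows "cov_covector S G I y w V t = cov_covector T K J y w V t"
  by (simp add: cov_covector_def at_within_openin[OF assms(1,2)] velocity_openin[OF assms(1,2)]
      christoffel_local[OF assms(3,4,5)] density_form_local[OF assms(3,4,5)])

lemma conf_metric_local: "G x = K x \<Longrightarrow> conf_metric G x = conf_metric K x"
  by (simp add: conf_metric_def scale_density_def)

lemma speed_density_local: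
  assumes "openin (top_of_set I) J" "t \<in> J" "G (y t) = K (y t)"
  shows "speed_density G I y t = speed_density K J y t" "conf_square G I y t = conf_square K J y t"
    "weighted_velocity G I y t = weighted_velocity K J y t" "unit_form G I y t = unit_form K J y t"
  by (simp_all add: speed_density_def conf_square_def weighted_velocity_def unit_form_def
      velocity_openin[OF assms(1,2)] conf_metric_local[of G "y t" K, OF assms(3)])

lemma schouten_local:
  assumes "openin (top_of_set S) T" "x \<in> T" "\<And>z. z \<in> T \<Longrightarrow> G z = K z"
  shows "schouten S G x = schouten T K x"
  using conf_metric_local[of G x K] assms(2,3)
  by (simp add: schouten_def schouten_trace_def conf_trace_def ricci_local[OF assms])

text \<open>Chart images may contain boundary points, whereas the curvature computations take place
  on open domains. The equation involves only derivatives within the sets, so both the time set and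
  the chart image may be cut down.\<close>

lemma conformal_circle_eq_local:
  assumes "openin (top_of_set I) J" "t \<in> J" "openin (top_of_set S) T" "y ` J \<subseteq> T" "\<And>z. z \<in> T \<Longrightarrow> G z = K z"
  shows "conformal_circle_eq S G I y t \<longleftrightarrow> conformal_circle_eq T K J y t"
proof -
  have yT: "y t \<in> T" if "t \<in> J" for t using that assms(4) by auto
  note cl = cov_vector_local[where S = S and T = T and G = G and K = K and y = y, OF assms(1) _ assms(3) yT assms(5)]
  note sl = speed_density_local[where G = G and K = K and y = y, OF assms(1) _ assms(5)[OF yT]]
  have "cov_vector S G I y w V t = cov_vector T K J y w W t" if "t \<in> J" "\<And>s. s \<in> J \<Longrightarrow> V s = W s" for w V W t
    using cl[OF that(1,1), of w V] cov_vector_cong[OF that] by simp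
  note cc = this
  have wa: "weighted_acceleration S G I y t = weighted_acceleration T K J y t" if "t \<in> J" for t
    unfolding weighted_acceleration_def sl(1)[OF that that] using cc[OF that sl(3)] by simp
  show ?thesis
    unfolding conformal_circle_eq_def
    using sl[OF assms(2,2)] cc[OF assms(2) wa] schouten_local[where G = G and K = K, OF assms(3) yT[OF assms(2)] assms(5)]
      conf_metric_local[of G "y t" K] assms(5)[OF yT[OF assms(2)]] by simp
qed

lemma tractor_local:
  assumes J: "openin (top_of_set I) J" "t \<in> J"
  shows "cov_tractor S G I y V t = cov_tractor S G J y V t"
  by (simp add: cov_tractor_def Let_def cov_density_def cov_covector_def at_within_openin[OF J] velocity_openin[OF J])

lemma wedge_scale_three_openin:
  assumes J: "openin (top_of_set I) J" "t \<in> J"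
  shows "wedge_scale_three S G \<sigma> I y t i = wedge_scale_three S G \<sigma> J y t i"
proof -
  have cong: "cov_tractor S G J y V t = cov_tractor S G J y W t" if "t \<in> J" "\<And>s. s \<in> J \<Longrightarrow> V s = W s" for t V W
  proof -
    have "vector_derivative (\<lambda>t. fst (V t)) (at t within J) = vector_derivative (\<lambda>t. fst (W t)) (at t within J)"
      "vector_derivative (\<lambda>t. fst (snd (V t))) (at t within J) = vector_derivative (\<lambda>t. fst (snd (W t))) (at t within J)"
      "vector_derivative (\<lambda>t. snd (snd (V t))) (at t within J) = vector_derivative (\<lambda>t. snd (snd (W t))) (at t within J)"
      by (intro vector_derivative_cong_on[OF that(1)]; simp add: that(2))+
    then show ?thesis
      using that(2)[OF that(1)] by (simp add: cov_tractor_def Let_def cov_density_def cov_covector_def)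
  qed
  have sd: "speed_density G I y s = speed_density G J y s" if "s \<in> J" for s
    by (rule speed_density_local(1)[of I J s G y G, OF J(1) that refl])
  have U: "tractor_U S G I y t = tractor_U S G J y t" if "t \<in> J" for t
    unfolding tractor_U_def tractor_local[OF J(1) that] by (rule cong[OF that]) (simp add: sd)
  have A: "tractor_A S G I y t = tractor_A S G J y t"
    unfolding tractor_A_def tractor_local[OF J] by (rule cong[OF J(2) U])
  show ?thesis
    unfolding wedge_scale_three_def three_tractor_def U[OF J(2)] A sd[OF J(2)] ..
qed

text \<open>The comparison goes through the criterion \<open>wedge_scale_three_zero_iff\<close>, so
  only first derivatives of the metric have to be localised.\<close>

lemma wedge_scale_three_local:
  assumes J: "rich J" "t \<in> J" and T: "openin (top_of_set S) T" "y t \<in> T" "\<And>z. z \<in> T \<Longrightarrow> G z = K z"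
    and y: "y ` J \<subseteq> T" and nz: "velocity J y t \<bullet> unit_form G J y t \<noteq> 0"
  shows "(\<forall>i. wedge_scale_three S G \<sigma> J y t i = 0) \<longleftrightarrow> (\<forall>i. wedge_scale_three T K \<sigma> J y t i = 0)"
proof -
  have JJ: "openin (top_of_set J) J" by simp
  have uf: "unit_form G J y s = unit_form K J y s" if "s \<in> J" for s
    using speed_density_local(4)[of J J s G y K, OF JJ that] T(3)[of "y s"] y that by auto
  have nz': "velocity J y t \<bullet> unit_form K J y t \<noteq> 0" using nz uf[OF J(2)] by simp
  have "cov_covector S G J y 1 (unit_form G J y) t = cov_covector T K J y 1 (unit_form K J y) t"
  proof -
    have "cov_covector S G J y 1 (unit_form G J y) t = cov_covector T K J y 1 (unit_form G J y) t"
      by (rule cov_covector_local[where G = G and K = K and y = y, OF JJ J(2) T])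
    also have "\<dots> = cov_covector T K J y 1 (unit_form K J y) t"
      using vector_derivative_cong_on[of t J "unit_form G J y" "unit_form K J y", OF J(2) uf] uf[OF J(2)]
      by (simp add: cov_covector_def)
    finally show ?thesis .
  qed
  moreover have "nabla_density S G 1 \<sigma> (y t) = nabla_density T K 1 \<sigma> (y t)"
    by (simp add: nabla_density_def density_form_local[where G = G and K = K, OF T] partial_openin[OF T(1,2)])
  ultimately show ?thesis
    unfolding wedge_scale_three_zero_iff[OF J nz] wedge_scale_three_zero_iff[OF J nz'] uf[OF J(2)] by simp
qed

section \<open>Curves under a change of coordinates\<close>

context coordinate_change
begin

lemma frechet_\<psi>: "x \<in> S \<Longrightarrow> frechet_derivative \<psi> (at x within S) v = J x *v v"
proof -
  assume x: "x \<in> S"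
  show ?thesis
    unfolding frechet_linear[OF smooth_\<psi> x, of v]
    by (simp add: vec_eq_iff matrix_vector_mult_def J_def[OF x] partial_nth[OF m.rich_S x smooth_\<psi>] mult.commute)
qed

lemma velocity_transform:
  assumes "rich I" "t \<in> I" "y ` I \<subseteq> S" "(y has_vector_derivative u) (at t within I)"
  shows "((\<lambda>t. \<psi> (y t)) has_vector_derivative J (y t) *v u) (at t within I)"
  using curve_chain[OF smooth_\<psi> assms(3,2,4)] frechet_\<psi>[of "y t"] assms(2,3) by auto

text \<open>Acceleration is a vector: the derivative of the Jacobian along the curve is the
  inhomogeneous term in \<open>J_conn\<close>.\<close>

lemma covariant_transform:
  assumes I: "rich I" "t \<in> I" and y: "y ` I \<subseteq> S" "smooth_on I y"
  shows "cov_vector S' G' I (\<lambda>t. \<psi> (y t)) 0 (velocity I (\<lambda>t. \<psi> (y t))) t = J (y t) *v cov_vector S G I y 0 (velocity I y) t"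
proof -
  let ?u = "velocity I y" and ?w = "velocity I (\<lambda>t. \<psi> (y t))"
  have dy: "(y has_vector_derivative ?u t) (at t within I)" if "t \<in> I" for t
    unfolding velocity_def by (rule smooth_on_has_vector_derivative[OF y(2) that])
  have w: "?w t = J (y t) *v ?u t" if "t \<in> I" for t
    unfolding velocity_def[of I "\<lambda>t. \<psi> (y t)"]
    by (rule rich_vector_derivative[OF I(1) that velocity_transform[OF I(1) that y(1) dy[OF that]]])
  have x: "y t \<in> S" using I y by auto
  have smu: "smooth_on I ?u" unfolding velocity_def by (rule smooth_on_velocity[OF I(1) y(2)])
  define u' where "u' = vector_derivative ?u (at t within I)"
  have du: "(?u has_vector_derivative u') (at t within I)"
    unfolding u'_def by (rule smooth_on_has_vector_derivative[OF smu I(2)])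
  define dJ where "dJ = (\<Sum>i\<in>UNIV. ?u t $ i *\<^sub>R dmat S i J (y t))"
  have "frechet_derivative J (at (y t) within S) (?u t) = dJ"
    unfolding frechet_linear[OF smooth_J x, of "?u t"] frechet_axis_matrix[OF m.rich_S x smooth_J] dJ_def ..
  then have "((\<lambda>t. J (y t)) has_vector_derivative dJ) (at t within I)"
    using curve_chain[OF smooth_J y(1) I(2) dy[OF I(2)]] by simp
  from matvec_has_vector_derivative[OF this du]
  have "vector_derivative (\<lambda>t. J (y t) *v ?u t) (at t within I) = J (y t) *v u' + dJ *v ?u t"
    by (rule rich_vector_derivative[OF I])
  then have dw: "vector_derivative ?w (at t within I) = J (y t) *v u' + dJ *v ?u t"
    using vector_derivative_cong_on[OF I(2) w] by simp
  have C: "connv S' G' (J (y t) *v ?u t) (\<psi> (y t)) = (\<Sum>i\<in>UNIV. ?u t $ i *\<^sub>R A i (y t))"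
  proof -
    have "(\<Sum>i\<in>UNIV. ?u t $ i *\<^sub>R A i (y t)) = (\<Sum>i\<in>UNIV. \<Sum>a\<in>UNIV. (J (y t) $ a $ i * ?u t $ i) *\<^sub>R m'.\<Gamma> a (\<psi> (y t)))"
      by (simp add: A_def scaleR_right.sum mult.commute)
    also have "\<dots> = (\<Sum>a\<in>UNIV. (J (y t) *v ?u t) $ a *\<^sub>R m'.\<Gamma> a (\<psi> (y t)))"
      by (subst sum.swap) (simp add: matrix_vector_mult_def scaleR_left.sum)
    finally show ?thesis by (simp add: connv_def)
  qed
  have "J (y t) *v (connv S G (?u t) (y t) *v ?u t) = (\<Sum>i\<in>UNIV. ?u t $ i *\<^sub>R (J (y t) ** m.\<Gamma> i (y t))) *v ?u t"
    by (simp add: connv_def matrix_vector_mul_assoc matrix_sum_distribs matrix_scaleR_distribs)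
  also have "\<dots> = (\<Sum>i\<in>UNIV. ?u t $ i *\<^sub>R A i (y t)) *v (J (y t) *v ?u t) + dJ *v ?u t"
    unfolding J_conn[OF x] dJ_def
    by (simp add: scaleR_add_right sum.distrib matrix_vector_mult_add_rdistrib matrix_vector_mul_assoc matrix_sum_distribs matrix_scaleR_distribs)
  finally show ?thesis
    unfolding cov_vector_0 dw w[OF I(2)] C u'_def[symmetric] by (simp add: matrix_vector_right_distrib add_ac)
qed

lemma norm_transform:
  assumes "x \<in> S"
  shows "(J x *v v) \<bullet> (G' (\<psi> x) *v (J x *v v)) = v \<bullet> (G x *v v)"
proof -
  have "(J x *v v) \<bullet> w = v \<bullet> (transpose (J x) *v w)" for w
    by (metis dot_lmul_matrix inner_commute transpose_matrix_vector transpose_transpose)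
  moreover have "G x *v v = transpose (J x) *v (G' (\<psi> x) *v (J x *v v))"
    by (simp add: pullback[OF assms] matrix_vector_mul_assoc matrix_mul_assoc del: transpose_matrix_vector)
  ultimately show ?thesis by metis
qed

end

section \<open>The conformal circle equation is closed\<close>

lemma smooth_on_conf_metric:
  assumes "rich S" "smooth_on S G" "\<And>x. x \<in> S \<Longrightarrow> det (G x) \<noteq> 0"
  shows "smooth_on S (scale_density G)" "smooth_on S (conf_metric G)" "smooth_on S (\<lambda>x. conf_metric_inv G x)"
    "x \<in> S \<Longrightarrow> det (conf_metric G x) \<noteq> 0" "x \<in> S \<Longrightarrow> scale_density G x > 0"
proof -
  show pos: "x \<in> S \<Longrightarrow> scale_density G x > 0" for x using assms(3)[of x] by (simp add: scale_density_def)
  show s: "smooth_on S (scale_density G)"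
    unfolding scale_density_def
    by (intro smooth_on_powr smooth_on_abs smooth_on_det smooth_on_entry assms(1,2)) (use assms(3) in auto)
  show m: "smooth_on S (conf_metric G)"
    unfolding conf_metric_def by (intro smooth_on_scaleR smooth_on_power s assms(1,2))
  show nz: "x \<in> S \<Longrightarrow> det (conf_metric G x) \<noteq> 0" for x
    using pos[of x] assms(3)[of x] by (simp add: conf_metric_def det_scaleR)
  show "smooth_on S (\<lambda>x. conf_metric_inv G x)"
    by (rule smooth_on_matrix_inv[OF assms(1) m nz])
qed

lemma smooth_on_divide_const:
  fixes f :: "'a::euclidean_space \<Rightarrow> real"
  shows "rich S \<Longrightarrow> smooth_on S f \<Longrightarrow> smooth_on S (\<lambda>x. f x / c)"
  unfolding divide_inverse by (intro smooth_on_mult smooth_on_const)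

lemma smooth_on_schouten:
  assumes "rich S" "smooth_on S G" "\<And>x. x \<in> S \<Longrightarrow> det (G x) \<noteq> 0"
  shows "smooth_on S (schouten S G)"
  unfolding schouten_def schouten_trace_def conf_trace_def
  by (intro smooth_on_scaleR smooth_on_diff smooth_on_const smooth_on_divide_const smooth_on_sum smooth_on_mult
      smooth_on_entry smooth_on_ricci smooth_on_conf_metric assms)

lemma smooth_on_cov_vector:
  assumes S: "rich S" "smooth_on S G" "\<And>x. x \<in> S \<Longrightarrow> det (G x) \<noteq> 0"
    and y: "rich J" "smooth_on J y" "y ` J \<subseteq> S" and V: "smooth_on J V"
  shows "smooth_on J (cov_vector S G J y w V)"
proof -
  have u: "smooth_on J (velocity J y)" unfolding velocity_def by (rule smooth_on_velocity[OF y(1,2)])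
  have "smooth_on J (\<lambda>t. connv S G (velocity J y t) (y t))"
    unfolding connv_def
    by (intro smooth_on_sum smooth_on_scaleR smooth_on_nth u y(1) smooth_on_compose[OF y(1) S(1) y(3,2)] smooth_on_conn S)
  moreover from this have "smooth_on J (\<lambda>t. trace (connv S G (velocity J y t) (y t)))"
    unfolding trace_def by (intro smooth_on_sum smooth_on_entry y(1))
  ultimately show ?thesis
    unfolding cov_vector_connv
    by (intro smooth_on_add smooth_on_matvec smooth_on_scaleR smooth_on_mult smooth_on_const smooth_on_velocity V y(1))
qed

text \<open>All ingredients, including the Schouten tensor, are smooth up to the boundary, so both
  sides are continuous in time, and each time of a rich set is a limit of others.\<close>

lemma conformal_circle_eq_limit:
  assumes S: "rich S" "smooth_on S G" "\<And>x. x \<in> S \<Longrightarrow> det (G x) \<noteq> 0"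
    and y: "rich J" "smooth_on J y" "y ` J \<subseteq> S"
    and nz: "\<And>t. t \<in> J \<Longrightarrow> velocity J y t \<bullet> (G (y t) *v velocity J y t) \<noteq> 0"
    and t: "t \<in> J" and lim: "\<forall>\<^sub>F r in at t within J. conformal_circle_eq S G J y r"
  shows "conformal_circle_eq S G J y t"
proof -
  note comp = smooth_on_compose[OF y(1) S(1) y(3,2)]
  have u: "smooth_on J (velocity J y)" unfolding velocity_def by (rule smooth_on_velocity[OF y(1,2)])
  have cs: "smooth_on J (conf_square G J y)"
    unfolding conf_square_def by (intro smooth_on_inner smooth_on_matvec u comp smooth_on_conf_metric S y(1))
  have cs0: "conf_square G J y t \<noteq> 0" if "t \<in> J" for t
    using nz[OF that] smooth_on_conf_metric(5)[OF S, of "y t"] that y(3)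
    by (auto simp: conf_square_def conf_metric_def scaleR_matrix_vector_mult)
  have sd: "smooth_on J (speed_density G J y)"
    unfolding speed_density_def by (intro smooth_on_sqrt smooth_on_abs cs y(1)) (use cs0 in auto)
  have sd1: "smooth_on J (\<lambda>t. 1 / speed_density G J y t)"
    by (intro smooth_on_divide smooth_on_const sd y(1)) (use cs0 in \<open>auto simp: speed_density_def\<close>)
  have wv: "smooth_on J (weighted_velocity G J y)"
    unfolding weighted_velocity_def by (intro smooth_on_scaleR sd1 u y(1))
  have wa: "smooth_on J (weighted_acceleration S G J y)"
    unfolding weighted_acceleration_def by (intro smooth_on_scaleR sd1 y(1) smooth_on_cov_vector[OF S y wv])
  have skew: "smooth_on J (\<lambda>t. skew_pair (v t) (w t))" if "smooth_on J v" "smooth_on J w" for v w :: "real \<Rightarrow> real^'n"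
    by (intro smooth_on_vec y(1)) (simp add: skew_pair_def,
      intro smooth_on_divide_const smooth_on_diff smooth_on_mult smooth_on_nth that y(1))
  define \<Phi> where "\<Phi> = (\<lambda>t. skew_pair ((1 / speed_density G J y t) *\<^sub>R
         cov_vector S G J y (- 2) (weighted_acceleration S G J y) t) (weighted_velocity G J y t)
     - sgn (conf_square G J y t) *\<^sub>R
       skew_pair (conf_metric_inv G (y t) *v (weighted_velocity G J y t v* schouten S G (y t))) (weighted_velocity G J y t))"
  have "smooth_on J \<Phi>"
    unfolding \<Phi>_def
    by (intro smooth_on_diff skew smooth_on_scaleR smooth_on_sgn cs cs0 sd1 wv y(1) smooth_on_cov_vector[OF S y wa]
        smooth_on_matvec smooth_on_vecmat comp smooth_on_conf_metric smooth_on_schouten S)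
  then have "(\<Phi> \<longlongrightarrow> \<Phi> t) (at t within J)"
    using smooth_on_continuous_on t by (auto simp: continuous_on)
  moreover have iff: "conformal_circle_eq S G J y r \<longleftrightarrow> \<Phi> r = 0" for r
    unfolding conformal_circle_eq_def \<Phi>_def by simp
  then have "(\<Phi> \<longlongrightarrow> 0) (at t within J)"
    using lim by (intro tendsto_eventually) simp
  moreover have "at t within J \<noteq> bot"
    using rich_not_bot[OF y(1) t] .
  ultimately have "\<Phi> t = 0" using tendsto_unique by blast
  then show ?thesis using iff by simp
qed

section \<open>Charts\<close>

lemma chart_facts:
  assumes "is_chart M c"
  shows "openin M (fst c)" "fst c \<subseteq> topspace M" "inj_on (snd c) (fst c)"
    "p \<in> fst c \<Longrightarrow> chart_inv c (snd c p) = p" "x \<in> img c \<Longrightarrow> chart_inv c x \<in> fst c" "x \<in> img c \<Longrightarrow> snd c (chart_inv c x) = x"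
    "openin M V \<Longrightarrow> openin (top_of_set (img c)) (snd c ` (fst c \<inter> V))"
    "continuous_map (top_of_set (img c)) M (chart_inv c)"
    "continuous_map (subtopology M (fst c)) (top_of_set (img c)) (snd c)"
    "p \<in> fst c \<Longrightarrow> snd c p \<in> img c"
proof -
  show o: "openin M (fst c)" and s: "fst c \<subseteq> topspace M"
    using assms openin_subset by (auto simp: is_chart_def)
  have h: "homeomorphic_map (subtopology M (fst c)) (top_of_set (img c)) (snd c)"
    using assms by (simp add: is_chart_def)
  have ts: "topspace (subtopology M (fst c)) = fst c" using s by auto
  show i: "inj_on (snd c) (fst c)"
    using homeomorphic_imp_injective_map[OF h] ts by simp
  show ci: "p \<in> fst c \<Longrightarrow> chart_inv c (snd c p) = p" for p
    unfolding chart_inv_def by (rule inv_into_f_f[OF i])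
  show "x \<in> img c \<Longrightarrow> chart_inv c x \<in> fst c" "x \<in> img c \<Longrightarrow> snd c (chart_inv c x) = x"
    unfolding chart_inv_def img_def by (auto intro: inv_into_into f_inv_into_f)
  show "openin M V \<Longrightarrow> openin (top_of_set (img c)) (snd c ` (fst c \<inter> V))"
    using homeomorphic_imp_open_map[OF h] o
    by (auto simp: open_map_def openin_subtopology Int_commute)
  show "continuous_map (subtopology M (fst c)) (top_of_set (img c)) (snd c)"
    by (rule homeomorphic_imp_continuous_map[OF h])
  obtain g where g: "homeomorphic_maps (subtopology M (fst c)) (top_of_set (img c)) (snd c) g"
    using h homeomorphic_map_maps by blast
  have "chart_inv c x = g x" if "x \<in> img c" for x
  proof -
    have "g x \<in> fst c" "snd c (g x) = x"
      using g that ts s by (auto simp: homeomorphic_maps_def continuous_map_def Pi_iff)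
    then show ?thesis using ci by metis
  qed
  note eq = this
  have "continuous_map (top_of_set (img c)) (subtopology M (fst c)) g"
    using g unfolding homeomorphic_maps_def by blast
  then have gc: "continuous_map (top_of_set (img c)) M g"
    by (rule continuous_map_into_fulltopology)
  show "continuous_map (top_of_set (img c)) M (chart_inv c)"
    by (rule continuous_map_eq[OF gc]) (simp add: eq)
  show "p \<in> fst c \<Longrightarrow> snd c p \<in> img c" for p by (simp add: img_def)
qed

lemma img_half_space:
  assumes "is_chart M c" "x \<in> img c"
  obtains k e where "e > 0" "ball x e \<inter> half_space k \<subseteq> img c" "img c \<subseteq> half_space k"
proof -
  obtain k where k: "openin (top_of_set (half_space k)) (img c)" using assms by (auto simp: is_chart_def)
  then obtain W where W: "open W" "img c = half_space k \<inter> W" by (auto simp: openin_open)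
  then have "x \<in> W" using assms(2) by simp
  then obtain e where "e > 0" "ball x e \<subseteq> W" using W(1) by (auto simp: open_contains_ball)
  then have "ball x e \<inter> half_space k \<subseteq> img c" "img c \<subseteq> half_space k" using W(2) by blast+
  with \<open>e > 0\<close> show ?thesis by (rule that)
qed

definition domain :: "'a set \<Rightarrow> ('a, 'n::finite) chart \<Rightarrow> (real^'n) set" where
  "domain U c = snd c ` (fst c \<inter> U)"

lemma curve_times_openin:
  assumes "continuous_map (top_of_set I) M \<gamma>" "openin M V"
  shows "openin (top_of_set I) {t\<in>I. \<gamma> t \<in> V}"
  using openin_continuous_map_preimage[OF assms] by simp

text \<open>Invariance of domain. \<open>manifold_interior\<close> requires a point to be interior
  in all charts around it, and this reduces the check to a single chart.\<close>

lemma transition_interior: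
  assumes c: "is_chart M c" and d: "is_chart M d" and sm: "smooth_on (overlap c d) (transition c d)"
    and q: "q \<in> fst c" "q \<in> fst d" "snd c q \<in> interior (img c)"
  shows "snd d q \<in> interior (img d)"
proof -
  note cf = chart_facts[OF c] and df = chart_facts[OF d]
  let ?W = "overlap c d \<inter> interior (img c)"
  have "openin (top_of_set (img c)) (overlap c d)"
    unfolding overlap_def by (rule cf(7)[OF df(1)])
  then obtain V where V: "open V" "overlap c d = img c \<inter> V" by (auto simp: openin_open)
  have "?W = V \<inter> interior (img c)" unfolding V(2) using interior_subset by blast
  then have W: "open ?W" using V(1) by auto
  have "continuous_on ?W (transition c d)"
    using continuous_on_subset[OF smooth_on_continuous_on[OF sm]] by auto
  moreover have "inj_on (transition c d) ?W"
  proof (rule inj_onI)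
    fix x z assume x: "x \<in> ?W" and z: "z \<in> ?W" and eq: "transition c d x = transition c d z"
    obtain a b where ab: "a \<in> fst c \<inter> fst d" "x = snd c a" "b \<in> fst c \<inter> fst d" "z = snd c b"
      using x z by (auto simp: overlap_def)
    then have "snd d a = snd d b" using eq cf(4) by (simp add: transition_def)
    then have "a = b" using df(3) ab by (auto dest: inj_onD)
    then show "x = z" using ab by simp
  qed
  ultimately have "open (transition c d ` ?W)" by (intro invariance_of_domain W)
  moreover have "transition c d ` ?W \<subseteq> img d"
    using cf(4) df(10) by (auto simp: overlap_def transition_def)
  moreover have "snd d q \<in> transition c d ` ?W"
    using q cf(4)[OF q(1)] by (intro image_eqI[of _ _ "snd c q"]) (auto simp: overlap_def transition_def)
  ultimately show ?thesis by (meson interiorI)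
qed

lemma atlas_chart:
  assumes "atlas M A"
  shows "c \<in> A \<Longrightarrow> is_chart M c" "c \<in> A \<Longrightarrow> d \<in> A \<Longrightarrow> smooth_on (overlap c d) (transition c d)"
    "p \<in> topspace M \<Longrightarrow> \<exists>c\<in>A. p \<in> fst c"
proof -
  show "c \<in> A \<Longrightarrow> is_chart M c" "c \<in> A \<Longrightarrow> d \<in> A \<Longrightarrow> smooth_on (overlap c d) (transition c d)"
    using assms unfolding atlas_def by blast+
  have "(\<Union>c\<in>A. fst c) = topspace M" using assms unfolding atlas_def by blast
  then show "p \<in> topspace M \<Longrightarrow> \<exists>c\<in>A. p \<in> fst c" by blast
qed

text \<open>Near a boundary point the interior looks like a ball cut by an open half space, which is
  convex and nonempty. Hence the interior is dense, and small neighbourhoods meet it in a set on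
  which a zero derivative forces constancy.\<close>

lemma interior_neighbourhood:
  fixes A :: "('a, 'n::finite) chart set"
  assumes at: "atlas M A" and c: "c \<in> A" "p \<in> fst c" and V: "openin M V" "p \<in> V"
  obtains V' where "openin M V'" "p \<in> V'" "V' \<subseteq> V \<inter> fst c"
    "convex (domain (V' \<inter> manifold_interior M A) c)" "domain (V' \<inter> manifold_interior M A) c \<noteq> {}"
proof -
  let ?U = "manifold_interior M A" and ?x = "snd c p"
  have ic: "is_chart M c" by (rule atlas_chart(1)[OF at c(1)])
  note cf = chart_facts[OF ic]
  have "openin (top_of_set (img c)) (snd c ` (fst c \<inter> V))" by (rule cf(7)[OF V(1)])
  then obtain T where T: "open T" "snd c ` (fst c \<inter> V) = img c \<inter> T" by (auto simp: openin_open)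
  have xT: "?x \<in> img c \<inter> T" unfolding T(2)[symmetric] using c V by auto
  obtain k e0 where e0: "e0 > 0" "ball ?x e0 \<inter> half_space k \<subseteq> img c" "img c \<subseteq> half_space k"
    by (rule img_half_space[OF ic cf(10)[OF c(2)]])
  obtain e1 where e1: "e1 > 0" "ball ?x e1 \<subseteq> T" by (meson IntD2 T(1) open_contains_ball xT)
  define e where "e = min e0 e1"
  have e: "e > 0" "ball ?x e \<inter> half_space k \<subseteq> img c" "ball ?x e \<subseteq> T"
    using e0 e1 by (auto simp: e_def)
  \<comment> \<open>The half ball; its points are interior in the chart \<open>c\<close>, hence in
    every chart by \<open>transition_interior\<close>.\<close>
  define P where "P = ball ?x e \<inter> {z. z $ k > 0}"
  have oP: "open P" unfolding P_def by (intro open_Int open_ball open_halfspace_component_gt_cart)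
  have Pimg: "P \<subseteq> img c" using e(2) by (auto simp: P_def half_space_def)
  then have Pint: "P \<subseteq> interior (img c)" using oP by (rule interior_maximal)
  have convP: "convex P"
  proof -
    have "{z :: real^'n. z $ k > 0} = {z. axis k 1 \<bullet> z > 0}" by (simp add: inner_axis inner_commute)
    then have "convex {z :: real^'n. z $ k > 0}" using convex_halfspace_gt[of 0 "axis k 1 :: real^'n"] by simp
    then show ?thesis unfolding P_def by (intro convex_Int convex_ball)
  qed
  have "?x $ k \<ge> 0" using e0(3) cf(10)[OF c(2)] by (auto simp: half_space_def)
  \<comment> \<open>A step of half the radius in the inward normal direction reaches the half ball
    even from a boundary point.\<close>
  then have "?x + (e/2) *\<^sub>R axis k 1 \<in> P" using e(1) by (auto simp: P_def dist_norm)
  then have Pne: "P \<noteq> {}" by auto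
  define V' where "V' = {q \<in> fst c. snd c q \<in> ball ?x e}"
  have eqP: "domain (V' \<inter> ?U) c = P"
  proof (rule set_eqI, rule iffI)
    fix z assume "z \<in> domain (V' \<inter> ?U) c"
    then obtain q where q: "q \<in> V'" "q \<in> ?U" "z = snd c q" by (auto simp: domain_def)
    have "snd c q \<in> interior (img c)"
      using q c(1) by (auto simp: V'_def manifold_interior_def manifold_boundary_def)
    then have "snd c q \<in> interior (half_space k)" using interior_mono[OF e0(3)] by blast
    also have "interior (half_space k) = {z :: real^'n. z $ k > 0}"
      unfolding half_space_def by (simp add: interior_halfspace_component_ge)
    finally show "z \<in> P" using q by (simp add: P_def V'_def)
  next
    fix z assume z: "z \<in> P"
    define q where "q = chart_inv c z"
    have q: "q \<in> fst c" "snd c q = z" using z Pimg cf(5,6) by (auto simp: q_def)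
    have "snd d q \<in> interior (img d)" if d: "d \<in> A" "q \<in> fst d" for d
      using transition_interior[OF ic atlas_chart(1,2)[OF at] q(1) d(2)] c(1) d(1) q(2) z Pint by auto
    then have "q \<in> ?U" using q(1) cf(2) by (auto simp: manifold_interior_def manifold_boundary_def)
    moreover have "q \<in> V'" using q z by (auto simp: V'_def P_def)
    ultimately show "z \<in> domain (V' \<inter> ?U) c" using q by (auto simp: domain_def)
  qed
  have "openin M V'"
  proof -
    have "openin (top_of_set (img c)) (img c \<inter> ball ?x e)" by (simp add: openin_open_Int)
    from openin_continuous_map_preimage[OF cf(9) this]
    have "openin (subtopology M (fst c)) {q \<in> topspace (subtopology M (fst c)). snd c q \<in> img c \<inter> ball ?x e}" .
    moreover have "{q \<in> topspace (subtopology M (fst c)). snd c q \<in> img c \<inter> ball ?x e} = V'"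
      using cf(2,10) by (auto simp: V'_def)
    ultimately show ?thesis using cf(1) openin_trans_full by metis
  qed
  moreover have "p \<in> V'" using c(2) e(1) by (simp add: V'_def)
  moreover have "V' \<subseteq> V \<inter> fst c"
  proof
    fix q assume q: "q \<in> V'"
    then have "snd c q \<in> snd c ` (fst c \<inter> V)" unfolding T(2) using e(3) cf(10) by (auto simp: V'_def)
    then show "q \<in> V \<inter> fst c" using q cf(3) by (auto simp: V'_def dest: inj_onD)
  qed
  ultimately show ?thesis by (intro that[of V']) (simp_all add: eqP convP Pne)
qed

text \<open>Connectedness is available for all of \<open>M\<close> only. Every point of
  \<open>M\<close>, also on the boundary, has a neighbourhood on whose interior part
  \<open>F\<close> is constant; density of the interior makes the open sets for different values
  disjoint, and connectedness leaves one of them.\<close>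

lemma constant_on_interior:
  fixes A :: "('a, 'n::finite) chart set" and F :: "'a \<Rightarrow> real"
  assumes M: "connected_manifold_with_boundary M A"
    and F: "\<And>c x. c \<in> A \<Longrightarrow> x \<in> domain (manifold_interior M A) c \<Longrightarrow> ((\<lambda>x. F (chart_inv c x)) has_derivative (\<lambda>v. 0)) (at x)"
  obtains k where "\<And>p. p \<in> manifold_interior M A \<Longrightarrow> F p = k"
proof -
  have at: "atlas M A" and con: "connected_space M" using M by (auto simp: connected_manifold_with_boundary_def)
  let ?U = "manifold_interior M A"
  have dense: "V \<inter> ?U \<noteq> {}" if V: "openin M V" "p \<in> V" for V p
  proof -
    have "p \<in> topspace M" using V openin_subset by blast
    then obtain c where c: "c \<in> A" "p \<in> fst c" using atlas_chart(3)[OF at] by blast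
    obtain V' where "V' \<subseteq> V \<inter> fst c" "domain (V' \<inter> ?U) c \<noteq> {}"
      by (rule interior_neighbourhood[OF at c V])
    then show ?thesis by (auto simp: domain_def)
  qed
  have loc: "\<exists>V k. openin M V \<and> p \<in> V \<and> (\<forall>q\<in>V \<inter> ?U. F q = k)" if p: "p \<in> topspace M" for p
  proof -
    obtain c where c: "c \<in> A" "p \<in> fst c" using atlas_chart(3)[OF at p] by blast
    note cf = chart_facts[OF atlas_chart(1)[OF at c(1)]]
    obtain V where V: "openin M V" "p \<in> V" "V \<subseteq> topspace M \<inter> fst c" "convex (domain (V \<inter> ?U) c)"
      by (rule interior_neighbourhood[OF at c openin_topspace p])
    have "\<exists>k. \<forall>z\<in>domain (V \<inter> ?U) c. F (chart_inv c z) = k"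
    proof (rule has_derivative_zero_constant[OF V(4)])
      fix z assume "z \<in> domain (V \<inter> ?U) c"
      then have "z \<in> domain ?U c" by (auto simp: domain_def)
      then show "((\<lambda>z. F (chart_inv c z)) has_derivative (\<lambda>h. 0)) (at z within domain (V \<inter> ?U) c)"
        using F[OF c(1)] has_derivative_at_withinI by blast
    qed
    then obtain m where m: "\<And>z. z \<in> domain (V \<inter> ?U) c \<Longrightarrow> F (chart_inv c z) = m" by blast
    have "F q = m" if q: "q \<in> V \<inter> ?U" for q
    proof -
      have "q \<in> fst c" using q V(3) by auto
      then show ?thesis using m[of "snd c q"] cf(4) q by (auto simp: domain_def)
    qed
    then show ?thesis by (intro exI[of _ V] exI[of _ m]) (use V(1,2) in auto)
  qed
  \<comment> \<open>The largest open set on whose interior part \<open>F\<close> takes the value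
    \<open>k\<close>; it may contain boundary points, where the value of \<open>F\<close> is not
    constrained.\<close>
  define W where "W = (\<lambda>k. \<Union>{V. openin M V \<and> (\<forall>q\<in>V \<inter> ?U. F q = k)})"
  have oW: "openin M (W k)" for k unfolding W_def by (intro openin_Union) auto
  have ex: "\<exists>k. p \<in> W k" if "p \<in> topspace M" for p
    using loc[OF that] unfolding W_def by blast
  have val: "F q = k" if "q \<in> W k" "q \<in> ?U" for q k using that by (auto simp: W_def)
  have disj: "W k \<inter> W k' = {}" if "k \<noteq> k'" for k k'
  proof (rule ccontr)
    assume "W k \<inter> W k' \<noteq> {}"
    then obtain p where "p \<in> W k \<inter> W k'" by auto
    then obtain q where "q \<in> W k \<inter> W k' \<inter> ?U" using dense[of "W k \<inter> W k'" p] oW by auto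
    then show False using val that by auto
  qed
  show ?thesis
  proof (cases "topspace M = {}")
    case True then show ?thesis by (intro that[of 0]) (auto simp: manifold_interior_def)
  next
    case False
    then obtain p k where p: "p \<in> topspace M" "p \<in> W k" using ex by blast
    let ?R = "\<Union>k'\<in>- {k}. W k'"
    have R: "openin M ?R" using oW by blast
    have cover: "topspace M \<subseteq> W k \<union> ?R" using ex by blast
    have int: "W k \<inter> ?R = {}" using disj by blast
    have "W k \<noteq> {}" using p by auto
    then have R0: "?R = {}" using con oW[of k] R cover int unfolding connected_space_def by metis
    have "F q = k" if "q \<in> ?U" for q
    proof -
      have "q \<in> topspace M" using that by (auto simp: manifold_interior_def)
      then have "q \<in> W k" using cover R0 by blast
      then show ?thesis using val that by blast
    qed
    then show ?thesis by (rule that)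
  qed
qed

section \<open>Einstein metrics are detected by non-null directions\<close>

text \<open>If all vectors are eigenvectors, the basis vectors make the matrix diagonal and their
  pairwise sums make the diagonal constant.\<close>

lemma scalar_matrix:
  fixes T :: "real^'n^'n::finite"
  assumes "\<And>v a b. (T *v v) $ a * v $ b = (T *v v) $ b * v $ a"
  obtains f where "T = f *\<^sub>R mat 1"
proof -
  have col: "(T *v axis i 1) $ a = T $ a $ i" for a i
    by (simp add: matrix_vector_mult_basis column_def)
  have ax: "axis i (1::real) $ a = (if a = i then 1 else 0)" for a i :: 'n
    by (simp add: axis_def)
  have off: "T $ a $ i = 0" if "a \<noteq> i" for a i
    using assms[of "axis i 1" a i] that by (simp add: col ax)
  have diag: "T $ i $ i = T $ j $ j" for i j
  proof (cases "i = j")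
    case False
    then show ?thesis
      using assms[of "axis i 1 + axis j 1" i j] off[of i j] off[of j i]
      by (simp add: matrix_vector_right_distrib col ax)
  qed simp
  fix i0 :: 'n
  have "T = T $ i0 $ i0 *\<^sub>R mat 1"
    using off diag[of _ i0] by (simp add: vec_eq_iff mat_def)
  then show ?thesis by (rule that)
qed

context metric_on
begin

text \<open>If all vectors were null, polarisation would annihilate every entry of the nondegenerate
  metric.\<close>

lemma nonnull_exists:
  assumes x: "x \<in> S"
  obtains w where "w \<bullet> (G x *v w) \<noteq> 0"
proof -
  have "\<exists>w. w \<bullet> (G x *v w) \<noteq> 0"
  proof (rule ccontr)
    assume "\<not> ?thesis"
    then have z: "w \<bullet> (G x *v w) = 0" for w by blast
    have entry: "axis i 1 \<bullet> (G x *v axis j 1) = G x $ i $ j" for i j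
      by (simp add: matrix_vector_mult_basis column_def inner_axis inner_axis')
    have "G x $ i $ j = 0" for i j
      using z[of "axis i 1 + axis j 1"] z[of "axis i 1"] z[of "axis j 1"] G_nth_sym[OF x, of i j]
      by (simp add: matrix_vector_right_distrib inner_add_left inner_add_right entry)
    then have "G x = 0" by (simp add: vec_eq_iff)
    then have "G x ** H x = 0" by (simp add: matrix_matrix_mult_def vec_eq_iff)
    then have "mat 1 = (0 :: real^'n^'n)" using GH(1)[OF x] by simp
    then have "mat 1 $ i $ i = (0 :: real^'n^'n) $ i $ i" for i by simp
    then show False by (simp add: mat_def)
  qed
  then show ?thesis using that by blast
qed

lemma ricci_proportional:
  assumes x: "x \<in> S"
    and circ: "\<And>v. v \<bullet> (G x *v v) \<noteq> 0 \<Longrightarrow> skew_pair (H x *v (v v* ricci S G x)) v = 0"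
  obtains f where "ricci S G x = f *\<^sub>R G x"
proof -
  define T where "T = H x ** transpose (ricci S G x)"
  have T: "H x *v (v v* ricci S G x) = T *v v" for v
    by (simp add: T_def matrix_vector_mul_assoc[symmetric])
  define P where "P = (\<lambda>a b v. (T *v v) $ a * v $ b - (T *v v) $ b * v $ a)"
  have P0: "P a b v = 0" if "v \<bullet> (G x *v v) \<noteq> 0" for a b v
    using circ[OF that] unfolding T by (simp add: skew_pair_def P_def vec_eq_iff)
  obtain w where w: "w \<bullet> (G x *v w) \<noteq> 0" by (rule nonnull_exists[OF x])
  have "P a b v = 0" for a b v
  proof (cases "v \<bullet> (G x *v v) = 0")
    case True
    \<comment> \<open>For null \<open>v\<close> the squared length of
      \<open>v + t *\<^sub>R w\<close> is a quadratic polynomial in \<open>t\<close> with roots 0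
      and \<tau>. All other small \<open>t\<close> give non-null vectors, and \<open>t\<close> tends
      to 0.\<close>
    define \<tau> where "\<tau> = - (v \<bullet> (G x *v w) + w \<bullet> (G x *v v)) / (w \<bullet> (G x *v w))"
    have nn: "(v + t *\<^sub>R w) \<bullet> (G x *v (v + t *\<^sub>R w)) \<noteq> 0" if "t \<noteq> 0" "t \<noteq> \<tau>" for t
    proof
      assume "(v + t *\<^sub>R w) \<bullet> (G x *v (v + t *\<^sub>R w)) = 0"
      then have "t * (v \<bullet> (G x *v w) + w \<bullet> (G x *v v) + t * (w \<bullet> (G x *v w))) = 0"
        using True by (simp add: matrix_vector_right_distrib matrix_vector_mult_scaleR inner_add_left inner_add_right algebra_simps)
      then have "v \<bullet> (G x *v w) + w \<bullet> (G x *v v) + t * (w \<bullet> (G x *v w)) = 0"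
        using that(1) by (simp only: mult_eq_0_iff) simp
      then have "t * (w \<bullet> (G x *v w)) = - (v \<bullet> (G x *v w) + w \<bullet> (G x *v v))" by linarith
      then have "t = \<tau>" using w unfolding \<tau>_def by (subst eq_divide_eq) simp
      then show False using that by simp
    qed
    have "\<forall>\<^sub>F t in at 0. t \<noteq> 0 \<and> t \<noteq> \<tau>"
      by (intro eventually_conj eventually_neq_at_within)
    then have "\<forall>\<^sub>F t in at 0. P a b (v + t *\<^sub>R w) = 0"
      by eventually_elim (use nn P0 in auto)
    then have l0: "((\<lambda>t. P a b (v + t *\<^sub>R w)) \<longlongrightarrow> 0) (at 0)"
      by (rule tendsto_eventually)
    have "((\<lambda>t. P a b (v + t *\<^sub>R w)) \<longlongrightarrow> P a b (v + 0 *\<^sub>R w)) (at 0)"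
      unfolding P_def matrix_vector_right_distrib matrix_vector_mult_scaleR
      by (intro tendsto_intros)
    then show ?thesis using tendsto_unique[OF _ l0] by force
  qed (rule P0)
  then have "(T *v v) $ a * v $ b = (T *v v) $ b * v $ a" for a b v by (simp add: P_def)
  then obtain f where f: "T = f *\<^sub>R mat 1" by (rule scalar_matrix)
  have "transpose (ricci S G x) = G x ** T"
    by (simp add: T_def matrix_mul_assoc GH[OF x])
  also have "\<dots> = f *\<^sub>R G x" unfolding f by (simp add: matrix_scaleR_distribs)
  finally have "transpose (transpose (ricci S G x)) = f *\<^sub>R transpose (G x)" by (simp only: transpose_scaleR)
  then have "ricci S G x = f *\<^sub>R G x" by (simp add: sym_G[OF x])
  then show ?thesis by (rule that)
qed

end

section \<open>Metrics on a region of a manifold\<close>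

lemma smooth_on_Pair:
  fixes f :: "'a::euclidean_space \<Rightarrow> 'b::real_normed_vector" and g :: "'a \<Rightarrow> 'c::real_normed_vector"
  assumes "rich S" "smooth_on S f" "smooth_on S g"
  shows "smooth_on S (\<lambda>x. (f x, g x))"
proof -
  have 1: "bounded_linear (\<lambda>y::'b. (y, 0::'c))" "bounded_linear (\<lambda>z::'c. (0::'b, z))"
    by (intro bounded_linear_Pair bounded_linear_ident bounded_linear_zero)+
  have "smooth_on S (\<lambda>x. (f x, 0) + (0, g x))"
    by (intro smooth_on_add smooth_on_bounded_linear[OF 1(1)] smooth_on_bounded_linear[OF 1(2)] assms)
  then show ?thesis by simp
qed

lemma curve_facts:
  fixes A :: "('a, 'n::finite) chart set"
  assumes at: "atlas M A" and \<gamma>: "curve M A I \<gamma>" and c: "c \<in> A"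
  shows "rich I" "openin (top_of_set I) {t\<in>I. \<gamma> t \<in> fst c}" "rich {t\<in>I. \<gamma> t \<in> fst c}"
    "smooth_on {t\<in>I. \<gamma> t \<in> fst c} (snd c \<circ> \<gamma>)" "(snd c \<circ> \<gamma>) ` {t\<in>I. \<gamma> t \<in> fst c} \<subseteq> img c"
    "open (domain U c) \<Longrightarrow> openin (top_of_set I) {t\<in>I. \<gamma> t \<in> fst c \<inter> U}"
proof -
  note cf = chart_facts[OF atlas_chart(1)[OF at c]]
  show I: "rich I" using \<gamma> rich_interval by (auto simp: curve_def)
  show J: "openin (top_of_set I) {t\<in>I. \<gamma> t \<in> fst c}"
    using \<gamma> cf(1) by (intro curve_times_openin) (auto simp: curve_def)
  show "rich {t\<in>I. \<gamma> t \<in> fst c}" by (rule rich_openin[OF I J])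
  show sm: "smooth_on {t\<in>I. \<gamma> t \<in> fst c} (snd c \<circ> \<gamma>)" using \<gamma> c by (auto simp: curve_def)
  show "(snd c \<circ> \<gamma>) ` {t\<in>I. \<gamma> t \<in> fst c} \<subseteq> img c" using cf(10) by auto
  assume o: "open (domain U c)"
  have "openin (top_of_set {t\<in>I. \<gamma> t \<in> fst c}) ({t\<in>I. \<gamma> t \<in> fst c} \<inter> (snd c \<circ> \<gamma>) -` domain U c)"
    by (rule continuous_openin_preimage_gen[OF smooth_on_continuous_on[OF sm] o])
  moreover have "{t\<in>I. \<gamma> t \<in> fst c} \<inter> (snd c \<circ> \<gamma>) -` domain U c = {t\<in>I. \<gamma> t \<in> fst c \<inter> U}"
    using cf(3) by (auto simp: domain_def dest: inj_onD)
  ultimately have "openin (top_of_set {t\<in>I. \<gamma> t \<in> fst c}) {t\<in>I. \<gamma> t \<in> fst c \<inter> U}" by simp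
  then show "openin (top_of_set I) {t\<in>I. \<gamma> t \<in> fst c \<inter> U}" by (rule openin_trans[OF _ J])
qed

text \<open>One setting for both statements: the region is the whole manifold with its metric, or
  the interior of a compactification with the interior metric, which does not extend to the
  boundary.\<close>

locale metric_region =
  fixes M :: "'a topology" and A :: "('a, 'n::finite) chart set" and U :: "'a set" and K :: "('a, 'n) bilinear_field"
  assumes at: "atlas M A"
    and metric: "\<And>c. c \<in> A \<Longrightarrow> metric_on (domain U c) (K c)"
    and compatible: "\<And>c d x. c \<in> A \<Longrightarrow> d \<in> A \<Longrightarrow> x \<in> domain U c \<inter> overlap c d \<Longrightarrow>
       K c x = transpose (jacobian c d x) ** K d (transition c d x) ** jacobian c d x"
begin

lemma open_domain: "c \<in> A \<Longrightarrow> open (domain U c)"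
  using metric metric_on.open_S by blast

lemma domain_img: "domain U c \<subseteq> img c" by (auto simp: domain_def img_def)

lemma openin_domain: "c \<in> A \<Longrightarrow> openin (top_of_set (img c)) (domain U c)"
  by (rule open_subset[OF domain_img open_domain])

lemma change:
  assumes c: "c \<in> A" and d: "d \<in> A"
  shows "coordinate_change (domain U c \<inter> overlap c d) (K c) (domain U d) (K d) (transition c d) (jacobian c d)"
proof -
  note cf = chart_facts[OF atlas_chart(1)[OF at c]] and df = chart_facts[OF atlas_chart(1)[OF at d]]
  interpret mc: metric_on "domain U c" "K c" by (rule metric[OF c])
  interpret md: metric_on "domain U d" "K d" by (rule metric[OF d])
  let ?S = "domain U c \<inter> overlap c d"
  have "openin (top_of_set (img c)) (overlap c d)" unfolding overlap_def by (rule cf(7)[OF df(1)])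
  then obtain V where V: "open V" "overlap c d = img c \<inter> V" by (auto simp: openin_open)
  have "?S = domain U c \<inter> V" using V(2) domain_img by blast
  then have oS: "open ?S" using V(1) mc.open_S by auto
  have oSc: "openin (top_of_set (domain U c)) ?S" by (rule open_subset[OF _ oS]) auto
  have oSo: "openin (top_of_set (overlap c d)) ?S" by (rule open_subset[OF _ oS]) auto
  have sm: "smooth_on ?S (transition c d)" by (rule smooth_on_openin[OF oSo atlas_chart(2)[OF at c d]])
  show ?thesis
  proof
    show "open ?S" by (rule oS)
    show "smooth_on ?S (K c)" by (rule smooth_on_openin[OF oSc mc.smooth_G])
    show "transpose (K c x) = K c x" "det (K c x) \<noteq> 0" if "x \<in> ?S" for x
      using that mc.sym_G mc.det_G by auto
    show "smooth_on ?S (transition c d)" by (rule sm)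
    show "transition c d ` ?S \<subseteq> domain U d"
    proof
      fix z assume "z \<in> transition c d ` ?S"
      then obtain p q where pq: "p \<in> fst c \<inter> U" "q \<in> fst c \<inter> fst d" "snd c p = snd c q" "z = transition c d (snd c p)"
        by (auto simp: domain_def overlap_def)
      then have "p = q" using cf(3) by (auto dest: inj_onD)
      then show "z \<in> domain U d" using pq cf(4) by (auto simp: domain_def transition_def)
    qed
    show "jacobian c d x = (\<chi> a i. partial ?S i (\<lambda>z. transition c d z $ a) x)" if x: "x \<in> ?S" for x
    proof -
      have "at x within overlap c d = at x within ?S" using at_within_openin[OF oSo x] ..
      then show ?thesis
        unfolding jacobian_def matrix_def partial_nth[OF rich_open[OF oS] x sm] by simp
    qed
    show "K c x = transpose (jacobian c d x) ** K d (transition c d x) ** jacobian c d x" if "x \<in> ?S" for x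
      by (rule compatible[OF c d that])
  qed
qed

text \<open>The geodesic equation is solved as a first order system in one chart and then
  transferred to all others by \<open>covariant_transform\<close>. A one-sided time interval
  suffices, since the circle equation is later evaluated at its initial time.\<close>

lemma geodesic_exists:
  assumes c: "c \<in> A" and x: "x \<in> domain U c" and v: "v \<bullet> (K c x *v v) \<noteq> 0"
  obtains T \<gamma> where "T > 0" "curve M A {0..T} \<gamma>" "\<gamma> ` {0..T} \<subseteq> fst c \<inter> U" "snd c (\<gamma> 0) = x" "velocity {0..T} (snd c \<circ> \<gamma>) 0 = v"
    "\<And>d t. d \<in> A \<Longrightarrow> t \<in> {0..T} \<Longrightarrow> \<gamma> t \<in> fst d \<Longrightarrow>
       cov_vector (domain U d) (K d) {0..T} (snd d \<circ> \<gamma>) 0 (velocity {0..T} (snd d \<circ> \<gamma>)) t = 0"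
    "\<And>d t. d \<in> A \<Longrightarrow> t \<in> {0..T} \<Longrightarrow> \<gamma> t \<in> fst d \<Longrightarrow>
       velocity {0..T} (snd d \<circ> \<gamma>) t \<bullet> (K d (snd d (\<gamma> t)) *v velocity {0..T} (snd d \<circ> \<gamma>) t) \<noteq> 0"
proof -
  note cf = chart_facts[OF atlas_chart(1)[OF at c]]
  interpret mc: metric_on "domain U c" "K c" by (rule metric[OF c])
  let ?S = "domain U c"
  \<comment> \<open>Non-nullity is built into the open phase space, so it holds along the whole
    solution without a conservation law.\<close>
  define E where "E = {z. fst z \<in> ?S \<and> snd z \<bullet> (K c (fst z) *v snd z) \<noteq> 0}"
  define f where "f = (\<lambda>z :: (real^'n) \<times> (real^'n). (snd z, - (connv ?S (K c) (snd z) (fst z) *v snd z)))"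
  have oE0: "open (?S \<times> (UNIV :: (real^'n) set))" by (intro open_Times mc.open_S open_UNIV)
  have smfst: "smooth_on X fst" "smooth_on X snd" if "rich X" for X :: "((real^'n) \<times> (real^'n)) set"
    using smooth_on_bounded_linear[OF bounded_linear_fst that smooth_on_ident[OF that]]
      smooth_on_bounded_linear[OF bounded_linear_snd that smooth_on_ident[OF that]] by auto
  have comp: "smooth_on X (\<lambda>z. F (fst z))" if "rich X" "X \<subseteq> ?S \<times> UNIV" "smooth_on ?S F"
    for X :: "((real^'n) \<times> (real^'n)) set" and F :: "real^'n \<Rightarrow> 'c::real_normed_vector"
    using that by (intro smooth_on_compose[OF that(1) mc.rich_S _ smfst(1)[OF that(1)] that(3)]) auto
  have "continuous_on (?S \<times> UNIV) (\<lambda>z. snd z \<bullet> (K c (fst z) *v snd z))"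
    by (intro smooth_on_continuous_on smooth_on_inner smooth_on_matvec smfst comp mc.smooth_G rich_open oE0) auto
  from continuous_open_preimage[OF this oE0, of "- {0}"]
  have "open ((?S \<times> UNIV) \<inter> (\<lambda>z. snd z \<bullet> (K c (fst z) *v snd z)) -` (- {0}))" by auto
  moreover have "(?S \<times> UNIV) \<inter> (\<lambda>z. snd z \<bullet> (K c (fst z) *v snd z)) -` (- {0}) = E"
    by (auto simp: E_def)
  ultimately have oE: "open E" by simp
  have rE: "rich E" by (rule rich_open[OF oE])
  have Esub: "E \<subseteq> ?S \<times> UNIV" by (auto simp: E_def)
  have smf: "smooth_on E f"
    unfolding f_def connv_def
    by (intro smooth_on_Pair smooth_on_uminus smooth_on_matvec smooth_on_sum smooth_on_scaleR smooth_on_nth smfst comp mc.smooth_\<Gamma> rE Esub)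
  have "(x, v) \<in> E" using x v by (simp add: E_def)
  then obtain T z where T: "T > 0" "z 0 = (x, v)" "z ` {0..T} \<subseteq> E"
    and dz: "\<And>t. t \<in> {0..T} \<Longrightarrow> (z has_vector_derivative f (z t)) (at t within {0..T})"
    using ode_exists[OF oE smf] by metis
  let ?I = "{0..T}"
  have rI: "rich ?I" by (rule rich_interval) (use T in auto)
  have smz: "smooth_on ?I z" by (rule ode_smooth[OF rI rE smf T(3) dz])
  define y where "y = (\<lambda>t. fst (z t))"
  define w where "w = (\<lambda>t. snd (z t))"
  have smy: "smooth_on ?I y" unfolding y_def by (rule smooth_on_bounded_linear[OF bounded_linear_fst rI smz])
  have dy: "(y has_vector_derivative w t) (at t within ?I)" if "t \<in> ?I" for t
    using bounded_linear.has_vector_derivative[OF bounded_linear_fst dz[OF that]] by (simp add: y_def w_def f_def)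
  have dw: "(w has_vector_derivative - (connv ?S (K c) (w t) (y t) *v w t)) (at t within ?I)" if "t \<in> ?I" for t
    using bounded_linear.has_vector_derivative[OF bounded_linear_snd dz[OF that]] by (simp add: y_def w_def f_def)
  have vel: "velocity ?I y t = w t" if "t \<in> ?I" for t
    unfolding velocity_def by (rule rich_vector_derivative[OF rI that dy[OF that]])
  have yS: "y t \<in> ?S" and wn: "w t \<bullet> (K c (y t) *v w t) \<noteq> 0" if "t \<in> ?I" for t
  proof -
    have "z t \<in> E" using T(3) that by blast
    then show "y t \<in> ?S" "w t \<bullet> (K c (y t) *v w t) \<noteq> 0" by (simp_all add: E_def y_def w_def)
  qed
  have cov0: "cov_vector ?S (K c) ?I y 0 (velocity ?I y) t = 0" if t: "t \<in> ?I" for t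
    using vector_derivative_cong_on[of t ?I "velocity ?I y" w, OF t vel] rich_vector_derivative[OF rI t dw[OF t]]
    unfolding cov_vector_0 vel[OF t] by simp
  define \<gamma> where "\<gamma> = (\<lambda>t. chart_inv c (y t))"
  have \<gamma>in: "\<gamma> t \<in> fst c \<inter> U" "snd c (\<gamma> t) = y t" if "t \<in> ?I" for t
    using yS[OF that] cf(4) by (auto simp: domain_def \<gamma>_def)
  have \<gamma>d: "snd d \<circ> \<gamma> = (\<lambda>t. transition c d (y t))" for d
    by (auto simp: \<gamma>_def transition_def)
  have contM: "continuous_map (top_of_set ?I) M \<gamma>"
  proof -
    have "continuous_map (top_of_set ?I) (top_of_set (img c)) y"
      using smooth_on_continuous_on[OF smy] yS domain_img[of c] by (auto simp: subset_iff)
    from continuous_map_compose[OF this cf(8)] show ?thesis by (simp add: \<gamma>_def comp_def)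
  qed
  \<comment> \<open>The times at which the curve lies in the domain of \<open>d\<close> form a
    relatively open set; the derivatives within it are those within the whole interval.\<close>
  have chart: "smooth_on {t\<in>?I. \<gamma> t \<in> fst d} (snd d \<circ> \<gamma>)
      \<and> (\<forall>t\<in>?I. \<gamma> t \<in> fst d \<longrightarrow> velocity ?I (snd d \<circ> \<gamma>) t \<bullet> (K d (snd d (\<gamma> t)) *v velocity ?I (snd d \<circ> \<gamma>) t) \<noteq> 0
         \<and> cov_vector (domain U d) (K d) ?I (snd d \<circ> \<gamma>) 0 (velocity ?I (snd d \<circ> \<gamma>)) t = 0)" if d: "d \<in> A" for d
  proof -
    note df = chart_facts[OF atlas_chart(1)[OF at d]]
    interpret ch: coordinate_change "domain U c \<inter> overlap c d" "K c" "domain U d" "K d" "transition c d" "jacobian c d"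
      by (rule change[OF c d])
    let ?J = "{t\<in>?I. \<gamma> t \<in> fst d}"
    have oJ: "openin (top_of_set ?I) ?J" by (rule curve_times_openin[OF contM df(1)])
    have rJ: "rich ?J" by (rule rich_openin[OF rI oJ])
    have yJ: "y ` ?J \<subseteq> domain U c \<inter> overlap c d"
    proof
      fix q assume "q \<in> y ` ?J"
      then obtain t where t: "t \<in> ?I" "\<gamma> t \<in> fst d" "q = y t" by auto
      then show "q \<in> domain U c \<inter> overlap c d" using yS \<gamma>in[OF t(1)] by (force simp: overlap_def)
    qed
    have smyJ: "smooth_on ?J y" by (rule smooth_on_openin[OF oJ smy])
    have sm: "smooth_on ?J (snd d \<circ> \<gamma>)"
      unfolding \<gamma>d by (rule smooth_on_compose[OF rJ ch.m.rich_S yJ smyJ ch.smooth_\<psi>])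
    have "velocity ?I (snd d \<circ> \<gamma>) t \<bullet> (K d (snd d (\<gamma> t)) *v velocity ?I (snd d \<circ> \<gamma>) t) \<noteq> 0
         \<and> cov_vector (domain U d) (K d) ?I (snd d \<circ> \<gamma>) 0 (velocity ?I (snd d \<circ> \<gamma>)) t = 0" if t: "t \<in> ?J" for t
    proof -
      have tI: "t \<in> ?I" using t by auto
      have yt: "y t \<in> domain U c \<inter> overlap c d" using yJ t by auto
      have at_eq: "at t within ?J = at t within ?I" by (rule at_within_openin[OF oJ t])
      have velJ: "velocity ?J y s = velocity ?I y s" "velocity ?J (snd d \<circ> \<gamma>) s = velocity ?I (snd d \<circ> \<gamma>) s" if "s \<in> ?J" for s
        by (simp_all add: velocity_openin[OF oJ that])
      have dyJ: "(y has_vector_derivative w t) (at t within ?J)" unfolding at_eq by (rule dy[OF tI])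
      have veld: "velocity ?I (snd d \<circ> \<gamma>) t = jacobian c d (y t) *v w t"
        unfolding velJ(2)[OF t, symmetric] unfolding velocity_def \<gamma>d
        by (rule rich_vector_derivative[OF rJ t ch.velocity_transform[OF rJ t yJ dyJ]])
      have sd: "snd d (\<gamma> t) = transition c d (y t)" by (simp add: \<gamma>_def transition_def)
      have "cov_vector (domain U c \<inter> overlap c d) (K c) ?J y 0 (velocity ?J y) t
        = cov_vector ?S (K c) ?I y 0 (velocity ?J y) t"
        by (rule cov_vector_local[where G = "K c" and K = "K c" and y = y, OF oJ t _ yt, symmetric])
           (auto intro!: open_subset ch.m.open_S)
      also have "\<dots> = cov_vector ?S (K c) ?I y 0 (velocity ?I y) t"
        using vector_derivative_cong_on[of t ?J "velocity ?J y" "velocity ?I y", OF t velJ(1)] velJ(1)[OF t]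
        unfolding cov_vector_0 at_eq by simp
      also have "\<dots> = 0" by (rule cov0[OF tI])
      finally have "cov_vector (domain U d) (K d) ?J (snd d \<circ> \<gamma>) 0 (velocity ?J (snd d \<circ> \<gamma>)) t = 0"
        unfolding \<gamma>d ch.covariant_transform[OF rJ t yJ smyJ] by simp
      moreover have "cov_vector (domain U d) (K d) ?J (snd d \<circ> \<gamma>) 0 (velocity ?J (snd d \<circ> \<gamma>)) t
         = cov_vector (domain U d) (K d) ?I (snd d \<circ> \<gamma>) 0 (velocity ?I (snd d \<circ> \<gamma>)) t"
        using vector_derivative_cong_on[of t ?J "velocity ?J (snd d \<circ> \<gamma>)" "velocity ?I (snd d \<circ> \<gamma>)", OF t velJ(2)] velJ(2)[OF t]
        unfolding cov_vector_0 at_eq by simp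
      moreover have "velocity ?I (snd d \<circ> \<gamma>) t \<bullet> (K d (snd d (\<gamma> t)) *v velocity ?I (snd d \<circ> \<gamma>) t) \<noteq> 0"
        unfolding veld sd ch.norm_transform[OF yt] by (rule wn[OF tI])
      ultimately show ?thesis by simp
    qed
    then show ?thesis using sm by blast
  qed
  have curve: "curve M A ?I \<gamma>"
    unfolding curve_def
  proof (intro conjI ballI impI)
    show "is_interval ?I" "interior ?I \<noteq> {}" using T by auto
    show "continuous_map (top_of_set ?I) M \<gamma>" by (rule contM)
    fix d assume d: "d \<in> A"
    show "smooth_on {t\<in>?I. \<gamma> t \<in> fst d} (snd d \<circ> \<gamma>)" using chart[OF d] by blast
    fix t assume "t \<in> ?I" "\<gamma> t \<in> fst d"
    then have "velocity ?I (snd d \<circ> \<gamma>) t \<bullet> (K d (snd d (\<gamma> t)) *v velocity ?I (snd d \<circ> \<gamma>) t) \<noteq> 0"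
      using chart[OF d] by blast
    then have "velocity ?I (snd d \<circ> \<gamma>) t \<noteq> 0" by auto
    then show "vector_derivative (snd d \<circ> \<gamma>) (at t within ?I) \<noteq> 0" by (simp add: velocity_def)
  qed
  have I0: "0 \<in> ?I" using T(1) by simp
  have "velocity ?I (snd c \<circ> \<gamma>) 0 = velocity ?I y 0"
    unfolding velocity_def by (rule vector_derivative_cong_on[OF I0]) (simp add: \<gamma>in)
  then have v0: "velocity ?I (snd c \<circ> \<gamma>) 0 = v" using vel[OF I0] T(2) by (simp add: w_def)
  have y0: "snd c (\<gamma> 0) = x" using \<gamma>in(2)[OF I0] T(2) by (simp add: y_def)
  show ?thesis
    by (rule that[OF T(1) curve _ y0 v0]) (use \<gamma>in chart in blast)+
qed

end

lemma cov_velocity_openin: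
  assumes "openin (top_of_set I) J" "t \<in> J"
  shows "cov_vector S G I y 0 (velocity I y) t = cov_vector S G J y 0 (velocity J y) t"
proof -
  have at_eq: "at t within J = at t within I" by (rule at_within_openin[OF assms])
  have v: "velocity I y s = velocity J y s" if "s \<in> J" for s by (rule velocity_openin[OF assms(1) that])
  show ?thesis
    using vector_derivative_cong_on[of t J "velocity I y" "velocity J y", OF assms(2) v] v[OF assms(2)]
    unfolding cov_vector_0 at_eq by simp
qed

lemma (in curve_in_metric) unit_form_nonzero: "t \<in> J \<Longrightarrow> u t \<bullet> unit_form G J y t \<noteq> 0"
  using s_pos[of t] q_pos[of t] nonnull[of t] by (simp add: unit_form_eq gue sgn_zero_iff)

lemma metric_on_subset:
  assumes "rich X" "smooth_on X G" "\<And>x. x \<in> X \<Longrightarrow> transpose (G x) = G x" "\<And>x. x \<in> X \<Longrightarrow> det (G x) \<noteq> 0"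
    "open S" "S \<subseteq> X"
  shows "metric_on S G"
  by standard (use assms smooth_on_openin[OF open_subset[OF assms(6,5)] assms(2)] in auto)

text \<open>The determinant scales by \<open>c ^ n\<close>, and the exponent
  \<open>- 1 / (2 n)\<close> turns this into the power \<open>- 1 / 2\<close>, whose square cancels
  the factor \<open>c\<close>.\<close>

lemma conf_metric_rescale:
  fixes G F :: "real^'n::finite \<Rightarrow> real^'n^'n"
  assumes "c > 0" "G x = c *\<^sub>R F x"
  shows "scale_density G x = c powr (- 1 / 2) * scale_density F x" "conf_metric G x = conf_metric F x"
proof -
  have "(c ^ CARD('n)) powr (- 1 / (2 * real CARD('n))) = c powr (- 1 / 2)"
    using assms(1) by (simp add: powr_realpow[symmetric] powr_powr)
  then show s: "scale_density G x = c powr (- 1 / 2) * scale_density F x"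
    using assms by (simp add: scale_density_def det_scaleR abs_mult powr_mult)
  have "(c powr (- 1 / 2))\<^sup>2 * c = 1"
    using assms(1) powr_add[of c "- 1 / 2" "- 1 / 2"] by (simp add: power2_eq_square powr_minus_divide)
  then show "conf_metric G x = conf_metric F x"
    unfolding conf_metric_def s assms(2) by (simp add: power_mult_distrib mult_ac)
qed

section \<open>Passage from chart domains to the manifold\<close>

context metric_region
begin

text \<open>The factors found in single charts agree on overlaps because the Ricci tensor and the
  metric pull back alike. They form one function on the interior, with zero derivative by the
  Bianchi identity.\<close>

lemma einstein_global:
  assumes M: "connected_manifold_with_boundary M A" and U: "U = manifold_interior M A" and n: "CARD('n) \<ge> 3"
    and ric_prop: "\<And>c x. c \<in> A \<Longrightarrow> x \<in> domain U c \<Longrightarrow> \<exists>f. ricci (domain U c) (K c) x = f *\<^sub>R K c x"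
  obtains k where "\<And>c x. c \<in> A \<Longrightarrow> x \<in> domain U c \<Longrightarrow> ricci (domain U c) (K c) x = k *\<^sub>R K c x"
proof -
  \<comment> \<open>The trace is an explicit formula for the factor of proportionality, from which
    its smoothness can be read off.\<close>
  define f where "f = (\<lambda>c x. trace (matrix_inv (K c x) ** ricci (domain U c) (K c) x) / real CARD('n))"
  have ric: "ricci (domain U c) (K c) x = f c x *\<^sub>R K c x" if c: "c \<in> A" and x: "x \<in> domain U c" for c x
  proof -
    interpret m: metric_on "domain U c" "K c" by (rule metric[OF c])
    obtain l where l: "ricci (domain U c) (K c) x = l *\<^sub>R K c x" using ric_prop[OF c x] by blast
    have "f c x = l" unfolding f_def l by (simp add: matrix_scaleR_distribs m.GH[OF x] trace_def mat_def)
    then show ?thesis using l by simp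
  qed
  have smf: "smooth_on (domain U c) (f c)" if c: "c \<in> A" for c
  proof -
    interpret m: metric_on "domain U c" "K c" by (rule metric[OF c])
    show ?thesis
      unfolding f_def trace_def
      by (intro smooth_on_divide_const smooth_on_sum smooth_on_entry smooth_on_matmul m.smooth_H
          smooth_on_ricci m.smooth_G m.det_G m.rich_S)
  qed
  have agree: "f c (snd c p) = f d (snd d p)" if c: "c \<in> A" "p \<in> fst c" and d: "d \<in> A" "p \<in> fst d" and p: "p \<in> U" for c d p
  proof -
    interpret ch: coordinate_change "domain U c \<inter> overlap c d" "K c" "domain U d" "K d" "transition c d" "jacobian c d"
      by (rule change[OF c(1) d(1)])
    have x: "snd c p \<in> domain U c \<inter> overlap c d" using c d p by (auto simp: domain_def overlap_def)
    have tr: "transition c d (snd c p) = snd d p"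
      using chart_facts(4)[OF atlas_chart(1)[OF at c(1)] c(2)] by (simp add: transition_def)
    have dp: "snd d p \<in> domain U d" using d p by (auto simp: domain_def)
    have "ricci (domain U c) (K c) (snd c p) = ricci (domain U c \<inter> overlap c d) (K c) (snd c p)"
      by (rule ricci_local[OF open_subset[OF _ ch.m.open_S] x]) auto
    also have "\<dots> = transpose (jacobian c d (snd c p)) ** (f d (snd d p) *\<^sub>R K d (snd d p)) ** jacobian c d (snd c p)"
      unfolding ch.ricci_pullback[OF x] tr ric[OF d(1) dp] ..
    also have "\<dots> = f d (snd d p) *\<^sub>R K c (snd c p)"
      unfolding ch.pullback[OF x] tr by (simp add: matrix_scaleR_distribs)
    finally have eq: "f c (snd c p) *\<^sub>R K c (snd c p) = f d (snd d p) *\<^sub>R K c (snd c p)"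
      using ric[OF c(1)] x by simp
    have "K c (snd c p) \<noteq> 0"
      using ch.m.nonnull_exists[OF x] by (metis inner_zero_right matrix_vector_mult_0)
    then show ?thesis using eq by simp
  qed
  \<comment> \<open>The chart is picked separately at each point; by \<open>agree\<close> the value
    does not depend on the choice, so near any point it may be computed in a fixed chart.\<close>
  define F where "F = (\<lambda>p. f (SOME c. c \<in> A \<and> p \<in> fst c) (snd (SOME c. c \<in> A \<and> p \<in> fst c) p))"
  have F: "F p = f c (snd c p)" if "c \<in> A" "p \<in> fst c" "p \<in> U" for c p
  proof -
    have "(SOME c. c \<in> A \<and> p \<in> fst c) \<in> A \<and> p \<in> fst (SOME c. c \<in> A \<and> p \<in> fst c)"
      by (rule someI[of _ c]) (use that in auto)
    then show ?thesis unfolding F_def using agree that by blast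
  qed
  have dF: "((\<lambda>x. F (chart_inv c x)) has_derivative (\<lambda>v. 0)) (at x)" if c: "c \<in> A" and x: "x \<in> domain U c" for c x
  proof -
    interpret m: metric_on "domain U c" "K c" by (rule metric[OF c])
    have "partial (domain U c) i (f c) x = 0" for i
      by (rule m.einstein_function_locally_constant[OF smf[OF c] ric[OF c] n x])
    then have "frechet_derivative (f c) (at x within domain U c) v = 0" for v
      unfolding frechet_linear[OF smf[OF c] x, of v] by (simp add: partial_def)
    then have "(f c has_derivative (\<lambda>v. 0)) (at x within domain U c)"
      using smooth_on_has_derivative[OF smf[OF c] x] by (auto elim!: has_derivative_eq_rhs)
    then have "(f c has_derivative (\<lambda>v. 0)) (at x)"
      using at_within_open[OF x m.open_S] by simp
    then show ?thesis
    proof (rule has_derivative_transform_within_open[OF _ m.open_S x])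
      fix z assume "z \<in> domain U c"
      then obtain p where "p \<in> fst c" "p \<in> U" "z = snd c p" by (auto simp: domain_def)
      then show "f c z = F (chart_inv c z)"
        using F[OF c] chart_facts(4)[OF atlas_chart(1)[OF at c]] by simp
    qed
  qed
  obtain k where k: "\<And>p. p \<in> U \<Longrightarrow> F p = k"
    using constant_on_interior[OF M dF[unfolded U]] U by metis
  show ?thesis
  proof (rule that)
    fix c x assume c: "c \<in> A" and x: "x \<in> domain U c"
    then obtain p where "p \<in> fst c" "p \<in> U" "x = snd c p" by (auto simp: domain_def)
    then have "f c x = k" using F[OF c] k by simp
    then show "ricci (domain U c) (K c) x = k *\<^sub>R K c x" using ric[OF c x] by simp
  qed
qed

lemma curve_in_region:
  fixes \<gamma> I c
  defines "J \<equiv> {t\<in>I. \<gamma> t \<in> fst c \<inter> U}"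
  assumes c: "c \<in> A" and \<gamma>: "curve M A I \<gamma>" and G: "metric_on (domain U c) G"
    and nn: "\<And>t. t \<in> J \<Longrightarrow> velocity I (snd c \<circ> \<gamma>) t \<bullet> (G (snd c (\<gamma> t)) *v velocity I (snd c \<circ> \<gamma>) t) \<noteq> 0"
  shows "openin (top_of_set I) J" "curve_in_metric (domain U c) G J (snd c \<circ> \<gamma>)"
proof -
  note cu = curve_facts[OF at \<gamma> c]
  show J: "openin (top_of_set I) J" unfolding J_def by (rule cu(6)[OF open_domain[OF c]])
  have "openin (top_of_set {t\<in>I. \<gamma> t \<in> fst c}) J"
    by (rule openin_subset_trans[OF J]) (auto simp: J_def)
  then have sm: "smooth_on J (snd c \<circ> \<gamma>)" by (rule smooth_on_openin[OF _ cu(4)])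
  interpret m: metric_on "domain U c" G by (rule G)
  show "curve_in_metric (domain U c) G J (snd c \<circ> \<gamma>)"
  proof
    show "rich J" by (rule rich_openin[OF cu(1) J])
    show "smooth_on J (snd c \<circ> \<gamma>)" by (rule sm)
    show "(snd c \<circ> \<gamma>) ` J \<subseteq> domain U c" by (auto simp: J_def domain_def)
    show "velocity J (snd c \<circ> \<gamma>) t \<bullet> (G ((snd c \<circ> \<gamma>) t) *v velocity J (snd c \<circ> \<gamma>) t) \<noteq> 0" if "t \<in> J" for t
      using nn[OF that] velocity_openin[OF J that, of "snd c \<circ> \<gamma>"] by simp
  qed
qed

lemma circle_iff:
  assumes c: "c \<in> A" and \<gamma>: "curve M A I \<gamma>" and t0: "t0 \<in> I" "\<gamma> t0 \<in> fst c \<inter> U" and n: "CARD('n) \<ge> 3"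
    and \<phi>: "smooth_on (domain U c) \<phi>" "\<And>x. x \<in> domain U c \<Longrightarrow> \<phi> x > 0"
    and h: "\<And>x. x \<in> domain U c \<Longrightarrow> h x = \<phi> x *\<^sub>R K c x"
    and nn: "\<And>t. t \<in> I \<Longrightarrow> \<gamma> t \<in> fst c \<inter> U \<Longrightarrow> velocity I (snd c \<circ> \<gamma>) t \<bullet> (K c (snd c (\<gamma> t)) *v velocity I (snd c \<circ> \<gamma>) t) \<noteq> 0"
    and geo: "\<And>t. t \<in> I \<Longrightarrow> \<gamma> t \<in> fst c \<inter> U \<Longrightarrow>
      \<exists>k. cov_vector (domain U c) (K c) I (snd c \<circ> \<gamma>) 0 (velocity I (snd c \<circ> \<gamma>)) t = k *\<^sub>R velocity I (snd c \<circ> \<gamma>) t"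
  shows "conformal_circle_eq (img c) h I (snd c \<circ> \<gamma>) t0 \<longleftrightarrow>
    skew_pair (matrix_inv (K c (snd c (\<gamma> t0))) *v (velocity I (snd c \<circ> \<gamma>) t0 v* ricci (domain U c) (K c) (snd c (\<gamma> t0))))
      (velocity I (snd c \<circ> \<gamma>) t0) = 0"
proof -
  let ?J = "{t\<in>I. \<gamma> t \<in> fst c \<inter> U}" and ?y = "snd c \<circ> \<gamma>" and ?S = "domain U c"
  have J: "openin (top_of_set I) ?J" and cim: "curve_in_metric ?S (K c) ?J ?y"
    by (rule curve_in_region[OF c \<gamma> metric[OF c]], use nn in blast)+
  have t: "t0 \<in> ?J" using t0 by simp
  interpret curve_in_metric ?S "K c" ?J ?y by (rule cim)
  interpret geodesic_rescaled ?S "K c" ?J ?y \<phi>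
  proof
    show "smooth_on ?S \<phi>" "\<And>x. x \<in> ?S \<Longrightarrow> \<phi> x > 0" by (fact \<phi>)+
    show "\<exists>k. cov_vector ?S (K c) ?J ?y 0 (velocity ?J ?y) t = k *\<^sub>R velocity ?J ?y t" if "t \<in> ?J" for t
      using geo[of t] that cov_velocity_openin[OF J that, of ?S "K c" ?y] velocity_openin[OF J that, of ?y] by simp
  qed
  have "conformal_circle_eq (img c) h I ?y t0 \<longleftrightarrow> conformal_circle_eq ?S (\<lambda>z. \<phi> z *\<^sub>R K c z) ?J ?y t0"
    by (rule conformal_circle_eq_local[OF J t openin_domain[OF c] y_in h])
  also have "\<dots> \<longleftrightarrow> skew_pair (H (?y t0) *v (e t0 v* ricci ?S (K c) (?y t0))) (e t0) = 0"
    by (rule conformal_circle_iff[OF t n])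
  \<comment> \<open>The expression is quadratic in the direction, so passing from the unit velocity
    to the velocity changes it by a nonzero factor.\<close>
  also have "skew_pair (H (?y t0) *v (e t0 v* ricci ?S (K c) (?y t0))) (e t0)
     = (1 / q t0 * (1 / q t0)) *\<^sub>R skew_pair (H (?y t0) *v (velocity ?J ?y t0 v* ricci ?S (K c) (?y t0))) (velocity ?J ?y t0)"
    unfolding e_def scaleR_vector_matrix_mult matrix_vector_mult_scaleR skew_pair_scaleR ..
  finally show ?thesis
    using q_pos[OF t] velocity_openin[OF J t, of ?y] by (simp add: comp_def)
qed

lemma wedge_geodesic:
  assumes c: "c \<in> A" and \<gamma>: "curve M A I \<gamma>" and t0: "t0 \<in> I" "\<gamma> t0 \<in> fst c \<inter> U"
    and h: "metric_on (domain U c) h"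
    and \<rho>: "smooth_on (domain U c) \<rho>" "\<And>x. x \<in> domain U c \<Longrightarrow> \<rho> x \<noteq> 0"
    and K: "\<And>x. x \<in> domain U c \<Longrightarrow> K c x = (1 / (\<rho> x)\<^sup>2) *\<^sub>R h x"
    and \<sigma>: "\<And>x. x \<in> domain U c \<Longrightarrow> \<sigma> x = \<rho> x * scale_density h x"
    and nn: "\<And>t. t \<in> I \<Longrightarrow> \<gamma> t \<in> fst c \<inter> U \<Longrightarrow> velocity I (snd c \<circ> \<gamma>) t \<bullet> (h (snd c (\<gamma> t)) *v velocity I (snd c \<circ> \<gamma>) t) \<noteq> 0"
  shows "(\<forall>i. wedge_scale_three (img c) h \<sigma> I (snd c \<circ> \<gamma>) t0 i = 0) \<longleftrightarrow>
     (\<exists>k. cov_vector (domain U c) (K c) I (snd c \<circ> \<gamma>) 0 (velocity I (snd c \<circ> \<gamma>)) t0 = k *\<^sub>R velocity I (snd c \<circ> \<gamma>) t0)"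
proof -
  let ?J = "{t\<in>I. \<gamma> t \<in> fst c \<inter> U}" and ?y = "snd c \<circ> \<gamma>" and ?S = "domain U c"
  have J: "openin (top_of_set I) ?J" and cim: "curve_in_metric ?S h ?J ?y"
    by (rule curve_in_region[OF c \<gamma> h], use nn in blast)+
  have t: "t0 \<in> ?J" using t0 by simp
  interpret curve_in_metric ?S h ?J ?y by (rule cim)
  interpret curve_in_defining_scale ?S h ?J ?y \<rho>
    by standard (fact \<rho>)+
  have "(\<forall>i. wedge_scale_three (img c) h \<sigma> I ?y t0 i = 0) \<longleftrightarrow> (\<forall>i. wedge_scale_three (img c) h \<sigma> ?J ?y t0 i = 0)"
    unfolding wedge_scale_three_openin[OF J t] ..
  also have "\<dots> \<longleftrightarrow> (\<forall>i. wedge_scale_three ?S h \<sigma> ?J ?y t0 i = 0)"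
    by (rule wedge_scale_three_local[OF rich_J t openin_domain[OF c] y_S[OF t] refl y_in unit_form_nonzero[OF t]])
  also have "\<dots> \<longleftrightarrow> (\<exists>k. cov_vector ?S (\<lambda>z. (1 / (\<rho> z)\<^sup>2) *\<^sub>R h z) ?J ?y 0 (velocity ?J ?y) t0 = k *\<^sub>R velocity ?J ?y t0)"
    by (rule wedge_zero_iff_geodesic[OF t \<sigma>])
  also have "cov_vector ?S (\<lambda>z. (1 / (\<rho> z)\<^sup>2) *\<^sub>R h z) ?J ?y 0 (velocity ?J ?y) t0 = cov_vector ?S (K c) ?J ?y 0 (velocity ?J ?y) t0"
    by (rule cov_vector_local[where y = ?y and K = "K c" and G = "\<lambda>z. (1 / (\<rho> z)\<^sup>2) *\<^sub>R h z", OF _ t _ y_S[OF t] K[symmetric]]) auto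
  also have "\<dots> = cov_vector ?S (K c) I ?y 0 (velocity I ?y) t0"
    by (rule cov_velocity_openin[OF J t, symmetric])
  finally show ?thesis unfolding velocity_openin[OF J t, of ?y] .
qed

text \<open>The initial velocity of a geodesic is an arbitrary non-null vector, so the equation at
  time 0 tests all such directions. The premise supplies a metric \<open>h\<close> for each curve
  because \<open>conformal_circle\<close> only asserts that some metric in the class serves.\<close>

lemma geodesics_circles_imp_proportional:
  assumes c: "c \<in> A" and n: "CARD('n) \<ge> 3" and x: "x \<in> domain U c"
    and circ: "\<And>T \<gamma>. T > 0 \<Longrightarrow> curve M A {0..T} \<gamma> \<Longrightarrow> \<gamma> ` {0..T} \<subseteq> fst c \<inter> U \<Longrightarrow>
      (\<And>d t. d \<in> A \<Longrightarrow> t \<in> {0..T} \<Longrightarrow> \<gamma> t \<in> fst d \<Longrightarrow>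
         cov_vector (domain U d) (K d) {0..T} (snd d \<circ> \<gamma>) 0 (velocity {0..T} (snd d \<circ> \<gamma>)) t = 0) \<Longrightarrow>
      (\<And>d t. d \<in> A \<Longrightarrow> t \<in> {0..T} \<Longrightarrow> \<gamma> t \<in> fst d \<Longrightarrow>
         velocity {0..T} (snd d \<circ> \<gamma>) t \<bullet> (K d (snd d (\<gamma> t)) *v velocity {0..T} (snd d \<circ> \<gamma>) t) \<noteq> 0) \<Longrightarrow>
      \<exists>h \<phi>. smooth_on (domain U c) \<phi> \<and> (\<forall>z\<in>domain U c. \<phi> z > 0 \<and> h z = \<phi> z *\<^sub>R K c z)
        \<and> conformal_circle_eq (img c) h {0..T} (snd c \<circ> \<gamma>) 0"
  shows "\<exists>f. ricci (domain U c) (K c) x = f *\<^sub>R K c x"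
proof -
  interpret m: metric_on "domain U c" "K c" by (rule metric[OF c])
  have "skew_pair (m.H x *v (v v* ricci (domain U c) (K c) x)) v = 0" if v: "v \<bullet> (K c x *v v) \<noteq> 0" for v
  proof -
    obtain T \<gamma> where T: "T > 0" and \<gamma>: "curve M A {0..T} \<gamma>" "\<gamma> ` {0..T} \<subseteq> fst c \<inter> U" "snd c (\<gamma> 0) = x"
      "velocity {0..T} (snd c \<circ> \<gamma>) 0 = v"
      and cov: "\<And>d t. d \<in> A \<Longrightarrow> t \<in> {0..T} \<Longrightarrow> \<gamma> t \<in> fst d \<Longrightarrow>
         cov_vector (domain U d) (K d) {0..T} (snd d \<circ> \<gamma>) 0 (velocity {0..T} (snd d \<circ> \<gamma>)) t = 0"
      and nn: "\<And>d t. d \<in> A \<Longrightarrow> t \<in> {0..T} \<Longrightarrow> \<gamma> t \<in> fst d \<Longrightarrow>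
         velocity {0..T} (snd d \<circ> \<gamma>) t \<bullet> (K d (snd d (\<gamma> t)) *v velocity {0..T} (snd d \<circ> \<gamma>) t) \<noteq> 0"
      by (rule geodesic_exists[OF c x v]) (rule that)
    obtain h \<phi> where h: "smooth_on (domain U c) \<phi>" "\<And>z. z \<in> domain U c \<Longrightarrow> \<phi> z > 0"
      "\<And>z. z \<in> domain U c \<Longrightarrow> h z = \<phi> z *\<^sub>R K c z" "conformal_circle_eq (img c) h {0..T} (snd c \<circ> \<gamma>) 0"
      using circ[OF T \<gamma>(1,2) cov nn] by blast
    have T0: "0 \<in> {0..T}" "\<gamma> 0 \<in> fst c \<inter> U" using T \<gamma>(2) by auto
    have "conformal_circle_eq (img c) h {0..T} (snd c \<circ> \<gamma>) 0 \<longleftrightarrow>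
      skew_pair (matrix_inv (K c (snd c (\<gamma> 0))) *v (velocity {0..T} (snd c \<circ> \<gamma>) 0 v* ricci (domain U c) (K c) (snd c (\<gamma> 0))))
        (velocity {0..T} (snd c \<circ> \<gamma>) 0) = 0"
      by (rule circle_iff[OF c \<gamma>(1) T0 n h(1,2,3)]) (use nn[OF c] cov[OF c] in \<open>auto intro: exI[of _ 0]\<close>)
    then show ?thesis using h(4) \<gamma>(3,4) by simp
  qed
  then show ?thesis using m.ricci_proportional[OF x] by metis
qed

lemma einstein_imp_circle:
  assumes c: "c \<in> A" and \<gamma>: "curve M A I \<gamma>" and t0: "t0 \<in> I" "\<gamma> t0 \<in> fst c \<inter> U" and n: "CARD('n) \<ge> 3"
    and \<phi>: "smooth_on (domain U c) \<phi>" "\<And>x. x \<in> domain U c \<Longrightarrow> \<phi> x > 0"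
    and h: "\<And>x. x \<in> domain U c \<Longrightarrow> h x = \<phi> x *\<^sub>R K c x"
    and nn: "\<And>t. t \<in> I \<Longrightarrow> \<gamma> t \<in> fst c \<inter> U \<Longrightarrow> velocity I (snd c \<circ> \<gamma>) t \<bullet> (K c (snd c (\<gamma> t)) *v velocity I (snd c \<circ> \<gamma>) t) \<noteq> 0"
    and geo: "\<And>t. t \<in> I \<Longrightarrow> \<gamma> t \<in> fst c \<inter> U \<Longrightarrow>
      \<exists>k. cov_vector (domain U c) (K c) I (snd c \<circ> \<gamma>) 0 (velocity I (snd c \<circ> \<gamma>)) t = k *\<^sub>R velocity I (snd c \<circ> \<gamma>) t"
    and ein: "\<And>x. x \<in> domain U c \<Longrightarrow> ricci (domain U c) (K c) x = k *\<^sub>R K c x"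
  shows "conformal_circle_eq (img c) h I (snd c \<circ> \<gamma>) t0"
proof -
  interpret m: metric_on "domain U c" "K c" by (rule metric[OF c])
  have x: "snd c (\<gamma> t0) \<in> domain U c" using t0(2) by (auto simp: domain_def)
  have "v v* (k *\<^sub>R K c (snd c (\<gamma> t0))) = k *\<^sub>R (K c (snd c (\<gamma> t0)) *v v)" for v
    by (metis m.sym_G[OF x] scaleR_matrix_vector_mult transpose_matrix_vector transpose_scaleR)
  then have "skew_pair (m.H (snd c (\<gamma> t0)) *v (v v* ricci (domain U c) (K c) (snd c (\<gamma> t0)))) v = 0" for v
    unfolding ein[OF x]
    by (simp add: matrix_vector_mult_scaleR matrix_vector_mul_assoc m.GH[OF x] skew_pair_self skew_pair_scaleR)
  then show ?thesis using circle_iff[OF c \<gamma> t0 n \<phi> h nn geo] by blast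
qed

end

section \<open>Conformal classes and the case without boundary\<close>

lemma chart_smooth_function:
  assumes "smooth_function A f" "c \<in> A"
  shows "smooth_on (img c) (\<lambda>x. f (chart_inv c x))"
  using assms by (simp add: smooth_function_def comp_def)

lemma conformal_class_rescale:
  assumes at: "atlas M A" and h: "h \<in> conformal_class A g"
  obtains \<omega> where "smooth_function A \<omega>" "\<And>c x. c \<in> A \<Longrightarrow> x \<in> img c \<Longrightarrow> h c x = exp (2 * \<omega> (chart_inv c x)) *\<^sub>R g c x"
proof -
  obtain \<omega> where \<omega>: "smooth_function A \<omega>" "\<And>c p. c \<in> A \<Longrightarrow> p \<in> fst c \<Longrightarrow> h c (snd c p) = exp (2 * \<omega> p) *\<^sub>R g c (snd c p)"
    using h by (auto simp: conformal_class_def)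
  have "h c x = exp (2 * \<omega> (chart_inv c x)) *\<^sub>R g c x" if c: "c \<in> A" and x: "x \<in> img c" for c x
    using \<omega>(2)[OF c, of "chart_inv c x"] chart_facts(5,6)[OF atlas_chart(1)[OF at c] x] by simp
  then show ?thesis using \<omega>(1) that by blast
qed

lemma conformal_class_self:
  assumes "atlas M A"
  shows "g \<in> conformal_class A g"
proof -
  have "smooth_function A (\<lambda>p. 0)"
    using rich_img[OF atlas_chart(1)[OF assms]] by (auto simp: smooth_function_def comp_def intro: smooth_on_const)
  then show ?thesis unfolding conformal_class_def by (intro CollectI exI[of _ "\<lambda>p. 0"]) auto
qed

theorem geodesics_conformal_circles_iff_einstein:
  fixes M :: "'a topology" and A :: "('a, 'n::finite) chart set"
  assumes n: "CARD('n) \<ge> 3" and M: "connected_manifold M A" and g: "pseudo_riemannian_metric A g"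
  shows "(\<forall>I \<gamma>. geodesic M A g I \<gamma> \<and> nowhere_null A g I \<gamma> \<longrightarrow> conformal_circle M A (conformal_class A g) I \<gamma>)
    \<longleftrightarrow> einstein_on A (topspace M) g"
proof -
  have Mb: "connected_manifold_with_boundary M A" and bd: "manifold_boundary A = {}" and at: "atlas M A"
    using M by (auto simp: connected_manifold_def connected_manifold_with_boundary_def)
  have int: "manifold_interior M A = topspace M" using bd by (simp add: manifold_interior_def)
  have dom: "domain (topspace M) c = img c" if "c \<in> A" for c
    using chart_facts(2)[OF atlas_chart(1)[OF at that]] by (auto simp: domain_def img_def)
  have op: "open (img c)" if "c \<in> A" for c
  proof -
    have "snd c p \<in> interior (img c)" if "p \<in> fst c" for p
      using bd \<open>c \<in> A\<close> that by (auto simp: manifold_boundary_def)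
    then have "img c \<subseteq> interior (img c)" by (auto simp: img_def)
    then show ?thesis by (metis interior_subset open_interior subset_antisym)
  qed
  have inU: "fst c \<subseteq> topspace M" if "c \<in> A" for c
    by (rule chart_facts(2)[OF atlas_chart(1)[OF at that]])
  interpret metric_region M A "topspace M" g
  proof (rule metric_region.intro)
    show "atlas M A" by (rule at)
    show "metric_on (domain (topspace M) c) (g c)" if "c \<in> A" for c
      unfolding dom[OF that] by unfold_locales (use g that op[OF that] in \<open>auto simp: pseudo_riemannian_metric_def\<close>)
    show "g c x = transpose (jacobian c d x) ** g d (transition c d x) ** jacobian c d x"
      if "c \<in> A" "d \<in> A" "x \<in> domain (topspace M) c \<inter> overlap c d" for c d x
      using g that by (simp add: pseudo_riemannian_metric_def)
  qed
  show ?thesis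
  proof
    assume L: "\<forall>I \<gamma>. geodesic M A g I \<gamma> \<and> nowhere_null A g I \<gamma> \<longrightarrow> conformal_circle M A (conformal_class A g) I \<gamma>"
    have ric_prop: "\<exists>f. ricci (domain (topspace M) c) (g c) x = f *\<^sub>R g c x" if c: "c \<in> A" and x: "x \<in> domain (topspace M) c" for c x
    proof (rule geodesics_circles_imp_proportional[OF c n x])
      fix T :: real and \<gamma>
      assume T: "T > 0" and \<gamma>: "curve M A {0..T} \<gamma>" "\<gamma> ` {0..T} \<subseteq> fst c \<inter> topspace M"
        and cov: "\<And>d t. d \<in> A \<Longrightarrow> t \<in> {0..T} \<Longrightarrow> \<gamma> t \<in> fst d \<Longrightarrow>
           cov_vector (domain (topspace M) d) (g d) {0..T} (snd d \<circ> \<gamma>) 0 (velocity {0..T} (snd d \<circ> \<gamma>)) t = 0"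
        and nn: "\<And>d t. d \<in> A \<Longrightarrow> t \<in> {0..T} \<Longrightarrow> \<gamma> t \<in> fst d \<Longrightarrow>
           velocity {0..T} (snd d \<circ> \<gamma>) t \<bullet> (g d (snd d (\<gamma> t)) *v velocity {0..T} (snd d \<circ> \<gamma>) t) \<noteq> 0"
      have "geodesic M A g {0..T} \<gamma>"
        unfolding geodesic_def
      proof (intro conjI ballI impI)
        fix d t assume d: "d \<in> A" "t \<in> {0..T}" "\<gamma> t \<in> fst d"
        show "\<exists>k. cov_vector (img d) (g d) {0..T} (snd d \<circ> \<gamma>) 0 (velocity {0..T} (snd d \<circ> \<gamma>)) t = k *\<^sub>R velocity {0..T} (snd d \<circ> \<gamma>) t"
          using cov[OF d] unfolding dom[OF d(1)] by (intro exI[of _ 0]) simp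
      qed (rule \<gamma>(1))
      moreover have "nowhere_null A g {0..T} \<gamma>" unfolding nowhere_null_def using nn by blast
      ultimately obtain h where h: "h \<in> conformal_class A g"
        "\<And>t. t \<in> {0..T} \<Longrightarrow> \<gamma> t \<in> fst c \<Longrightarrow> conformal_circle_eq (img c) (h c) {0..T} (snd c \<circ> \<gamma>) t"
        using L c unfolding conformal_circle_def by blast
      obtain \<omega> where \<omega>: "smooth_function A \<omega>" "\<And>c x. c \<in> A \<Longrightarrow> x \<in> img c \<Longrightarrow> h c x = exp (2 * \<omega> (chart_inv c x)) *\<^sub>R g c x"
        by (rule conformal_class_rescale[OF at h(1)]) (rule that)
      have "smooth_on (domain (topspace M) c) (\<lambda>x. exp (2 * \<omega> (chart_inv c x)))"
        unfolding dom[OF c]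
        by (intro smooth_on_exp smooth_on_mult smooth_on_const chart_smooth_function[OF \<omega>(1) c] rich_open op[OF c])
      moreover have "conformal_circle_eq (img c) (h c) {0..T} (snd c \<circ> \<gamma>) 0"
        using T \<gamma>(2) by (intro h(2)) auto
      ultimately show "\<exists>h \<phi>. smooth_on (domain (topspace M) c) \<phi> \<and> (\<forall>z\<in>domain (topspace M) c. \<phi> z > 0 \<and> h z = \<phi> z *\<^sub>R g c z)
          \<and> conformal_circle_eq (img c) h {0..T} (snd c \<circ> \<gamma>) 0"
        using \<omega>(2)[OF c] unfolding dom[OF c]
        by (intro exI[of _ "h c"] exI[of _ "\<lambda>x. exp (2 * \<omega> (chart_inv c x))"]) simp
    qed
    obtain k where k: "\<And>c x. c \<in> A \<Longrightarrow> x \<in> domain (topspace M) c \<Longrightarrow> ricci (domain (topspace M) c) (g c) x = k *\<^sub>R g c x"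
      by (rule einstein_global[OF Mb int[symmetric] n]) (erule (1) ric_prop, rule that)
    show "einstein_on A (topspace M) g"
      unfolding einstein_on_def using k dom by (intro exI[of _ k]) (auto simp: img_def)
  next
    assume "einstein_on A (topspace M) g"
    then obtain k where k: "\<And>c p. c \<in> A \<Longrightarrow> p \<in> fst c \<Longrightarrow> ricci (img c) (g c) (snd c p) = k *\<^sub>R g c (snd c p)"
      unfolding einstein_on_def using inU by blast
    show "\<forall>I \<gamma>. geodesic M A g I \<gamma> \<and> nowhere_null A g I \<gamma> \<longrightarrow> conformal_circle M A (conformal_class A g) I \<gamma>"
    proof (intro allI impI)
      fix I \<gamma> assume "geodesic M A g I \<gamma> \<and> nowhere_null A g I \<gamma>"
      then have cu: "curve M A I \<gamma>" and nn: "nowhere_null A g I \<gamma>" and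
        geo: "\<And>c t. c \<in> A \<Longrightarrow> t \<in> I \<Longrightarrow> \<gamma> t \<in> fst c \<Longrightarrow>
          \<exists>k. cov_vector (img c) (g c) I (snd c \<circ> \<gamma>) 0 (velocity I (snd c \<circ> \<gamma>)) t = k *\<^sub>R velocity I (snd c \<circ> \<gamma>) t"
        by (auto simp: geodesic_def)
      have "conformal_circle_eq (img c) (g c) I (snd c \<circ> \<gamma>) t" if c: "c \<in> A" and t: "t \<in> I" "\<gamma> t \<in> fst c" for c t
      proof -
        have tU: "\<gamma> t \<in> fst c \<inter> topspace M" using t inU[OF c] by auto
        \<comment> \<open>The metric itself witnesses the circle equation, so the conformal factor
          is 1.\<close>
        show ?thesis
          by (rule einstein_imp_circle[OF c cu t(1) tU n, where \<phi> = "\<lambda>x. 1" and k = k, unfolded dom[OF c]])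
            (use nn geo[OF c] c k[OF c] in \<open>auto simp: nowhere_null_def img_def intro: smooth_on_const rich_open op[unfolded img_def]\<close>)
      qed
      then show "conformal_circle M A (conformal_class A g) I \<gamma>"
        unfolding conformal_circle_def using cu nn conformal_class_self[OF at] by blast
    qed
  qed
qed

section \<open>Conformally compact manifolds\<close>

text \<open>Where \<sigma> vanishes, the acceleration drops out of
  \<open>wedge_scale_three_zero_iff\<close>, and the differential of \<rho> is a multiple of the
  lowered velocity. The latter pairs nontrivially with the non-null velocity, so \<rho> has nonzero
  derivative along the curve and its zero is isolated.\<close>

lemma wedge_zero_imp_transverse:
  fixes y :: "real \<Rightarrow> real^'n::finite"
  assumes S: "rich S" "smooth_on S G" "\<And>x. x \<in> S \<Longrightarrow> det (G x) \<noteq> 0"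
    and y: "rich J" "smooth_on J y" "y ` J \<subseteq> S" and t: "t \<in> J"
    and nn: "velocity J y t \<bullet> (G (y t) *v velocity J y t) \<noteq> 0"
    and \<rho>: "smooth_on S \<rho>" "\<rho> (y t) = 0" "partial S i \<rho> (y t) \<noteq> 0"
    and \<sigma>: "\<And>x. x \<in> S \<Longrightarrow> \<sigma> x = \<rho> x * scale_density G x"
    and wedge: "\<forall>i. wedge_scale_three S G \<sigma> J y t i = 0"
  shows "\<forall>\<^sub>F r in at t within J. \<rho> (y r) \<noteq> 0"
proof -
  have x: "y t \<in> S" using y(3) t by auto
  define u where "u = velocity J y t"
  define m where "m = unit_form G J y t"
  define d where "d = (\<chi> a. partial S a \<rho> (y t))"
  define s where "s = scale_density G (y t)"
  have sd: "smooth_on S (scale_density G)" by (rule smooth_on_conf_metric(1)[OF S])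
  have s: "s > 0" unfolding s_def by (rule smooth_on_conf_metric(5)[OF S x])
  have cs: "conf_square G J y t \<noteq> 0"
    using nn s by (simp add: conf_square_def conf_metric_def s_def scaleR_matrix_vector_assoc[symmetric])
  have "u \<bullet> m = conf_square G J y t / speed_density G J y t"
    by (simp add: m_def u_def unit_form_def conf_square_def inner_commute[of "velocity J y t"] dot_lmul_matrix)
  then have \<alpha>: "u \<bullet> m \<noteq> 0" using cs by (simp add: speed_density_def)
  have \<sigma>0: "\<sigma> (y t) = 0" using \<sigma>[OF x] \<rho>(2) by simp
  have "partial S a \<sigma> (y t) = s * d $ a" for a
  proof -
    have "partial S a \<sigma> (y t) = partial S a (\<lambda>z. \<rho> z * scale_density G z) (y t)"
      by (rule partial_cong[OF x \<sigma>])
    also have "\<dots> = partial S a \<rho> (y t) * s + \<rho> (y t) * partial S a (scale_density G) (y t)"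
      unfolding s_def by (rule partial_mult[OF S(1) x \<rho>(1) sd])
    finally show ?thesis by (simp add: \<rho>(2) d_def)
  qed
  then have nabla: "nabla_density S G 1 \<sigma> (y t) = s *\<^sub>R d"
    by (simp add: nabla_density_def \<sigma>0 vec_eq_iff)
  obtain \<beta> where \<beta>: "(u \<bullet> m) *\<^sub>R s *\<^sub>R d = \<beta> *\<^sub>R m"
    using wedge wedge_scale_three_zero_iff[OF y(1) t, of y G S \<sigma>] \<alpha> unfolding nabla \<sigma>0 u_def m_def by auto
  have "d \<noteq> 0" using \<rho>(3) by (auto simp: d_def vec_eq_iff)
  then have "\<beta> \<noteq> 0" using \<beta> \<alpha> s by auto
  \<comment> \<open>Pairing with the velocity: since \<open>d\<close> is nonzero, so is \<beta>, and
    hence also the derivative \<open>u \<bullet> d\<close> of \<rho> along the curve.\<close>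
  have "(u \<bullet> m) * s * (u \<bullet> d) = \<beta> * (u \<bullet> m)" using arg_cong[OF \<beta>, of "inner u"] by simp
  then have ud: "u \<bullet> d \<noteq> 0" using \<alpha> \<open>\<beta> \<noteq> 0\<close> by auto
  have dy: "(y has_vector_derivative u) (at t within J)"
    unfolding u_def velocity_def by (rule smooth_on_has_vector_derivative[OF y(2) t])
  have "frechet_derivative \<rho> (at (y t) within S) u = u \<bullet> d"
    unfolding frechet_linear[OF \<rho>(1) x, of u] by (simp add: d_def inner_vec_def partial_def)
  then have "((\<lambda>t. \<rho> (y t)) has_real_derivative (u \<bullet> d)) (at t within J)"
    using curve_chain[OF \<rho>(1) y(3) t dy] by (simp add: has_real_derivative_iff_has_vector_derivative)
  then have "((\<lambda>r. (\<rho> (y r) - \<rho> (y t)) / (r - t)) \<longlongrightarrow> u \<bullet> d) (at t within J)"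
    by (simp add: has_field_derivative_iff)
  then have "\<forall>\<^sub>F r in at t within J. (\<rho> (y r) - \<rho> (y t)) / (r - t) \<noteq> 0"
    using ud by (rule tendsto_imp_eventually_ne)
  then show ?thesis by eventually_elim (use \<rho>(2) in auto)
qed

text \<open>If g is multiplied by exp (2 \<omega>) and r by exp \<omega>, neither \<sigma> nor the
  interior metric changes. Each of the definitions involved may choose its own metric in the class,
  and this reconciles the choices.\<close>

lemma conformal_representative:
  assumes at: "atlas M A" and g: "pseudo_riemannian_metric A g" and r: "defining_function M A r"
    and h: "h \<in> conformal_class A g"
  obtains r' where "pseudo_riemannian_metric A h" "defining_function M A r'"
    "\<And>c p. c \<in> A \<Longrightarrow> p \<in> fst c \<Longrightarrow> r p * scale_density (g c) (snd c p) = r' p * scale_density (h c) (snd c p)"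
    "\<And>c x. c \<in> A \<Longrightarrow> x \<in> img c \<Longrightarrow> conf_metric (h c) x = conf_metric (g c) x"
proof -
  obtain \<omega> where \<omega>: "smooth_function A \<omega>" "\<And>c x. c \<in> A \<Longrightarrow> x \<in> img c \<Longrightarrow> h c x = exp (2 * \<omega> (chart_inv c x)) *\<^sub>R g c x"
    by (rule conformal_class_rescale[OF at h]) (rule that)
  define r' where "r' = (\<lambda>p. r p * exp (\<omega> p))"
  note rich = rich_img[OF atlas_chart(1)[OF at]]
  note inv = chart_facts(4)[OF atlas_chart(1)[OF at]]
  have sr: "smooth_function A r" using r by (simp add: defining_function_def)
  have gc: "smooth_on (img c) (g c)" if "c \<in> A" for c
    using g that by (auto simp: pseudo_riemannian_metric_def)
  have gx: "transpose (g c x) = g c x" "det (g c x) \<noteq> 0" if "c \<in> A" "x \<in> img c" for c x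
    using g that by (auto simp: pseudo_riemannian_metric_def)
  have se: "smooth_on (img c) (\<lambda>x. exp (a * \<omega> (chart_inv c x)))" if "c \<in> A" for a c
    by (intro smooth_on_exp smooth_on_mult smooth_on_const chart_smooth_function[OF \<omega>(1)] rich that)
  show ?thesis
  proof (rule that[of r'])
    show "pseudo_riemannian_metric A h"
      unfolding pseudo_riemannian_metric_def
    proof (intro conjI ballI)
      fix c assume c: "c \<in> A"
      have "smooth_on (img c) (\<lambda>x. exp (2 * \<omega> (chart_inv c x)) *\<^sub>R g c x)"
        by (rule smooth_on_scaleR[OF rich[OF c] se[OF c] gc[OF c]])
      then show "smooth_on (img c) (h c)"
        using smooth_on_cong[of "img c" "h c" "\<lambda>x. exp (2 * \<omega> (chart_inv c x)) *\<^sub>R g c x", OF \<omega>(2)[OF c]] by simp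
      fix x assume "x \<in> img c"
      then show "transpose (h c x) = h c x" "det (h c x) \<noteq> 0"
        using gx[OF c] \<omega>(2)[OF c] by (auto simp: transpose_scaleR det_scaleR)
    next
      fix c d x assume c: "c \<in> A" and d: "d \<in> A" and x: "x \<in> overlap c d"
      then obtain p where p: "p \<in> fst c" "p \<in> fst d" "x = snd c p" by (auto simp: overlap_def)
      have tr: "transition c d x = snd d p" using inv[OF c p(1)] by (simp add: transition_def p)
      have xi: "x \<in> img c" "transition c d x \<in> img d" using p by (auto simp: img_def tr[unfolded p(3)])
      have "g c x = transpose (jacobian c d x) ** g d (transition c d x) ** jacobian c d x"
        using g c d x by (simp add: pseudo_riemannian_metric_def)
      then show "h c x = transpose (jacobian c d x) ** h d (transition c d x) ** jacobian c d x"
        unfolding \<omega>(2)[OF c xi(1)] \<omega>(2)[OF d xi(2)]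
        using inv[OF c p(1)] inv[OF d p(2)] by (simp add: tr[unfolded p(3)] p(3) matrix_scaleR_distribs)
    qed
    show "defining_function M A r'"
      unfolding defining_function_def
    proof (intro conjI ballI)
      show "smooth_function A r'"
        unfolding smooth_function_def comp_def r'_def
        using se[of _ 1] by (auto intro!: smooth_on_mult rich chart_smooth_function[OF sr])
      show "{p \<in> topspace M. r' p = 0} = manifold_boundary A"
        using r by (simp add: defining_function_def r'_def)
      fix c p assume c: "c \<in> A" and p: "p \<in> fst c \<inter> manifold_boundary A"
      then have p': "p \<in> fst c" and r0: "r p = 0" using r by (auto simp: defining_function_def)
      obtain i where i: "partial (img c) i (\<lambda>x. r (chart_inv c x)) (snd c p) \<noteq> 0"
        using r c p unfolding defining_function_def comp_def by blast
      have "snd c p \<in> img c" using p' by (simp add: img_def)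
      \<comment> \<open>As \<open>r\<close> vanishes at \<open>p\<close>, the derivative of the
        exponential does not contribute and that of \<open>r\<close> is merely scaled.\<close>
      from partial_mult[OF rich[OF c] this chart_smooth_function[OF sr c] se[OF c, of 1], of i]
      show "\<exists>i. partial (img c) i (r' \<circ> chart_inv c) (snd c p) \<noteq> 0"
        using i r0 by (intro exI[of _ i]) (simp add: r'_def comp_def inv[OF c p'])
    qed
    fix c assume c: "c \<in> A"
    show "conf_metric (h c) x = conf_metric (g c) x" if x: "x \<in> img c" for x
      by (rule conf_metric_rescale(2)[where G = "h c" and F = "g c", OF exp_gt_zero \<omega>(2)[OF c x]])
    fix p assume p: "p \<in> fst c"
    then have x: "snd c p \<in> img c" by (simp add: img_def)
    show "r p * scale_density (g c) (snd c p) = r' p * scale_density (h c) (snd c p)"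
      unfolding conf_metric_rescale(1)[where G = "h c" and F = "g c", OF exp_gt_zero \<omega>(2)[OF c x]] inv[OF c p] r'_def
      by (simp add: powr_def exp_minus)
  qed
qed

section \<open>The interior metric of a compactification\<close>

text \<open>A compactification with the representative metric fixed. The locale is interpreted again
  for other representatives of the class, with the same \<sigma>.\<close>

locale compactified =
  fixes M :: "'a topology" and A :: "('a, 'n::finite) chart set" and g :: "('a, 'n) bilinear_field"
    and r :: "'a \<Rightarrow> real" and \<sigma> :: "('a, 'n) density_field"
  assumes M: "connected_manifold_with_boundary M A" and g: "pseudo_riemannian_metric A g"
    and r: "defining_function M A r"
    and \<sigma>: "\<And>c p. c \<in> A \<Longrightarrow> p \<in> fst c \<Longrightarrow> \<sigma> c (snd c p) = r p * scale_density (g c) (snd c p)"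
begin

abbreviation "U \<equiv> manifold_interior M A"
abbreviation "\<rho> c x \<equiv> r (chart_inv c x)"

definition K :: "('a, 'n) bilinear_field" where
  "K c x = (1 / (\<rho> c x)\<^sup>2) *\<^sub>R g c x"

lemma at_M: "atlas M A" using M by (simp add: connected_manifold_with_boundary_def)

lemma inv: "c \<in> A \<Longrightarrow> p \<in> fst c \<Longrightarrow> chart_inv c (snd c p) = p"
  by (rule chart_facts(4)[OF atlas_chart(1)[OF at_M]])

lemma rich_c: "c \<in> A \<Longrightarrow> rich (img c)"
  by (rule rich_img[OF atlas_chart(1)[OF at_M]])

lemma smooth_\<rho>: "c \<in> A \<Longrightarrow> smooth_on (img c) (\<rho> c)"
  using r chart_smooth_function[of A r c] by (simp add: defining_function_def)

lemma g_img:
  assumes "c \<in> A"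
  shows "smooth_on (img c) (g c)" "\<And>x. x \<in> img c \<Longrightarrow> transpose (g c x) = g c x" "\<And>x. x \<in> img c \<Longrightarrow> det (g c x) \<noteq> 0"
  using g assms by (auto simp: pseudo_riemannian_metric_def)

lemma in_U_iff:
  assumes "c \<in> A" "p \<in> fst c"
  shows "p \<in> U \<longleftrightarrow> r p \<noteq> 0"
proof -
  have "p \<in> topspace M" using chart_facts(2)[OF atlas_chart(1)[OF at_M assms(1)]] assms(2) by blast
  then show ?thesis using r by (auto simp: defining_function_def manifold_interior_def)
qed

lemma domain_eq: "c \<in> A \<Longrightarrow> domain U c = {x \<in> img c. \<rho> c x \<noteq> 0}"
  using in_U_iff[of c] inv[of c] by (auto simp: domain_def img_def)

lemma \<sigma>_img: "c \<in> A \<Longrightarrow> x \<in> img c \<Longrightarrow> \<sigma> c x = \<rho> c x * scale_density (g c) x"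
  using \<sigma>[of c] inv[of c] by (auto simp: img_def)

lemma open_domain_U:
  assumes c: "c \<in> A"
  shows "open (domain U c)"
proof -
  have "openin (top_of_set (img c)) (img c \<inter> \<rho> c -` (- {0}))"
    by (rule continuous_openin_preimage_gen[OF smooth_on_continuous_on[OF smooth_\<rho>[OF c]]]) auto
  then obtain W where W: "open W" "img c \<inter> \<rho> c -` (- {0}) = img c \<inter> W" by (auto simp: openin_open)
  then have "domain U c = img c \<inter> W" by (auto simp: domain_eq[OF c])
  \<comment> \<open>Relative openness in the image becomes openness because interior points of the
    manifold are interior points of the image.\<close>
  moreover have "domain U c \<subseteq> interior (img c)"
    using c by (auto simp: domain_def manifold_interior_def manifold_boundary_def)
  ultimately have "domain U c = interior (img c) \<inter> W" using interior_subset by blast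
  then show ?thesis using W(1) by auto
qed

lemma metric_g: "c \<in> A \<Longrightarrow> metric_on (domain U c) (g c)"
  using g_img rich_c open_domain_U by (intro metric_on_subset[of "img c"]) (auto simp: domain_eq)

lemma K_density: "c \<in> A \<Longrightarrow> x \<in> img c \<Longrightarrow> (1 / (\<sigma> c x)\<^sup>2) *\<^sub>R conf_metric (g c) x = K c x"
  using smooth_on_conf_metric(5)[OF rich_c g_img(1,3), of c x]
  by (simp add: \<sigma>_img K_def conf_metric_def power_mult_distrib)

lemma g_eq: "c \<in> A \<Longrightarrow> x \<in> domain U c \<Longrightarrow> g c x = (\<rho> c x)\<^sup>2 *\<^sub>R K c x"
  by (simp add: K_def domain_eq)

lemma smooth_\<rho>_U: "c \<in> A \<Longrightarrow> smooth_on (domain U c) (\<rho> c)"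
  by (rule smooth_on_openin[OF open_subset[OF _ open_domain_U] smooth_\<rho>]) (auto simp: domain_eq)

sublocale metric_region M A U K
proof (rule metric_region.intro)
  show "atlas M A" by (rule at_M)
  fix c assume c: "c \<in> A"
  interpret m: metric_on "domain U c" "g c" by (rule metric_g[OF c])
  show "metric_on (domain U c) (K c)"
  proof
    show "open (domain U c)" by (rule m.open_S)
    have "smooth_on (domain U c) (\<lambda>x. (1 / (\<rho> c x)\<^sup>2) *\<^sub>R g c x)"
      by (intro smooth_on_scaleR smooth_on_divide smooth_on_const smooth_on_power smooth_\<rho>_U[OF c] m.smooth_G m.rich_S)
        (simp add: domain_eq[OF c])
    then show "smooth_on (domain U c) (K c)" by (simp add: K_def[abs_def])
    show "transpose (K c x) = K c x" "det (K c x) \<noteq> 0" if "x \<in> domain U c" for x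
      using m.sym_G[OF that] m.det_G[OF that] that by (simp_all add: K_def transpose_scaleR det_scaleR domain_eq[OF c])
  qed
  fix d x assume d: "d \<in> A" and x: "x \<in> domain U c \<inter> overlap c d"
  then obtain p where p: "p \<in> fst c" "p \<in> fst d" "x = snd c p" by (auto simp: overlap_def)
  have "g c x = transpose (jacobian c d x) ** g d (transition c d x) ** jacobian c d x"
    using g c d x by (simp add: pseudo_riemannian_metric_def)
  moreover have "\<rho> d (transition c d x) = \<rho> c x"
    using p c d by (simp add: transition_def inv)
  ultimately show "K c x = transpose (jacobian c d x) ** K d (transition c d x) ** jacobian c d x"
    by (simp add: K_def matrix_scaleR_distribs)
qed

lemma wedge_iff_geodesic:
  assumes c: "c \<in> A" and \<gamma>: "curve M A I \<gamma>" and nn: "nowhere_null A g I \<gamma>" and t: "t \<in> I" "\<gamma> t \<in> fst c \<inter> U"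
  shows "(\<forall>i. wedge_scale_three (img c) (g c) (\<sigma> c) I (snd c \<circ> \<gamma>) t i = 0) \<longleftrightarrow>
     (\<exists>k. cov_vector (domain U c) (K c) I (snd c \<circ> \<gamma>) 0 (velocity I (snd c \<circ> \<gamma>)) t = k *\<^sub>R velocity I (snd c \<circ> \<gamma>) t)"
  using nn c
  by (intro wedge_geodesic[where \<rho> = "\<rho> c", OF c \<gamma> t metric_g smooth_\<rho>_U])
     (auto simp: domain_eq K_def \<sigma>_img nowhere_null_def)

text \<open>The curve is a geodesic of the interior metric \<open>K\<close>, while the equation is
  stated in the compactified metric \<open>g\<close>, whose conformal factor over \<open>K\<close>
  is the square of the defining function.\<close>

lemma conformal_circle_eq_interior:
  assumes c: "c \<in> A" and \<gamma>: "curve M A I \<gamma>" and nn: "nowhere_null A g I \<gamma>" and t: "t \<in> I" "\<gamma> t \<in> fst c \<inter> U"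
    and n: "CARD('n) \<ge> 3"
    and ein: "\<And>x. x \<in> domain U c \<Longrightarrow> ricci (domain U c) (K c) x = k *\<^sub>R K c x"
    and wedge: "\<And>t i. t \<in> I \<Longrightarrow> \<gamma> t \<in> fst c \<Longrightarrow> wedge_scale_three (img c) (g c) (\<sigma> c) I (snd c \<circ> \<gamma>) t i = 0"
  shows "conformal_circle_eq (img c) (g c) I (snd c \<circ> \<gamma>) t"
proof (rule einstein_imp_circle[where \<phi> = "\<lambda>x. (\<rho> c x)\<^sup>2" and k = k, OF c \<gamma> t n])
  show "smooth_on (domain U c) (\<lambda>x. (\<rho> c x)\<^sup>2)"
    by (intro smooth_on_power smooth_\<rho>_U[OF c] rich_open open_domain_U[OF c])
  show "g c x = (\<rho> c x)\<^sup>2 *\<^sub>R K c x" if "x \<in> domain U c" for x by (rule g_eq[OF c that])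
  show "velocity I (snd c \<circ> \<gamma>) t \<bullet> (K c (snd c (\<gamma> t)) *v velocity I (snd c \<circ> \<gamma>) t) \<noteq> 0"
    if "t \<in> I" "\<gamma> t \<in> fst c \<inter> U" for t
    using nn c that in_U_iff[OF c, of "\<gamma> t"]
    by (auto simp: K_def nowhere_null_def inv[OF c] scaleR_matrix_vector_assoc[symmetric])
  show "\<exists>k. cov_vector (domain U c) (K c) I (snd c \<circ> \<gamma>) 0 (velocity I (snd c \<circ> \<gamma>)) t = k *\<^sub>R velocity I (snd c \<circ> \<gamma>) t"
    if "t \<in> I" "\<gamma> t \<in> fst c \<inter> U" for t
    using wedge_iff_geodesic[OF c \<gamma> nn that] wedge that by blast
qed (use ein in \<open>auto simp: domain_eq[OF c]\<close>)

text \<open>The equation extends to boundary points by continuity, since generalised geodesics meet the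
  boundary transversally.\<close>

lemma conformal_circle_eq_everywhere:
  assumes c: "c \<in> A" and \<gamma>: "curve M A I \<gamma>" and nn: "nowhere_null A g I \<gamma>" and t: "t \<in> I" "\<gamma> t \<in> fst c"
    and n: "CARD('n) \<ge> 3"
    and ein: "\<And>x. x \<in> domain U c \<Longrightarrow> ricci (domain U c) (K c) x = k *\<^sub>R K c x"
    and wedge: "\<And>t i. t \<in> I \<Longrightarrow> \<gamma> t \<in> fst c \<Longrightarrow> wedge_scale_three (img c) (g c) (\<sigma> c) I (snd c \<circ> \<gamma>) t i = 0"
  shows "conformal_circle_eq (img c) (g c) I (snd c \<circ> \<gamma>) t"
proof (cases "\<gamma> t \<in> U")
  case True
  then show ?thesis using conformal_circle_eq_interior[OF c \<gamma> nn t(1) _ n ein wedge] t(2) by blast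
next
  case False
  define J where "J = {t\<in>I. \<gamma> t \<in> fst c}"
  define y where "y = snd c \<circ> \<gamma>"
  note cu = curve_facts[OF at_M \<gamma> c, folded J_def y_def]
  have tJ: "t \<in> J" using t by (simp add: J_def)
  have loc: "conformal_circle_eq (img c) (g c) I y s \<longleftrightarrow> conformal_circle_eq (img c) (g c) J y s" if "s \<in> J" for s
    by (rule conformal_circle_eq_local[OF cu(2) that _ cu(5)]) auto
  have nnJ: "velocity J y s \<bullet> (g c (y s) *v velocity J y s) \<noteq> 0" if "s \<in> J" for s
  proof -
    have "velocity I y s \<bullet> (g c (y s) *v velocity I y s) \<noteq> 0"
      using nn c that by (auto simp: nowhere_null_def y_def J_def)
    then show ?thesis unfolding velocity_openin[OF cu(2) that, of y] .
  qed
  have r0: "r (\<gamma> t) = 0" using False in_U_iff[OF c t(2)] by simp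
  have "\<gamma> t \<in> fst c \<inter> manifold_boundary A"
    using False t(2) chart_facts(2)[OF atlas_chart(1)[OF at_M c]] by (auto simp: manifold_interior_def)
  then obtain i where i: "partial (img c) i (\<rho> c) (y t) \<noteq> 0"
    using r c unfolding defining_function_def comp_def y_def by blast
  have w: "\<forall>i. wedge_scale_three (img c) (g c) (\<sigma> c) J y t i = 0"
    using wedge[OF t] wedge_scale_three_openin[OF cu(2) tJ, of "img c" "g c" "\<sigma> c" y] by (simp add: y_def)
  have \<rho>0: "\<rho> c (y t) = 0" using r0 t(2) by (simp add: y_def inv[OF c])
  have "\<forall>\<^sub>F s in at t within J. \<rho> c (y s) \<noteq> 0"
    by (rule wedge_zero_imp_transverse[OF rich_c[OF c] g_img(1,3)[OF c] cu(3,4,5) tJ nnJ[OF tJ] smooth_\<rho>[OF c] \<rho>0 i \<sigma>_img[OF c] w])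
  moreover have "\<forall>\<^sub>F s in at t within J. s \<in> J" by (simp add: eventually_at_filter)
  ultimately have lim: "\<forall>\<^sub>F s in at t within J. conformal_circle_eq (img c) (g c) J y s"
  proof eventually_elim
    case (elim s)
    then have s: "s \<in> I" "\<gamma> s \<in> fst c" "r (\<gamma> s) \<noteq> 0" by (auto simp: J_def y_def inv[OF c])
    then have "\<gamma> s \<in> fst c \<inter> U" using in_U_iff[OF c] by blast
    then show ?case
      using conformal_circle_eq_interior[OF c \<gamma> nn s(1) _ n ein wedge] loc[OF elim(2)] by (simp add: y_def)
  qed
  have "conformal_circle_eq (img c) (g c) J y t"
    by (rule conformal_circle_eq_limit[OF rich_c[OF c] g_img(1,3)[OF c] cu(3,4,5) nnJ tJ lim])
  then show ?thesis using loc[OF tJ] by (simp add: y_def)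
qed

end

theorem generalised_geodesics_conformal_circles_iff_poincare_einstein:
  fixes M :: "'a topology" and A :: "('a, 'n::finite) chart set"
  assumes n: "CARD('n) \<ge> 3" and cc: "conformally_compact M A C \<sigma>"
  shows "(\<forall>I \<gamma>. generalised_geodesic M A C \<sigma> I \<gamma> \<longrightarrow> conformal_circle M A C I \<gamma>) \<longleftrightarrow> poincare_einstein M A C \<sigma>"
proof -
  obtain g r where C: "C = conformal_class A g" and "compactified M A g r \<sigma>"
    using cc unfolding conformally_compact_def compactified_def by blast
  then interpret compactified M A g r \<sigma> by simp
  show ?thesis
  proof
    assume L: "\<forall>I \<gamma>. generalised_geodesic M A C \<sigma> I \<gamma> \<longrightarrow> conformal_circle M A C I \<gamma>"
    have gC: "g \<in> C" unfolding C by (rule conformal_class_self[OF at_M])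
    have ric_prop: "\<exists>f. ricci (domain U c) (K c) x = f *\<^sub>R K c x" if c: "c \<in> A" and x: "x \<in> domain U c" for c x
    proof (rule geodesics_circles_imp_proportional[OF c n x])
      fix T :: real and \<gamma>
      assume T: "T > 0" and \<gamma>: "curve M A {0..T} \<gamma>" "\<gamma> ` {0..T} \<subseteq> fst c \<inter> U"
        and cov: "\<And>d t. d \<in> A \<Longrightarrow> t \<in> {0..T} \<Longrightarrow> \<gamma> t \<in> fst d \<Longrightarrow>
           cov_vector (domain U d) (K d) {0..T} (snd d \<circ> \<gamma>) 0 (velocity {0..T} (snd d \<circ> \<gamma>)) t = 0"
        and nn: "\<And>d t. d \<in> A \<Longrightarrow> t \<in> {0..T} \<Longrightarrow> \<gamma> t \<in> fst d \<Longrightarrow>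
           velocity {0..T} (snd d \<circ> \<gamma>) t \<bullet> (K d (snd d (\<gamma> t)) *v velocity {0..T} (snd d \<circ> \<gamma>) t) \<noteq> 0"
      have nng: "nowhere_null A g {0..T} \<gamma>"
        unfolding nowhere_null_def
      proof (intro ballI impI)
        fix d t assume d: "d \<in> A" "t \<in> {0..T}" "\<gamma> t \<in> fst d"
        show "velocity {0..T} (snd d \<circ> \<gamma>) t \<bullet> (g d (snd d (\<gamma> t)) *v velocity {0..T} (snd d \<circ> \<gamma>) t) \<noteq> 0"
          using nn[OF d] unfolding K_def by (auto simp: scaleR_matrix_vector_assoc[symmetric])
      qed
      have "generalised_geodesic M A C \<sigma> {0..T} \<gamma>"
        unfolding generalised_geodesic_def
      proof (intro conjI bexI[OF _ gC] ballI impI)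
        fix d t assume d: "d \<in> A" "t \<in> {0..T}" "\<gamma> t \<in> fst d"
        then have "\<gamma> t \<in> fst d \<inter> U" using \<gamma>(2) by auto
        moreover have "\<exists>k. cov_vector (domain U d) (K d) {0..T} (snd d \<circ> \<gamma>) 0 (velocity {0..T} (snd d \<circ> \<gamma>)) t = k *\<^sub>R velocity {0..T} (snd d \<circ> \<gamma>) t"
          unfolding cov[OF d] by (intro exI[of _ 0]) simp
        ultimately show "\<forall>i. wedge_scale_three (img d) (g d) (\<sigma> d) {0..T} (snd d \<circ> \<gamma>) t i = 0"
          using wedge_iff_geodesic[OF d(1) \<gamma>(1) nng d(2)] by blast
      qed (fact \<gamma>(1) nng)+
      then obtain h where h: "h \<in> C"
        "\<And>t. t \<in> {0..T} \<Longrightarrow> \<gamma> t \<in> fst c \<Longrightarrow> conformal_circle_eq (img c) (h c) {0..T} (snd c \<circ> \<gamma>) t"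
        using L c unfolding conformal_circle_def by blast
      \<comment> \<open>The metric \<open>h\<close> in which the circle equation is granted may
        differ from \<open>g\<close>; it comes with its own defining function for the same
        \<sigma>.\<close>
      obtain r' where r': "pseudo_riemannian_metric A h" "defining_function M A r'"
        "\<And>c p. c \<in> A \<Longrightarrow> p \<in> fst c \<Longrightarrow> r p * scale_density (g c) (snd c p) = r' p * scale_density (h c) (snd c p)"
        "\<And>c x. c \<in> A \<Longrightarrow> x \<in> img c \<Longrightarrow> conf_metric (h c) x = conf_metric (g c) x"
        by (rule conformal_representative[OF at_M g r h(1)[unfolded C]]) (rule that)
      interpret h: compactified M A h r' \<sigma>
        using M r'(1,2) \<sigma> r'(3) by unfold_locales auto
      \<comment> \<open>Both are the conformal metric divided by the square of \<sigma>, so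
        \<open>h\<close> is a positive multiple of the metric \<open>K\<close> whose geodesic is
        tested.\<close>
      have K: "h.K c z = K c z" if "z \<in> img c" for z
        using K_density[OF c that] h.K_density[OF c that] r'(4)[OF c that] by simp
      have "smooth_on (domain U c) (\<lambda>x. (h.\<rho> c x)\<^sup>2)"
        by (intro smooth_on_power h.smooth_\<rho>_U[OF c] rich_open open_domain_U[OF c])
      moreover have "(h.\<rho> c z)\<^sup>2 > 0 \<and> h c z = (h.\<rho> c z)\<^sup>2 *\<^sub>R K c z" if "z \<in> domain U c" for z
        using h.g_eq[OF c that] K[of z] that h.domain_eq[OF c] by auto
      moreover have "conformal_circle_eq (img c) (h c) {0..T} (snd c \<circ> \<gamma>) 0"
        using T \<gamma>(2) by (intro h(2)) auto
      ultimately show "\<exists>h \<phi>. smooth_on (domain U c) \<phi> \<and> (\<forall>z\<in>domain U c. \<phi> z > 0 \<and> h z = \<phi> z *\<^sub>R K c z)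
          \<and> conformal_circle_eq (img c) h {0..T} (snd c \<circ> \<gamma>) 0"
        by blast
    qed
    obtain k where k: "\<And>c x. c \<in> A \<Longrightarrow> x \<in> domain U c \<Longrightarrow> ricci (domain U c) (K c) x = k *\<^sub>R K c x"
      by (rule einstein_global[OF M refl n]) (erule (1) ric_prop, rule that)
    have "ricci (img c) (\<lambda>x. (1 / (\<sigma> c x)\<^sup>2) *\<^sub>R conf_metric (g c) x) (snd c p) = k *\<^sub>R ((1 / (\<sigma> c (snd c p))\<^sup>2) *\<^sub>R conf_metric (g c) (snd c p))"
      if c: "c \<in> A" and p: "p \<in> fst c \<inter> U" for c p
    proof -
      have x: "snd c p \<in> domain U c" using p by (auto simp: domain_def)
      have eq: "(1 / (\<sigma> c z)\<^sup>2) *\<^sub>R conf_metric (g c) z = K c z" if "z \<in> domain U c" for z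
        using K_density[OF c, of z] that domain_img by blast
      show ?thesis
        unfolding eq[OF x] k[OF c x, symmetric]
        by (rule ricci_local[where G = "\<lambda>x. (1 / (\<sigma> c x)\<^sup>2) *\<^sub>R conf_metric (g c) x" and H = "K c", OF openin_domain[OF c] x eq])
    qed
    then show "poincare_einstein M A C \<sigma>"
      unfolding poincare_einstein_def einstein_on_def using cc gC by blast
  next
    assume "poincare_einstein M A C \<sigma>"
    then obtain g' k where g': "g' \<in> C" and ein: "\<And>c p. c \<in> A \<Longrightarrow> p \<in> fst c \<inter> U \<Longrightarrow>
      ricci (img c) (\<lambda>x. (1 / (\<sigma> c x)\<^sup>2) *\<^sub>R conf_metric (g' c) x) (snd c p) = k *\<^sub>R ((1 / (\<sigma> c (snd c p))\<^sup>2) *\<^sub>R conf_metric (g' c) (snd c p))"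
      unfolding poincare_einstein_def einstein_on_def by blast
    show "\<forall>I \<gamma>. generalised_geodesic M A C \<sigma> I \<gamma> \<longrightarrow> conformal_circle M A C I \<gamma>"
    proof (intro allI impI)
      fix I \<gamma> assume "generalised_geodesic M A C \<sigma> I \<gamma>"
      then obtain h where \<gamma>: "curve M A I \<gamma>" and h: "h \<in> C" "nowhere_null A h I \<gamma>"
        "\<And>c t i. c \<in> A \<Longrightarrow> t \<in> I \<Longrightarrow> \<gamma> t \<in> fst c \<Longrightarrow> wedge_scale_three (img c) (h c) (\<sigma> c) I (snd c \<circ> \<gamma>) t i = 0"
        unfolding generalised_geodesic_def by blast
      obtain r' where r': "pseudo_riemannian_metric A h" "defining_function M A r'"
        "\<And>c p. c \<in> A \<Longrightarrow> p \<in> fst c \<Longrightarrow> r p * scale_density (g c) (snd c p) = r' p * scale_density (h c) (snd c p)"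
        "\<And>c x. c \<in> A \<Longrightarrow> x \<in> img c \<Longrightarrow> conf_metric (h c) x = conf_metric (g c) x"
        by (rule conformal_representative[OF at_M g r h(1)[unfolded C]]) (rule that)
      \<comment> \<open>Here \<open>h\<close> comes from the generalised geodesic, \<open>g'\<close>
        from the Einstein condition and \<open>g\<close> from the compactification. Their conformal
        metrics agree, hence so do the interior metrics built from them.\<close>
      obtain r'' where r'': "\<And>c x. c \<in> A \<Longrightarrow> x \<in> img c \<Longrightarrow> conf_metric (g' c) x = conf_metric (g c) x"
        by (rule conformal_representative[OF at_M g r g'[unfolded C]]) (rule that)
      interpret h: compactified M A h r' \<sigma>
        using M r'(1,2) \<sigma> r'(3) by unfold_locales auto
      have ein_h: "ricci (domain U c) (h.K c) x = k *\<^sub>R h.K c x" if c: "c \<in> A" and x: "x \<in> domain U c" for c x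
      proof -
        have eq: "(1 / (\<sigma> c z)\<^sup>2) *\<^sub>R conf_metric (g' c) z = h.K c z" if "z \<in> domain U c" for z
          using h.K_density[OF c, of z] r'(4)[OF c, of z] r''[OF c, of z] that domain_img[of c] by auto
        obtain p where p: "p \<in> fst c \<inter> U" "x = snd c p" using x by (auto simp: domain_def)
        have "ricci (domain U c) (h.K c) x = ricci (img c) (\<lambda>x. (1 / (\<sigma> c x)\<^sup>2) *\<^sub>R conf_metric (g' c) x) x"
          by (rule ricci_local[where G = "\<lambda>x. (1 / (\<sigma> c x)\<^sup>2) *\<^sub>R conf_metric (g' c) x" and H = "h.K c", OF openin_domain[OF c] x eq, symmetric])
        then show ?thesis using ein[OF c p(1)] eq[OF x] p(2) by (simp only:)
      qed
      have "conformal_circle_eq (img c) (h c) I (snd c \<circ> \<gamma>) t" if "c \<in> A" "t \<in> I" "\<gamma> t \<in> fst c" for c t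
        by (rule h.conformal_circle_eq_everywhere[OF that(1) \<gamma> h(2) that(2,3) n ein_h[OF that(1)] h(3)[OF that(1)]])
      then show "conformal_circle M A C I \<gamma>"
        unfolding conformal_circle_def using \<gamma> h(1,2) by blast
    qed
  qed
qed

theorem theorem3:
  assumes "CARD('n::finite) \<ge> 3"
  shows "(\<forall>(M :: 'a topology) (A :: ('a, 'n) chart set) g.
            connected_manifold M A \<and> pseudo_riemannian_metric A g \<longrightarrow>
            ((\<forall>I \<gamma>. geodesic M A g I \<gamma> \<and> nowhere_null A g I \<gamma> \<longrightarrow>
                      conformal_circle M A (conformal_class A g) I \<gamma>)
             \<longleftrightarrow> einstein_on A (topspace M) g))
       \<and> (\<forall>(M :: 'a topology) (A :: ('a, 'n) chart set) C \<sigma>.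
            conformally_compact M A C \<sigma> \<longrightarrow>
            ((\<forall>I \<gamma>. generalised_geodesic M A C \<sigma> I \<gamma> \<longrightarrow> conformal_circle M A C I \<gamma>)
             \<longleftrightarrow> poincare_einstein M A C \<sigma>))"
  using geodesics_conformal_circles_iff_einstein[OF assms]
    generalised_geodesics_conformal_circles_iff_poincare_einstein[OF assms] by blast

end
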